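(* Let $X$ be an affine variety and let $L\subseteq\operatorname{Vec}(X)$ be the Lie subalgebra generated by a family of locally finite Lie subalgebras $L_i\subseteq\operatorname{Vec}(X)$, $i\in I$. Assume that each $L_i$ is algebraic, i.e. $L_i=\operatorname{Lie}G_i$ for a connected algebraic group $G_i\subseteq\operatorname{Aut}(X)$. Then $L$ is locally finite if and only if $L$ is finite dimensional. In this case the subgroup $G$ of $\operatorname{Aut}(X)$ generated by the $G_i$ is algebraic and $L=\operatorname{Lie}G$. In particular, $L$ is algebraic.
   Context: $\Bbbk$ is an algebraically closed field of characteristic zero; varieties are over $\Bbbk$, algebraic groups are affine. $\operatorname{Vec}(X)=\operatorname{Der}_\Bbbk(\mathcal O(X))$ is the Lie algebra of algebraic vector fields on $X$. A subset $S\subseteq\operatorname{Vec}(X)$ is locally finite if every $f\in\mathcal O(X)$ is contained in a finite dimensional subspace of $\mathcal O(X)$ that is invariant under all elements of $S$. An algebraic subgroup $G\subseteq\operatorname{Aut}(X)$ is a subgroup which is (the image of) a linear algebraic group acting faithfully and regularly on $X$. Its Lie algebra is identified with a subspace of $\operatorname{Vec}(X)$ via the injective anti-homomorphism $A\mapsto\xi_A$, $\xi_A(x)=(d\theta_x)_e(A)\in T_xX$, where $\theta_x\colon G\to X$, $g\mapsto gx$. *)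

theory Defs
  imports
    "HOL-Computational_Algebra.Computational_Algebra"
    "HOL-Library.Function_Algebras"
    "HOL-Algebra.Bij"
    "HOL-Algebra.Generated_Groups"
    "HOL-Analysis.Function_Topology"
begin

definition fscale :: "'k::field \<Rightarrow> ('a \<Rightarrow> 'k) \<Rightarrow> 'a \<Rightarrow> 'k"
  where "fscale c f = (\<lambda>x. c * f x)"

definition vscale :: "'k::field \<Rightarrow> ('b \<Rightarrow> 'a \<Rightarrow> 'k) \<Rightarrow> 'b \<Rightarrow> 'a \<Rightarrow> 'k"
  where "vscale c D = (\<lambda>f. fscale c (D f))"

global_interpretation fun_vs: vector_space "fscale :: 'k::field \<Rightarrow> ('a \<Rightarrow> 'k) \<Rightarrow> 'a \<Rightarrow> 'k"
  by unfold_locales (auto simp: fscale_def fun_eq_iff algebra_simps)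

global_interpretation vec_vs: vector_space
  "vscale :: 'k::field \<Rightarrow> ('b \<Rightarrow> 'a \<Rightarrow> 'k) \<Rightarrow> 'b \<Rightarrow> 'a \<Rightarrow> 'k"
  by unfold_locales (auto simp: vscale_def fscale_def fun_eq_iff algebra_simps)

definition finite_dimensional ::
    "('k::field \<Rightarrow> 'v::ab_group_add \<Rightarrow> 'v) \<Rightarrow> 'v set \<Rightarrow> bool"
  where "finite_dimensional s V \<longleftrightarrow> (\<exists>B. finite B \<and> V = module.span s B)"

text \<open>A variety is given by its set of (closed) points together with its algebra of regular
  functions. Functions on a set are extended by \<open>0\<close>, so that equality on the set is
  equality in HOL.\<close>

record ('a, 'k) variety =
  pts :: "'a set"
  reg :: "('a \<Rightarrow> 'k) set"

definition zero_outside :: "'a set \<Rightarrow> ('a \<Rightarrow> 'b::zero) \<Rightarrow> 'a \<Rightarrow> 'b"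
  where "zero_outside S f = (\<lambda>x. if x \<in> S then f x else 0)"

abbreviation affine_space :: "nat \<Rightarrow> (nat \<Rightarrow> 'k) set"
  where "affine_space n \<equiv> {..<n} \<rightarrow>\<^sub>E UNIV"

inductive_set poly_funs :: "nat \<Rightarrow> ((nat \<Rightarrow> 'k::field) \<Rightarrow> 'k) set" for n :: nat where
  const: "(\<lambda>_. c) \<in> poly_funs n"
| coord: "i < n \<Longrightarrow> (\<lambda>x. x i) \<in> poly_funs n"
| add: "p \<in> poly_funs n \<Longrightarrow> q \<in> poly_funs n \<Longrightarrow> (\<lambda>x. p x + q x) \<in> poly_funs n"
| mult: "p \<in> poly_funs n \<Longrightarrow> q \<in> poly_funs n \<Longrightarrow> (\<lambda>x. p x * q x) \<in> poly_funs n"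

definition zariski_closed :: "nat \<Rightarrow> (nat \<Rightarrow> 'k::field) set \<Rightarrow> bool"
  where "zariski_closed n Z \<longleftrightarrow>
    (\<exists>S \<subseteq> poly_funs n. Z = {x \<in> affine_space n. \<forall>p\<in>S. p x = 0})"

text \<open>An affine variety is one that is isomorphic to a Zariski closed subset of some
  \<open>k^n\<close> with its coordinate ring. It need not be irreducible.\<close>

definition affine_variety :: "('a, 'k::field) variety \<Rightarrow> bool"
  where "affine_variety X \<longleftrightarrow>
    (\<exists>n \<phi>. inj_on \<phi> (pts X) \<and> zariski_closed n (\<phi> ` pts X) \<and>
       reg X = (\<lambda>p. zero_outside (pts X) (\<lambda>x. p (\<phi> x))) ` poly_funs n)"

definition pullback ::
    "('a, 'k::field) variety \<Rightarrow> ('a \<Rightarrow> 'b) \<Rightarrow> ('b \<Rightarrow> 'k) \<Rightarrow> 'a \<Rightarrow> 'k"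
  where "pullback X \<phi> f = zero_outside (pts X) (\<lambda>x. f (\<phi> x))"

definition morphism ::
    "('a, 'k::field) variety \<Rightarrow> ('b, 'k) variety \<Rightarrow> ('a \<Rightarrow> 'b) \<Rightarrow> bool"
  where "morphism X Y \<phi> \<longleftrightarrow>
    \<phi> \<in> pts X \<rightarrow> pts Y \<and> (\<forall>f \<in> reg Y. pullback X \<phi> f \<in> reg X)"

text \<open>The algebra of regular functions on a product is the image of the tensor product.\<close>

definition prod_variety ::
    "('a, 'k::field) variety \<Rightarrow> ('b, 'k) variety \<Rightarrow> ('a \<times> 'b, 'k) variety"
  where "prod_variety X Y =
    \<lparr>pts = pts X \<times> pts Y,
     reg = fun_vs.span {\<lambda>(x, y). f x * g y | f g. f \<in> reg X \<and> g \<in> reg Y}\<rparr>"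

text \<open>The sets of non-vanishing of regular functions form a basis of the Zariski topology.\<close>

definition zariski_topology :: "('a, 'k::field) variety \<Rightarrow> 'a topology"
  where "zariski_topology X = topology_generated_by ((\<lambda>f. {x \<in> pts X. f x \<noteq> 0}) ` reg X)"

definition Vec :: "('a, 'k::field) variety \<Rightarrow> (('a \<Rightarrow> 'k) \<Rightarrow> 'a \<Rightarrow> 'k) set"
  where "Vec X = {D.
    (\<forall>f \<in> reg X. D f \<in> reg X) \<and>
    (\<forall>f \<in> reg X. \<forall>g \<in> reg X. D (f + g) = D f + D g) \<and>
    (\<forall>c. \<forall>f \<in> reg X. D (fscale c f) = fscale c (D f)) \<and>
    (\<forall>f \<in> reg X. \<forall>g \<in> reg X. D (f * g) = f * D g + D f * g) \<and>
    (\<forall>f. f \<notin> reg X \<longrightarrow> D f = 0)}"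

definition lie_bracket ::
    "(('a \<Rightarrow> 'k::field) \<Rightarrow> 'a \<Rightarrow> 'k) \<Rightarrow> (('a \<Rightarrow> 'k) \<Rightarrow> 'a \<Rightarrow> 'k) \<Rightarrow> ('a \<Rightarrow> 'k) \<Rightarrow> 'a \<Rightarrow> 'k"
  where "lie_bracket D E = (\<lambda>f. D (E f) - E (D f))"

definition lie_subalgebra ::
    "('a, 'k::field) variety \<Rightarrow> (('a \<Rightarrow> 'k) \<Rightarrow> 'a \<Rightarrow> 'k) set \<Rightarrow> bool"
  where "lie_subalgebra X L \<longleftrightarrow>
    L \<subseteq> Vec X \<and> vec_vs.subspace L \<and> (\<forall>D \<in> L. \<forall>E \<in> L. lie_bracket D E \<in> L)"

definition lie_generated ::
    "('a, 'k::field) variety \<Rightarrow> (('a \<Rightarrow> 'k) \<Rightarrow> 'a \<Rightarrow> 'k) set \<Rightarrow> (('a \<Rightarrow> 'k) \<Rightarrow> 'a \<Rightarrow> 'k) set"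
  where "lie_generated X S = lie_subalgebra X hull S"

definition locally_finite ::
    "('a, 'k::field) variety \<Rightarrow> (('a \<Rightarrow> 'k) \<Rightarrow> 'a \<Rightarrow> 'k) set \<Rightarrow> bool"
  where "locally_finite X S \<longleftrightarrow>
    (\<forall>f \<in> reg X. \<exists>V \<subseteq> reg X. finite_dimensional fscale V \<and> f \<in> V \<and>
      (\<forall>D \<in> S. D ` V \<subseteq> V))"

definition Aut :: "('a, 'k::field) variety \<Rightarrow> ('a \<Rightarrow> 'a) monoid"
  where "Aut X = (BijGroup (pts X))
    \<lparr>carrier := {\<phi> \<in> Bij (pts X). morphism X X \<phi> \<and> morphism X X (inv_into (pts X) \<phi>)}\<rparr>"

definition algebraic_group :: "'g monoid \<Rightarrow> ('g, 'k::field) variety \<Rightarrow> bool"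
  where "algebraic_group H G \<longleftrightarrow>
    group H \<and> carrier H = pts G \<and> affine_variety G \<and>
    morphism (prod_variety G G) G (\<lambda>(g, h). g \<otimes>\<^bsub>H\<^esub> h) \<and>
    morphism G G (\<lambda>g. inv\<^bsub>H\<^esub> g)"

text \<open>An algebraic group acting faithfully on \<open>X\<close> is replaced by its isomorphic image in
  the automorphism group, to which its structure of a variety is transported.\<close>

definition algebraic_subgroup ::
    "('a, 'k::field) variety \<Rightarrow> ('a \<Rightarrow> 'a, 'k) variety \<Rightarrow> bool"
  where "algebraic_subgroup X G \<longleftrightarrow>
    subgroup (pts G) (Aut X) \<and>
    algebraic_group ((Aut X)\<lparr>carrier := pts G\<rparr>) G \<and>
    morphism (prod_variety G X) X (\<lambda>(g, x). g x)"

text \<open>Tangent vectors are point derivations.\<close>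

definition tangent_space :: "('a, 'k::field) variety \<Rightarrow> 'a \<Rightarrow> (('a \<Rightarrow> 'k) \<Rightarrow> 'k) set"
  where "tangent_space X x = {A.
    (\<forall>f \<in> reg X. \<forall>g \<in> reg X. A (f + g) = A f + A g) \<and>
    (\<forall>c. \<forall>f \<in> reg X. A (fscale c f) = c * A f) \<and>
    (\<forall>f \<in> reg X. \<forall>g \<in> reg X. A (f * g) = f x * A g + A f * g x) \<and>
    (\<forall>f. f \<notin> reg X \<longrightarrow> A f = 0)}"

definition differential ::
    "('a, 'k::field) variety \<Rightarrow> ('b, 'k) variety \<Rightarrow> ('a \<Rightarrow> 'b) \<Rightarrow> (('a \<Rightarrow> 'k) \<Rightarrow> 'k) \<Rightarrow> ('b \<Rightarrow> 'k) \<Rightarrow> 'k"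
  where "differential X Y \<phi> A = zero_outside (reg Y) (\<lambda>f. A (pullback X \<phi> f))"

text \<open>The value of the vector field \<open>\<xi>\<close> at \<open>x\<close> is the image of the tangent vector \<open>A\<close> under
  the differential of the orbit map of \<open>x\<close>; as a derivation, \<open>\<xi>\<close> sends \<open>f\<close> to the function
  \<open>x \<mapsto> \<xi>(x) f\<close>.\<close>

definition fundamental_field ::
    "('a, 'k::field) variety \<Rightarrow> ('a \<Rightarrow> 'a, 'k) variety \<Rightarrow>
      ((('a \<Rightarrow> 'a) \<Rightarrow> 'k) \<Rightarrow> 'k) \<Rightarrow> ('a \<Rightarrow> 'k) \<Rightarrow> 'a \<Rightarrow> 'k"
  where "fundamental_field X G A =
    (\<lambda>f. zero_outside (pts X) (\<lambda>x. differential G X (\<lambda>g. g x) A f))"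

definition Lie ::
    "('a, 'k::field) variety \<Rightarrow> ('a \<Rightarrow> 'a, 'k) variety \<Rightarrow> (('a \<Rightarrow> 'k) \<Rightarrow> 'a \<Rightarrow> 'k) set"
  where "Lie X G = fundamental_field X G ` tangent_space G \<one>\<^bsub>Aut X\<^esub>"

definition algebraic_lie ::
    "('a, 'k::field) variety \<Rightarrow> (('a \<Rightarrow> 'k) \<Rightarrow> 'a \<Rightarrow> 'k) set \<Rightarrow> bool"
  where "algebraic_lie X L \<longleftrightarrow>
    (\<exists>G. algebraic_subgroup X G \<and> connected_space (zariski_topology G) \<and> L = Lie X G)"

end

theory Submission
  imports Defs
begin

text \<open>
  The proof replaces algebraic geometry over \<open>k\<close> by explicit algebras of functions. Two principles
  carry it.

  \<^item> Infinitesimal invariance. If a space of regular functions on a connected group is stable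
    under the invariant derivations and its members vanish at one point, then they are all zero
    (\<open>stable_zero\<close>). Near the identity this holds because the Euler vector field forces such
    functions into every power of the maximal ideal, where Krull's intersection theorem applies; the
    common zero set is therefore open and closed. Consequently a finite dimensional space that is
    stable under \<open>Lie G\<close> is stable under \<open>G\<close>, and a connected group is irreducible.

  \<^item> Generic lifting. A homomorphism into the dual numbers \<open>k[\<epsilon>]\<close> is a point with a tangent vector.
    For a finitely generated extension of domains in characteristic zero, almost all of them lift
    (\<open>generic_lifting\<close>). This one algebraic statement serves both as Chevalley's theorem on
    images and as generic smoothness.

  A locally finite \<open>L\<close> is finite dimensional because a vector field is determined by its values on
  generators of the coordinate ring, and these lie in a finite dimensional \<open>L\<close>-stable space.

  Conversely, let \<open>L\<close> be finite dimensional. By infinitesimal invariance the groups \<open>G\<^sub>i\<close> act on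
  \<open>L\<close> by conjugation. The span of all conjugates of the \<open>Lie G\<^sub>i\<close> under the generated group \<open>G\<close> is
  stable under \<open>G\<close>, hence a Lie algebra, hence equal to \<open>L\<close> (\<open>L_span_conjugates\<close>). So \<open>L\<close> has a
  finite spanning family \<open>e\<^sub>1, \<dots>, e\<^sub>d\<close> of conjugates of elements of the \<open>Lie G\<^sub>i\<close>, each of which acts
  locally finitely. Every word in the \<open>e\<^sub>j\<close> is a combination of ordered words, as in the theorem of
  Poincare, Birkhoff and Witt, and ordered words generate finite dimensional spaces by \<open>d\<close> successive
  enlargements; therefore \<open>L\<close> is locally finite.

  It remains to make \<open>G\<close> algebraic. It acts faithfully on a finite dimensional \<open>L\<close>-stable space of
  functions that contains generators of the coordinate ring, and \<open>R\<close> is the algebra generated by the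
  matrix coefficients of \<open>g\<close> and \<open>g\<inverse>\<close>. Let \<open>H\<^sub>j\<close> be the conjugate of some \<open>G\<^sub>i\<close> whose Lie algebra
  contains \<open>e\<^sub>j\<close>. A function in \<open>R\<close> that vanishes on the product \<open>H\<^sub>d \<cdots> H\<^sub>1\<close> is annihilated at the
  identity by all ordered, hence by all words in the \<open>e\<^sub>j\<close>, and is zero by infinitesimal invariance.
  So some product map \<open>G\<^sub>i\<^sub>1 \<times> \<dots> \<times> G\<^sub>i\<^sub>n \<rightarrow> G\<close> is dominant (\<open>exists_dense_word\<close>). Lifting points along
  it shows that the spectrum of \<open>R\<close> contains an open set of elements of \<open>G\<close>, and by translation
  consists of elements of \<open>G\<close> (\<open>chars_Gt\<close>): thus \<open>G\<close> is closed. Lifting tangent vectors shows that a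
  tangent vector at a general point of \<open>G\<close> is a sum of tangent vectors along the factors; after
  translation to the identity these become conjugates of elements of the \<open>Lie G\<^sub>i\<close>, which lie in \<open>L\<close>
  (\<open>xi_in_L\<close>). Hence \<open>Lie G = L\<close>.
\<close>

section \<open>Subrings and finitely generated extensions\<close>

definition is_subring :: "'b::comm_ring_1 set \<Rightarrow> bool"
  where "is_subring A \<longleftrightarrow> 1 \<in> A \<and> (\<forall>x\<in>A. - x \<in> A) \<and> (\<forall>x\<in>A. \<forall>y\<in>A. x + y \<in> A \<and> x * y \<in> A)"

lemma is_subringD:
  assumes "is_subring A"
  shows "1 \<in> A" "0 \<in> A" "\<And>x. x \<in> A \<Longrightarrow> - x \<in> A"
    "\<And>x y. x \<in> A \<Longrightarrow> y \<in> A \<Longrightarrow> x + y \<in> A"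
    "\<And>x y. x \<in> A \<Longrightarrow> y \<in> A \<Longrightarrow> x * y \<in> A"
    "\<And>x y. x \<in> A \<Longrightarrow> y \<in> A \<Longrightarrow> x - y \<in> A"
proof -
  show 1: "1 \<in> A" and m: "\<And>x. x \<in> A \<Longrightarrow> - x \<in> A"
    and a: "\<And>x y. x \<in> A \<Longrightarrow> y \<in> A \<Longrightarrow> x + y \<in> A"
    and "\<And>x y. x \<in> A \<Longrightarrow> y \<in> A \<Longrightarrow> x * y \<in> A"
    using assms by (auto simp: is_subring_def)
  show "0 \<in> A" using a[OF 1 m[OF 1]] by simp
  show "\<And>x y. x \<in> A \<Longrightarrow> y \<in> A \<Longrightarrow> x - y \<in> A"
    using a m by (metis diff_conv_add_uminus)
qed

lemma is_subring_sum:
  assumes "is_subring A" "\<And>i. i \<in> S \<Longrightarrow> f i \<in> A" shows "sum f S \<in> A"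
  using assms(2) by (induction S rule: infinite_finite_induct) (auto simp: is_subringD[OF assms(1)])

lemma is_subring_power: "is_subring A \<Longrightarrow> x \<in> A \<Longrightarrow> x ^ n \<in> A"
  by (induction n) (auto simp: is_subringD)

lemma is_subring_of_nat: "is_subring A \<Longrightarrow> of_nat n \<in> A"
  by (induction n) (auto simp: is_subringD)

definition poly_over :: "'b::comm_ring_1 set \<Rightarrow> 'b poly set"
  where "poly_over A = {p. \<forall>i. coeff p i \<in> A}"

lemma is_subring_poly_over:
  assumes "is_subring A" shows "is_subring (poly_over A)"
  unfolding is_subring_def poly_over_def
  using assms by (auto simp: is_subringD coeff_1 coeff_mult intro!: is_subring_sum)

lemma poly_over_intros:
  assumes "is_subring A"
  shows "a \<in> A \<Longrightarrow> monom a n \<in> poly_over A" "a \<in> A \<Longrightarrow> [:a:] \<in> poly_over A"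
    "a \<in> A \<Longrightarrow> p \<in> poly_over A \<Longrightarrow> smult a p \<in> poly_over A"
    "p \<in> poly_over A \<Longrightarrow> coeff p i \<in> A"
  using assms by (auto simp: poly_over_def is_subringD coeff_monom coeff_pCons split: nat.splits)

definition adjoin :: "'b::comm_ring_1 set \<Rightarrow> 'b \<Rightarrow> 'b set"
  where "adjoin A t = (\<lambda>p. poly p t) ` poly_over A"

lemma is_subring_adjoin:
  assumes "is_subring A" shows "is_subring (adjoin A t)"
proof -
  note P = is_subringD[OF is_subring_poly_over[OF assms]]
  show ?thesis
    unfolding is_subring_def adjoin_def
  proof (intro conjI ballI)
    show "1 \<in> (\<lambda>p. poly p t) ` poly_over A" using P(1) by (metis image_eqI poly_1)
    fix x assume "x \<in> (\<lambda>p. poly p t) ` poly_over A"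
    then obtain p where p: "p \<in> poly_over A" "x = poly p t" by auto
    show "- x \<in> (\<lambda>p. poly p t) ` poly_over A" using P(3)[OF p(1)] p(2) by (metis image_eqI poly_minus)
    fix y assume "y \<in> (\<lambda>p. poly p t) ` poly_over A"
    then obtain q where q: "q \<in> poly_over A" "y = poly q t" by auto
    show "x + y \<in> (\<lambda>p. poly p t) ` poly_over A"
      using P(4)[OF p(1) q(1)] p(2) q(2) by (metis image_eqI poly_add)
    show "x * y \<in> (\<lambda>p. poly p t) ` poly_over A"
      using P(5)[OF p(1) q(1)] p(2) q(2) by (metis image_eqI poly_mult)
  qed
qed

lemma adjoin_contains:
  assumes "is_subring A" shows "A \<subseteq> adjoin A t" "t \<in> adjoin A t"
proof -
  show "A \<subseteq> adjoin A t"
    unfolding adjoin_def using poly_over_intros(2)[OF assms] by (force intro!: image_eqI)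
  have "[:0, 1:] \<in> poly_over A"
    using is_subringD[OF assms] by (auto simp: poly_over_def coeff_pCons split: nat.splits)
  then show "t \<in> adjoin A t" unfolding adjoin_def by (force intro!: image_eqI)
qed

lemma adjoin_least:
  assumes "is_subring S" "A \<subseteq> S" "t \<in> S" shows "adjoin A t \<subseteq> S"
  unfolding adjoin_def
  using assms by (auto simp: poly_altdef poly_over_def is_subringD
      intro!: is_subring_sum is_subringD(5) is_subring_power)

fun adjoins :: "'b::comm_ring_1 set \<Rightarrow> 'b list \<Rightarrow> 'b set"
  where "adjoins A [] = A" | "adjoins A (t # ts) = adjoins (adjoin A t) ts"

lemma adjoins_props:
  assumes "is_subring A"
  shows "is_subring (adjoins A ts)" "A \<subseteq> adjoins A ts" "set ts \<subseteq> adjoins A ts"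
  using assms
proof (induction ts arbitrary: A)
  case (Cons t ts)
  case 1 show ?case using Cons(1)[OF is_subring_adjoin[OF 1]] by simp
  case 2 show ?case using Cons(2)[OF is_subring_adjoin[OF 2]] adjoin_contains[OF 2] by auto
  case 3 show ?case using Cons(2,3)[OF is_subring_adjoin[OF 3]] adjoin_contains[OF 3, of t] by auto
qed auto

lemma adjoins_least:
  assumes "is_subring S" "A \<subseteq> S" "set ts \<subseteq> S" shows "adjoins A ts \<subseteq> S"
  using assms(2,3) by (induction ts arbitrary: A) (auto simp: adjoin_least[OF assms(1)])

section \<open>The basis theorem and Krull's intersection theorem\<close>

definition lspan :: "'b::comm_ring_1 set \<Rightarrow> (nat \<Rightarrow> 'b) \<Rightarrow> nat \<Rightarrow> 'b set"
  where "lspan A b N = {\<Sum>i<N. r i * b i | r. \<forall>i. r i \<in> A}"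

definition noeth :: "'b::comm_ring_1 set \<Rightarrow> bool"
  where "noeth A \<longleftrightarrow> (\<forall>b. range b \<subseteq> A \<longrightarrow> (\<exists>N. b N \<in> lspan A b N))"

lemma lspan_add: 
  assumes "is_subring A" "x \<in> lspan A b N" "y \<in> lspan A b N" shows "x + y \<in> lspan A b N"
proof -
  from assms obtain r s where r: "\<forall>i. r i \<in> A" "x = (\<Sum>i<N. r i * b i)"
    and s: "\<forall>i. s i \<in> A" "y = (\<Sum>i<N. s i * b i)" by (auto simp: lspan_def)
  have "x + y = (\<Sum>i<N. (r i + s i) * b i)" by (simp add: r s sum.distrib algebra_simps)
  then show ?thesis using r s is_subringD[OF assms(1)] unfolding lspan_def by (auto intro!: exI[of _ "\<lambda>i. r i + s i"])
qed

lemma lspan_mult: 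
  assumes "is_subring A" "x \<in> lspan A b N" "a \<in> A" shows "a * x \<in> lspan A b N"
proof -
  from assms obtain r where r: "\<forall>i. r i \<in> A" "x = (\<Sum>i<N. r i * b i)" by (auto simp: lspan_def)
  have "a * x = (\<Sum>i<N. (a * r i) * b i)" by (simp add: r sum_distrib_left algebra_simps)
  then show ?thesis using r assms is_subringD[OF assms(1)]
    unfolding lspan_def by (auto intro!: exI[of _ "\<lambda>i. a * r i"])
qed

lemma lspan_zero: "is_subring A \<Longrightarrow> 0 \<in> lspan A b N"
  unfolding lspan_def by (auto intro!: exI[of _ "\<lambda>_. 0"] simp: is_subringD)

lemma lspan_gen:
  assumes "is_subring A" "i < N" shows "b i \<in> lspan A b N"
proof -
  have "b i = (\<Sum>j<N. (if j = i then 1 else 0) * b j)"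
    using assms(2) by (simp add: if_distrib[of "\<lambda>x. x * _"] sum.delta cong: if_cong)
  then show ?thesis unfolding lspan_def using is_subringD[OF assms(1)]
    by (intro CollectI exI[of _ "\<lambda>j. if j = i then 1 else 0"]) auto
qed

lemma lspan_sum:
  assumes "is_subring A" "\<And>i. i \<in> S \<Longrightarrow> f i \<in> lspan A b N" shows "sum f S \<in> lspan A b N"
  using assms(2)
  by (induction S rule: infinite_finite_induct) (auto simp: lspan_zero[OF assms(1)] intro: lspan_add[OF assms(1)])

lemma lspan_mono:
  assumes "is_subring A" "N \<le> M" shows "lspan A b N \<subseteq> lspan A b M"
proof
  fix x assume "x \<in> lspan A b N"
  then obtain r where r: "\<forall>i. r i \<in> A" "x = (\<Sum>i<N. r i * b i)" by (auto simp: lspan_def)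
  show "x \<in> lspan A b M" unfolding r(2)
    using r(1) assms by (auto intro!: lspan_sum lspan_mult lspan_gen)
qed

lemma lspan_trans:
  assumes "is_subring A" "\<And>i. i < N \<Longrightarrow> q i \<in> lspan A p M" shows "lspan A q N \<subseteq> lspan A p M"
  using assms by (auto simp: lspan_def[of A q] intro!: lspan_sum lspan_mult)

text \<open>Hilbert's argument: elements of least degree that are not yet generated have leading
  coefficients that, by assumption on \<open>A\<close>, become dependent.\<close>

lemma noeth_poly_over:
  fixes A :: "'b::comm_ring_1 set"
  assumes A: "is_subring A" and noe: "noeth A"
  shows "noeth (poly_over A)"
  unfolding noeth_def
proof (intro allI impI, rule ccontr)
  fix p :: "nat \<Rightarrow> 'b poly"
  let ?P = "poly_over A"
  note P = is_subring_poly_over[OF A]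
  assume p: "range p \<subseteq> ?P" and no: "\<nexists>N. p N \<in> lspan ?P p N"
  define J where "J = (\<Union>N. lspan ?P p N)"
  have Jadd: "x + y \<in> J" if "x \<in> J" "y \<in> J" for x y
  proof -
    from that obtain N M where "x \<in> lspan ?P p N" "y \<in> lspan ?P p M" by (auto simp: J_def)
    then have "x \<in> lspan ?P p (max N M)" "y \<in> lspan ?P p (max N M)"
      using lspan_mono[OF P] by (meson max.cobounded1 max.cobounded2 subsetD)+
    then have "x + y \<in> lspan ?P p (max N M)" by (rule lspan_add[OF P])
    then show ?thesis by (auto simp: J_def)
  qed
  have Jmult: "a * x \<in> J" if "x \<in> J" "a \<in> ?P" for a x
    using that lspan_mult[OF P] unfolding J_def by blast
  have J0: "0 \<in> J" by (auto simp: J_def lspan_zero[OF P])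
  have Jsum: "sum f S \<in> J" if "\<And>i. i \<in> S \<Longrightarrow> f i \<in> J" for f and S :: "nat set"
    using that by (induction S rule: infinite_finite_induct)
      (use J0 in \<open>auto intro!: Jadd\<close>)
  have pJ: "p N \<in> J" for N using lspan_gen[OF P, of N "Suc N"] by (auto simp: J_def)
  have JP: "J \<subseteq> ?P" unfolding J_def lspan_def
    using p by (auto intro!: is_subring_sum[OF P] is_subringD(5)[OF P])
  define least where "least q k x \<longleftrightarrow> x \<in> J \<and> x \<notin> lspan ?P q k \<and>
    (\<forall>y. y \<in> J \<and> y \<notin> lspan ?P q k \<longrightarrow> degree x \<le> degree y)" for q k x
  have "\<exists>q. \<forall>k. least q k (q k)"
  proof (rule dependent_wf_choice[OF wf_less_than])
    fix f g :: "nat \<Rightarrow> 'b poly" and k r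
    assume "\<And>z. (z, k) \<in> less_than \<Longrightarrow> f z = g z"
    then have "lspan ?P f k = lspan ?P g k" by (auto simp: lspan_def)
    then show "least f k r = least g k r" by (simp add: least_def)
  next
    fix k and q :: "nat \<Rightarrow> 'b poly"
    assume "\<And>y. (y, k) \<in> less_than \<Longrightarrow> least q y (q y)"
    then have "\<forall>i<k. q i \<in> J" by (simp add: least_def)
    then have "\<forall>i. \<exists>n. i < k \<longrightarrow> q i \<in> lspan ?P p n" by (auto simp: J_def)
    then obtain n where n: "i < k \<Longrightarrow> q i \<in> lspan ?P p (n i)" for i by metis
    define M where "M = Max (n ` {..<k} \<union> {0})"
    have "q i \<in> lspan ?P p M" if "i < k" for i
      using n[OF that] lspan_mono[OF P, of "n i" M p] that by (auto simp: M_def)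
    then have "lspan ?P q k \<subseteq> lspan ?P p M" by (rule lspan_trans[OF P])
    then have "p M \<in> J \<and> p M \<notin> lspan ?P q k" using no pJ by auto
    from ex_has_least_nat[of "\<lambda>x. x \<in> J \<and> x \<notin> lspan ?P q k", OF this, of degree]
    show "\<exists>r. least q k r" by (auto simp: least_def)
  qed
  then obtain q where q: "\<And>k. least q k (q k)" by auto
  have qJ: "q k \<in> J" and qn: "q k \<notin> lspan ?P q k" for k using q by (auto simp: least_def)
  have "range (\<lambda>k. lead_coeff (q k)) \<subseteq> A" using qJ JP by (auto simp: poly_over_def)
  then obtain N where "lead_coeff (q N) \<in> lspan A (\<lambda>k. lead_coeff (q k)) N"
    using noe by (auto simp: noeth_def)
  then obtain r where r: "\<And>i. r i \<in> A" and eq: "lead_coeff (q N) = (\<Sum>i<N. r i * lead_coeff (q i))"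
    by (auto simp: lspan_def)
  have dle: "degree (q i) \<le> degree (q N)" if "i < N" for i
    using q[of i] qJ[of N] qn[of N] lspan_mono[OF P, of i N q] that by (auto simp: least_def)
  define s where "s = (\<Sum>i<N. monom (r i) (degree (q N) - degree (q i)) * q i)"
  have sl: "s \<in> lspan ?P q N"
    unfolding s_def by (auto intro!: lspan_sum[OF P] lspan_mult[OF P] lspan_gen[OF P] poly_over_intros(1)[OF A] r)
  have sJ: "s \<in> J" unfolding s_def by (intro Jsum Jmult qJ poly_over_intros(1)[OF A] r)
  have hJ: "q N - s \<in> J"
    using Jadd[OF qJ[of N] Jmult[OF sJ, of "- 1"]] is_subringD[OF P] by simp
  have hn: "q N - s \<notin> lspan ?P q N"
    using lspan_add[OF P _ sl, of "q N - s"] qn[of N] by auto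
  have "degree s \<le> degree (q N)"
    unfolding s_def
  proof (rule degree_sum_le, simp)
    fix i assume "i \<in> {..<N}"
    have "degree (monom (r i) (degree (q N) - degree (q i)) * q i)
        \<le> (degree (q N) - degree (q i)) + degree (q i)"
      by (intro order.trans[OF degree_mult_le] add_right_mono degree_monom_le)
    then show "degree (monom (r i) (degree (q N) - degree (q i)) * q i) \<le> degree (q N)"
      using dle[of i] \<open>i \<in> {..<N}\<close> by simp
  qed
  then have dh: "degree (q N - s) \<le> degree (q N)" by (simp add: degree_diff_le)
  have "coeff s (degree (q N)) = (\<Sum>i<N. r i * lead_coeff (q i))"
    unfolding s_def coeff_sum using dle by (intro sum.cong) (auto simp: coeff_monom_mult)
  then have "coeff (q N - s) (degree (q N)) = 0" using eq by simp
  moreover have "degree (q N) \<le> degree (q N - s)" using q[of N] hJ hn by (auto simp: least_def)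
  ultimately have "q N - s = 0" using dh by (metis le_antisym leading_coeff_0_iff)
  then show False using hn lspan_zero[OF P] by auto
qed

lemma noeth_adjoin:
  assumes A: "is_subring A" and noe: "noeth A"
  shows "noeth (adjoin A t)"
  unfolding noeth_def
proof (intro allI impI)
  fix b :: "nat \<Rightarrow> 'a" assume b: "range b \<subseteq> adjoin A t"
  then have "\<forall>i. \<exists>p. p \<in> poly_over A \<and> b i = poly p t" by (auto simp: adjoin_def)
  then obtain p where p: "\<And>i. p i \<in> poly_over A" "\<And>i. b i = poly (p i) t" by metis
  obtain N where "p N \<in> lspan (poly_over A) p N"
    using noeth_poly_over[OF A noe] p(1) by (auto simp: noeth_def)
  then obtain r where r: "\<And>i. r i \<in> poly_over A" and eq: "p N = (\<Sum>i<N. r i * p i)"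
    by (auto simp: lspan_def)
  have "b N = (\<Sum>i<N. poly (r i) t * b i)" by (simp add: p(2) eq poly_sum)
  then show "\<exists>N. b N \<in> lspan (adjoin A t) b N"
    unfolding lspan_def adjoin_def using r by (intro exI[of _ N] CollectI exI[of _ "\<lambda>i. poly (r i) t"]) auto
qed

lemma noeth_adjoins: "is_subring A \<Longrightarrow> noeth A \<Longrightarrow> noeth (adjoins A ts)"
  by (induction ts arbitrary: A) (auto simp: noeth_adjoin is_subring_adjoin)

lemma noeth_field:
  assumes "is_subring K" "\<And>x. x \<in> K \<Longrightarrow> x \<noteq> 0 \<Longrightarrow> \<exists>y\<in>K. x * y = 1"
  shows "noeth K"
  unfolding noeth_def
proof (intro allI impI)
  fix b :: "nat \<Rightarrow> 'a" assume b: "range b \<subseteq> K"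
  show "\<exists>N. b N \<in> lspan K b N"
  proof (cases "b 0 = 0")
    case True
    then show ?thesis using lspan_zero[OF assms(1), of b 0] by (intro exI[of _ 0]) simp
  next
    case False
    then obtain y where y: "y \<in> K" "b 0 * y = 1" using assms(2) b by blast
    have "b 1 = (b 1 * y) * b 0" using y by (metis mult.assoc mult.commute mult.right_neutral)
    then have "b 1 \<in> lspan K b 1"
      using lspan_mult[OF assms(1) lspan_gen[OF assms(1), of 0 1 b], of "b 1 * y"] b y
        is_subringD(5)[OF assms(1)] by auto
    then show ?thesis by blast
  qed
qed

inductive_set sums_of :: "'b::comm_monoid_add set \<Rightarrow> 'b set" for S where
  zero: "0 \<in> sums_of S"
| plus: "x \<in> S \<Longrightarrow> y \<in> sums_of S \<Longrightarrow> x + y \<in> sums_of S"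

lemma sums_of_gen: "x \<in> S \<Longrightarrow> x \<in> sums_of S"
  using sums_of.plus[OF _ sums_of.zero] by fastforce

lemma sums_of_subset:
  assumes "0 \<in> A" "\<And>x y. x \<in> A \<Longrightarrow> y \<in> A \<Longrightarrow> x + y \<in> A" "S \<subseteq> A"
  shows "sums_of S \<subseteq> A"
proof
  fix x assume "x \<in> sums_of S"
  then show "x \<in> A" by induction (use assms in auto)
qed

lemma sums_of_add: "x \<in> sums_of S \<Longrightarrow> y \<in> sums_of S \<Longrightarrow> x + y \<in> sums_of S"
  by (induction rule: sums_of.induct) (auto simp: add.assoc intro: sums_of.plus)

fun ipow :: "'b::comm_ring set \<Rightarrow> 'b set \<Rightarrow> nat \<Rightarrow> 'b set"
  where "ipow A M 0 = A"
  | "ipow A M (Suc n) = sums_of {a * b | a b. a \<in> M \<and> b \<in> ipow A M n}"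

lemma ipow_add:
  assumes "\<And>x y. x \<in> A \<Longrightarrow> y \<in> A \<Longrightarrow> x + y \<in> A" "x \<in> ipow A M n" "y \<in> ipow A M n"
  shows "x + y \<in> ipow A M n"
  using assms by (cases n) (auto intro: sums_of_add)

lemma ipow_multA:
  assumes "\<And>x y. x \<in> A \<Longrightarrow> y \<in> A \<Longrightarrow> x * y \<in> A" "x \<in> A" "y \<in> ipow A M n"
  shows "x * y \<in> ipow A M n"
  using assms(2,3)
proof (induction n arbitrary: x y)
  case (Suc n)
  from Suc.prems(2) have "y \<in> sums_of {a * b | a b. a \<in> M \<and> b \<in> ipow A M n}" by simp
  then have "x * y \<in> sums_of {a * b | a b. a \<in> M \<and> b \<in> ipow A M n}"
  proof (induction rule: sums_of.induct)
    case (plus u v)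
    then obtain a b where "u = a * b" "a \<in> M" "b \<in> ipow A M n" by auto
    then have "x * u = a * (x * b)" "x * b \<in> ipow A M n"
      using Suc by (auto simp: mult.left_commute)
    then show ?case using plus \<open>a \<in> M\<close> by (auto simp: distrib_left intro!: sums_of.plus)
  qed (simp add: sums_of.zero)
  then show ?case by simp
qed (use assms in auto)

lemma ipow_mult:
  assumes A: "\<And>x y. x \<in> A \<Longrightarrow> y \<in> A \<Longrightarrow> x * y \<in> A" "\<And>x y. x \<in> A \<Longrightarrow> y \<in> A \<Longrightarrow> x + y \<in> A"
    and xy: "x \<in> ipow A M m" "y \<in> ipow A M n"
  shows "x * y \<in> ipow A M (m + n)"
  using xy(1)
proof (induction m arbitrary: x)
  case 0
  then show ?case using ipow_multA[OF A(1) _ xy(2)] by simp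
next
  case (Suc m)
  from Suc.prems have "x \<in> sums_of {a * b | a b. a \<in> M \<and> b \<in> ipow A M m}" by simp
  then have "x * y \<in> sums_of {a * b | a b. a \<in> M \<and> b \<in> ipow A M (m + n)}"
  proof (induction rule: sums_of.induct)
    case (plus u v)
    then obtain a b where "u = a * b" "a \<in> M" "b \<in> ipow A M m" by auto
    then show ?case using plus Suc.IH[of b] by (auto simp: distrib_right mult.assoc intro!: sums_of.plus)
  qed (simp add: sums_of.zero)
  then show ?case by simp
qed

abbreviation consts_fun :: "('a \<Rightarrow> 'k) set"
  where "consts_fun \<equiv> range (\<lambda>c _. c)"

lemma is_subring_consts: "is_subring (consts_fun :: ('a \<Rightarrow> 'k::field) set)"
  unfolding is_subring_def by (auto simp: fun_eq_iff)

text \<open>Krull's intersection theorem at a point. The graded ring \<open>A \<oplus> M t \<oplus> M\<^sup>2 t\<^sup>2 \<oplus> \<dots>\<close> is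
  finitely generated, hence noetherian; a relation between the elements \<open>b t\<^sup>n\<close> yields, in one degree,
  \<open>b = z b\<close> with \<open>z \<in> M\<close>.\<close>

lemma krull_at_point:
  fixes xs :: "('a \<Rightarrow> 'k::field) list" and e :: 'a
  defines "A \<equiv> adjoins consts_fun xs"
  defines "M \<equiv> {f \<in> A. f e = 0}"
  assumes b: "\<And>n. b \<in> ipow A M n"
  shows "\<exists>z\<in>M. b = z * b"
proof -
  let ?c = "\<lambda>f :: 'a \<Rightarrow> 'k. (\<lambda>_ :: 'a. f e)"
  define K' where "K' = (\<lambda>c. [:c:]) ` (consts_fun :: ('a \<Rightarrow> 'k) set)"
  define ys where "ys = map (\<lambda>x. [:x:]) xs @ map (\<lambda>x. monom (x - ?c x) 1) xs"
  define R where "R = adjoins K' ys"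
  have A: "is_subring A" and KA: "consts_fun \<subseteq> A" and xA: "set xs \<subseteq> A"
    unfolding A_def using adjoins_props[OF is_subring_consts, where ts = xs] by auto
  note AD = is_subringD[OF A]
  have K': "is_subring K'" unfolding K'_def
    by (auto simp: is_subring_def one_pCons fun_eq_iff image_iff)
  have "noeth K'"
  proof (rule noeth_field[OF K'])
    fix x assume "x \<in> K'" "x \<noteq> 0"
    then obtain c :: 'k where c: "x = [:\<lambda>_. c:]" "c \<noteq> 0" by (auto simp: K'_def fun_eq_iff)
    then have "x * [:\<lambda>_. inverse c:] = 1" by (auto simp: one_pCons fun_eq_iff)
    then show "\<exists>y\<in>K'. x * y = 1" by (auto simp: K'_def)
  qed
  then have Rn: "noeth R" unfolding R_def by (rule noeth_adjoins[OF K'])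
  have R: "is_subring R" and KR: "K' \<subseteq> R" and yR: "set ys \<subseteq> R"
    unfolding R_def using adjoins_props[OF K'] by auto
  note RD = is_subringD[OF R]
  define S where "S = {f. [:f:] \<in> R \<and> monom (f - ?c f) 1 \<in> R}"
  have "is_subring S"
    unfolding is_subring_def
  proof (intro conjI ballI)
    have "(1 :: 'a \<Rightarrow> 'k) - ?c 1 = 0" by (auto simp: fun_eq_iff)
    then show "1 \<in> S" using RD by (simp add: S_def one_pCons[symmetric])
    fix x assume x: "x \<in> S"
    have "- x - ?c (- x) = - (x - ?c x)" by (auto simp: fun_eq_iff)
    then show "- x \<in> S" using x RD(3)[of "[:x:]"] RD(3)[of "monom (x - ?c x) 1"]
      unfolding S_def mem_Collect_eq by (simp only: minus_pCons minus_monom[symmetric] minus_zero)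
    fix y assume y: "y \<in> S"
    have "x + y - ?c (x + y) = (x - ?c x) + (y - ?c y)" by (auto simp: fun_eq_iff)
    then show "x + y \<in> S" using x y RD(4)[of "[:x:]" "[:y:]"]
        RD(4)[of "monom (x - ?c x) 1" "monom (y - ?c y) 1"]
      unfolding S_def mem_Collect_eq by (simp only: add_monom) simp
    have "?c x \<in> consts_fun" by blast
    then have cR: "[:?c x:] \<in> R" using KR unfolding K'_def by blast
    have e1: "x * y - ?c (x * y) = (x - ?c x) * y + ?c x * (y - ?c y)"
      by (auto simp: fun_eq_iff algebra_simps)
    have "monom (x * y - ?c (x * y)) 1 = [:y:] * monom (x - ?c x) 1 + [:?c x:] * monom (y - ?c y) 1"
      unfolding e1 by (simp add: add_monom[symmetric] smult_monom mult.commute)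
    moreover have "[:y:] \<in> R" "monom (x - ?c x) 1 \<in> R" "monom (y - ?c y) 1 \<in> R"
      using x y unfolding S_def by blast+
    ultimately have "monom (x * y - ?c (x * y)) 1 \<in> R" using cR by (metis RD(4,5))
    moreover have "[:x * y:] = [:x:] * [:y:]" by simp
    then have "[:x * y:] \<in> R" using x y unfolding S_def by (auto intro!: RD(5) simp only: mem_Collect_eq)
    ultimately show "x * y \<in> S" by (simp add: S_def)
  qed
  moreover have "consts_fun \<subseteq> S"
  proof
    fix f :: "'a \<Rightarrow> 'k" assume f: "f \<in> consts_fun"
    then have "f - ?c f = 0" by (auto simp: fun_eq_iff)
    moreover have "[:f:] \<in> R" using f KR unfolding K'_def by blast
    ultimately show "f \<in> S" using RD(2) by (simp add: S_def)
  qed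
  moreover have "set xs \<subseteq> S" using yR by (auto simp: S_def ys_def)
  ultimately have AS: "A \<subseteq> S" unfolding A_def by (rule adjoins_least)
  have mon: "monom a n \<in> R" if "a \<in> ipow A M n" for a n
    using that
  proof (induction n arbitrary: a)
    case 0
    then show ?case using AS by (auto simp: S_def monom_0)
  next
    case (Suc n)
    from Suc.prems have "a \<in> sums_of {x * y | x y. x \<in> M \<and> y \<in> ipow A M n}" by simp
    then show ?case
    proof (induction rule: sums_of.induct)
      case (plus u v)
      then obtain x y where xy: "u = x * y" "x \<in> M" "y \<in> ipow A M n" by auto
      then have "x - ?c x = x" "x \<in> S" using AS by (auto simp: M_def fun_eq_iff)
      then have "monom x 1 \<in> R" by (metis (no_types, lifting) S_def mem_Collect_eq)
      then have "monom x 1 * monom y n \<in> R" using Suc.IH[OF xy(3)] RD(5) by blast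
      then have "monom u (Suc n) \<in> R" by (simp add: mult_monom xy)
      then show ?case using RD(4)[OF _ plus.IH] by (metis add_monom)
    next
      case zero
      then show ?case using RD(2) by (metis monom_eq_0)
    qed
  qed
  define T where "T = {p. \<forall>n. coeff p n \<in> ipow A M n}"
  have i0: "0 \<in> ipow A M n" for n using AD(2) by (cases n) (auto intro: sums_of.zero)
  have isum: "sum f S \<in> ipow A M n" if "\<And>i. i \<in> S \<Longrightarrow> f i \<in> ipow A M n" for f n and S :: "nat set"
    using that by (induction S rule: infinite_finite_induct) (auto simp: i0 intro!: ipow_add[OF AD(4)])
  have "is_subring T"
    unfolding is_subring_def
  proof (intro conjI ballI)
    have "coeff 1 n \<in> ipow A M n" for n using i0[of n] AD(1) by (cases "n = 0") simp_all
    then show "1 \<in> T" by (simp add: T_def)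
    fix x assume x: "x \<in> T"
    have "- 1 * coeff x n \<in> ipow A M n" for n
      by (rule ipow_multA[OF AD(5)]) (use x AD in \<open>auto simp: T_def\<close>)
    then show "- x \<in> T" by (simp add: T_def)
    fix y assume y: "y \<in> T"
    show "x + y \<in> T" using x y by (auto simp: T_def intro!: ipow_add[OF AD(4)])
    have "coeff x i * coeff y (n - i) \<in> ipow A M n" if "i \<le> n" for i n
      using ipow_mult[OF AD(5,4), of "coeff x i" M i "coeff y (n - i)" "n - i"] x y that by (simp add: T_def)
    then show "x * y \<in> T" by (auto simp: T_def coeff_mult intro!: isum)
  qed
  moreover have cT: "[:f:] \<in> T" if "f \<in> A" for f
    using that i0 by (auto simp: T_def coeff_pCons sums_of.zero split: nat.splits)
  then have "K' \<subseteq> T" using KA by (auto simp: K'_def)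
  moreover have "set ys \<subseteq> T"
  proof -
    have "monom (x - ?c x) 1 \<in> T" if "x \<in> set xs" for x
    proof -
      have xA': "x \<in> A" using that xA by auto
      have "?c x \<in> A" using KA by blast
      then have "x - ?c x \<in> M" using AD(6)[OF xA'] by (simp add: M_def)
      then have "(x - ?c x) * 1 \<in> sums_of {a * b | a b. a \<in> M \<and> b \<in> ipow A M 0}"
        using AD(1) by (intro sums_of_gen) (simp only: ipow.simps, blast)
      then have "x - ?c x \<in> ipow A M 1" by simp
      then show ?thesis using i0 by (auto simp: T_def coeff_monom sums_of.zero simp del: ipow.simps)
    qed
    then show ?thesis using cT xA unfolding ys_def by auto
  qed
  ultimately have RT: "R \<subseteq> T" unfolding R_def by (rule adjoins_least)
  have "range (\<lambda>n. monom b n) \<subseteq> R" using mon[OF b] by blast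
  then obtain N where "monom b N \<in> lspan R (\<lambda>n. monom b n) N" using Rn unfolding noeth_def by blast
  then obtain r where r: "\<And>i. r i \<in> R" and eq: "monom b N = (\<Sum>i<N. r i * monom b i)"
    by (auto simp: lspan_def)
  define z where "z = (\<Sum>i<N. coeff (r i) (N - i))"
  have "b = coeff (\<Sum>i<N. r i * monom b i) N" unfolding eq[symmetric] by simp
  also have "\<dots> = (\<Sum>i<N. coeff (r i) (N - i) * b)"
    unfolding coeff_sum
  proof (intro sum.cong refl)
    fix i assume "i \<in> {..<N}"
    then have "coeff (monom b i * r i) N = b * coeff (r i) (N - i)" by (simp add: coeff_monom_mult)
    then show "coeff (r i * monom b i) N = coeff (r i) (N - i) * b" by (metis mult.commute)
  qed
  also have "\<dots> = z * b" by (simp add: z_def sum_distrib_right)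
  finally have "b = z * b" .
  moreover have "z \<in> M"
  proof -
    have i1: "ipow A M (Suc n) \<subseteq> M" for n
    proof (induction n)
      case 0
      show ?case unfolding ipow.simps
        by (rule sums_of_subset) (use AD in \<open>auto simp: M_def\<close>)
    next
      case (Suc n)
      then have "ipow A M (Suc n) \<subseteq> A" by (auto simp: M_def)
      then show ?case unfolding ipow.simps(2)[of A M "Suc n"]
        by (intro sums_of_subset) (use AD in \<open>auto simp: M_def\<close>)
    qed
    have rM: "coeff (r i) (N - i) \<in> M" if "i < N" for i
    proof -
      have "coeff (r i) (N - i) \<in> ipow A M (N - i)" using r RT unfolding T_def by blast
      moreover obtain k where "N - i = Suc k" using \<open>i < N\<close> by (metis Suc_diff_Suc)
      ultimately show ?thesis using i1 by auto
    qed
    have sM: "sum f S \<in> M" if "\<And>i. i \<in> S \<Longrightarrow> f i \<in> M" for f and S :: "nat set"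
      using that by (induction S rule: infinite_finite_induct) (use AD(2,4) in \<open>auto simp: M_def\<close>)
    show ?thesis unfolding z_def by (rule sM) (simp add: rM)
  qed
  ultimately show ?thesis by blast
qed

section \<open>Lifting homomorphisms into dual numbers\<close>

text \<open>The ring \<open>k[\<epsilon>]/(\<epsilon>\<^sup>2)\<close>: a homomorphism into it is a point together with a tangent vector.\<close>

datatype 'k dual = Dual (dre: 'k) (dep: 'k)

instantiation dual :: (comm_ring_1) comm_ring_1
begin
definition "0 = Dual 0 0"
definition "1 = Dual 1 0"
definition "x + y = Dual (dre x + dre y) (dep x + dep y)"
definition "x - y = Dual (dre x - dre y) (dep x - dep y)"
definition "- x = Dual (- dre x) (- dep x)"
definition "x * y = Dual (dre x * dre y) (dre x * dep y + dep x * dre y)"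
instance
  by standard (auto simp: zero_dual_def one_dual_def plus_dual_def minus_dual_def uminus_dual_def
      times_dual_def algebra_simps)
end

lemma dual_sel [simp]:
  "dre 0 = 0" "dep 0 = 0" "dre 1 = 1" "dep 1 = 0"
  "dre (x + y) = dre x + dre y" "dep (x + y) = dep x + dep y"
  "dre (x * y) = dre x * dre y" "dep (x * y) = dre x * dep y + dep x * dre y"
  by (simp_all add: zero_dual_def one_dual_def plus_dual_def times_dual_def)

lemma dre_of_nat [simp]: "dre (of_nat n) = of_nat n"
  by (induction n) auto

lemma dre_poly: "dre (poly p T) = poly (map_poly dre p) (dre T)"
  by (induction p) (auto simp: map_poly_pCons)

lemma dep_poly: "dep (poly p (Dual \<tau> \<tau>')) =
    dep (poly p (Dual \<tau> 0)) + \<tau>' * poly (pderiv (map_poly dre p)) (\<tau> :: 'k::field)"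
proof (induction p)
  case (pCons a p)
  have "dre (poly p (Dual \<tau> \<tau>')) = poly (map_poly dre p) \<tau>" for \<tau>' by (simp add: dre_poly)
  then show ?case using pCons by (simp add: map_poly_pCons pderiv_pCons algebra_simps)
qed simp

lemma dual_cancel: "dre (x :: 'k::field dual) \<noteq> 0 \<Longrightarrow> x * y = 0 \<Longrightarrow> y = 0"
  by (cases y) (auto simp: zero_dual_def times_dual_def)

definition rhom :: "'b::comm_ring_1 set \<Rightarrow> ('b \<Rightarrow> 'c::comm_ring_1) \<Rightarrow> bool"
  where "rhom A \<Psi> \<longleftrightarrow> \<Psi> 1 = 1 \<and> (\<forall>x\<in>A. \<forall>y\<in>A. \<Psi> (x + y) = \<Psi> x + \<Psi> y \<and> \<Psi> (x * y) = \<Psi> x * \<Psi> y)"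

lemma rhomD:
  assumes "rhom A \<Psi>" "is_subring A"
  shows "\<Psi> 1 = 1" "\<And>x y. x \<in> A \<Longrightarrow> y \<in> A \<Longrightarrow> \<Psi> (x + y) = \<Psi> x + \<Psi> y"
    "\<And>x y. x \<in> A \<Longrightarrow> y \<in> A \<Longrightarrow> \<Psi> (x * y) = \<Psi> x * \<Psi> y" "\<Psi> 0 = 0"
proof -
  show "\<Psi> 1 = 1" and a: "\<And>x y. x \<in> A \<Longrightarrow> y \<in> A \<Longrightarrow> \<Psi> (x + y) = \<Psi> x + \<Psi> y"
    and "\<And>x y. x \<in> A \<Longrightarrow> y \<in> A \<Longrightarrow> \<Psi> (x * y) = \<Psi> x * \<Psi> y"
    using assms(1) by (auto simp: rhom_def)
  show "\<Psi> 0 = 0" using a[of 0 0] is_subringD(2)[OF assms(2)] by simp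
qed

lemma rhom_sum:
  assumes "rhom A \<Psi>" "is_subring A" "\<And>i. i \<in> S \<Longrightarrow> f i \<in> A"
  shows "\<Psi> (sum f S) = (\<Sum>i\<in>S. \<Psi> (f i))"
  using assms(3)
proof (induction S rule: infinite_finite_induct)
  case (insert x F)
  then have "\<Psi> (f x + sum f F) = \<Psi> (f x) + \<Psi> (sum f F)"
    by (intro rhomD(2)[OF assms(1,2)] is_subring_sum[OF assms(2)]) auto
  then show ?case using insert by simp
qed (auto simp: rhomD(4)[OF assms(1,2)])

lemma rhom_of_nat: "rhom A \<Psi> \<Longrightarrow> is_subring A \<Longrightarrow> \<Psi> (of_nat n) = of_nat n"
  by (induction n) (auto simp: rhomD is_subring_of_nat is_subringD)

lemma rhom_power: "rhom A \<Psi> \<Longrightarrow> is_subring A \<Longrightarrow> x \<in> A \<Longrightarrow> \<Psi> (x ^ n) = \<Psi> x ^ n"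
  by (induction n) (auto simp: rhomD is_subring_power)

lemma rhom_map_poly:
  assumes "rhom A \<Psi>" "is_subring A"
  shows "rhom (poly_over A) (\<lambda>p. poly (map_poly \<Psi> p) T)"
proof -
  note R = rhomD[OF assms]
  have "map_poly \<Psi> (p + q) = map_poly \<Psi> p + map_poly \<Psi> q" if "p \<in> poly_over A" "q \<in> poly_over A" for p q
    using that by (intro poly_eqI) (auto simp: coeff_map_poly R poly_over_def)
  moreover have "map_poly \<Psi> (p * q) = map_poly \<Psi> p * map_poly \<Psi> q"
    if "p \<in> poly_over A" "q \<in> poly_over A" for p q
    using that by (intro poly_eqI) (auto simp: coeff_map_poly R poly_over_def coeff_mult
        is_subringD[OF assms(2)] intro!: rhom_sum[OF assms, THEN trans])
  ultimately show ?thesis by (auto simp: rhom_def map_poly_1' R)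
qed

lemma pseudo_division_over:
  fixes A :: "'b::comm_ring_1 set"
  assumes A: "is_subring A" and g: "g \<in> poly_over A" "g \<noteq> 0" and f: "f \<in> poly_over A"
  shows "\<exists>N. \<exists>s\<in>poly_over A. \<exists>r\<in>poly_over A. smult (lead_coeff g ^ N) f = s * g + r \<and>
    (r = 0 \<or> degree r < degree g)"
  using f
proof (induction "degree f" arbitrary: f rule: less_induct)
  case less
  note P = is_subringD[OF is_subring_poly_over[OF A]]
  let ?c = "lead_coeff g"
  have c: "?c \<in> A" using g by (auto simp: poly_over_def)
  show ?case
  proof (cases "f = 0 \<or> degree f < degree g")
    case True
    then show ?thesis using less.prems P(2) by (intro exI[of _ 0] bexI[of _ 0] bexI[of _ f]) auto
  next
    case False
    let ?m = "monom (lead_coeff f) (degree f - degree g)"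
    define h where "h = smult ?c f - ?m * g"
    have m: "?m \<in> poly_over A" by (rule poly_over_intros(1)[OF A]) (use less.prems in \<open>auto simp: poly_over_def\<close>)
    have hP: "h \<in> poly_over A" unfolding h_def using m g c less.prems
      by (intro P(5,6) poly_over_intros(3)[OF A])
    have "degree (?m * g) \<le> degree f"
      using degree_mult_le[of ?m g] degree_monom_le[of "lead_coeff f" "degree f - degree g"] False by linarith
    then have "degree h \<le> degree f"
      unfolding h_def by (intro degree_diff_le) (auto intro: order.trans[OF degree_smult_le])
    moreover have "coeff (?m * g) (degree f) = lead_coeff f * lead_coeff g"
      using False by (simp add: coeff_monom_mult)
    then have "coeff h (degree f) = 0" by (simp add: h_def mult.commute)
    ultimately have dh: "h = 0 \<or> degree h < degree f" 
      by (metis leading_coeff_0_iff linorder_neqE_nat linorder_not_less)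
    have "\<exists>N. \<exists>s\<in>poly_over A. \<exists>r\<in>poly_over A. smult (?c ^ N) h = s * g + r \<and> (r = 0 \<or> degree r < degree g)"
    proof (cases "h = 0")
      case True
      then show ?thesis using P(2) by (intro exI[of _ 0] bexI[of _ 0]) auto
    next
      case False
      then show ?thesis using less.hyps[OF _ hP] dh by blast
    qed
    then obtain N s r where s: "s \<in> poly_over A" "r \<in> poly_over A" "smult (?c ^ N) h = s * g + r"
      "r = 0 \<or> degree r < degree g" by blast
    have "smult (?c ^ Suc N) f = smult (?c ^ N) (h + ?m * g)" by (simp add: h_def mult.commute)
    also have "\<dots> = (s + smult (?c ^ N) ?m) * g + r" by (simp add: smult_add_right s(3) distrib_right)
    finally show ?thesis using s m c
      by (intro exI[of _ "Suc N"] bexI[of _ "s + smult (?c ^ N) ?m"] bexI[of _ r] conjI P(4) poly_over_intros(3)[OF A]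
          is_subring_power[OF A])
  qed
qed

text \<open>Without assuming a field of fractions, coprimality of a minimal polynomial \<open>p\<close> of \<open>t\<close> and of
  \<open>q\<close> with \<open>q(t) \<noteq> 0\<close> is expressed by a nonzero constant in the ideal \<open>(p, q)\<close>.\<close>

lemma minimal_poly_bezout:
  fixes A :: "'b::comm_ring_1 set"
  assumes A: "is_subring A" and B: "is_subring B" "A \<subseteq> B" "t \<in> B"
    and dom: "\<And>x y. x \<in> B \<Longrightarrow> y \<in> B \<Longrightarrow> x * y = 0 \<Longrightarrow> x = 0 \<or> y = 0"
    and p: "p \<in> poly_over A" "p \<noteq> 0" "poly p t = 0"
    and min: "\<And>q. q \<in> poly_over A \<Longrightarrow> q \<noteq> 0 \<Longrightarrow> poly q t = 0 \<Longrightarrow> degree p \<le> degree q"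
    and q: "q \<in> poly_over A" "poly q t \<noteq> 0"
  shows "\<exists>u\<in>poly_over A. \<exists>v\<in>poly_over A. \<exists>r\<in>A. r \<noteq> 0 \<and> u * q + v * p = [:r:]"
proof -
  note P = is_subringD[OF is_subring_poly_over[OF A]]
  have inB: "poly f t \<in> B" if "f \<in> poly_over A" for f
    using adjoin_least[OF B] that by (auto simp: adjoin_def)
  have powne: "c ^ N \<noteq> 0" if "c \<in> B" "c \<noteq> 0" for c N
    using dom[OF that(1) is_subring_power[OF B(1) that(1)]] that(2)
    by (induction N) auto
  define I where "I = {u * q + v * p | u v. u \<in> poly_over A \<and> v \<in> poly_over A}"
  have IP: "I \<subseteq> poly_over A" using P p q by (auto simp: I_def)
  have "p = 0 * q + 1 * p" "q = 1 * q + 0 * p" by auto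
  then have pI: "p \<in> I" and qI: "q \<in> I" unfolding I_def using P by blast+
  from ex_has_least_nat[of "\<lambda>g. g \<in> I \<and> g \<noteq> 0" p degree]
  obtain g where g: "g \<in> I" "g \<noteq> 0" and gmin: "\<And>h. h \<in> I \<Longrightarrow> h \<noteq> 0 \<Longrightarrow> degree g \<le> degree h"
    using pI p by auto
  let ?c = "lead_coeff g"
  have gP: "g \<in> poly_over A" using g IP by auto
  have cA: "?c \<in> A" and c0: "?c \<noteq> 0" using gP g by (auto simp: poly_over_def)
  have div: "\<exists>N. \<exists>s\<in>poly_over A. smult (?c ^ N) f = s * g" if f: "f \<in> I" for f
  proof -
    obtain N s r where s: "s \<in> poly_over A" "r \<in> poly_over A" "smult (?c ^ N) f = s * g + r"
      "r = 0 \<or> degree r < degree g"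
      using pseudo_division_over[OF A gP g(2), of f] f IP by blast
    obtain u v u' v' where f': "f = u * q + v * p" "u \<in> poly_over A" "v \<in> poly_over A"
      and g': "g = u' * q + v' * p" "u' \<in> poly_over A" "v' \<in> poly_over A"
      using f g unfolding I_def by blast
    have "r = smult (?c ^ N) f - s * g" using s by simp
    also have "\<dots> = (smult (?c ^ N) u - s * u') * q + (smult (?c ^ N) v - s * v') * p"
      by (subst f', subst (2) g') (simp add: algebra_simps smult_add_right)
    finally have "r \<in> I" unfolding I_def
      using f' g' s(1) cA by (auto intro!: exI P(5,6) poly_over_intros(3)[OF A] is_subring_power[OF A])
    then have "r = 0" using gmin[of r] s(4) by (metis not_less)
    then show ?thesis using s by auto
  qed
  obtain N s where s: "s \<in> poly_over A" "smult (?c ^ N) p = s * g" using div[OF pI] by blast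
  obtain M s' where s': "s' \<in> poly_over A" "smult (?c ^ M) q = s' * g" using div[OF qI] by blast
  have cB: "?c \<in> B" using cA B by auto
  have "poly s' t * poly g t = ?c ^ M * poly q t" using arg_cong[OF s'(2), of "\<lambda>p. poly p t"] by simp
  moreover have "?c ^ M * poly q t \<noteq> 0"
    using dom[of "?c ^ M" "poly q t"] powne[OF cB c0] q inB is_subring_power[OF B(1) cB] by auto
  ultimately have "poly g t \<noteq> 0" by auto
  moreover have "poly s t * poly g t = 0" using arg_cong[OF s(2), of "\<lambda>p. poly p t"] p by simp
  ultimately have st: "poly s t = 0" using dom inB s(1) gP by blast
  have lp: "?c ^ N * lead_coeff p \<noteq> 0"
    using dom[of "?c ^ N" "lead_coeff p"] powne[OF cB c0] p B is_subring_power[OF B(1) cB]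
    by (auto simp: poly_over_def)
  have "s \<noteq> 0"
  proof
    assume "s = 0"
    then have "coeff (smult (?c ^ N) p) (degree p) = 0" using s by simp
    then show False using lp by simp
  qed
  then have ds: "degree p \<le> degree s" using min[OF s(1)] st by auto
  have "lead_coeff s * ?c \<noteq> 0"
    using dom[of "lead_coeff s" ?c] \<open>s \<noteq> 0\<close> c0 cB s(1) B by (auto simp: poly_over_def)
  then have "coeff (s * g) (degree s + degree g) \<noteq> 0" by (simp add: coeff_mult_degree_sum)
  then have "degree s + degree g \<le> degree (s * g)" by (rule le_degree)
  also have "\<dots> \<le> degree p" unfolding s(2)[symmetric] by (rule degree_smult_le)
  finally have "degree g = 0" using ds by simp
  then obtain r where r: "g = [:r:]" by (rule degree_eq_zeroE)
  moreover have "r \<in> A" "r \<noteq> 0" using cA c0 r by auto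
  moreover obtain u v where "g = u * q + v * p" "u \<in> poly_over A" "v \<in> poly_over A"
    using g unfolding I_def by blast
  ultimately show ?thesis by metis
qed

text \<open>The formal derivative over a ring that may have zero divisors.\<close>

definition pder :: "'b::comm_ring_1 poly \<Rightarrow> 'b poly"
  where "pder p = (\<Sum>i\<le>degree p. monom (of_nat i * coeff p i) (i - 1))"

lemma coeff_pder: "coeff (pder p) n = of_nat (Suc n) * coeff p (Suc n)"
proof -
  have "coeff (pder p) n = (\<Sum>i\<le>degree p. if i = Suc n then of_nat i * coeff p i else 0)"
    unfolding pder_def coeff_sum
  proof (intro sum.cong refl)
    fix i show "coeff (monom (of_nat i * coeff p i) (i - 1)) n = (if i = Suc n then of_nat i * coeff p i else 0)"
      by (cases i) (auto simp: coeff_monom)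
  qed
  then show ?thesis by (simp add: sum.delta' coeff_eq_0)
qed

lemma rhom_extend:
  assumes A: "is_subring A" and \<Psi>: "rhom A \<Psi>"
    and T: "\<And>q. q \<in> poly_over A \<Longrightarrow> poly q t = 0 \<Longrightarrow> poly (map_poly \<Psi> q) T = 0"
  shows "\<exists>\<Psi>'. rhom (adjoin A t) \<Psi>' \<and> (\<forall>q\<in>poly_over A. \<Psi>' (poly q t) = poly (map_poly \<Psi> q) T)"
proof -
  note P = is_subringD[OF is_subring_poly_over[OF A]]
  let ?\<Phi> = "\<lambda>q. poly (map_poly \<Psi> q) T"
  note H = rhomD[OF rhom_map_poly[OF \<Psi> A, of T] is_subring_poly_over[OF A]]
  define \<Psi>' where "\<Psi>' y = ?\<Phi> (SOME q. q \<in> poly_over A \<and> poly q t = y)" for y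
  have ev: "\<Psi>' (poly q t) = ?\<Phi> q" if q: "q \<in> poly_over A" for q
  proof -
    define q' where "q' = (SOME q'. q' \<in> poly_over A \<and> poly q' t = poly q t)"
    have "q' \<in> poly_over A \<and> poly q' t = poly q t"
      unfolding q'_def by (rule someI[of _ q]) (use q in auto)
    then have q': "q' \<in> poly_over A" "poly q' t = poly q t" by auto
    have "?\<Phi> (q' - q) = 0" using T[of "q' - q"] P(6)[OF q'(1) q] q'(2) by simp
    moreover have "?\<Phi> ((q' - q) + q) = ?\<Phi> (q' - q) + ?\<Phi> q" by (intro H(2) P(6) q'(1) q)
    ultimately show ?thesis by (simp add: \<Psi>'_def q'_def[symmetric])
  qed
  have "rhom (adjoin A t) \<Psi>'"
    unfolding rhom_def
  proof (intro conjI ballI)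
    show "\<Psi>' 1 = 1" using ev[OF P(1)] H(1) by simp
    fix x y assume "x \<in> adjoin A t" "y \<in> adjoin A t"
    then obtain p q where "p \<in> poly_over A" "x = poly p t" "q \<in> poly_over A" "y = poly q t"
      by (auto simp: adjoin_def)
    then show "\<Psi>' (x + y) = \<Psi>' x + \<Psi>' y" "\<Psi>' (x * y) = \<Psi>' x * \<Psi>' y"
      using ev[OF P(4)[of p q]] ev[OF P(5)[of p q]] H(2,3)[of p q] ev[of p] ev[of q] by auto
  qed
  with ev show ?thesis by blast
qed

text \<open>If \<open>t\<close> is transcendental over \<open>A\<close>, it may be sent to any scalar that is not a root of the image
  of a polynomial \<open>q\<^sub>0\<close> with \<open>b = q\<^sub>0(t)\<close>. If \<open>t\<close> has a minimal polynomial \<open>p\<close>, it must be sent to a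
  root of the image of \<open>p\<close>: a root in the field exists, and if it is simple it lifts to the dual
  numbers. The factors of \<open>a\<close> ensure in turn that the degree of \<open>p\<close> does not drop, that \<open>b\<close> stays
  nonzero and that the root is simple; the last one is nonzero by characteristic zero.\<close>

lemma lift_one_generator:
  fixes A :: "'b::comm_ring_1 set"
  assumes A: "is_subring A" and B: "is_subring B" "A \<subseteq> B" "t \<in> B"
    and dom: "\<And>x y. x \<in> B \<Longrightarrow> y \<in> B \<Longrightarrow> x * y = 0 \<Longrightarrow> x = 0 \<or> y = 0"
    and char0: "\<And>n. n > 0 \<Longrightarrow> of_nat n \<noteq> (0 :: 'b)"
    and b: "b \<in> adjoin A t" "b \<noteq> 0"
  shows "\<exists>a\<in>A. a \<noteq> 0 \<and> (\<forall>\<Psi> :: 'b \<Rightarrow> 'k::{alg_closed_field,field_char_0} dual. rhom A \<Psi> \<longrightarrow> dre (\<Psi> a) \<noteq> 0 \<longrightarrow>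
    (\<exists>\<Psi>'. rhom (adjoin A t) \<Psi>' \<and> (\<forall>x\<in>A. \<Psi>' x = \<Psi> x) \<and> dre (\<Psi>' b) \<noteq> 0))"
proof -
  note P = is_subringD[OF is_subring_poly_over[OF A]]
  obtain q0 where q0: "q0 \<in> poly_over A" "b = poly q0 t" using b by (auto simp: adjoin_def)
  have ext: "\<exists>\<Psi>'. rhom (adjoin A t) \<Psi>' \<and> (\<forall>x\<in>A. \<Psi>' x = \<Psi> x) \<and> dre (\<Psi>' b) \<noteq> 0"
    if \<Psi>: "rhom A \<Psi>" and T: "\<And>q. q \<in> poly_over A \<Longrightarrow> poly q t = 0 \<Longrightarrow> poly (map_poly \<Psi> q) T = 0"
      and nz: "dre (poly (map_poly \<Psi> q0) T) \<noteq> 0" for \<Psi> :: "'b \<Rightarrow> 'k dual" and T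
  proof -
    obtain \<Psi>' where \<Psi>': "rhom (adjoin A t) \<Psi>'" 
      and ev: "\<And>q. q\<in>poly_over A \<Longrightarrow> \<Psi>' (poly q t) = poly (map_poly \<Psi> q) T"
      using rhom_extend[OF A \<Psi> T] by blast
    have "\<Psi>' x = \<Psi> x" if "x \<in> A" for x
      using ev[OF poly_over_intros(2)[OF A that]] rhomD[OF \<Psi> A] by (simp add: map_poly_pCons)
    then show ?thesis using \<Psi>' ev[OF q0(1)] nz q0(2) by auto
  qed
  show ?thesis
  proof (cases "\<exists>p\<in>poly_over A. p \<noteq> 0 \<and> poly p t = 0")
    case False
    have "q0 \<noteq> 0" using b q0 by auto
    let ?a = "lead_coeff q0"
    have "\<exists>\<Psi>'. rhom (adjoin A t) \<Psi>' \<and> (\<forall>x\<in>A. \<Psi>' x = \<Psi> x) \<and> dre (\<Psi>' b) \<noteq> 0"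
      if \<Psi>: "rhom A \<Psi>" and nz: "dre (\<Psi> ?a) \<noteq> 0" for \<Psi> :: "'b \<Rightarrow> 'k dual"
    proof -
      let ?q = "map_poly dre (map_poly \<Psi> q0)"
      have "coeff ?q (degree q0) \<noteq> 0" using nz rhomD[OF \<Psi> A] by (simp add: coeff_map_poly)
      then have "?q \<noteq> 0" by auto
      then have "finite {x. poly ?q x = 0}" by (rule poly_roots_finite)
      then have "\<exists>\<tau>. \<tau> \<notin> {x. poly ?q x = 0}" using infinite_UNIV_char_0[where 'a = 'k] ex_new_if_finite by blast
      then obtain \<tau> where "poly ?q \<tau> \<noteq> 0" by auto
      then show ?thesis using False by (intro ext[OF \<Psi>, of "Dual \<tau> 0"]) (auto simp: dre_poly)
    qed
    moreover have "?a \<in> A" using q0 by (auto simp: poly_over_def)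
    ultimately show ?thesis using \<open>q0 \<noteq> 0\<close> by (intro bexI[of _ ?a]) auto
  next
    case True
    then obtain p0 where "p0 \<in> poly_over A \<and> p0 \<noteq> 0 \<and> poly p0 t = 0" by blast
    from ex_has_least_nat[of "\<lambda>p. p \<in> poly_over A \<and> p \<noteq> 0 \<and> poly p t = 0", OF this, of degree]
    obtain p where p: "p \<in> poly_over A" "p \<noteq> 0" "poly p t = 0"
      and min: "\<And>q. q \<in> poly_over A \<Longrightarrow> q \<noteq> 0 \<Longrightarrow> poly q t = 0 \<Longrightarrow> degree p \<le> degree q" by auto
    let ?c = "lead_coeff p"
    have cA: "?c \<in> A" and c0: "?c \<noteq> 0" using p by (auto simp: poly_over_def)
    have dp: "degree p > 0"
    proof (rule ccontr)
      assume "\<not> degree p > 0"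
      then have "degree p = 0" by simp
      then obtain a where "p = [:a:]" by (rule degree_eq_zeroE)
      then show False using p by simp
    qed
    have prod_ne: "x * y \<noteq> 0" if "x \<in> A" "x \<noteq> 0" "y \<in> A" "y \<noteq> 0" for x y
      using dom[of x y] that B(2) by auto
    have p'P: "pder p \<in> poly_over A"
      using p(1) is_subring_of_nat[OF A] is_subringD(5)[OF A]
      by (auto simp: poly_over_def coeff_pder simp del: of_nat_Suc)
    have "coeff (pder p) (degree p - 1) \<noteq> 0" using dp c0 cA char0[of "degree p"]
      by (simp add: coeff_pder del: of_nat_Suc) (intro prod_ne is_subring_of_nat[OF A], auto)
    then have p'0: "pder p \<noteq> 0" by auto
    have "degree (pder p) < degree p"
    proof -
      have "degree (pder p) \<le> degree p - 1"
        by (rule degree_le) (auto simp: coeff_pder coeff_eq_0 simp del: of_nat_Suc)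
      then show ?thesis using dp by simp
    qed
    then have p't: "poly (pder p) t \<noteq> 0" using min[OF p'P p'0] by auto
    have bez: "\<exists>u\<in>poly_over A. \<exists>v\<in>poly_over A. \<exists>r\<in>A. r \<noteq> 0 \<and> u * q + v * p = [:r:]"
      if "q \<in> poly_over A" "poly q t \<noteq> 0" for q
      by (rule minimal_poly_bezout[OF A B _ p _ that]) (erule (2) dom, erule (2) min)
    obtain u v r where u: "u \<in> poly_over A" "v \<in> poly_over A" "r \<in> A" "r \<noteq> 0" "u * q0 + v * p = [:r:]"
      using bez[OF q0(1)] q0(2) b(2) by blast
    obtain u' v' r' where u': "u' \<in> poly_over A" "v' \<in> poly_over A" "r' \<in> A" "r' \<noteq> 0"
      "u' * pder p + v' * p = [:r':]"
      using bez[OF p'P p't] by blast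
    let ?a = "?c * (r * r')"
    have aA: "?a \<in> A" using cA u u' is_subringD(5)[OF A] by auto
    have "\<exists>\<Psi>'. rhom (adjoin A t) \<Psi>' \<and> (\<forall>x\<in>A. \<Psi>' x = \<Psi> x) \<and> dre (\<Psi>' b) \<noteq> 0"
      if \<Psi>: "rhom A \<Psi>" and nz: "dre (\<Psi> ?a) \<noteq> 0" for \<Psi> :: "'b \<Rightarrow> 'k dual"
    proof -
      have "\<Psi> ?a = \<Psi> ?c * (\<Psi> r * \<Psi> r')"
        using rhomD(3)[OF \<Psi> A] cA u u' is_subringD(5)[OF A] by auto
      then have nz': "dre (\<Psi> ?c) \<noteq> 0" "dre (\<Psi> r) \<noteq> 0" "dre (\<Psi> r') \<noteq> 0" using nz by auto
      note H = rhomD[OF rhom_map_poly[OF \<Psi> A] is_subring_poly_over[OF A]]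
      have H0: "poly (map_poly \<Psi> [:x:]) T = \<Psi> x" for x T
        using rhomD(4)[OF \<Psi> A] by (simp add: map_poly_pCons)
      have Hlin: "poly (map_poly \<Psi> (a * b + c * d)) T = poly (map_poly \<Psi> a) T * poly (map_poly \<Psi> b) T
          + poly (map_poly \<Psi> c) T * poly (map_poly \<Psi> d) T"
        if "a \<in> poly_over A" "b \<in> poly_over A" "c \<in> poly_over A" "d \<in> poly_over A" for a b c d T
        using that P(4,5) by (simp add: H)
      let ?p = "map_poly dre (map_poly \<Psi> p)"
      have "coeff ?p (degree p) \<noteq> 0" using nz' rhomD(4)[OF \<Psi> A] by (simp add: coeff_map_poly)
      then have "degree ?p > 0" using dp le_degree[of ?p "degree p"] by simp
      then obtain \<tau> where \<tau>: "poly ?p \<tau> = 0" using alg_closed_imp_poly_has_root by blast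
      have "map_poly dre (map_poly \<Psi> (pder p)) = pderiv ?p"
        using p(1) rhomD[OF \<Psi> A] is_subring_of_nat[OF A]
        by (intro poly_eqI) (auto simp: coeff_map_poly coeff_pderiv coeff_pder rhomD(3)[OF \<Psi> A]
            rhom_of_nat[OF \<Psi> A] poly_over_def dre_of_nat simp del: of_nat_Suc)
      moreover have "dre (poly (map_poly \<Psi> (pder p)) (Dual \<tau> 0)) \<noteq> 0"
      proof -
        have "\<Psi> r' = poly (map_poly \<Psi> u') (Dual \<tau> 0) * poly (map_poly \<Psi> (pder p)) (Dual \<tau> 0)
            + poly (map_poly \<Psi> v') (Dual \<tau> 0) * poly (map_poly \<Psi> p) (Dual \<tau> 0)"
          using Hlin[OF u'(1) p'P u'(2) p(1), of "Dual \<tau> 0"] unfolding u'(5) H0 .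
        then have "dre (\<Psi> r') = dre (poly (map_poly \<Psi> u') (Dual \<tau> 0)) * dre (poly (map_poly \<Psi> (pder p)) (Dual \<tau> 0))"
          using \<tau> by (simp add: dre_poly)
        then show ?thesis using nz' by auto
      qed
      ultimately have p'\<tau>: "poly (pderiv ?p) \<tau> \<noteq> 0" by (simp add: dre_poly)
      define T where "T = Dual \<tau> (- dep (poly (map_poly \<Psi> p) (Dual \<tau> 0)) / poly (pderiv ?p) \<tau>)"
      have pT: "poly (map_poly \<Psi> p) T = 0"
      proof -
        have "dep (poly (map_poly \<Psi> p) T) = 0" unfolding T_def dep_poly[of _ _ "_ / _"] using p'\<tau> by simp
        moreover have "dre (poly (map_poly \<Psi> p) T) = 0" using \<tau> by (simp add: dre_poly T_def)
        ultimately show ?thesis by (simp add: dual.expand)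
      qed
      show ?thesis
      proof (rule ext[OF \<Psi>, of T])
        fix q assume q: "q \<in> poly_over A" "poly q t = 0"
        obtain N s w where s: "s \<in> poly_over A" "w \<in> poly_over A" "smult (?c ^ N) q = s * p + w"
          "w = 0 \<or> degree w < degree p"
          using pseudo_division_over[OF A p(1,2) q(1)] by blast
        have "poly w t = 0" using arg_cong[OF s(3), of "\<lambda>q. poly q t"] q p by simp
        then have "w = 0" using min[OF s(2)] s(4) by (metis not_less)
        then have "[:?c ^ N:] * q = s * p" using s by simp
        then have "poly (map_poly \<Psi> ([:?c ^ N:] * q)) T = poly (map_poly \<Psi> (s * p)) T" by simp
        then have "\<Psi> ?c ^ N * poly (map_poly \<Psi> q) T = 0"
          using s p q cA is_subring_power[OF A cA] pT
          by (simp only: H poly_over_intros(2)[OF A] H0 rhom_power[OF \<Psi> A]) simp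
        moreover have "dre (x ^ N) = dre x ^ N" for x :: "'k dual" by (induction N) auto
        ultimately show "poly (map_poly \<Psi> q) T = 0" using nz'(1) dual_cancel[of "\<Psi> ?c ^ N"] by simp
      next
        have "\<Psi> r = poly (map_poly \<Psi> u) T * poly (map_poly \<Psi> q0) T"
          using Hlin[OF u(1) q0(1) u(2) p(1), of T] unfolding u(5) H0 by (simp add: pT)
        then show "dre (poly (map_poly \<Psi> q0) T) \<noteq> 0" using nz' by auto
      qed
    qed
    moreover have "?a \<noteq> 0" using c0 cA u u' is_subringD(5)[OF A] by (intro prod_ne) auto
    ultimately show ?thesis using aA by (intro bexI[of _ ?a]) auto
  qed
qed

theorem generic_lifting:
  fixes A :: "'b::comm_ring_1 set"
  assumes A: "is_subring A"
    and dom: "\<And>x y. x \<in> adjoins A ts \<Longrightarrow> y \<in> adjoins A ts \<Longrightarrow> x * y = 0 \<Longrightarrow> x = 0 \<or> y = 0"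
    and char0: "\<And>n. n > 0 \<Longrightarrow> of_nat n \<noteq> (0 :: 'b)"
    and b: "b \<in> adjoins A ts" "b \<noteq> 0"
  shows "\<exists>a\<in>A. a \<noteq> 0 \<and> (\<forall>\<Psi> :: 'b \<Rightarrow> 'k::{alg_closed_field,field_char_0} dual. rhom A \<Psi> \<longrightarrow> dre (\<Psi> a) \<noteq> 0 \<longrightarrow>
    (\<exists>\<Psi>'. rhom (adjoins A ts) \<Psi>' \<and> (\<forall>x\<in>A. \<Psi>' x = \<Psi> x) \<and> dre (\<Psi>' b) \<noteq> 0))"
  using A dom b
proof (induction ts arbitrary: A)
  case Nil
  then show ?case by (intro bexI[of _ b]) auto
next
  case (Cons t ts)
  note At = is_subring_adjoin[OF Cons.prems(1), of t]
  obtain a1 where a1: "a1 \<in> adjoin A t" "a1 \<noteq> 0" and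
    l1: "\<And>\<Psi> :: 'b \<Rightarrow> 'k dual. rhom (adjoin A t) \<Psi> \<Longrightarrow> dre (\<Psi> a1) \<noteq> 0 \<Longrightarrow>
      \<exists>\<Psi>'. rhom (adjoins A (t # ts)) \<Psi>' \<and> (\<forall>x\<in>adjoin A t. \<Psi>' x = \<Psi> x) \<and> dre (\<Psi>' b) \<noteq> 0"
    using Cons.IH[OF At] Cons.prems by (auto 0 3)
  note B = adjoins_props[OF At, of ts]
  note tA = adjoin_contains[OF Cons.prems(1)]
  have AB: "A \<subseteq> adjoins (adjoin A t) ts" and tB: "t \<in> adjoins (adjoin A t) ts"
    using tA[of t] B(2) by auto
  obtain a where a: "a \<in> A" "a \<noteq> 0" and
    l2: "\<And>\<Psi> :: 'b \<Rightarrow> 'k dual. rhom A \<Psi> \<Longrightarrow> dre (\<Psi> a) \<noteq> 0 \<Longrightarrow>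
      \<exists>\<Psi>'. rhom (adjoin A t) \<Psi>' \<and> (\<forall>x\<in>A. \<Psi>' x = \<Psi> x) \<and> dre (\<Psi>' a1) \<noteq> 0"
    using lift_one_generator[OF Cons.prems(1) B(1) AB tB _ char0 a1, where 'k = 'k]
      Cons.prems(2)[unfolded adjoins.simps] by metis
  have "\<exists>\<Psi>'. rhom (adjoins A (t # ts)) \<Psi>' \<and> (\<forall>x\<in>A. \<Psi>' x = \<Psi> x) \<and> dre (\<Psi>' b) \<noteq> 0"
    if \<Psi>: "rhom A \<Psi>" "dre (\<Psi> a) \<noteq> 0" for \<Psi> :: "'b \<Rightarrow> 'k dual"
  proof -
    obtain \<Psi>1 where "rhom (adjoin A t) \<Psi>1" "\<forall>x\<in>A. \<Psi>1 x = \<Psi> x" "dre (\<Psi>1 a1) \<noteq> 0"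
      using l2[OF \<Psi>] by blast
    moreover then obtain \<Psi>2 where "rhom (adjoins A (t # ts)) \<Psi>2" "\<forall>x\<in>adjoin A t. \<Psi>2 x = \<Psi>1 x"
      "dre (\<Psi>2 b) \<noteq> 0" using l1 by blast
    ultimately show ?thesis using tA(1)[of t] by (intro exI[of _ \<Psi>2]) auto
  qed
  then show ?case using a by (intro bexI[of _ a]) auto
qed

section \<open>Spaces of functions\<close>

lemma fscale_apply: "fscale c f x = c * f x"
  by (simp add: fscale_def)

lemma vscale_apply: "vscale c D f = fscale c (D f)"
  by (simp add: vscale_def)

lemma zero_outside_apply: "zero_outside S f x = (if x \<in> S then f x else 0)"
  by (simp add: zero_outside_def)

lemma sum_fun_apply: "(\<Sum>i\<in>S. f i) x = (\<Sum>i\<in>S. f i x)"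
  by (induction S rule: infinite_finite_induct) auto

context vector_space
begin

lemma finite_dimensional_subspace:
  assumes "finite_dimensional scale V" "subspace S" "S \<subseteq> V"
  shows "finite_dimensional scale S"
proof -
  obtain B where B: "finite B" "V = span B" using assms(1) by (auto simp: finite_dimensional_def)
  obtain C where C: "C \<subseteq> S" "independent C" "S \<subseteq> span C" by (rule maximal_independent_subset)
  have "finite C" using independent_span_bound[OF B(1) C(2)] C(1) assms(3) B(2) by auto
  moreover have "S = span C" using C assms(2) by (simp add: span_subspace)
  ultimately show ?thesis by (auto simp: finite_dimensional_def)
qed

lemma finite_dimensional_spanning_subset:
  assumes "finite_dimensional scale (span S)"
  shows "\<exists>B. finite B \<and> B \<subseteq> S \<and> span B = span S"
proof -
  obtain B where B: "finite B" "span S = span B" using assms by (auto simp: finite_dimensional_def)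
  obtain C where C: "C \<subseteq> S" "independent C" "S \<subseteq> span C" by (rule maximal_independent_subset)
  have "C \<subseteq> span B" using C(1) span_superset[of S] B(2) by auto
  then have "finite C" using independent_span_bound[OF B(1) C(2)] by auto
  moreover have "span C = span S" using C by (metis span_eq span_superset subset_trans)
  ultimately show ?thesis using C by auto
qed

end

text \<open>Linear functionals on spaces of functions are represented by finite linear combinations of
  evaluations. Applied to a function that depends on a group element \<open>g\<close>, they produce regular
  functions of \<open>g\<close> from regular values.\<close>

definition ev :: "('k \<times> 's) list \<Rightarrow> ('s \<Rightarrow> 'k::field) \<Rightarrow> 'k"
  where "ev cs v = (\<Sum>(c, s)\<leftarrow>cs. c * v s)"

lemma ev_simps [simp]: "ev [] v = 0" "ev ((c, s) # cs) v = c * v s + ev cs v"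
  "ev (cs @ ds) v = ev cs v + ev ds v"
  by (auto simp: ev_def)

lemma ev_add: "ev cs (v + w) = ev cs v + ev cs w"
  by (induction cs) (auto simp: algebra_simps)

lemma ev_fscale: "ev cs (fscale c v) = c * ev cs v"
  by (induction cs) (auto simp: algebra_simps fscale_apply)

lemma ev_diff: "ev cs (v - w) = ev cs v - ev cs w"
  by (induction cs) (auto simp: algebra_simps)

lemma ev_zero [simp]: "ev cs 0 = 0" "ev cs (\<lambda>_. 0) = 0"
  by (induction cs) auto

lemma ev_sum: "ev cs (\<Sum>i\<in>S. v i) = (\<Sum>i\<in>S. ev cs (v i))"
proof (induction S rule: infinite_finite_induct)
  case (insert x F)
  then show ?case by (simp only: sum.insert ev_add not_False_eq_True)
qed auto

lemma ev_scale_list: "ev (map (\<lambda>(c, s). (a * c, s)) cs) v = a * ev cs v"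
  by (induction cs) (auto simp: algebra_simps)

lemma ev_span:
  assumes "\<And>v. v \<in> B \<Longrightarrow> ev cs v = 0" "w \<in> fun_vs.span B" shows "ev cs w = 0"
proof -
  have "fun_vs.subspace {w. ev cs w = 0}"
    by (rule fun_vs.subspaceI) (auto simp: ev_add ev_fscale)
  then have "fun_vs.span B \<subseteq> {w. ev cs w = 0}" using assms(1) by (intro fun_vs.span_minimal) auto
  then show ?thesis using assms(2) by auto
qed

lemma eval_separation:
  fixes h :: "'s \<Rightarrow> 'k::field"
  assumes "finite B" "h \<notin> fun_vs.span B"
  shows "\<exists>cs. (\<forall>v\<in>fun_vs.span B. ev cs v = 0) \<and> ev cs h \<noteq> 0"
  using assms
proof (induction B arbitrary: h)
  case empty
  then have "h \<noteq> 0" using fun_vs.span_zero by metis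
  then obtain s where "h s \<noteq> 0" by (auto simp: fun_eq_iff)
  then show ?case by (intro exI[of _ "[(1, s)]"]) auto
next
  case (insert b B)
  show ?case
  proof (cases "b \<in> fun_vs.span B")
    case True
    then have "fun_vs.span (insert b B) = fun_vs.span B" by (rule fun_vs.span_redundant)
    then show ?thesis using insert by metis
  next
    case False
    then obtain bs where bs: "\<And>v. v \<in> fun_vs.span B \<Longrightarrow> ev bs v = 0" "ev bs b \<noteq> 0" using insert.IH by blast
    let ?t = "ev bs h / ev bs b"
    have "h - fscale ?t b \<notin> fun_vs.span B"
      using insert.prems fun_vs.span_breakdown_eq[of h b B] by blast
    then obtain ds where ds: "\<And>v. v \<in> fun_vs.span B \<Longrightarrow> ev ds v = 0" "ev ds (h - fscale ?t b) \<noteq> 0"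
      using insert.IH by blast
    define cs where "cs = ds @ map (\<lambda>(c, s). (- (ev ds b / ev bs b) * c, s)) bs"
    have cs: "ev cs v = ev ds v - (ev ds b / ev bs b) * ev bs v" for v
      unfolding cs_def ev_simps ev_scale_list by simp
    have "ev cs v = 0" if "v \<in> insert b B" for v
      using that bs ds(1) by (auto simp: cs fun_vs.span_base)
    then have "\<forall>v\<in>fun_vs.span (insert b B). ev cs v = 0" using ev_span by blast
    moreover have "ev cs h \<noteq> 0" using ds(2) by (simp add: cs ev_diff ev_fscale mult.commute)
    ultimately show ?thesis by blast
  qed
qed

definition uncur :: "('b \<Rightarrow> 'a \<Rightarrow> 'k) \<Rightarrow> 'b \<times> 'a \<Rightarrow> 'k"
  where "uncur E = (\<lambda>(f, x). E f x)"

lemma module_hom_uncur: "module_hom vscale fscale (uncur :: ('b \<Rightarrow> 'a \<Rightarrow> 'k::field) \<Rightarrow> _)"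
proof -
  have "Vector_Spaces.linear vscale fscale (uncur :: ('b \<Rightarrow> 'a \<Rightarrow> 'k) \<Rightarrow> _)"
    by (intro Vector_Spaces.linear.intro module_hom.intro module_hom_axioms.intro
        vec_vs.vector_space_axioms fun_vs.vector_space_axioms vec_vs.module_axioms fun_vs.module_axioms)
      (auto simp: uncur_def fun_eq_iff vscale_apply fscale_apply)
  then show ?thesis by (rule Vector_Spaces.linear.axioms(3))
qed

lemma vec_eval_separation:
  fixes h :: "'b \<Rightarrow> 'a \<Rightarrow> 'k::field"
  assumes "finite_dimensional vscale V" "h \<notin> V"
  shows "\<exists>cs. (\<forall>v\<in>V. ev cs (uncur v) = 0) \<and> ev cs (uncur h) \<noteq> 0"
proof -
  obtain B where B: "finite B" "V = vec_vs.span B" using assms(1) by (auto simp: finite_dimensional_def)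
  have im: "fun_vs.span (uncur ` B) = uncur ` vec_vs.span B"
    by (rule module_hom.span_image[OF module_hom_uncur])
  have "inj (uncur :: ('b \<Rightarrow> 'a \<Rightarrow> 'k) \<Rightarrow> _)" by (rule injI) (auto simp: uncur_def fun_eq_iff)
  then have "uncur h \<notin> fun_vs.span (uncur ` B)" using assms(2) im B(2) by (auto dest: injD)
  then obtain cs where "\<forall>v\<in>fun_vs.span (uncur ` B). ev cs v = 0" "ev cs (uncur h) \<noteq> 0"
    using eval_separation B(1) by (metis finite_imageI)
  then show ?thesis using im B(2) by auto
qed

section \<open>Ordered words of operators\<close>

text \<open>The spanning half of the Poincare-Birkhoff-Witt theorem: operators whose commutators are
  linear combinations of them can be reordered modulo shorter words.\<close>

fun word_app :: "(nat \<Rightarrow> 'v \<Rightarrow> 'v) \<Rightarrow> nat list \<Rightarrow> 'v \<Rightarrow> 'v"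
  where "word_app D [] v = v" | "word_app D (i # w) v = D i (word_app D w v)"

locale lie_operators =
  fixes V :: "('s \<Rightarrow> 'k::field) set" and D :: "nat \<Rightarrow> ('s \<Rightarrow> 'k) \<Rightarrow> 's \<Rightarrow> 'k" and d :: nat
  assumes V: "fun_vs.subspace V"
    and closed: "\<And>i v. i < d \<Longrightarrow> v \<in> V \<Longrightarrow> D i v \<in> V"
    and add: "\<And>i v w. i < d \<Longrightarrow> v \<in> V \<Longrightarrow> w \<in> V \<Longrightarrow> D i (v + w) = D i v + D i w"
    and scale: "\<And>i c v. i < d \<Longrightarrow> v \<in> V \<Longrightarrow> D i (fscale c v) = fscale c (D i v)"
    and comm: "\<And>i j v. i < d \<Longrightarrow> j < d \<Longrightarrow> v \<in> V \<Longrightarrow>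
      D i (D j v) - D j (D i v) \<in> fun_vs.span {D k v | k. k < d}"
begin

lemma D_zero: "i < d \<Longrightarrow> D i 0 = 0"
  using scale[of i 0 0] fun_vs.subspace_0[OF V] by simp

lemma D_diff: "i < d \<Longrightarrow> v \<in> V \<Longrightarrow> w \<in> V \<Longrightarrow> D i (v - w) = D i v - D i w"
  using add[of i "v - w" w] fun_vs.subspace_diff[OF V] by (simp add: algebra_simps)

lemma D_span:
  assumes i: "i < d" and S: "S \<subseteq> V" "v \<in> fun_vs.span S" and W: "fun_vs.subspace W" "D i ` S \<subseteq> W"
  shows "D i v \<in> W"
proof -
  have "fun_vs.subspace {v \<in> V. D i v \<in> W}"
    by (rule fun_vs.subspaceI)
      (use V W(1) i in \<open>auto simp: D_zero add scale fun_vs.subspace_0 fun_vs.subspace_add fun_vs.subspace_scale\<close>)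
  then have "fun_vs.span S \<subseteq> {v \<in> V. D i v \<in> W}" using S(1) W(2) by (intro fun_vs.span_minimal) auto
  then show ?thesis using S(2) by auto
qed

lemma word_app_in: "v \<in> V \<Longrightarrow> set w \<subseteq> {..<d} \<Longrightarrow> word_app D w v \<in> V"
  by (induction w) (auto simp: closed)

definition shorter :: "('s \<Rightarrow> 'k) \<Rightarrow> nat \<Rightarrow> ('s \<Rightarrow> 'k) set"
  where "shorter v n = fun_vs.span {word_app D w v | w. set w \<subseteq> {..<d} \<and> length w < n}"

lemma D_shorter:
  assumes "v \<in> V" "i < d" "u \<in> shorter v n" shows "D i u \<in> shorter v (Suc n)"
  unfolding shorter_def
proof (rule D_span[OF assms(2) _ assms(3)[unfolded shorter_def]])
  show "{word_app D w v | w. set w \<subseteq> {..<d} \<and> length w < n} \<subseteq> V" using word_app_in[OF assms(1)] by auto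
  show "D i ` {word_app D w v | w. set w \<subseteq> {..<d} \<and> length w < n}
      \<subseteq> fun_vs.span {word_app D w v | w. set w \<subseteq> {..<d} \<and> length w < Suc n}"
  proof (rule subset_trans[OF _ fun_vs.span_superset], rule image_subsetI)
    fix u assume "u \<in> {word_app D w v | w. set w \<subseteq> {..<d} \<and> length w < n}"
    then obtain w where "u = word_app D w v" "set w \<subseteq> {..<d}" "length w < n" by auto
    then show "D i u \<in> {word_app D w v | w. set w \<subseteq> {..<d} \<and> length w < Suc n}"
      using assms(2) by (intro CollectI exI[of _ "i # w"]) auto
  qed
qed simp

lemma shorter_add: "x \<in> shorter v n \<Longrightarrow> y \<in> shorter v n \<Longrightarrow> x + y \<in> shorter v n"
  by (simp add: shorter_def fun_vs.span_add)

lemma shorter_self: "x - x \<in> shorter v n"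
  unfolding shorter_def diff_self by (rule fun_vs.span_zero)

lemma word_insort:
  assumes v: "v \<in> V" and "i < d" "set w \<subseteq> {..<d}"
  shows "word_app D (i # w) v - word_app D (insort i w) v \<in> shorter v (Suc (length w))"
  using assms(3)
proof (induction w)
  case Nil
  have "insort i [] = [i]" by simp
  then show ?case using shorter_self by (simp only: list.size)
next
  case (Cons j w)
  show ?case
  proof (cases "i \<le> j")
    case True
    then have "insort i (j # w) = i # j # w" by simp
    then show ?thesis using shorter_self by (simp only:)
  next
    case False
    let ?u = "word_app D w v"
    have jw: "j < d" "set w \<subseteq> {..<d}" using Cons.prems by auto
    have u: "?u \<in> V" and iu: "word_app D (insort i w) v \<in> V"
      using word_app_in[OF v] jw assms(2) by (auto simp: set_insort_key)
    have 1: "D i (D j ?u) - D j (D i ?u) \<in> shorter v (Suc (length (j # w)))"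
    proof -
      have "fun_vs.span {D k ?u | k. k < d} \<subseteq> shorter v (Suc (length (j # w)))"
        unfolding shorter_def
      proof (rule fun_vs.span_mono, safe)
        fix k assume "k < d"
        then show "\<exists>w'. D k ?u = word_app D w' v \<and> set w' \<subseteq> {..<d} \<and> length w' < Suc (length (j # w))"
          using jw by (intro exI[of _ "k # w"]) auto
      qed
      then show ?thesis using comm[OF assms(2) jw(1) u] by auto
    qed
    have "D j (D i ?u - word_app D (insort i w) v) \<in> shorter v (Suc (length (j # w)))"
      using D_shorter[OF v jw(1) Cons.IH[OF jw(2)]] by (simp only: length_Cons word_app.simps)
    then have 2: "D j (D i ?u) - D j (word_app D (insort i w) v) \<in> shorter v (Suc (length (j # w)))"
      using D_diff[OF jw(1) closed[OF assms(2) u] iu] by simp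
    have eq: "word_app D (i # j # w) v - word_app D (insort i (j # w)) v =
        (D i (D j ?u) - D j (D i ?u)) + (D j (D i ?u) - D j (word_app D (insort i w) v))"
      using False by simp
    have "word_app D (i # j # w) v - word_app D (insort i (j # w)) v \<in> shorter v (Suc (length (j # w)))"
      unfolding eq by (rule shorter_add[OF 1 2])
    then show ?thesis .
  qed
qed

lemma word_sort:
  assumes v: "v \<in> V" and "set w \<subseteq> {..<d}"
  shows "word_app D w v - word_app D (sort w) v \<in> shorter v (length w)"
  using assms(2)
proof (induction w)
  case Nil
  have "sort [] = ([] :: nat list)" by simp
  then show ?case using shorter_self by (simp only: list.size)
next
  case (Cons i w)
  then have iw: "i < d" "set w \<subseteq> {..<d}" by auto
  have "D i (word_app D w v - word_app D (sort w) v) \<in> shorter v (Suc (length w))"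
    using D_shorter[OF v iw(1) Cons.IH[OF iw(2)]] .
  then have 1: "D i (word_app D w v) - D i (word_app D (sort w) v) \<in> shorter v (Suc (length w))"
    using D_diff[OF iw(1)] word_app_in[OF v] iw by simp
  have 2: "word_app D (i # sort w) v - word_app D (insort i (sort w)) v \<in> shorter v (Suc (length w))"
    using word_insort[OF v iw(1), of "sort w"] iw(2) unfolding length_sort set_sort .
  have eq: "word_app D (i # w) v - word_app D (sort (i # w)) v =
      (D i (word_app D w v) - D i (word_app D (sort w) v)) +
      (word_app D (i # sort w) v - word_app D (insort i (sort w)) v)" by simp
  have "word_app D (i # w) v - word_app D (sort (i # w)) v \<in> shorter v (length (i # w))"
    unfolding eq length_Cons by (rule shorter_add[OF 1 2])
  then show ?case .
qed

lemma words_sorted_span: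
  assumes v: "v \<in> V" and "set w \<subseteq> {..<d}"
  shows "word_app D w v \<in> fun_vs.span {word_app D w v | w. set w \<subseteq> {..<d} \<and> sorted w}"
  using assms(2)
proof (induction w rule: measure_induct_rule[of length])
  case (less w)
  let ?S = "fun_vs.span {word_app D w v | w. set w \<subseteq> {..<d} \<and> sorted w}"
  have "shorter v (length w) \<subseteq> ?S"
    unfolding shorter_def
  proof (rule fun_vs.span_minimal)
    show "{word_app D w' v | w'. set w' \<subseteq> {..<d} \<and> length w' < length w} \<subseteq> ?S"
    proof
      fix u assume "u \<in> {word_app D w' v | w'. set w' \<subseteq> {..<d} \<and> length w' < length w}"
      then obtain w' where w': "u = word_app D w' v" "set w' \<subseteq> {..<d}" "length w' < length w" by auto
      show "u \<in> ?S" unfolding w'(1) by (rule less.IH[OF w'(3,2)])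
    qed
  qed (rule fun_vs.subspace_span)
  then have 1: "word_app D w v - word_app D (sort w) v \<in> ?S" using word_sort[OF v less.prems] by (rule subsetD)
  have 2: "word_app D (sort w) v \<in> ?S"
  proof (rule fun_vs.span_base)
    have "set (sort w) \<subseteq> {..<d} \<and> sorted (sort w)" using less.prems by simp
    then show "word_app D (sort w) v \<in> {word_app D w v | w. set w \<subseteq> {..<d} \<and> sorted w}" by blast
  qed
  show ?case using fun_vs.span_add[OF 1 2] unfolding diff_add_cancel .
qed

text \<open>In an ordered word the operators of index \<open>d - 1\<close> act first, then those of index \<open>d - 2\<close>, and so
  on; each group enlarges a finite dimensional space to another one. Ordered words suffice by the
  reordering above.\<close>

lemma locally_finite_of_generators:
  assumes lf: "\<And>i v. i < d \<Longrightarrow> v \<in> V \<Longrightarrow>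
      \<exists>W\<subseteq>V. finite_dimensional fscale W \<and> v \<in> W \<and> D i ` W \<subseteq> W"
    and v: "v \<in> V"
  shows "\<exists>W\<subseteq>V. finite_dimensional fscale W \<and> v \<in> W \<and> (\<forall>i<d. D i ` W \<subseteq> W)"
proof -
  have "\<exists>B\<subseteq>V. finite B \<and> (\<forall>w. sorted w \<longrightarrow> set w \<subseteq> {d - k..<d} \<longrightarrow> word_app D w v \<in> fun_vs.span B)"
    if "k \<le> d" for k
    using that
  proof (induction k)
    case 0
    have "v \<in> fun_vs.span {v}" by (simp add: fun_vs.span_base)
    then show ?case using v by (intro exI[of _ "{v}"] conjI allI impI) auto
  next
    case (Suc k)
    then obtain B where B: "B \<subseteq> V" "finite B"
      "\<And>w. sorted w \<Longrightarrow> set w \<subseteq> {d - k..<d} \<Longrightarrow> word_app D w v \<in> fun_vs.span B" by auto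
    define i where "i = d - Suc k"
    have i: "i < d" "d - k = Suc i" using Suc by (auto simp: i_def)
    have "\<forall>b. \<exists>C. b \<in> B \<longrightarrow> finite C \<and> b \<in> fun_vs.span C \<and> fun_vs.span C \<subseteq> V \<and> D i ` fun_vs.span C \<subseteq> fun_vs.span C"
    proof (intro allI)
      fix b
      show "\<exists>C. b \<in> B \<longrightarrow> finite C \<and> b \<in> fun_vs.span C \<and> fun_vs.span C \<subseteq> V \<and> D i ` fun_vs.span C \<subseteq> fun_vs.span C"
      proof (cases "b \<in> B")
        case True
        then show ?thesis using lf[OF i(1), of b] B(1) unfolding finite_dimensional_def by blast
      qed simp
    qed
    then obtain C where C: "\<And>b. b \<in> B \<Longrightarrow> finite (C b) \<and> b \<in> fun_vs.span (C b) \<and> fun_vs.span (C b) \<subseteq> V \<and>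
        D i ` fun_vs.span (C b) \<subseteq> fun_vs.span (C b)" by metis
    let ?U = "\<Union>b\<in>B. C b"
    have "C b \<subseteq> V" if "b \<in> B" for b using C[OF that] fun_vs.span_superset[of "C b"] by blast
    then have UV: "?U \<subseteq> V" by blast
    have BU: "fun_vs.span B \<subseteq> fun_vs.span ?U"
    proof (rule fun_vs.span_minimal)
      show "B \<subseteq> fun_vs.span ?U"
      proof
        fix b assume b: "b \<in> B"
        then have "C b \<subseteq> ?U" by blast
        then show "b \<in> fun_vs.span ?U" using C[OF b] fun_vs.span_mono[of "C b" ?U] by blast
      qed
    qed simp
    have DU: "D i u \<in> fun_vs.span ?U" if "u \<in> fun_vs.span ?U" for u
    proof (rule D_span[OF i(1) UV that])
      show "D i ` ?U \<subseteq> fun_vs.span ?U"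
      proof (rule image_subsetI)
        fix u assume "u \<in> ?U"
        then obtain b where "b \<in> B" "u \<in> C b" by auto
        then show "D i u \<in> fun_vs.span ?U"
          using C[of b] fun_vs.span_mono[of "C b" ?U] fun_vs.span_base[of u "C b"] by blast
      qed
    qed simp
    have "word_app D w v \<in> fun_vs.span ?U" if "sorted w" "set w \<subseteq> {i..<d}" for w
      using that
    proof (induction w)
      case Nil
      then show ?case using B(3)[of "[]"] BU by auto
    next
      case (Cons j w)
      show ?case
      proof (cases "j = i")
        case True
        then show ?thesis using Cons DU by auto
      next
        case False
        then have "set (j # w) \<subseteq> {Suc i..<d}" using Cons.prems by fastforce
        then show ?thesis using B(3)[OF Cons.prems(1)] BU i(2) by auto
      qed
    qed
    moreover have "finite ?U" using B(2) C by auto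
    ultimately show ?case using UV unfolding i_def by (intro exI[of _ ?U]) auto
  qed
  from this[of d] obtain B where B: "B \<subseteq> V" "finite B"
    "\<And>w. sorted w \<Longrightarrow> set w \<subseteq> {..<d} \<Longrightarrow> word_app D w v \<in> fun_vs.span B"
    by (auto simp: atLeast0LessThan)
  let ?S = "{word_app D w v | w. set w \<subseteq> {..<d}}"
  let ?W = "fun_vs.span ?S"
  have SV: "?S \<subseteq> V" using word_app_in[OF v] by auto
  have "fun_vs.span {word_app D w v | w. set w \<subseteq> {..<d} \<and> sorted w} \<subseteq> fun_vs.span B"
    by (rule fun_vs.span_minimal) (use B(3) in blast, simp)
  then have "?W \<subseteq> fun_vs.span B"
    by (intro fun_vs.span_minimal) (use words_sorted_span[OF v] in blast, simp)
  then have "finite_dimensional fscale ?W"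
    by (intro fun_vs.finite_dimensional_subspace[of "fun_vs.span B" ?W])
      (use B(2) in \<open>auto simp: finite_dimensional_def\<close>)
  moreover have "?W \<subseteq> V" using SV V by (rule fun_vs.span_minimal)
  moreover have "v \<in> ?W" by (rule fun_vs.span_base) (auto intro!: exI[of _ "[]"])
  moreover have "D i u \<in> ?W" if "i < d" "u \<in> ?W" for i u
  proof (rule D_span[OF that(1) SV that(2)])
    show "D i ` ?S \<subseteq> ?W"
    proof (rule subset_trans[OF _ fun_vs.span_superset], rule image_subsetI)
      fix u assume "u \<in> ?S"
      then obtain w where "u = word_app D w v" "set w \<subseteq> {..<d}" by auto
      then show "D i u \<in> ?S" using that(1) by (intro CollectI exI[of _ "i # w"]) auto
    qed
  qed simp
  ultimately show ?thesis by (intro exI[of _ ?W]) auto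
qed

end

section \<open>Affine varieties as algebras of functions\<close>

inductive_set alg_gen :: "'a set \<Rightarrow> ('a \<Rightarrow> 'k::field) set \<Rightarrow> ('a \<Rightarrow> 'k) set" for P S where
  const: "zero_outside P (\<lambda>_. c) \<in> alg_gen P S"
| gen: "f \<in> S \<Longrightarrow> f \<in> alg_gen P S"
| add: "f \<in> alg_gen P S \<Longrightarrow> g \<in> alg_gen P S \<Longrightarrow> (\<lambda>x. f x + g x) \<in> alg_gen P S"
| mult: "f \<in> alg_gen P S \<Longrightarrow> g \<in> alg_gen P S \<Longrightarrow> (\<lambda>x. f x * g x) \<in> alg_gen P S"

text \<open>Algebra homomorphisms to the field: the points of the spectrum, described without an embedding
  into affine space.\<close>

definition is_char :: "'a set \<Rightarrow> ('a \<Rightarrow> 'k::field) set \<Rightarrow> (('a \<Rightarrow> 'k) \<Rightarrow> 'k) \<Rightarrow> bool"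
  where "is_char P R \<chi> \<longleftrightarrow> (\<forall>f\<in>R. \<forall>g\<in>R. \<chi> (\<lambda>x. f x + g x) = \<chi> f + \<chi> g \<and> \<chi> (\<lambda>x. f x * g x) = \<chi> f * \<chi> g) \<and>
    (\<forall>c. \<chi> (zero_outside P (\<lambda>_. c)) = c)"

lemma alg_gen_supp:
  assumes "f \<in> alg_gen P S" "\<And>f x. f \<in> S \<Longrightarrow> x \<notin> P \<Longrightarrow> f x = 0" "x \<notin> P" shows "f x = 0"
  using assms by (induction rule: alg_gen.induct) (auto simp: zero_outside_def)

lemma affine_variety_spectrum:
  fixes X :: "('a, 'k::field) variety"
  assumes "affine_variety X"
  shows "\<exists>C. finite C \<and> (\<forall>f\<in>C. \<forall>x. x \<notin> pts X \<longrightarrow> f x = 0) \<and> reg X = alg_gen (pts X) C \<and>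
    (\<forall>x\<in>pts X. \<forall>y\<in>pts X. (\<forall>f\<in>reg X. f x = f y) \<longrightarrow> x = y) \<and>
    (\<forall>\<chi>. is_char (pts X) (reg X) \<chi> \<longrightarrow> (\<exists>x\<in>pts X. \<forall>f\<in>reg X. \<chi> f = f x))"
proof -
  let ?P = "pts X"
  obtain n \<phi> where inj: "inj_on \<phi> ?P" and cl: "zariski_closed n (\<phi> ` ?P)"
    and reg: "reg X = (\<lambda>p. zero_outside ?P (\<lambda>x. p (\<phi> x))) ` poly_funs n"
    using assms unfolding affine_variety_def by blast
  define C where "C = (\<lambda>i. zero_outside ?P (\<lambda>x. \<phi> x i)) ` {..<n}"
  have 1: "zero_outside ?P (\<lambda>x. p (\<phi> x)) \<in> alg_gen ?P C" if "p \<in> poly_funs n" for p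
    using that
  proof induction
    case (coord i)
    then show ?case by (intro alg_gen.gen) (auto simp: C_def)
  next
    case (add p q)
    have "zero_outside ?P (\<lambda>x. p (\<phi> x) + q (\<phi> x)) =
        (\<lambda>x. zero_outside ?P (\<lambda>x. p (\<phi> x)) x + zero_outside ?P (\<lambda>x. q (\<phi> x)) x)"
      by (auto simp: zero_outside_def)
    then show ?case using alg_gen.add[OF add.IH] by simp
  next
    case (mult p q)
    have "zero_outside ?P (\<lambda>x. p (\<phi> x) * q (\<phi> x)) =
        (\<lambda>x. zero_outside ?P (\<lambda>x. p (\<phi> x)) x * zero_outside ?P (\<lambda>x. q (\<phi> x)) x)"
      by (auto simp: zero_outside_def)
    then show ?case using alg_gen.mult[OF mult.IH] by simp
  qed (auto intro: alg_gen.const)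
  have 2: "f \<in> reg X" if "f \<in> alg_gen ?P C" for f
    using that
  proof induction
    case (const c)
    then show ?case unfolding reg by (intro image_eqI[of _ _ "\<lambda>_. c"]) (auto intro: poly_funs.const)
  next
    case (gen f)
    then show ?case unfolding reg C_def by (auto intro!: image_eqI[of _ _ "\<lambda>x. x _"] poly_funs.coord)
  next
    case (add f g)
    then obtain p q where "p \<in> poly_funs n" "q \<in> poly_funs n" "f = zero_outside ?P (\<lambda>x. p (\<phi> x))"
      "g = zero_outside ?P (\<lambda>x. q (\<phi> x))" unfolding reg by blast
    then show ?case unfolding reg
      by (intro image_eqI[of _ _ "\<lambda>x. p x + q x"] poly_funs.add) (auto simp: zero_outside_def)
  next
    case (mult f g)
    then obtain p q where "p \<in> poly_funs n" "q \<in> poly_funs n" "f = zero_outside ?P (\<lambda>x. p (\<phi> x))"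
      "g = zero_outside ?P (\<lambda>x. q (\<phi> x))" unfolding reg by blast
    then show ?case unfolding reg
      by (intro image_eqI[of _ _ "\<lambda>x. p x * q x"] poly_funs.mult) (auto simp: zero_outside_def)
  qed
  have R: "reg X = alg_gen ?P C" using 1 2 unfolding reg by auto
  have aff: "\<phi> ` ?P \<subseteq> affine_space n" using cl by (auto simp: zariski_closed_def)
  have sep: "x = y" if xy: "x \<in> ?P" "y \<in> ?P" "\<forall>f\<in>reg X. f x = f y" for x y
  proof -
    have "\<phi> x i = \<phi> y i" if "i < n" for i
    proof -
      have "zero_outside ?P (\<lambda>x. \<phi> x i) \<in> reg X" unfolding R by (rule alg_gen.gen) (use that in \<open>auto simp: C_def\<close>)
      then have "zero_outside ?P (\<lambda>x. \<phi> x i) x = zero_outside ?P (\<lambda>x. \<phi> x i) y" using xy by blast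
      then show ?thesis using xy by (simp add: zero_outside_def)
    qed
    moreover have "\<phi> x \<in> affine_space n" "\<phi> y \<in> affine_space n" using aff xy by auto
    ultimately have "\<phi> x = \<phi> y" by (intro PiE_ext[of _ "{..<n}" "\<lambda>_. UNIV"]) auto
    then show ?thesis using inj xy by (auto dest: inj_onD)
  qed
  have ch: "\<exists>x\<in>?P. \<forall>f\<in>reg X. \<chi> f = f x" if \<chi>: "is_char ?P (reg X) \<chi>" for \<chi>
  proof -
    define z where "z = (\<lambda>i\<in>{..<n}. \<chi> (zero_outside ?P (\<lambda>x. \<phi> x i)))"
    have zp: "\<chi> (zero_outside ?P (\<lambda>x. p (\<phi> x))) = p z" if "p \<in> poly_funs n" for p
      using that
    proof induction
      case (const c)
      then show ?case using \<chi> by (simp add: is_char_def)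
    next
      case (coord i)
      then show ?case by (simp add: z_def)
    next
      case (add p q)
      have "zero_outside ?P (\<lambda>x. p (\<phi> x) + q (\<phi> x)) =
          (\<lambda>x. zero_outside ?P (\<lambda>x. p (\<phi> x)) x + zero_outside ?P (\<lambda>x. q (\<phi> x)) x)"
        by (auto simp: zero_outside_def)
      then show ?case using \<chi> 1[OF add.hyps(1)] 1[OF add.hyps(2)] R add.IH unfolding is_char_def by simp
    next
      case (mult p q)
      have "zero_outside ?P (\<lambda>x. p (\<phi> x) * q (\<phi> x)) =
          (\<lambda>x. zero_outside ?P (\<lambda>x. p (\<phi> x)) x * zero_outside ?P (\<lambda>x. q (\<phi> x)) x)"
        by (auto simp: zero_outside_def)
      then show ?case using \<chi> 1[OF mult.hyps(1)] 1[OF mult.hyps(2)] R mult.IH unfolding is_char_def by simp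
    qed
    obtain S where S: "S \<subseteq> poly_funs n" "\<phi> ` ?P = {x \<in> affine_space n. \<forall>p\<in>S. p x = 0}"
      using cl unfolding zariski_closed_def by blast
    have "p z = 0" if "p \<in> S" for p
    proof -
      have "zero_outside ?P (\<lambda>x. p (\<phi> x)) = zero_outside ?P (\<lambda>_. 0)"
      proof
        fix x show "zero_outside ?P (\<lambda>x. p (\<phi> x)) x = zero_outside ?P (\<lambda>_. 0) x"
          using S(2) that by (cases "x \<in> ?P") (auto simp: zero_outside_def)
      qed
      then show ?thesis using zp[of p] S(1) that \<chi> by (auto simp: is_char_def)
    qed
    moreover have "z \<in> affine_space n" by (simp add: z_def)
    ultimately have "z \<in> \<phi> ` ?P" using S(2) by auto
    then obtain x where x: "x \<in> ?P" "z = \<phi> x" by auto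
    then have "\<chi> f = f x" if "f \<in> reg X" for f
      using that zp unfolding reg by (auto simp: zero_outside_def)
    then show ?thesis using x by blast
  qed
  have "\<forall>f\<in>C. \<forall>x. x \<notin> ?P \<longrightarrow> f x = 0" by (auto simp: C_def zero_outside_def)
  moreover have "finite C" by (simp add: C_def)
  moreover have "\<forall>x\<in>?P. \<forall>y\<in>?P. (\<forall>f\<in>reg X. f x = f y) \<longrightarrow> x = y"
    using sep by blast
  moreover have "\<forall>\<chi>. is_char ?P (reg X) \<chi> \<longrightarrow> (\<exists>x\<in>?P. \<forall>f\<in>reg X. \<chi> f = f x)"
    by (intro allI impI ch)
  ultimately show ?thesis using R by (intro exI[of _ C] conjI)
qed

text \<open>The generators embed the variety into affine space. The image is closed, since a zero of all
  relations between the generators defines a homomorphism.\<close>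

lemma affine_varietyI:
  fixes X :: "('a, 'k::field) variety"
  assumes C: "finite C" "\<And>f x. f \<in> C \<Longrightarrow> x \<notin> pts X \<Longrightarrow> f x = 0" and R: "reg X = alg_gen (pts X) C"
    and sep: "\<And>x y. x \<in> pts X \<Longrightarrow> y \<in> pts X \<Longrightarrow> (\<And>f. f \<in> reg X \<Longrightarrow> f x = f y) \<Longrightarrow> x = y"
    and ch: "\<And>\<chi>. is_char (pts X) (reg X) \<chi> \<Longrightarrow> \<exists>x\<in>pts X. \<forall>f\<in>reg X. \<chi> f = f x"
  shows "affine_variety X"
proof -
  let ?P = "pts X"
  obtain cs where cs: "set cs = C" using C(1) finite_list by blast
  define n where "n = length cs"
  define \<phi> where "\<phi> x = (\<lambda>i\<in>{..<n}. (cs ! i) x)" for x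
  let ?z = "\<lambda>p. zero_outside ?P (\<lambda>x. p (\<phi> x))"
  have csC: "cs ! i \<in> C" if "i < n" for i using that cs by (auto simp: n_def)
  have zc: "?z (\<lambda>x. x i) = cs ! i" if "i < n" for i
    using that C(2)[OF csC[OF that]] by (auto simp: zero_outside_def \<phi>_def fun_eq_iff)
  have za: "?z (\<lambda>x. p x + q x) = (\<lambda>x. ?z p x + ?z q x)" "?z (\<lambda>x. p x * q x) = (\<lambda>x. ?z p x * ?z q x)" for p q :: "(nat \<Rightarrow> 'k) \<Rightarrow> 'k"
    by (auto simp: zero_outside_def fun_eq_iff)
  have 1: "?z p \<in> alg_gen ?P C" if "p \<in> poly_funs n" for p
    using that
  proof induction
    case (coord i)
    then show ?case using zc csC by (auto intro: alg_gen.gen)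
  qed (auto simp: za intro: alg_gen.intros)
  have 2: "f \<in> ?z ` poly_funs n" if "f \<in> alg_gen ?P C" for f
    using that
  proof induction
    case (const c)
    show ?case by (intro image_eqI[of _ _ "\<lambda>_. c"]) (auto intro: poly_funs.const)
  next
    case (gen f)
    then obtain i where "i < n" "f = cs ! i" using cs by (metis in_set_conv_nth n_def)
    then show ?case using zc[of i] by (intro image_eqI[of _ _ "\<lambda>x. x i"]) (auto intro: poly_funs.coord)
  next
    case (add f g)
    then obtain p q where "p \<in> poly_funs n" "q \<in> poly_funs n" "f = ?z p" "g = ?z q" by blast
    then show ?case using za(1)[of p q] by (intro image_eqI[of _ _ "\<lambda>x. p x + q x"] poly_funs.add) auto
  next
    case (mult f g)
    then obtain p q where "p \<in> poly_funs n" "q \<in> poly_funs n" "f = ?z p" "g = ?z q" by blast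
    then show ?case using za(2)[of p q] by (intro image_eqI[of _ _ "\<lambda>x. p x * q x"] poly_funs.mult) auto
  qed
  have reg: "reg X = ?z ` poly_funs n" using 1 2 R by auto
  have inj: "inj_on \<phi> ?P"
  proof (rule inj_onI)
    fix x y assume xy: "x \<in> ?P" "y \<in> ?P" "\<phi> x = \<phi> y"
    show "x = y" by (rule sep) (use xy reg in \<open>auto simp: zero_outside_def\<close>)
  qed
  define S where "S = {p \<in> poly_funs n. \<forall>x\<in>?P. p (\<phi> x) = 0}"
  have "\<phi> ` ?P = {x \<in> affine_space n. \<forall>p\<in>S. p x = 0}"
  proof (intro equalityI subsetI)
    fix z assume "z \<in> {x \<in> affine_space n. \<forall>p\<in>S. p x = 0}"
    then have z: "z \<in> affine_space n" "\<And>p. p \<in> S \<Longrightarrow> p z = 0" by auto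
    define \<chi> where "\<chi> f = (SOME p. p \<in> poly_funs n \<and> f = ?z p) z" for f
    have \<chi>: "\<chi> (?z p) = p z" if p: "p \<in> poly_funs n" for p
    proof -
      define q where "q = (SOME q. q \<in> poly_funs n \<and> ?z p = ?z q)"
      have q: "q \<in> poly_funs n" "?z p = ?z q"
        using someI[of "\<lambda>q. q \<in> poly_funs n \<and> ?z p = ?z q" p] p unfolding q_def by auto
      have "(\<lambda>x. p x + (\<lambda>_. - 1) x * q x) \<in> poly_funs n" using p q(1) by (intro poly_funs.intros)
      moreover have "p (\<phi> x) = q (\<phi> x)" if "x \<in> ?P" for x
        using fun_cong[OF q(2), of x] that by (simp add: zero_outside_def)
      ultimately have "(\<lambda>x. p x + (\<lambda>_. - 1) x * q x) \<in> S" by (simp add: S_def)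
      then show ?thesis using z(2) by (force simp: \<chi>_def q_def)
    qed
    have "is_char ?P (reg X) \<chi>"
      unfolding is_char_def
    proof (intro conjI ballI allI)
      fix f g assume "f \<in> reg X" "g \<in> reg X"
      then obtain p q where pq: "p \<in> poly_funs n" "q \<in> poly_funs n" "f = ?z p" "g = ?z q" unfolding reg by blast
      show "\<chi> (\<lambda>x. f x + g x) = \<chi> f + \<chi> g"
        unfolding pq za(1)[symmetric] using \<chi> pq(1,2) poly_funs.add[OF pq(1,2)] by simp
      show "\<chi> (\<lambda>x. f x * g x) = \<chi> f * \<chi> g"
        unfolding pq za(2)[symmetric] using \<chi> pq(1,2) poly_funs.mult[OF pq(1,2)] by simp
    next
      fix c show "\<chi> (zero_outside ?P (\<lambda>_. c)) = c" using \<chi>[OF poly_funs.const[of c]] by simp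
    qed
    then obtain x where x: "x \<in> ?P" "\<And>f. f \<in> reg X \<Longrightarrow> \<chi> f = f x" using ch by blast
    have "z = \<phi> x"
    proof (rule PiE_ext[OF z(1)])
      show "\<phi> x \<in> affine_space n" by (simp add: \<phi>_def)
      fix i assume "i \<in> {..<n}"
      then have i: "i < n" by simp
      have "z i = \<chi> (?z (\<lambda>x. x i))" using \<chi>[OF poly_funs.coord[OF i]] by simp
      also have "\<dots> = (?z (\<lambda>x. x i)) x" using x(2) reg poly_funs.coord[OF i] by blast
      finally show "z i = \<phi> x i" using x(1) by (simp add: zero_outside_def)
    qed
    then show "z \<in> \<phi> ` ?P" using x(1) by auto
  qed (auto simp: \<phi>_def S_def split: if_splits)
  then have "zariski_closed n (\<phi> ` ?P)"
    unfolding zariski_closed_def by (intro exI[of _ S]) (auto simp: S_def)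
  then show ?thesis using inj reg unfolding affine_variety_def by blast
qed

lemma prod_variety_expand:
  assumes "\<And>c f. f \<in> reg X \<Longrightarrow> fscale c f \<in> reg X"
  shows "F \<in> reg (prod_variety X Y) \<longleftrightarrow>
    (\<exists>n a b. (\<forall>i<n. a i \<in> reg X \<and> b i \<in> reg Y) \<and> F = (\<lambda>(x, y). \<Sum>i<(n::nat). a i x * b i y))" (is "_ \<longleftrightarrow> ?E F")
proof
  assume "F \<in> reg (prod_variety X Y)"
  then have "F \<in> fun_vs.span {\<lambda>(x, y). f x * g y | f g. f \<in> reg X \<and> g \<in> reg Y}" by (simp only: prod_variety_def variety.select_convs)
  then show "?E F"
  proof (induction rule: fun_vs.span_induct_alt)
    case base
    show ?case by (intro exI[of _ 0]) (auto simp: fun_eq_iff)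
  next
    case (step c F G)
    then obtain f g where fg: "F = (\<lambda>(x, y). f x * g y)" "f \<in> reg X" "g \<in> reg Y" by blast
    obtain n a b where ab: "\<forall>i<n. a i \<in> reg X \<and> b i \<in> reg Y" "G = (\<lambda>(x, y). \<Sum>i<(n::nat). a i x * b i y)"
      using step.IH by blast
    show ?case
      by (rule exI[of _ "Suc n"], rule exI[of _ "a(n := fscale c f)"], rule exI[of _ "b(n := g)"])
        (use fg ab assms in \<open>auto simp: fun_eq_iff less_Suc_eq fscale_apply\<close>)
  qed
next
  assume "?E F"
  then obtain n a b where ab: "\<And>i. i < n \<Longrightarrow> a i \<in> reg X" "\<And>i. i < n \<Longrightarrow> b i \<in> reg Y"
    and F: "F = (\<lambda>(x, y). \<Sum>i<(n::nat). a i x * b i y)" by blast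
  have "F = (\<Sum>i<n. (\<lambda>(x, y). a i x * b i y))" unfolding F by (auto simp: fun_eq_iff sum_fun_apply)
  also have "\<dots> \<in> fun_vs.span {\<lambda>(x, y). f x * g y | f g. f \<in> reg X \<and> g \<in> reg Y}"
    by (intro fun_vs.span_sum fun_vs.span_base) (use ab in blast)
  finally show "F \<in> reg (prod_variety X Y)" by (simp only: prod_variety_def variety.select_convs)
qed

section \<open>Groups with an algebra of functions\<close>

text \<open>Tangent vectors at \<open>x\<close> as point derivations. In contrast to members of the tangent space,
  they may take any values outside \<open>R\<close>.\<close>

definition pd :: "('a \<Rightarrow> 'k::field) set \<Rightarrow> 'a \<Rightarrow> (('a \<Rightarrow> 'k) \<Rightarrow> 'k) \<Rightarrow> bool"
  where "pd R x A \<longleftrightarrow> (\<forall>f\<in>R. \<forall>g\<in>R. A (f + g) = A f + A g \<and> A (f * g) = f x * A g + A f * g x) \<and>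
    (\<forall>c. \<forall>f\<in>R. A (fscale c f) = c * A f)"

lemma tangent_space_iff:
  "A \<in> tangent_space X x \<longleftrightarrow> pd (reg X) x A \<and> (\<forall>f. f \<notin> reg X \<longrightarrow> A f = 0)"
  by (auto simp: tangent_space_def pd_def)

lemma pdD:
  assumes "pd R x A"
  shows "\<And>f g. f \<in> R \<Longrightarrow> g \<in> R \<Longrightarrow> A (f + g) = A f + A g"
    "\<And>f g. f \<in> R \<Longrightarrow> g \<in> R \<Longrightarrow> A (f * g) = f x * A g + A f * g x"
    "\<And>c f. f \<in> R \<Longrightarrow> A (fscale c f) = c * A f"
    "0 \<in> R \<Longrightarrow> A 0 = 0"
proof -
  show s: "\<And>c f. f \<in> R \<Longrightarrow> A (fscale c f) = c * A f" and
    "\<And>f g. f \<in> R \<Longrightarrow> g \<in> R \<Longrightarrow> A (f + g) = A f + A g"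
    "\<And>f g. f \<in> R \<Longrightarrow> g \<in> R \<Longrightarrow> A (f * g) = f x * A g + A f * g x"
    using assms by (auto simp: pd_def)
  have "fscale 0 0 = (0 :: 'a \<Rightarrow> 'b)" by (simp add: fscale_def fun_eq_iff)
  then show "0 \<in> R \<Longrightarrow> A 0 = 0" using s[of 0 0] by simp
qed

lemma pd_sum:
  assumes "pd R x A" "0 \<in> R" "\<And>f g. f \<in> R \<Longrightarrow> g \<in> R \<Longrightarrow> f + g \<in> R" "\<And>i. i \<in> S \<Longrightarrow> f i \<in> R"
  shows "A (\<Sum>i\<in>S. f i) = (\<Sum>i\<in>S. A (f i)) \<and> (\<Sum>i\<in>S. f i) \<in> R"
  using assms(4)
proof (induction S rule: infinite_finite_induct)
  case (insert y F)
  then have "A (sum f F) = (\<Sum>i\<in>F. A (f i))" "sum f F \<in> R" "f y \<in> R" by auto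
  then have "A (f y + sum f F) = A (f y) + (\<Sum>i\<in>F. A (f i))" "f y + sum f F \<in> R"
    using pdD(1)[OF assms(1), of "f y" "sum f F"] assms(3)[of "f y" "sum f F"] by auto
  then show ?case using insert(1,2) by (simp only: sum.insert not_False_eq_True)
qed (use pdD(4)[OF assms(1,2)] assms(2) in auto)

lemma zo_eq_iff: "(\<And>x. x \<in> P \<Longrightarrow> f x = g x) \<Longrightarrow> zero_outside P f = zero_outside P g"
  by (auto simp: zero_outside_def fun_eq_iff)

locale function_algebra =
  fixes P :: "'g set" and R :: "('g \<Rightarrow> 'k::field) set"
  assumes supp: "f \<in> R \<Longrightarrow> x \<notin> P \<Longrightarrow> f x = 0"
    and const: "zero_outside P (\<lambda>_. c) \<in> R"
    and add: "f \<in> R \<Longrightarrow> g \<in> R \<Longrightarrow> f + g \<in> R"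
    and mult: "f \<in> R \<Longrightarrow> g \<in> R \<Longrightarrow> f * g \<in> R"
begin

lemma eqI: "f \<in> R \<Longrightarrow> g \<in> R \<Longrightarrow> (\<And>x. x \<in> P \<Longrightarrow> f x = g x) \<Longrightarrow> f = g"
  using supp by (metis ext)

lemma zero: "0 \<in> R"
proof -
  have "zero_outside P (\<lambda>_. 0) = (0 :: 'g \<Rightarrow> 'k)" by (auto simp: zero_outside_def)
  then show ?thesis using const[of 0] by metis
qed

lemma zo_self: "f \<in> R \<Longrightarrow> zero_outside P f = f"
  using supp by (auto simp: zero_outside_def fun_eq_iff)

lemma fscale_eq: "f \<in> R \<Longrightarrow> fscale c f = zero_outside P (\<lambda>_. c) * f"
  using supp by (auto simp: zero_outside_def fun_eq_iff fscale_apply)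

lemma scale: "f \<in> R \<Longrightarrow> fscale c f \<in> R"
  using fscale_eq mult const by metis

lemma subspace: "fun_vs.subspace R"
  by (rule fun_vs.subspaceI) (auto intro: zero add scale)

lemma diff: "f \<in> R \<Longrightarrow> g \<in> R \<Longrightarrow> f - g \<in> R"
  using fun_vs.subspace_diff[OF subspace] .

lemma sum: "(\<And>i. i \<in> S \<Longrightarrow> f i \<in> R) \<Longrightarrow> (\<Sum>i\<in>S. f i) \<in> R"
  using fun_vs.subspace_sum[OF subspace] .

abbreviation one_fun :: "'g \<Rightarrow> 'k" where "one_fun \<equiv> zero_outside P (\<lambda>_. 1)"

lemma one_mult: "f \<in> R \<Longrightarrow> one_fun * f = f" "f \<in> R \<Longrightarrow> f * one_fun = f"
  using supp by (auto simp: zero_outside_def fun_eq_iff)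

lemma lincomb: "(\<And>i. i < n \<Longrightarrow> a i \<in> R) \<Longrightarrow> zero_outside P (\<lambda>x. \<Sum>i<(n::nat). c i * a i x) = (\<Sum>i<n. fscale (c i) (a i))"
proof (rule ext)
  fix x assume "\<And>i. i < n \<Longrightarrow> a i \<in> R"
  then have "x \<notin> P \<Longrightarrow> (\<Sum>i<n. c i * a i x) = 0" using supp by (intro sum.neutral) auto
  then show "zero_outside P (\<lambda>x. \<Sum>i<n. c i * a i x) x = (\<Sum>i<n. fscale (c i) (a i)) x"
    by (auto simp: zero_outside_apply sum_fun_apply fscale_apply)
qed

lemma lincomb_in:
  assumes "\<And>i. i < n \<Longrightarrow> a i \<in> R"
  shows "zero_outside P (\<lambda>x. \<Sum>i<(n::nat). c i * a i x) \<in> R"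
proof -
  have "(\<Sum>i<n. fscale (c i) (a i)) \<in> R" using assms by (intro sum scale) simp
  then show ?thesis using lincomb[of n a c] assms by simp
qed

lemma pd_lincomb:
  assumes "pd R x A" "\<And>i. i < n \<Longrightarrow> a i \<in> R"
  shows "A (zero_outside P (\<lambda>x. \<Sum>i<(n::nat). c i * a i x)) = (\<Sum>i<n. c i * A (a i))"
proof -
  have "A (\<Sum>i<n. fscale (c i) (a i)) = (\<Sum>i<n. c i * A (a i))"
    using pd_sum[OF assms(1) zero add, of "{..<n}" "\<lambda>i. fscale (c i) (a i)"] assms(2) scale
    by (simp add: pdD(3)[OF assms(1)])
  then show ?thesis using lincomb[of n a c] assms(2) by simp
qed

lemma pd_const:
  assumes "pd R x A" "x \<in> P"
  shows "A (zero_outside P (\<lambda>_. c)) = 0"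
proof -
  have "A (one_fun * one_fun) = one_fun x * A one_fun + A one_fun * one_fun x"
    by (rule pdD(2)[OF assms(1) const const])
  then have "A one_fun = 1 * A one_fun + A one_fun * 1"
    using assms(2) unfolding one_mult(1)[OF const] by (simp only: zero_outside_apply if_True)
  then have 1: "A one_fun = 0" by (metis add_cancel_left_left mult_1 mult_1_right)
  have "zero_outside P (\<lambda>_. c) = fscale c one_fun" by (auto simp: zero_outside_def fscale_def)
  then show ?thesis using 1 pdD(3)[OF assms(1) const] by simp
qed

end

lemma ipow_subset:
  fixes A :: "'b::comm_ring set"
  assumes "0 \<in> A" "\<And>x y. x \<in> A \<Longrightarrow> y \<in> A \<Longrightarrow> x + y \<in> A" "\<And>x y. x \<in> A \<Longrightarrow> y \<in> A \<Longrightarrow> x * y \<in> A" "M \<subseteq> A"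
  shows "ipow A M n \<subseteq> A"
proof (induction n)
  case (Suc n)
  have "{a * b | a b. a \<in> M \<and> b \<in> ipow A M n} \<subseteq> A" using Suc assms(3,4) by blast
  then show ?case unfolding ipow.simps by (intro sums_of_subset assms(1,2))
qed simp

locale function_group = group H + function_algebra "carrier H" R
  for H :: "'g monoid" (structure) and R :: "('g \<Rightarrow> 'k::field) set" +
  assumes comul: "f \<in> R \<Longrightarrow> \<exists>(n::nat) a b. (\<forall>i<n. a i \<in> R \<and> b i \<in> R) \<and>
      (\<forall>g\<in>carrier H. \<forall>h\<in>carrier H. f (g \<otimes> h) = (\<Sum>i<n. a i g * b i h))"
    and inverse: "f \<in> R \<Longrightarrow> zero_outside (carrier H) (\<lambda>g. f (inv g)) \<in> R"
begin

abbreviation "P \<equiv> carrier H"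

definition rt :: "'g \<Rightarrow> ('g \<Rightarrow> 'k) \<Rightarrow> 'g \<Rightarrow> 'k"
  where "rt g f = zero_outside P (\<lambda>h. f (h \<otimes> g))"

text \<open>The derivation of \<open>R\<close> that commutes with the operators \<open>rt g\<close> and has the value \<open>A\<close> at the
  identity.\<close>

definition Dr :: "(('g \<Rightarrow> 'k) \<Rightarrow> 'k) \<Rightarrow> ('g \<Rightarrow> 'k) \<Rightarrow> 'g \<Rightarrow> 'k"
  where "Dr A f = zero_outside P (\<lambda>g. A (rt g f))"

lemma rt_in: assumes "f \<in> R" "g \<in> P" shows "rt g f \<in> R"
proof -
  obtain n :: nat and a b where ab: "\<forall>i<n. a i \<in> R \<and> b i \<in> R"
    "\<forall>g\<in>P. \<forall>h\<in>P. f (g \<otimes> h) = (\<Sum>i<n. a i g * b i h)" using comul[OF assms(1)] by blast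
  have "rt g f = zero_outside P (\<lambda>h. \<Sum>i<n. b i g * a i h)"
    unfolding rt_def by (rule zo_eq_iff) (use ab assms in \<open>simp add: mult.commute\<close>)
  also have "\<dots> \<in> R" using ab by (intro lincomb_in) auto
  finally show ?thesis .
qed

lemma rt_apply: "h \<in> P \<Longrightarrow> rt g f h = f (h \<otimes> g)"
  by (simp add: rt_def zero_outside_def)

lemma Dr_apply: "g \<in> P \<Longrightarrow> Dr A f g = A (rt g f)"
  by (simp add: Dr_def zero_outside_def)

lemma Dr_in: assumes "f \<in> R" "pd R x A" shows "Dr A f \<in> R"
proof -
  obtain n :: nat and a b where ab: "\<forall>i<n. a i \<in> R \<and> b i \<in> R"
    "\<forall>g\<in>P. \<forall>h\<in>P. f (g \<otimes> h) = (\<Sum>i<n. a i g * b i h)" using comul[OF assms(1)] by blast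
  have "A (rt g f) = (\<Sum>i<n. A (a i) * b i g)" if "g \<in> P" for g
  proof -
    have "rt g f = zero_outside P (\<lambda>h. \<Sum>i<n. b i g * a i h)"
      unfolding rt_def by (rule zo_eq_iff) (use ab that in \<open>simp add: mult.commute\<close>)
    then show ?thesis using pd_lincomb[OF assms(2), of n a "\<lambda>i. b i g"] ab by (simp add: mult.commute)
  qed
  then have "Dr A f = zero_outside P (\<lambda>g. \<Sum>i<n. A (a i) * b i g)"
    unfolding Dr_def by (intro zo_eq_iff) auto
  also have "\<dots> \<in> R" using ab by (intro lincomb_in) auto
  finally show ?thesis .
qed

lemma rt_hom: "rt g (f1 + f2) = rt g f1 + rt g f2" "rt g (f1 * f2) = rt g f1 * rt g f2"
  "rt g (fscale c f) = fscale c (rt g f)"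
  by (auto simp: rt_def zero_outside_def fun_eq_iff fscale_apply)

lemma rt_rt: "g1 \<in> P \<Longrightarrow> g2 \<in> P \<Longrightarrow> rt g1 (rt g2 f) = rt (g1 \<otimes> g2) f"
  unfolding rt_def by (rule zo_eq_iff) (auto simp: zero_outside_def m_assoc)

lemma rt_one: "f \<in> R \<Longrightarrow> rt \<one> f = f"
  by (rule eqI) (auto simp: rt_in rt_apply)

lemma rt_Dr:
  assumes "g \<in> P" shows "rt g (Dr A f) = Dr A (rt g f)"
proof -
  have "zero_outside P (\<lambda>h. Dr A f (h \<otimes> g)) = zero_outside P (\<lambda>h. A (rt h (rt g f)))"
    by (rule zo_eq_iff) (use assms in \<open>simp add: Dr_apply rt_rt\<close>)
  then show ?thesis by (simp add: Dr_def[of A "rt g f"] rt_def[of g "Dr A f"])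
qed

lemma Dr_props:
  assumes A: "pd R \<one> A"
  shows "f \<in> R \<Longrightarrow> g \<in> R \<Longrightarrow> Dr A (f + g) = Dr A f + Dr A g"
    "f \<in> R \<Longrightarrow> g \<in> R \<Longrightarrow> Dr A (f * g) = f * Dr A g + Dr A f * g"
    "f \<in> R \<Longrightarrow> Dr A (fscale c f) = fscale c (Dr A f)"
    "f \<in> R \<Longrightarrow> Dr A f \<one> = A f"
proof -
  note D = Dr_in[OF _ A]
  show "Dr A (f + g) = Dr A f + Dr A g" if "f \<in> R" "g \<in> R"
    by (rule eqI) (use that D add in \<open>auto simp: Dr_apply rt_hom pdD(1)[OF A] rt_in\<close>)
  show "Dr A (f * g) = f * Dr A g + Dr A f * g" if "f \<in> R" "g \<in> R"
    by (rule eqI) (use that D add mult in \<open>auto simp: Dr_apply rt_hom pdD(2)[OF A] rt_in rt_apply\<close>)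
  show "Dr A (fscale c f) = fscale c (Dr A f)" if "f \<in> R"
    by (rule eqI) (use that D scale in \<open>auto simp: Dr_apply rt_hom pdD(3)[OF A] rt_in fscale_apply\<close>)
  show "Dr A f \<one> = A f" if "f \<in> R" using that by (simp add: Dr_apply rt_one)
qed

text \<open>Differentiating \<open>f(g g\<inverse>) = f(1)\<close>.\<close>

lemma pd_inverse:
  assumes A: "pd R \<one> A" and f: "f \<in> R"
  shows "A (zero_outside P (\<lambda>g. f (inv g))) = - A f"
proof -
  obtain n :: nat and a b where ab: "\<forall>i<n. a i \<in> R \<and> b i \<in> R"
    "\<forall>g\<in>P. \<forall>h\<in>P. f (g \<otimes> h) = (\<Sum>i<n. a i g * b i h)" using comul[OF f] by blast
  let ?i = "\<lambda>f. zero_outside P (\<lambda>g. f (inv g))"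
  have "(\<Sum>i<n. a i * ?i (b i)) = zero_outside P (\<lambda>_. f \<one>)"
  proof (rule eqI)
    show "(\<Sum>i<n. a i * ?i (b i)) \<in> R" using ab by (auto intro!: sum mult inverse)
    fix g assume "g \<in> P"
    then show "(\<Sum>i<n. a i * ?i (b i)) g = zero_outside P (\<lambda>_. f \<one>) g"
      using ab(2)[rule_format, of g "inv g"] by (simp add: sum_fun_apply zero_outside_apply)
  qed (rule const)
  then have "0 = A (\<Sum>i<n. a i * ?i (b i))" using pd_const[OF A] by simp
  also have "\<dots> = (\<Sum>i<n. A (a i * ?i (b i)))"
    using pd_sum[OF A zero add, of "{..<n}" "\<lambda>i. a i * ?i (b i)"] ab by (auto intro!: mult inverse)
  also have "\<dots> = (\<Sum>i<n. a i \<one> * A (?i (b i)) + A (a i) * b i \<one>)"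
    using ab by (intro sum.cong) (auto simp: pdD(2)[OF A] inverse zero_outside_apply)
  also have "\<dots> = (\<Sum>i<n. a i \<one> * A (?i (b i))) + (\<Sum>i<n. b i \<one> * A (a i))"
    by (simp add: sum.distrib mult.commute)
  also have "(\<Sum>i<n. b i \<one> * A (a i)) = A (zero_outside P (\<lambda>x. \<Sum>i<n. b i \<one> * a i x))"
    using pd_lincomb[OF A, of n a "\<lambda>i. b i \<one>"] ab by simp
  also have "zero_outside P (\<lambda>x. \<Sum>i<n. b i \<one> * a i x) = f"
  proof (rule eqI)
    fix g assume "g \<in> P"
    then show "zero_outside P (\<lambda>x. \<Sum>i<n. b i \<one> * a i x) g = f g"
      using ab(2)[rule_format, of g \<one>] by (simp add: zero_outside_apply mult.commute)
  qed (use ab f in \<open>auto intro!: lincomb_in\<close>)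
  also have "(\<Sum>i<n. a i \<one> * A (?i (b i))) = A (zero_outside P (\<lambda>x. \<Sum>i<n. a i \<one> * ?i (b i) x))"
    using pd_lincomb[OF A, of n "\<lambda>i. ?i (b i)" "\<lambda>i. a i \<one>"] ab inverse by simp
  also have "zero_outside P (\<lambda>x. \<Sum>i<n. a i \<one> * ?i (b i) x) = ?i f"
  proof (rule eqI)
    fix g assume "g \<in> P"
    then show "zero_outside P (\<lambda>x. \<Sum>i<n. a i \<one> * ?i (b i) x) g = ?i f g"
      using ab(2)[rule_format, of \<one> "inv g"] by (simp add: zero_outside_apply)
  qed (use ab f inverse in \<open>auto intro!: lincomb_in\<close>)
  finally show ?thesis by (simp add: eq_neg_iff_add_eq_0)
qed

definition "m_one = {f \<in> R. f \<one> = 0}"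

lemma ipow_facts:
  shows "ipow R m_one n \<subseteq> R" "f \<in> ipow R m_one n \<Longrightarrow> fscale c f \<in> ipow R m_one n"
    "0 \<in> ipow R m_one n" "f \<in> ipow R m_one n \<Longrightarrow> g \<in> ipow R m_one n \<Longrightarrow> f + g \<in> ipow R m_one n"
    "f \<in> m_one \<Longrightarrow> g \<in> ipow R m_one n \<Longrightarrow> f * g \<in> ipow R m_one (Suc n)"
    "m_one \<subseteq> ipow R m_one (Suc 0)"
proof -
  show 1: "ipow R m_one n \<subseteq> R" for n by (rule ipow_subset) (auto simp: m_one_def zero add mult)
  show s: "fscale c f \<in> ipow R m_one n" if "f \<in> ipow R m_one n" for c f n
  proof -
    have "f \<in> R" using 1 that by (rule subsetD)
    then show ?thesis unfolding fscale_eq[OF \<open>f \<in> R\<close>] by (intro ipow_multA[OF mult const that])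
  qed
  show "0 \<in> ipow R m_one n" for n using zero by (cases n) (auto intro: sums_of.zero)
  show "f \<in> ipow R m_one n \<Longrightarrow> g \<in> ipow R m_one n \<Longrightarrow> f + g \<in> ipow R m_one n" for f g
    using ipow_add[OF add] by blast
  show *: "f \<in> m_one \<Longrightarrow> g \<in> ipow R m_one n \<Longrightarrow> f * g \<in> ipow R m_one (Suc n)" for f g n
    unfolding ipow.simps by (rule sums_of_gen) blast
  show "m_one \<subseteq> ipow R m_one (Suc 0)"
  proof
    fix f assume f: "f \<in> m_one"
    then have "f * one_fun \<in> ipow R m_one (Suc 0)" by (intro *) (simp_all add: const)
    then show "f \<in> ipow R m_one (Suc 0)" using one_mult(2) f by (simp add: m_one_def)
  qed
qed

lemma subspace_ipow: "fun_vs.subspace (ipow R m_one n)"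
  by (rule fun_vs.subspaceI) (use ipow_facts in auto)

end

section \<open>Connected algebraic groups in characteristic zero\<close>

locale algebraic_function_group = function_group H R
  for H :: "'g monoid" (structure) and R :: "('g \<Rightarrow> 'k::field_char_0) set" +
  fixes C :: "('g \<Rightarrow> 'k) set"
  assumes fin: "finite C" and gen: "R = alg_gen (carrier H) C"
begin

text \<open>Coordinates at the identity whose differentials are dual to a basis of the tangent space.\<close>

lemma euler_coordinates:
  "\<exists>(Q :: ('g \<Rightarrow> 'k) set) A x. finite Q \<and> (\<forall>q\<in>Q. pd R \<one> (A q) \<and> x q \<in> m_one) \<and>
    (\<forall>y\<in>m_one. y - (\<Sum>q\<in>Q. fscale (A q y) (x q)) \<in> ipow R m_one (Suc (Suc 0)))"
proof -
  let ?m2 = "ipow R m_one (Suc (Suc 0))"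
  let ?N = "fun_vs.span (insert one_fun ?m2)"
  have m2: "f * g \<in> ?m2" if "f \<in> m_one" "g \<in> m_one" for f g
    using ipow_facts(5,6) that by blast
  obtain B0 where B0: "B0 \<subseteq> ?N" "fun_vs.independent B0" "?N \<subseteq> fun_vs.span B0"
    by (rule fun_vs.maximal_independent_subset)
  have B0N: "fun_vs.span B0 = ?N"
    by (rule subset_antisym[OF fun_vs.span_minimal[OF B0(1) fun_vs.subspace_span] B0(3)])
  obtain B where B: "B0 \<subseteq> B" "B \<subseteq> B0 \<union> C" "fun_vs.independent B" "B0 \<union> C \<subseteq> fun_vs.span B"
    by (rule fun_vs.maximal_independent_subset_extend[OF _ B0(2), of "B0 \<union> C"]) auto
  have NB: "?N \<subseteq> fun_vs.span B" unfolding B0N[symmetric] by (rule fun_vs.span_mono[OF B(1)])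
  have split: "f * g = (fscale (f \<one>) g + fscale (g \<one>) f - fscale (f \<one> * g \<one>) one_fun) +
      (f - fscale (f \<one>) one_fun) * (g - fscale (g \<one>) one_fun)" if "f \<in> R" "g \<in> R" for f g
    using supp[OF that(1)] supp[OF that(2)]
    by (auto simp: fun_eq_iff fscale_apply zero_outside_apply algebra_simps)
  have cent: "f - fscale (f \<one>) one_fun \<in> m_one" if "f \<in> R" for f
    using that by (auto simp: m_one_def fscale_apply zero_outside_apply intro!: diff scale const)
  have one_N: "one_fun \<in> ?N" and m2_N: "?m2 \<subseteq> ?N" by (auto intro: fun_vs.span_base)
  have RB: "f \<in> fun_vs.span B" if "f \<in> alg_gen P C" for f
    using that
  proof (induction rule: alg_gen.induct)
    case (const c)
    have "zero_outside P (\<lambda>_. c) = fscale c one_fun" by (auto simp: zero_outside_def fscale_def)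
    moreover have "fscale c one_fun \<in> fun_vs.span B" using NB one_N by (intro fun_vs.span_scale) (rule subsetD)
    ultimately show ?case by (simp only:)
  next
    case (gen f)
    then show ?case using B(4) by auto
  next
    case (add f g)
    then have "f + g \<in> fun_vs.span B" by (intro fun_vs.span_add)
    then show ?case by (simp only: plus_fun_def)
  next
    case (mult f g)
    have fg: "f \<in> R" "g \<in> R" using mult gen by auto
    have "(f - fscale (f \<one>) one_fun) * (g - fscale (g \<one>) one_fun) \<in> fun_vs.span B"
      using m2[OF cent[OF fg(1)] cent[OF fg(2)]] m2_N NB by blast
    then have "f * g \<in> fun_vs.span B"
      unfolding split[OF fg] using mult.IH NB one_N
      by (intro fun_vs.span_add fun_vs.span_diff fun_vs.span_scale) auto
    then show ?case by (simp only: times_fun_def)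
  qed
  define Q where "Q = B - B0"
  define A where "A q f = fun_vs.representation B f q" for q f
  define x where "x q = q - fscale (q \<one>) one_fun" for q
  have QR: "Q \<subseteq> R" using B(2) gen by (auto simp: Q_def intro: alg_gen.gen)
  have "finite Q" using B(2) fin by (auto simp: Q_def intro: finite_subset)
  have AN: "A q f = 0" if "q \<in> Q" "f \<in> ?N" for q f
  proof -
    have "fun_vs.representation B f = fun_vs.representation B0 f"
      by (rule fun_vs.representation_extend[OF B(3) _ B(1)]) (use that B0N in simp)
    then show ?thesis using fun_vs.representation_ne_zero[of B0 f q] that by (auto simp: A_def Q_def)
  qed
  have Aadd: "A q (f + g) = A q f + A q g" if "f \<in> fun_vs.span B" "g \<in> fun_vs.span B" for q f g
    using fun_vs.representation_add[OF B(3) that(2,1)] by (simp add: A_def)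
  have Asc: "A q (fscale c f) = c * A q f" if "f \<in> fun_vs.span B" for q c f
    using fun_vs.representation_scale[OF B(3) that] by (simp add: A_def)
  have Adf: "A q (f - g) = A q f - A q g" if "f \<in> fun_vs.span B" "g \<in> fun_vs.span B" for q f g
    using fun_vs.representation_diff[OF B(3) that(2,1)] by (simp add: A_def)
  have pdA: "pd R \<one> (A q)" if q: "q \<in> Q" for q
    unfolding pd_def
  proof (intro conjI ballI allI)
    fix f g assume fg: "f \<in> R" "g \<in> R"
    then have fgB: "f \<in> fun_vs.span B" "g \<in> fun_vs.span B" using RB gen by auto
    show "A q (f + g) = A q f + A q g" using Aadd fgB by blast
    have 1: "fscale (f \<one> * g \<one>) one_fun \<in> fun_vs.span B" using NB one_N by (intro fun_vs.span_scale) auto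
    have 2: "fscale (f \<one>) g \<in> fun_vs.span B" "fscale (g \<one>) f \<in> fun_vs.span B"
      using fgB by (auto intro: fun_vs.span_scale)
    have 3: "(f - fscale (f \<one>) one_fun) * (g - fscale (g \<one>) one_fun) \<in> ?N"
      using m2[OF cent[OF fg(1)] cent[OF fg(2)]] m2_N by blast
    have 4: "fscale (f \<one> * g \<one>) one_fun \<in> ?N" using one_N by (rule fun_vs.span_scale)
    have "A q (f * g) = A q (fscale (f \<one>) g) + A q (fscale (g \<one>) f) - A q (fscale (f \<one> * g \<one>) one_fun) +
        A q ((f - fscale (f \<one>) one_fun) * (g - fscale (g \<one>) one_fun))"
      unfolding split[OF fg] using 1 2 3 NB
      by (subst Aadd, blast intro: fun_vs.span_diff fun_vs.span_add, blast,
          subst Adf, blast intro: fun_vs.span_add, blast, subst Aadd) auto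
    also have "\<dots> = f \<one> * A q g + A q f * g \<one>"
      using AN[OF q 3] AN[OF q 4] Asc fgB by simp
    finally show "A q (f * g) = f \<one> * A q g + A q f * g \<one>" .
  next
    fix c f assume "f \<in> R"
    then show "A q (fscale c f) = c * A q f" using Asc RB gen by blast
  qed
  have "y - (\<Sum>q\<in>Q. fscale (A q y) (x q)) \<in> ?m2" if y: "y \<in> m_one" for y
  proof -
    have "y \<in> alg_gen P C" using y unfolding m_one_def gen[symmetric] by blast
    then have yB: "y \<in> fun_vs.span B" by (rule RB)
    let ?S = "{b. fun_vs.representation B y b \<noteq> 0}"
    have S: "finite ?S" "?S \<subseteq> B"
      using fun_vs.finite_representation fun_vs.representation_ne_zero by blast+
    have "y = (\<Sum>b\<in>?S. fscale (fun_vs.representation B y b) b)"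
      using fun_vs.sum_nonzero_representation_eq[OF B(3) yB] by simp
    also have "\<dots> = (\<Sum>b\<in>(?S \<inter> B0) \<union> Q. fscale (fun_vs.representation B y b) b)"
      using S \<open>finite Q\<close> by (intro sum.mono_neutral_left) (auto simp: Q_def)
    also have "\<dots> = (\<Sum>b\<in>?S \<inter> B0. fscale (fun_vs.representation B y b) b) + (\<Sum>q\<in>Q. fscale (A q y) q)"
      unfolding A_def using S \<open>finite Q\<close> by (intro sum.union_disjoint) (auto simp: Q_def)
    finally have 1: "y - (\<Sum>q\<in>Q. fscale (A q y) q) = (\<Sum>b\<in>?S \<inter> B0. fscale (fun_vs.representation B y b) b)"
      by (simp only: diff_eq_eq)
    have xs: "(\<Sum>q\<in>Q. fscale (A q y) (x q)) = (\<Sum>q\<in>Q. fscale (A q y) q) - fscale (\<Sum>q\<in>Q. A q y * q \<one>) one_fun"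
      by (simp add: x_def fun_eq_iff sum_fun_apply fscale_apply algebra_simps sum_subtractf sum_distrib_left sum_distrib_right)
    have diff_diff: "a - (b - c) = (a - b) + c" for a b c :: "'g \<Rightarrow> 'k" by simp
    have 2: "y - (\<Sum>q\<in>Q. fscale (A q y) (x q)) =
        (\<Sum>b\<in>?S \<inter> B0. fscale (fun_vs.representation B y b) b) + fscale (\<Sum>q\<in>Q. A q y * q \<one>) one_fun"
      unfolding xs diff_diff 1 ..
    let ?w = "y - (\<Sum>q\<in>Q. fscale (A q y) (x q))"
    have "?w \<in> ?N"
      unfolding 2 using B0(1) one_N by (intro fun_vs.span_add fun_vs.span_sum fun_vs.span_scale) auto
    then obtain c where c: "?w - fscale c one_fun \<in> fun_vs.span ?m2"
      using fun_vs.span_breakdown_eq by blast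
    then have c2: "?w - fscale c one_fun \<in> ?m2" unfolding fun_vs.span_eq_iff[THEN iffD2, OF subspace_ipow] .
    have "(\<Sum>q\<in>Q. fscale (A q y) (x q)) \<one> = 0"
      by (simp add: sum_fun_apply fscale_apply x_def zero_outside_apply)
    then have w1: "?w \<one> = 0" using y by (simp add: m_one_def)
    have "?m2 \<subseteq> m_one"
      unfolding ipow.simps(2)[of R m_one "Suc 0"]
      by (rule sums_of_subset) (use ipow_facts(1)[of "Suc 0"] in \<open>auto simp: m_one_def zero add mult\<close>)
    then have "(?w - fscale c one_fun) \<one> = 0" using c2 by (auto simp: m_one_def)
    then have "c = 0" using w1 by (simp add: fscale_apply zero_outside_apply)
    then have "fscale c one_fun = 0" by (auto simp: fscale_apply)
    then show ?thesis using c2 by (simp only: diff_zero)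
  qed
  moreover have "x q \<in> m_one" if "q \<in> Q" for q using cent QR that by (auto simp: x_def)
  ultimately show ?thesis using pdA \<open>finite Q\<close> by (intro exI[of _ Q] exI[of _ A] exI[of _ x]) auto
qed

text \<open>The vector field \<open>\<Sum> x\<^sub>i D\<^sub>i\<close> acts on \<open>m\<^sup>k / m\<^sup>k\<^sup>+\<^sup>1\<close> as multiplication by \<open>k\<close>,
  so a set of functions that vanish at the identity and is stable under invariant derivations
  cannot leave \<open>m\<^sup>k\<close> for \<open>m\<^sup>k\<^sup>-\<^sup>1\<close>. Characteristic zero is used to divide by \<open>k\<close>.\<close>

lemma stable_in_ipow:
  assumes F: "F \<subseteq> m_one" and st: "\<And>f A. f \<in> F \<Longrightarrow> pd R \<one> A \<Longrightarrow> Dr A f \<in> F"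
  shows "F \<subseteq> ipow R m_one (Suc n)"
proof -
  obtain Q :: "('g \<Rightarrow> 'k) set" and A x where Q: "finite Q" "\<And>q. q \<in> Q \<Longrightarrow> pd R \<one> (A q)" "\<And>q. q \<in> Q \<Longrightarrow> x q \<in> m_one"
    "\<And>y. y \<in> m_one \<Longrightarrow> y - (\<Sum>q\<in>Q. fscale (A q y) (x q)) \<in> ipow R m_one (Suc (Suc 0))"
    using euler_coordinates by blast
  define E where "E f = (\<Sum>q\<in>Q. x q * Dr (A q) f)" for f
  have xR: "x q \<in> R" if "q \<in> Q" for q using Q(3)[OF that] by (simp add: m_one_def)
  have ER: "E f \<in> R" if "f \<in> R" for f unfolding E_def using xR Dr_in[OF that Q(2)] by (intro sum mult)
  have Eadd: "E (f + g) = E f + E g" if "f \<in> R" "g \<in> R" for f g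
    unfolding E_def using that Dr_props(1)[OF Q(2)] by (simp add: sum.distrib distrib_left)
  have Emult: "E (f * g) = f * E g + E f * g" if "f \<in> R" "g \<in> R" for f g
  proof -
    have "E (f * g) = (\<Sum>q\<in>Q. f * (x q * Dr (A q) g) + (x q * Dr (A q) f) * g)"
      unfolding E_def using that Dr_props(2)[OF Q(2)] by (intro sum.cong) (auto simp: algebra_simps)
    then show ?thesis by (simp add: E_def sum.distrib sum_distrib_left sum_distrib_right)
  qed
  have E1: "E a - a \<in> ipow R m_one (Suc (Suc 0))" if a: "a \<in> m_one" for a
  proof -
    have aR: "a \<in> R" using a by (simp add: m_one_def)
    have "Dr (A q) a - fscale (A q a) one_fun \<in> m_one" if "q \<in> Q" for q
      using Dr_in[OF aR Q(2)[OF that]] Dr_props(4)[OF Q(2)[OF that] aR]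
      by (auto simp: m_one_def fscale_apply zero_outside_apply intro!: diff scale const)
    then have "x q * (Dr (A q) a - fscale (A q a) one_fun) \<in> ipow R m_one (Suc (Suc 0))" if "q \<in> Q" for q
      using ipow_facts(5)[OF Q(3)[OF that]] ipow_facts(6) that by blast
    then have 1: "(\<Sum>q\<in>Q. x q * (Dr (A q) a - fscale (A q a) one_fun)) \<in> ipow R m_one (Suc (Suc 0))"
      by (rule fun_vs.subspace_sum[OF subspace_ipow])
    have "x q * fscale (A q a) one_fun = fscale (A q a) (x q)" if "q \<in> Q" for q
      using supp[OF xR[OF that]] by (auto simp: fun_eq_iff fscale_apply zero_outside_apply)
    then have "(\<Sum>q\<in>Q. x q * (Dr (A q) a - fscale (A q a) one_fun)) = E a - (\<Sum>q\<in>Q. fscale (A q a) (x q))"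
      by (simp add: E_def right_diff_distrib sum_subtractf)
    then have eq: "E a - a = (\<Sum>q\<in>Q. x q * (Dr (A q) a - fscale (A q a) one_fun)) - (a - (\<Sum>q\<in>Q. fscale (A q a) (x q)))"
      by (simp only: algebra_simps)
    show ?thesis unfolding eq by (rule fun_vs.subspace_diff[OF subspace_ipow 1 Q(4)[OF a]])
  qed
  have Ek: "E f - fscale (of_nat k) f \<in> ipow R m_one (Suc k)" if "f \<in> ipow R m_one k" for f k
    using that
  proof (induction k arbitrary: f)
    case 0
    have "x q * Dr (A q) f \<in> ipow R m_one (Suc 0)" if "q \<in> Q" for q
      by (rule ipow_facts(5)[OF Q(3)[OF that]]) (use 0 Dr_in Q(2) that in auto)
    then have "E f \<in> ipow R m_one (Suc 0)" unfolding E_def by (rule fun_vs.subspace_sum[OF subspace_ipow])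
    moreover have "E f - fscale (of_nat 0) f = E f" by (auto simp: fun_eq_iff fscale_apply)
    ultimately show ?case by (simp only:)
  next
    case (Suc k)
    let ?T = "{f \<in> R. E f - fscale (of_nat (Suc k)) f \<in> ipow R m_one (Suc (Suc k))}"
    have "ipow R m_one (Suc k) \<subseteq> ?T"
      unfolding ipow.simps(2)[of R m_one k]
    proof (rule sums_of_subset)
      have "E 0 = E 0 + E 0" using Eadd[OF zero zero] by simp
      then have "E 0 - fscale (of_nat (Suc k)) 0 = 0" by (auto simp: fun_eq_iff fscale_apply)
      then show "0 \<in> ?T" using zero ipow_facts(3) by (simp only: mem_Collect_eq)
    next
      fix f g assume fg: "f \<in> ?T" "g \<in> ?T"
      have "E (f + g) - fscale (of_nat (Suc k)) (f + g) =
          (E f - fscale (of_nat (Suc k)) f) + (E g - fscale (of_nat (Suc k)) g)"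
        using fg Eadd[of f g] by (simp add: fun_eq_iff fscale_apply algebra_simps)
      moreover have "(E f - fscale (of_nat (Suc k)) f) + (E g - fscale (of_nat (Suc k)) g) \<in> ipow R m_one (Suc (Suc k))"
        using fg by (intro ipow_facts(4)) (simp_all only: mem_Collect_eq)
      moreover have "f + g \<in> R" using fg by (intro add) (simp_all only: mem_Collect_eq)
      ultimately show "f + g \<in> ?T" by (simp only: mem_Collect_eq)
    next
      show "{a * b | a b. a \<in> m_one \<and> b \<in> ipow R m_one k} \<subseteq> ?T"
      proof
        fix f assume "f \<in> {a * b | a b. a \<in> m_one \<and> b \<in> ipow R m_one k}"
        then obtain a b where ab: "f = a * b" "a \<in> m_one" "b \<in> ipow R m_one k" by blast
        have R: "a \<in> R" "b \<in> R" using ab ipow_facts(1) by (auto simp: m_one_def)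
        have 1: "a * (E b - fscale (of_nat k) b) \<in> ipow R m_one (Suc (Suc k))"
          by (rule ipow_facts(5)[OF ab(2) Suc.IH[OF ab(3)]])
        have 2: "(E a - a) * b \<in> ipow R m_one (Suc (Suc k))"
          using ipow_mult[OF mult add E1[OF ab(2)] ab(3)] by simp
        have "E f - fscale (of_nat (Suc k)) f = a * (E b - fscale (of_nat k) b) + (E a - a) * b"
          unfolding ab(1) Emult[OF R] by (auto simp: fun_eq_iff fscale_apply algebra_simps)
        then show "f \<in> ?T" using ipow_facts(4)[OF 1 2] mult[OF R] ab(1)
          by (simp only: mem_Collect_eq)
      qed
    qed
    then show ?case using Suc.prems by blast
  qed
  show ?thesis
  proof (induction n)
    case 0
    then show ?case using F ipow_facts(6) by blast
  next
    case (Suc n)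
    show ?case
    proof
      fix f assume f: "f \<in> F"
      have "x q * Dr (A q) f \<in> ipow R m_one (Suc (Suc n))" if "q \<in> Q" for q
        using ipow_facts(5)[OF Q(3)[OF that]] st[OF f Q(2)[OF that]] Suc.IH by blast
      then have 1: "E f \<in> ipow R m_one (Suc (Suc n))" unfolding E_def by (rule fun_vs.subspace_sum[OF subspace_ipow])
      have 2: "E f - fscale (of_nat (Suc n)) f \<in> ipow R m_one (Suc (Suc n))" using Ek f Suc.IH by blast
      have "fscale (of_nat (Suc n)) f \<in> ipow R m_one (Suc (Suc n))"
        using fun_vs.subspace_diff[OF subspace_ipow 1 2] by (simp only: diff_diff_eq2 add_diff_cancel_left')
      then have "fscale (1 / of_nat (Suc n)) (fscale (of_nat (Suc n)) f) \<in> ipow R m_one (Suc (Suc n))"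
        by (rule ipow_facts(2))
      moreover have "fscale (1 / of_nat (Suc n)) (fscale (of_nat (Suc n)) f) = f"
        by (auto simp: fun_eq_iff fscale_apply simp del: of_nat_Suc)
      ultimately show "f \<in> ipow R m_one (Suc (Suc n))" by (simp only:)
    qed
  qed
qed

text \<open>Elements of \<open>R\<close> vanish outside the group. Extending them by their value at the identity turns the
  constants of \<open>R\<close> into constant functions, so that Krull's theorem for rings of total functions
  applies.\<close>

definition tot :: "('g \<Rightarrow> 'k) \<Rightarrow> 'g \<Rightarrow> 'k"
  where "tot f = (\<lambda>g. if g \<in> P then f g else f \<one>)"

lemma tot_hom: "tot (f + g) = tot f + tot g" "tot (f * g) = tot f * tot g" "tot 0 = 0"
  by (auto simp: tot_def fun_eq_iff)

lemma total_ring: "\<exists>cs. (\<forall>f\<in>R. tot f \<in> adjoins consts_fun cs) \<and>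
    (\<forall>z\<in>adjoins consts_fun cs. zero_outside P z \<in> R)"
proof -
  obtain cs where cs: "set cs = C" using fin finite_list by blast
  let ?A = "adjoins consts_fun (map tot cs)"
  have A: "is_subring ?A" "consts_fun \<subseteq> ?A" "set (map tot cs) \<subseteq> ?A"
    by (rule adjoins_props[OF is_subring_consts])+
  have "tot f \<in> ?A" if "f \<in> alg_gen P C" for f
    using that
  proof (induction rule: alg_gen.induct)
    case (const c)
    have "tot (zero_outside P (\<lambda>_. c)) = (\<lambda>_. c)" by (auto simp: tot_def zero_outside_def)
    then show ?case using A(2) by auto
  next
    case (gen f)
    then show ?case using A(3) cs by auto
  next
    case (add f g)
    then have "tot (f + g) \<in> ?A" using is_subringD(4)[OF A(1)] by (simp only: tot_hom)
    then show ?case by (simp only: plus_fun_def)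
  next
    case (mult f g)
    then have "tot (f * g) \<in> ?A" using is_subringD(5)[OF A(1)] by (simp only: tot_hom)
    then show ?case by (simp only: times_fun_def)
  qed
  moreover have "?A \<subseteq> {z. zero_outside P z \<in> R}"
  proof (rule adjoins_least)
    show "is_subring {z. zero_outside P z \<in> R}"
      unfolding is_subring_def
    proof (intro conjI ballI; unfold mem_Collect_eq)
      have "zero_outside P 1 = one_fun" by (auto simp: zero_outside_def)
      then show "zero_outside P 1 \<in> R" using const by (simp only:)
      fix f assume f: "zero_outside P f \<in> R"
      have "zero_outside P (- f) = 0 - zero_outside P f" by (auto simp: zero_outside_def)
      then show "zero_outside P (- f) \<in> R" using diff[OF zero f] by (simp only:)
      fix g assume g: "zero_outside P g \<in> R"
      have "zero_outside P (f + g) = zero_outside P f + zero_outside P g" by (auto simp: zero_outside_def)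
      then show "zero_outside P (f + g) \<in> R" using add[OF f g] by (simp only:)
      have "zero_outside P (f * g) = zero_outside P f * zero_outside P g" by (auto simp: zero_outside_def)
      then show "zero_outside P (f * g) \<in> R" using mult[OF f g] by (simp only:)
    qed
    show "consts_fun \<subseteq> {z. zero_outside P z \<in> R}" using const by auto
    show "set (map tot cs) \<subseteq> {z. zero_outside P z \<in> R}"
    proof
      fix z assume "z \<in> set (map tot cs)"
      then obtain f where f: "f \<in> R" "z = tot f" using cs gen by (auto intro: alg_gen.gen)
      have "zero_outside P (tot f) = f" using supp[OF f(1)] by (auto simp: zero_outside_def tot_def)
      then show "z \<in> {z. zero_outside P z \<in> R}" using f by simp
    qed
  qed
  ultimately show ?thesis using gen by (intro exI[of _ "map tot cs"]) auto
qed

text \<open>The family lies in all powers of the maximal ideal at the identity, so Krull's theorem gives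
  \<open>f = z f\<close> with \<open>z(1) = 0\<close>; then \<open>u = 1 - z\<close>.\<close>

lemma stable_locally_zero:
  assumes F: "F \<subseteq> m_one" and st: "\<And>f A. f \<in> F \<Longrightarrow> pd R \<one> A \<Longrightarrow> Dr A f \<in> F" and f: "f \<in> F"
  shows "\<exists>u\<in>R. u \<one> \<noteq> 0 \<and> (\<forall>g\<in>P. u g * f g = 0)"
proof -
  obtain cs where cs: "\<And>f. f \<in> R \<Longrightarrow> tot f \<in> adjoins consts_fun cs"
    "\<And>z. z \<in> adjoins consts_fun cs \<Longrightarrow> zero_outside P z \<in> R" using total_ring by blast
  define A where "A = adjoins consts_fun cs"
  define M where "M = {f \<in> A. f \<one> = 0}"
  have A: "is_subring A" unfolding A_def by (rule adjoins_props(1)[OF is_subring_consts])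
  have "h \<in> ipow R m_one n \<Longrightarrow> tot h \<in> ipow A M n" for h n
  proof (induction n arbitrary: h)
    case (Suc n)
    have "ipow R m_one (Suc n) \<subseteq> {h. tot h \<in> ipow A M (Suc n)}"
      unfolding ipow.simps(2)[of R]
    proof (rule sums_of_subset)
      have "tot 0 \<in> ipow A M (Suc n)" unfolding tot_hom by (simp add: sums_of.zero)
      then show "0 \<in> {h. tot h \<in> ipow A M (Suc n)}" by blast
    next
      fix f g assume "f \<in> {h. tot h \<in> ipow A M (Suc n)}" "g \<in> {h. tot h \<in> ipow A M (Suc n)}"
      then have "tot (f + g) \<in> ipow A M (Suc n)"
        unfolding tot_hom using ipow_add[OF is_subringD(4)[OF A]] by blast
      then show "f + g \<in> {h. tot h \<in> ipow A M (Suc n)}" by blast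
    next
      show "{a * b | a b. a \<in> m_one \<and> b \<in> ipow R m_one n} \<subseteq> {h. tot h \<in> ipow A M (Suc n)}"
      proof
        fix h assume "h \<in> {a * b | a b. a \<in> m_one \<and> b \<in> ipow R m_one n}"
        then obtain a b where ab: "h = a * b" "a \<in> m_one" "b \<in> ipow R m_one n" by blast
        have "tot a \<in> M" using ab(2) cs(1) by (auto simp: M_def A_def m_one_def tot_def)
        then have "tot a * tot b \<in> ipow A M (Suc n)"
          unfolding ipow.simps using Suc.IH[OF ab(3)] by (intro sums_of_gen) blast
        then have "tot h \<in> ipow A M (Suc n)" unfolding ab(1) tot_hom .
        then show "h \<in> {h. tot h \<in> ipow A M (Suc n)}" by blast
      qed
    qed
    then show ?case using Suc.prems by blast
  qed (use cs in \<open>auto simp: A_def\<close>)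
  moreover have "f \<in> ipow R m_one n" for n
  proof (cases n)
    case 0
    then show ?thesis using f F by (auto simp: m_one_def)
  next
    case (Suc k)
    then show ?thesis using stable_in_ipow[OF F st] f by blast
  qed
  ultimately have "tot f \<in> ipow A M n" for n by blast
  then obtain z where z: "z \<in> M" "tot f = z * tot f"
    using krull_at_point[of "tot f" cs \<one>] unfolding A_def M_def by blast
  let ?u = "one_fun - zero_outside P z"
  have "?u \<in> R" using z(1) cs(2) by (intro diff const) (simp add: M_def A_def)
  moreover have "?u \<one> \<noteq> 0" using z(1) by (simp add: M_def zero_outside_apply)
  moreover have "?u g * f g = 0" if "g \<in> P" for g
    using fun_cong[OF z(2), of g] that by (simp add: tot_def zero_outside_apply algebra_simps)
  ultimately show ?thesis by blast
qed

text \<open>Needed to intersect the neighbourhoods on which the single members of a family vanish; the basis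
  theorem provides the finite subfamily.\<close>

lemma finitely_many_equations:
  assumes F: "F \<subseteq> R"
  shows "\<exists>F0\<subseteq>F. finite F0 \<and> (\<forall>g\<in>P. (\<forall>f\<in>F0. f g = 0) \<longrightarrow> (\<forall>f\<in>F. f g = 0))"
proof (rule ccontr)
  assume "\<not> ?thesis"
  then have no: "\<exists>g\<in>P. (\<forall>f\<in>F0. f g = 0) \<and> (\<exists>f\<in>F. f g \<noteq> 0)" if "F0 \<subseteq> F" "finite F0" for F0
    using that by auto
  obtain cs where cs: "\<And>f. f \<in> R \<Longrightarrow> tot f \<in> adjoins consts_fun cs" using total_ring by blast
  define A where "A = adjoins consts_fun cs"
  have A: "noeth A" unfolding A_def
  proof (rule noeth_adjoins[OF is_subring_consts noeth_field[OF is_subring_consts]])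
    fix x :: "'g \<Rightarrow> 'k" assume "x \<in> consts_fun" "x \<noteq> 0"
    then obtain c where "x = (\<lambda>_. c)" "c \<noteq> 0" by (auto simp: fun_eq_iff)
    then show "\<exists>y\<in>consts_fun. x * y = 1" by (intro bexI[of _ "\<lambda>_. inverse c"]) (auto simp: fun_eq_iff)
  qed
  have "\<exists>q. \<forall>k. q k \<in> F \<and> tot (q k) \<notin> lspan A (\<lambda>i. tot (q i)) k"
  proof (rule dependent_wf_choice[OF wf_less_than])
    fix q :: "nat \<Rightarrow> 'g \<Rightarrow> 'k" and k
    assume q: "\<And>y. (y, k) \<in> less_than \<Longrightarrow> q y \<in> F \<and> tot (q y) \<notin> lspan A (\<lambda>i. tot (q i)) y"
    then have "q ` {..<k} \<subseteq> F" by auto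
    from no[OF this finite_imageI[OF finite_lessThan]] obtain g f where g: "g \<in> P" "\<forall>f\<in>q ` {..<k}. f g = 0" and f: "f \<in> F" "f g \<noteq> 0"
      by (elim bexE conjE) auto
    have "tot f \<notin> lspan A (\<lambda>i. tot (q i)) k"
    proof
      assume "tot f \<in> lspan A (\<lambda>i. tot (q i)) k"
      then obtain r where "tot f = (\<Sum>i<k. r i * tot (q i))" by (auto simp: lspan_def)
      then have "f g = (\<Sum>i<k. r i g * q i g)" using g(1)
        by (auto simp: tot_def sum_fun_apply dest: fun_cong[where x = g])
      then show False using g(2) f(2) by simp
    qed
    then show "\<exists>r. r \<in> F \<and> tot r \<notin> lspan A (\<lambda>i. tot (q i)) k" using f by blast
  next
    fix f g :: "nat \<Rightarrow> 'g \<Rightarrow> 'k" and k r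
    assume "\<And>z. (z, k) \<in> less_than \<Longrightarrow> f z = g z"
    then have "lspan A (\<lambda>i. tot (f i)) k = lspan A (\<lambda>i. tot (g i)) k" by (auto simp: lspan_def)
    then show "(r \<in> F \<and> tot r \<notin> lspan A (\<lambda>i. tot (f i)) k) = (r \<in> F \<and> tot r \<notin> lspan A (\<lambda>i. tot (g i)) k)" by simp
  qed
  then obtain q where q: "\<And>k. q k \<in> F" "\<And>k. tot (q k) \<notin> lspan A (\<lambda>i. tot (q i)) k" by blast
  have "range (\<lambda>k. tot (q k)) \<subseteq> A" using q(1) F cs by (auto simp: A_def)
  then show False using A q(2) unfolding noeth_def by blast
qed

end

locale connected_function_group = algebraic_function_group H R C
  for H :: "'g monoid" (structure) and R :: "('g \<Rightarrow> 'k::field_char_0) set" and C +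
  assumes conn: "connected_space (zariski_topology \<lparr>pts = carrier H, reg = R\<rparr>)"
begin

text \<open>The common zero set is closed, and open because the local statement at the identity can be
  translated to each of its points.\<close>

lemma stable_zero:
  assumes F: "F \<subseteq> m_one" and st: "\<And>f A. f \<in> F \<Longrightarrow> pd R \<one> A \<Longrightarrow> Dr A f \<in> F"
    and f: "f \<in> F"
  shows "f = 0"
proof -
  let ?T = "zariski_topology \<lparr>pts = P, reg = R\<rparr>"
  have FR: "F \<subseteq> R" using F by (auto simp: m_one_def)
  have op: "openin ?T {x \<in> P. f x \<noteq> 0}" if "f \<in> R" for f
    unfolding zariski_topology_def openin_topology_generated_by_iff
    by (rule generate_topology_on.Basis) (use that in auto)
  have top: "topspace ?T = P"
  proof -
    have "{x \<in> P. one_fun x \<noteq> 0} = P" by (auto simp: zero_outside_def)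
    then have "P \<in> (\<lambda>f. {x \<in> P. f x \<noteq> 0}) ` R" using const[of 1] by (intro image_eqI[of _ _ one_fun]) simp_all
    then show ?thesis unfolding zariski_topology_def topology_generated_by_topspace by auto
  qed
  define Z where "Z = {x \<in> P. \<forall>f\<in>F. f x = 0}"
  have "openin ?T (\<Union>f\<in>F. {x \<in> P. f x \<noteq> 0})" using op FR by (intro openin_Union) auto
  moreover have "P - Z = (\<Union>f\<in>F. {x \<in> P. f x \<noteq> 0})" by (auto simp: Z_def)
  ultimately have cl: "closedin ?T Z" unfolding closedin_def top by (auto simp: Z_def)
  obtain F0 where F0: "F0 \<subseteq> F" "finite F0" "\<And>g. g \<in> P \<Longrightarrow> \<forall>f\<in>F0. f g = 0 \<Longrightarrow> \<forall>f\<in>F. f g = 0"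
    using finitely_many_equations[OF FR] by blast
  have "openin ?T Z"
  proof (subst openin_subopen, intro ballI)
    fix g assume "g \<in> Z"
    then have g: "g \<in> P" "\<And>f. f \<in> F \<Longrightarrow> f g = 0" by (auto simp: Z_def)
    have "\<exists>w. w \<in> R \<and> w g \<noteq> 0 \<and> (\<forall>x\<in>P. w x * f x = 0)" if f: "f \<in> F" for f
    proof -
      have "rt g ` F \<subseteq> m_one" using g FR by (auto simp: m_one_def rt_in rt_apply)
      moreover have "Dr A h \<in> rt g ` F" if "h \<in> rt g ` F" "pd R \<one> A" for h A
        using that st g(1) by (auto simp: rt_Dr[symmetric])
      ultimately obtain u where u: "u \<in> R" "u \<one> \<noteq> 0" "\<forall>x\<in>P. u x * rt g f x = 0"
        using stable_locally_zero[of "rt g ` F" "rt g f"] f by blast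
      have "rt (inv g) u g \<noteq> 0" using g u by (simp add: rt_apply)
      moreover have "rt (inv g) u x * f x = 0" if x: "x \<in> P" for x
        using u(3)[rule_format, of "x \<otimes> inv g"] x g(1) by (simp add: rt_apply m_assoc)
      ultimately show ?thesis using rt_in[OF u(1)] g(1) by (intro exI[of _ "rt (inv g) u"]) auto
    qed
    then have "\<forall>f\<in>F. \<exists>w. w \<in> R \<and> w g \<noteq> 0 \<and> (\<forall>x\<in>P. w x * f x = 0)" by blast
    from bchoice[OF this] obtain w where "\<forall>f\<in>F. w f \<in> R \<and> w f g \<noteq> 0 \<and> (\<forall>x\<in>P. w f x * f x = 0)" ..
    then have w: "\<And>f. f \<in> F \<Longrightarrow> w f \<in> R" "\<And>f. f \<in> F \<Longrightarrow> w f g \<noteq> 0"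
      "\<And>f x. f \<in> F \<Longrightarrow> x \<in> P \<Longrightarrow> w f x * f x = 0" by blast+
    define v where "v = zero_outside P (\<lambda>x. \<Prod>f\<in>F0. w f x)"
    have "v \<in> R" unfolding v_def using F0(2,1)
    proof (induction F0)
      case empty
      then show ?case using const[of 1] by simp
    next
      case (insert f F0)
      have "zero_outside P (\<lambda>x. \<Prod>f\<in>insert f F0. w f x) = w f * zero_outside P (\<lambda>x. \<Prod>f\<in>F0. w f x)"
        using insert by (auto simp: zero_outside_def fun_eq_iff)
      moreover have "w f * zero_outside P (\<lambda>x. \<Prod>f\<in>F0. w f x) \<in> R"
        by (rule mult[OF w(1)]) (use insert in auto)
      ultimately show ?case by (simp only:)
    qed
    moreover have "v g \<noteq> 0" using g(1) w(2) F0 by (auto simp: v_def zero_outside_apply)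
    moreover have "{x \<in> P. v x \<noteq> 0} \<subseteq> Z"
    proof
      fix x assume "x \<in> {x \<in> P. v x \<noteq> 0}"
      then have x: "x \<in> P" "(\<Prod>f\<in>F0. w f x) \<noteq> 0" by (auto simp: v_def zero_outside_apply)
      then have "\<forall>f\<in>F0. w f x \<noteq> 0" using F0(2) by simp
      then have "\<forall>f\<in>F0. f x = 0" using w(3) x F0(1) by (meson mult_eq_0_iff subsetD)
      then show "x \<in> Z" using F0(3)[OF x(1)] x by (auto simp: Z_def)
    qed
    ultimately show "\<exists>T. openin ?T T \<and> g \<in> T \<and> T \<subseteq> Z"
      using op g(1) by (intro exI[of _ "{x \<in> P. v x \<noteq> 0}"]) auto
  qed
  then have "Z = {} \<or> Z = P" using conn cl top unfolding connected_space_clopen_in by auto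
  moreover have "\<one> \<in> Z" using F by (auto simp: Z_def m_one_def)
  ultimately have "Z = P" by auto
  then show ?thesis using f FR eqI[OF _ zero, of f] by (auto simp: Z_def)
qed

lemma stable_zero_at:
  assumes F: "F \<subseteq> R" and g: "g \<in> P" "\<And>f. f \<in> F \<Longrightarrow> f g = 0"
    and st: "\<And>f A. f \<in> F \<Longrightarrow> pd R \<one> A \<Longrightarrow> Dr A f \<in> F" and f: "f \<in> F"
  shows "f = 0"
proof -
  have "rt g f = 0"
  proof (rule stable_zero)
    show "rt g ` F \<subseteq> m_one" using g F by (auto simp: m_one_def rt_in rt_apply)
    show "Dr A h \<in> rt g ` F" if "h \<in> rt g ` F" "pd R \<one> A" for h A
      using that st g(1) by (auto simp: rt_Dr[symmetric])
  qed (use f in auto)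
  then have "rt (inv g) (rt g f) = rt (inv g) 0" by simp
  moreover have "rt (inv g) 0 = 0" by (auto simp: rt_def zero_outside_def)
  ultimately show ?thesis using g(1) F f by (auto simp: rt_rt rt_one)
qed

text \<open>In a reduced algebra annihilators are stable under derivations; hence a connected group is
  irreducible.\<close>

lemma no_zero_divisors:
  assumes "f \<in> R" "h \<in> R" "f * h = 0"
  shows "f = 0 \<or> h = 0"
proof -
  define F where "F = {u \<in> R. u * f = 0}"
  have FR: "F \<subseteq> R" by (auto simp: F_def)
  have st: "Dr A u \<in> F" if u: "u \<in> F" and A: "pd R \<one> A" for u A
  proof -
    have uR: "u \<in> R" "u * f = 0" using u by (auto simp: F_def)
    have "Dr A 0 = 0" using Dr_props(1)[OF A zero zero] by simp
    then have "u * Dr A f + Dr A u * f = 0" using Dr_props(2)[OF A uR(1) assms(1)] uR(2) by simp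
    then have eq: "u x * Dr A f x + Dr A u x * f x = 0" for x by (auto dest: fun_cong[where x = x])
    have "Dr A u x * f x = 0" for x
    proof (cases "f x = 0")
      case False
      have "(u * f) x = 0" using uR(2) by simp
      then have "u x = 0" using False by simp
      then show ?thesis using eq[of x] by simp
    qed simp
    then have "Dr A u * f = 0" by (auto simp: fun_eq_iff)
    then show ?thesis using Dr_in[OF uR(1) A] by (simp add: F_def)
  qed
  have "h \<in> F" using assms by (simp add: F_def mult.commute)
  show ?thesis
  proof (cases "\<exists>g\<in>P. \<forall>u\<in>F. u g = 0")
    case True
    then show ?thesis using stable_zero_at[OF FR _ _ st \<open>h \<in> F\<close>] by blast
  next
    case False
    have "f g = 0" if "g \<in> P" for g
    proof -
      obtain u where u: "u \<in> F" "u g \<noteq> 0" using False \<open>g \<in> P\<close> by blast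
      have "(u * f) g = 0" using u(1) by (simp add: F_def)
      then show ?thesis using u(2) by simp
    qed
    then have "f = 0" using eqI[OF assms(1) zero] by auto
    then show ?thesis ..
  qed
qed

end

section \<open>Automorphisms and vector fields of an affine variety\<close>

lemma function_algebra_alg_gen:
  assumes "\<And>f x. f \<in> C \<Longrightarrow> x \<notin> P \<Longrightarrow> f x = 0"
  shows "function_algebra P (alg_gen P C)"
proof
  show "f \<in> alg_gen P C \<Longrightarrow> x \<notin> P \<Longrightarrow> f x = 0" for f x by (rule alg_gen_supp) (use assms in auto)
  show "f \<in> alg_gen P C \<Longrightarrow> g \<in> alg_gen P C \<Longrightarrow> f + g \<in> alg_gen P C" for f g
    unfolding plus_fun_def by (rule alg_gen.add)
  show "f \<in> alg_gen P C \<Longrightarrow> g \<in> alg_gen P C \<Longrightarrow> f * g \<in> alg_gen P C" for f g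
    unfolding times_fun_def by (rule alg_gen.mult)
qed (rule alg_gen.const)

lemma alg_gen_induct [consumes 1, case_names const gen add mult]:
  assumes "f \<in> alg_gen P C" "\<And>c. Q (zero_outside P (\<lambda>_. c))" "\<And>f. f \<in> C \<Longrightarrow> Q f"
    "\<And>f g. f \<in> alg_gen P C \<Longrightarrow> g \<in> alg_gen P C \<Longrightarrow> Q f \<Longrightarrow> Q g \<Longrightarrow> Q (f + g)"
    "\<And>f g. f \<in> alg_gen P C \<Longrightarrow> g \<in> alg_gen P C \<Longrightarrow> Q f \<Longrightarrow> Q g \<Longrightarrow> Q (f * g)"
  shows "Q f"
  using assms(1)
proof (induction rule: alg_gen.induct)
  case (add f g)
  then have "Q (f + g)" by (intro assms(4))
  then show ?case unfolding plus_fun_def .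
next
  case (mult f g)
  then have "Q (f * g)" by (intro assms(5))
  then show ?case unfolding times_fun_def .
qed (use assms(2,3) in auto)

locale aff =
  fixes X :: "('a, 'k::{alg_closed_field,field_char_0}) variety"
  assumes affine: "affine_variety X"
begin

abbreviation "PX \<equiv> pts X"
abbreviation "\<O> \<equiv> reg X"

definition gens :: "('a \<Rightarrow> 'k) set"
  where "gens = (SOME C. finite C \<and> (\<forall>f\<in>C. \<forall>x. x \<notin> pts X \<longrightarrow> f x = 0) \<and> reg X = alg_gen (pts X) C)"

lemma gens: "finite gens" "\<And>f x. f \<in> gens \<Longrightarrow> x \<notin> PX \<Longrightarrow> f x = 0" "\<O> = alg_gen PX gens"
proof -
  have "\<exists>C. finite C \<and> (\<forall>f\<in>C. \<forall>x. x \<notin> pts X \<longrightarrow> f x = 0) \<and> reg X = alg_gen (pts X) C"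
    using affine_variety_spectrum[OF affine] by auto
  from someI_ex[OF this, folded gens_def]
  show "finite gens" "\<And>f x. f \<in> gens \<Longrightarrow> x \<notin> PX \<Longrightarrow> f x = 0" "\<O> = alg_gen PX gens" by auto
qed

lemma separate_points: "x \<in> PX \<Longrightarrow> y \<in> PX \<Longrightarrow> (\<And>f. f \<in> \<O> \<Longrightarrow> f x = f y) \<Longrightarrow> x = y"
  using affine_variety_spectrum[OF affine] by auto

sublocale O: function_algebra PX \<O>
  unfolding gens(3) by (rule function_algebra_alg_gen) (rule gens(2))

definition act :: "('a \<Rightarrow> 'a) \<Rightarrow> ('a \<Rightarrow> 'k) \<Rightarrow> 'a \<Rightarrow> 'k"
  where "act g f = zero_outside PX (\<lambda>x. f (g x))"

lemma act_pullback: "pullback X g f = act g f"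
  by (simp add: pullback_def act_def)

lemma act_apply: "x \<in> PX \<Longrightarrow> act g f x = f (g x)" "x \<notin> PX \<Longrightarrow> act g f x = 0"
  by (simp_all add: act_def zero_outside_def)

lemma act_hom: "act g (f1 + f2) = act g f1 + act g f2" "act g (f1 * f2) = act g f1 * act g f2"
  "act g (fscale c f) = fscale c (act g f)" "act g 0 = 0" "act g (f1 - f2) = act g f1 - act g f2"
  by (auto simp: act_def zero_outside_def fun_eq_iff fscale_apply)

lemma act_cong: "(\<And>x. x \<in> PX \<Longrightarrow> g x = h x) \<Longrightarrow> act g = act h"
  by (auto simp: act_def zero_outside_def fun_eq_iff)

lemma morphism_iff: "morphism X X g \<longleftrightarrow> g \<in> PX \<rightarrow> PX \<and> (\<forall>f\<in>\<O>. act g f \<in> \<O>)"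
  by (simp add: morphism_def act_pullback)

lemma morphism_cong: "(\<And>x. x \<in> PX \<Longrightarrow> g x = h x) \<Longrightarrow> morphism X X g \<longleftrightarrow> morphism X X h"
  unfolding morphism_iff using act_cong[of g h] by (simp add: Pi_iff)

lemma BijGroup_mult: "g \<in> Bij PX \<Longrightarrow> h \<in> Bij PX \<Longrightarrow> g \<otimes>\<^bsub>BijGroup PX\<^esub> h = compose PX g h"
  by (simp add: BijGroup_def)

lemma morphism_compose:
  assumes "morphism X X g" "morphism X X h" shows "morphism X X (compose PX g h)"
proof -
  have "act (compose PX g h) f = act h (act g f)" for f
    using assms unfolding morphism_iff by (auto simp: act_def zero_outside_def fun_eq_iff compose_def)
  then show ?thesis using assms unfolding morphism_iff by (auto simp: compose_def)
qed

lemma carrier_Aut: "carrier (Aut X) = {\<phi> \<in> Bij PX. morphism X X \<phi> \<and> morphism X X (inv\<^bsub>BijGroup PX\<^esub> \<phi>)}"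
proof -
  have "morphism X X (inv_into PX \<phi>) \<longleftrightarrow> morphism X X (inv\<^bsub>BijGroup PX\<^esub> \<phi>)" if "\<phi> \<in> Bij PX" for \<phi>
    by (rule morphism_cong) (simp add: inv_BijGroup[OF that])
  then show ?thesis by (auto simp: Aut_def)
qed

lemma Aut_eq: "Aut X = (BijGroup PX)\<lparr>carrier := carrier (Aut X)\<rparr>"
  by (simp add: Aut_def)

lemma subgroup_Aut: "subgroup (carrier (Aut X)) (BijGroup PX)"
proof -
  interpret B: group "BijGroup PX" by (rule group_BijGroup)
  have cB: "carrier (BijGroup PX) = Bij PX" by (simp add: BijGroup_def)
  have "morphism X X \<one>\<^bsub>BijGroup PX\<^esub>"
  proof -
    have "act (\<lambda>x\<in>PX. x) f = f" if "f \<in> \<O>" for f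
      using O.supp[OF that] by (auto simp: act_def zero_outside_def fun_eq_iff)
    then show ?thesis unfolding morphism_iff by (auto simp: BijGroup_def)
  qed
  then have one: "\<one>\<^bsub>BijGroup PX\<^esub> \<in> carrier (Aut X)"
    using B.one_closed unfolding carrier_Aut cB by simp
  show ?thesis
  proof (rule B.subgroupI)
    show "carrier (Aut X) \<subseteq> carrier (BijGroup PX)" unfolding cB carrier_Aut by blast
    show "carrier (Aut X) \<noteq> {}" using one by blast
    fix g assume g: "g \<in> carrier (Aut X)"
    then have gB: "g \<in> carrier (BijGroup PX)" unfolding cB carrier_Aut by blast
    show "inv\<^bsub>BijGroup PX\<^esub> g \<in> carrier (Aut X)"
      using g B.inv_closed[OF gB] B.inv_inv[OF gB] unfolding carrier_Aut cB by auto
    fix h assume h: "h \<in> carrier (Aut X)"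
    then have hB: "h \<in> carrier (BijGroup PX)" unfolding cB carrier_Aut by blast
    have "morphism X X (g \<otimes>\<^bsub>BijGroup PX\<^esub> h)"
      using gB hB g h unfolding cB carrier_Aut by (auto simp: BijGroup_mult intro!: morphism_compose)
    moreover have "morphism X X (inv\<^bsub>BijGroup PX\<^esub> h \<otimes>\<^bsub>BijGroup PX\<^esub> inv\<^bsub>BijGroup PX\<^esub> g)"
      using B.inv_closed[OF gB] B.inv_closed[OF hB] g h unfolding cB carrier_Aut
      by (auto simp: BijGroup_mult intro!: morphism_compose)
    ultimately show "g \<otimes>\<^bsub>BijGroup PX\<^esub> h \<in> carrier (Aut X)"
      using B.m_closed[OF gB hB] B.inv_mult_group[OF gB hB] unfolding carrier_Aut cB by auto
  qed
qed

sublocale A: group "Aut X"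
  by (subst Aut_eq) (rule subgroup.subgroup_is_group[OF subgroup_Aut group_BijGroup])

abbreviation comp (infixl "\<odot>" 70) where "g \<odot> h \<equiv> g \<otimes>\<^bsub>Aut X\<^esub> h"
abbreviation idX ("\<iota>") where "\<iota> \<equiv> \<one>\<^bsub>Aut X\<^esub>"
abbreviation invX where "invX g \<equiv> inv\<^bsub>Aut X\<^esub> g"

lemma Aut_Bij: "g \<in> carrier (Aut X) \<Longrightarrow> g \<in> Bij PX"
  unfolding carrier_Aut by blast

lemma Aut_mult: "g \<in> carrier (Aut X) \<Longrightarrow> h \<in> carrier (Aut X) \<Longrightarrow> x \<in> PX \<Longrightarrow> (g \<odot> h) x = g (h x)"
proof -
  assume gh: "g \<in> carrier (Aut X)" "h \<in> carrier (Aut X)" "x \<in> PX"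
  have "g \<odot> h = g \<otimes>\<^bsub>BijGroup PX\<^esub> h" by (simp add: Aut_def)
  then show "(g \<odot> h) x = g (h x)"
    using BijGroup_mult[OF Aut_Bij[OF gh(1)] Aut_Bij[OF gh(2)]] gh(3) by (simp add: compose_def)
qed

lemma Aut_one: "x \<in> PX \<Longrightarrow> \<iota> x = x"
  by (simp add: Aut_def BijGroup_def)

lemma Aut_in: "g \<in> carrier (Aut X) \<Longrightarrow> x \<in> PX \<Longrightarrow> g x \<in> PX"
  using Aut_Bij Bij_imp_funcset by blast

lemma Aut_inv: "g \<in> carrier (Aut X) \<Longrightarrow> x \<in> PX \<Longrightarrow> g (invX g x) = x"
  "g \<in> carrier (Aut X) \<Longrightarrow> x \<in> PX \<Longrightarrow> invX g (g x) = x"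
  using Aut_mult[of g "invX g" x] Aut_mult[of "invX g" g x] Aut_one by (auto simp: A.r_inv A.l_inv)

lemma Aut_ext: 
  assumes "g \<in> carrier (Aut X)" "h \<in> carrier (Aut X)" "\<And>x. x \<in> PX \<Longrightarrow> g x = h x" shows "g = h"
  using Bij_imp_extensional[OF Aut_Bij[OF assms(1)]] Bij_imp_extensional[OF Aut_Bij[OF assms(2)]] assms(3)
  by (rule extensionalityI)

lemma act_in: "g \<in> carrier (Aut X) \<Longrightarrow> f \<in> \<O> \<Longrightarrow> act g f \<in> \<O>"
  unfolding carrier_Aut morphism_iff by blast

lemma act_mult: "g \<in> carrier (Aut X) \<Longrightarrow> h \<in> carrier (Aut X) \<Longrightarrow> act (g \<odot> h) f = act h (act g f)"
  by (auto simp: act_def zero_outside_def fun_eq_iff Aut_mult Aut_in)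

lemma act_one: "f \<in> \<O> \<Longrightarrow> act \<iota> f = f"
  using O.supp by (auto simp: act_def zero_outside_def fun_eq_iff Aut_one)

lemma act_inv: "g \<in> carrier (Aut X) \<Longrightarrow> f \<in> \<O> \<Longrightarrow> act g (act (invX g) f) = f"
  "g \<in> carrier (Aut X) \<Longrightarrow> f \<in> \<O> \<Longrightarrow> act (invX g) (act g f) = f"
  using act_mult[of "invX g" g f] act_mult[of g "invX g" f] act_one by (auto simp: A.r_inv A.l_inv)

lemma VecD:
  assumes "D \<in> Vec X"
  shows "f \<in> \<O> \<Longrightarrow> D f \<in> \<O>" "f \<in> \<O> \<Longrightarrow> g \<in> \<O> \<Longrightarrow> D (f + g) = D f + D g"
    "f \<in> \<O> \<Longrightarrow> D (fscale c f) = fscale c (D f)"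
    "f \<in> \<O> \<Longrightarrow> g \<in> \<O> \<Longrightarrow> D (f * g) = f * D g + D f * g"
    "f \<notin> \<O> \<Longrightarrow> D f = 0" "D 0 = 0"
    "f \<in> \<O> \<Longrightarrow> g \<in> \<O> \<Longrightarrow> D (f - g) = D f - D g"
proof -
  show "f \<in> \<O> \<Longrightarrow> D f \<in> \<O>" and a: "\<And>f g. f \<in> \<O> \<Longrightarrow> g \<in> \<O> \<Longrightarrow> D (f + g) = D f + D g"
    and "f \<in> \<O> \<Longrightarrow> D (fscale c f) = fscale c (D f)"
    "f \<in> \<O> \<Longrightarrow> g \<in> \<O> \<Longrightarrow> D (f * g) = f * D g + D f * g"
    "f \<notin> \<O> \<Longrightarrow> D f = 0" using assms by (auto simp: Vec_def)
  show "D 0 = 0" using a[OF O.zero O.zero] by simp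
  show "D (f - g) = D f - D g" if "f \<in> \<O>" "g \<in> \<O>"
    using a[OF O.diff[OF that] that(2)] by simp
qed

lemma Vec_sum:
  assumes "D \<in> Vec X" "\<And>i. i \<in> S \<Longrightarrow> f i \<in> \<O>"
  shows "D (\<Sum>i\<in>S. f i) = (\<Sum>i\<in>S. D (f i))"
  using assms(2)
proof (induction S rule: infinite_finite_induct)
  case (insert y F)
  then have "D (f y + sum f F) = D (f y) + (\<Sum>i\<in>F. D (f i))"
    using VecD(2)[OF assms(1), of "f y" "sum f F"] O.sum[of F f] by auto
  then show ?case using insert(1,2) by (simp only: sum.insert not_False_eq_True)
qed (use VecD(6)[OF assms(1)] in auto)

lemma Vec_span:
  assumes "D \<in> Vec X" "S \<subseteq> \<O>" "v \<in> fun_vs.span S" "fun_vs.subspace W" "D ` S \<subseteq> W"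
  shows "D v \<in> W"
proof -
  have "fun_vs.subspace {v \<in> \<O>. D v \<in> W}"
    by (rule fun_vs.subspaceI) (use assms(4) in \<open>auto simp: VecD[OF assms(1)] fun_vs.subspace_0
      fun_vs.subspace_add fun_vs.subspace_scale intro: O.zero O.add O.scale\<close>)
  then have "fun_vs.span S \<subseteq> {v \<in> \<O>. D v \<in> W}" using assms(2,5) by (intro fun_vs.span_minimal) auto
  then show ?thesis using assms(3) by auto
qed

lemma subspace_Vec: "vec_vs.subspace (Vec X)"
  unfolding vec_vs.subspace_def
proof (intro conjI ballI allI)
  show "0 \<in> Vec X" by (auto simp: Vec_def O.zero fun_eq_iff fscale_apply)
  fix D E assume "D \<in> Vec X" "E \<in> Vec X"
  note D = VecD[OF this(1)] and E = VecD[OF this(2)]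
  show "D + E \<in> Vec X"
    unfolding Vec_def by (auto simp: D E fun_eq_iff fscale_apply algebra_simps intro!: O.add)
next
  fix c D assume "D \<in> Vec X"
  note D = VecD[OF this]
  show "vscale c D \<in> Vec X"
    unfolding Vec_def by (auto simp: D vscale_apply fun_eq_iff fscale_apply algebra_simps intro!: O.scale)
qed

lemma bracket_Vec:
  assumes "D \<in> Vec X" "E \<in> Vec X" shows "lie_bracket D E \<in> Vec X"
proof -
  note D = VecD[OF assms(1)] and E = VecD[OF assms(2)]
  have "lie_bracket D E (f * g) = f * lie_bracket D E g + lie_bracket D E f * g" if "f \<in> \<O>" "g \<in> \<O>" for f g
    using that by (simp add: lie_bracket_def D E O.mult O.add fun_eq_iff algebra_simps)
  moreover have "lie_bracket D E (f + g) = lie_bracket D E f + lie_bracket D E g" if "f \<in> \<O>" "g \<in> \<O>" for f g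
    using that by (simp add: lie_bracket_def D E fun_eq_iff)
  moreover have "lie_bracket D E (fscale c f) = fscale c (lie_bracket D E f)" if "f \<in> \<O>" for f c
    using that by (simp add: lie_bracket_def D E fun_eq_iff fscale_apply algebra_simps)
  moreover have "lie_bracket D E f \<in> \<O>" if "f \<in> \<O>" for f
    using that unfolding lie_bracket_def by (intro O.diff D(1) E(1))
  moreover have "lie_bracket D E f = 0" if "f \<notin> \<O>" for f
    using that by (simp add: lie_bracket_def D E)
  ultimately show ?thesis unfolding Vec_def by blast
qed

lemma lie_generated_props:
  assumes "S \<subseteq> Vec X"
  shows "lie_subalgebra X (lie_generated X S)" "S \<subseteq> lie_generated X S"
    "lie_subalgebra X T \<Longrightarrow> S \<subseteq> T \<Longrightarrow> lie_generated X S \<subseteq> T"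
proof -
  have V: "lie_subalgebra X (Vec X)" by (simp add: lie_subalgebra_def subspace_Vec bracket_Vec)
  show "S \<subseteq> lie_generated X S" unfolding lie_generated_def by (rule hull_subset)
  show "lie_subalgebra X T \<Longrightarrow> S \<subseteq> T \<Longrightarrow> lie_generated X S \<subseteq> T"
    unfolding lie_generated_def by (rule hull_minimal)
  have "lie_generated X S \<subseteq> Vec X" unfolding lie_generated_def by (rule hull_minimal[of _ _ "lie_subalgebra X"]) (use assms V in auto)
  moreover have "vec_vs.subspace (lie_generated X S)"
    unfolding lie_generated_def hull_def by (rule vec_vs.subspace_Inter) (auto simp: lie_subalgebra_def)
  moreover have "lie_bracket D E \<in> lie_generated X S" if "D \<in> lie_generated X S" "E \<in> lie_generated X S" for D E
    using that unfolding lie_generated_def hull_def by (auto simp: lie_subalgebra_def)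
  ultimately show "lie_subalgebra X (lie_generated X S)" by (simp add: lie_subalgebra_def)
qed

lemma Vec_const: assumes "D \<in> Vec X" shows "D (zero_outside PX (\<lambda>_. c)) = 0"
proof -
  have "D (O.one_fun * O.one_fun) = O.one_fun * D O.one_fun + D O.one_fun * O.one_fun"
    by (rule VecD(4)[OF assms O.const O.const])
  then have "D O.one_fun = D O.one_fun + D O.one_fun"
    unfolding O.one_mult(1)[OF O.const] O.one_mult(1)[OF VecD(1)[OF assms O.const]]
      O.one_mult(2)[OF VecD(1)[OF assms O.const]] .
  then have 1: "D O.one_fun = 0" by simp
  have "zero_outside PX (\<lambda>_. c) = fscale c O.one_fun" by (auto simp: zero_outside_def fscale_def)
  then show ?thesis by (simp only: 1 VecD(3)[OF assms O.const] fun_vs.scale_zero_right)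
qed

lemma Vec_eqI:
  assumes "D \<in> Vec X" "E \<in> Vec X" "\<And>f. f \<in> gens \<Longrightarrow> D f = E f"
  shows "D = E"
proof
  fix f
  show "D f = E f"
  proof (cases "f \<in> \<O>")
    case True
    then show ?thesis unfolding gens(3)
    proof (induction rule: alg_gen_induct)
      case (add f g)
      then have fg: "f \<in> \<O>" "g \<in> \<O>" using gens(3) by simp_all
      show ?case by (simp only: VecD(2)[OF assms(1) fg] VecD(2)[OF assms(2) fg] add.IH)
    next
      case (mult f g)
      then have fg: "f \<in> \<O>" "g \<in> \<O>" using gens(3) by simp_all
      show ?case by (simp only: VecD(4)[OF assms(1) fg] VecD(4)[OF assms(2) fg] mult.IH)
    qed (simp_all add: Vec_const assms)
  qed (simp add: VecD(5) assms)
qed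

lemma exists_invariant_generating:
  assumes L: "L \<subseteq> Vec X" and lf: "locally_finite X L"
  shows "\<exists>B. finite B \<and> fun_vs.span B \<subseteq> \<O> \<and> gens \<subseteq> fun_vs.span B \<and> (\<forall>D\<in>L. D ` fun_vs.span B \<subseteq> fun_vs.span B)"
proof -
  have gO: "gens \<subseteq> \<O>" unfolding gens(3) by (auto intro: alg_gen.gen)
  have "\<forall>f\<in>gens. \<exists>B. finite B \<and> fun_vs.span B \<subseteq> \<O> \<and> f \<in> fun_vs.span B \<and> (\<forall>D\<in>L. D ` fun_vs.span B \<subseteq> fun_vs.span B)"
  proof
    fix f assume "f \<in> gens"
    then obtain V where "V \<subseteq> \<O>" "finite_dimensional fscale V" "f \<in> V" "\<forall>D\<in>L. D ` V \<subseteq> V"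
      using lf gO unfolding locally_finite_def by (meson subsetD)
    then show "\<exists>B. finite B \<and> fun_vs.span B \<subseteq> \<O> \<and> f \<in> fun_vs.span B \<and> (\<forall>D\<in>L. D ` fun_vs.span B \<subseteq> fun_vs.span B)"
      unfolding finite_dimensional_def by auto
  qed
  from bchoice[OF this] obtain B where B: "\<forall>f\<in>gens. finite (B f) \<and> fun_vs.span (B f) \<subseteq> \<O> \<and> f \<in> fun_vs.span (B f) \<and>
    (\<forall>D\<in>L. D ` fun_vs.span (B f) \<subseteq> fun_vs.span (B f))" ..
  let ?U = "\<Union>f\<in>gens. B f"
  have sub: "fun_vs.span (B f) \<subseteq> fun_vs.span ?U" if "f \<in> gens" for f
    by (rule fun_vs.span_mono) (use that in auto)
  have "B f \<subseteq> \<O>" if f: "f \<in> gens" for f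
  proof -
    have "fun_vs.span (B f) \<subseteq> \<O>" using B f by simp
    then show ?thesis using fun_vs.span_superset[of "B f"] by (rule subset_trans[rotated])
  qed
  then have UO: "?U \<subseteq> \<O>" by auto
  have "D v \<in> fun_vs.span ?U" if D: "D \<in> L" and v: "v \<in> fun_vs.span ?U" for D v
  proof (rule Vec_span[OF _ UO v])
    show "D ` ?U \<subseteq> fun_vs.span ?U"
    proof (rule image_subsetI)
      fix u assume "u \<in> ?U"
      then obtain f where f: "f \<in> gens" "u \<in> B f" by auto
      then have "D u \<in> fun_vs.span (B f)" using B D fun_vs.span_base[of u "B f"] by auto
      then show "D u \<in> fun_vs.span ?U" using sub[OF f(1)] by auto
    qed
  qed (use D L in auto)
  moreover have "finite ?U" using B gens(1) by simp
  moreover have "fun_vs.span ?U \<subseteq> \<O>" using UO O.subspace by (rule fun_vs.span_minimal)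
  moreover have "f \<in> fun_vs.span ?U" if f: "f \<in> gens" for f
  proof -
    have "f \<in> fun_vs.span (B f)" using B f by simp
    then show ?thesis using sub[OF f] by (rule subsetD[rotated])
  qed
  then have "gens \<subseteq> fun_vs.span ?U" by (rule subsetI)
  ultimately show ?thesis by (intro exI[of _ ?U] conjI ballI image_subsetI)
qed

text \<open>A vector field is determined by its values on generators, so an algebra that preserves a
  finite dimensional generating space embeds in the endomorphisms of that space.\<close>

lemma locally_finite_imp_finite_dimensional:
  assumes L: "L \<subseteq> Vec X" "vec_vs.subspace L" and lf: "locally_finite X L"
  shows "finite_dimensional vscale L"
proof -
  obtain B where B: "finite B" "gens \<subseteq> fun_vs.span B" "\<And>D. D \<in> L \<Longrightarrow> D ` fun_vs.span B \<subseteq> fun_vs.span B"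
    using exists_invariant_generating[OF L(1) lf] by blast
  define T :: "(('a \<Rightarrow> 'k) \<Rightarrow> 'a \<Rightarrow> 'k) \<Rightarrow> ('a \<Rightarrow> 'k) \<times> 'a \<Rightarrow> 'k"
    where "T E = (\<lambda>(f, x). if f \<in> gens then E f x else 0)" for E
  define \<iota>' :: "('a \<Rightarrow> 'k) \<Rightarrow> ('a \<Rightarrow> 'k) \<Rightarrow> ('a \<Rightarrow> 'k) \<times> 'a \<Rightarrow> 'k"
    where "\<iota>' c w = (\<lambda>(f, x). if f = c then w x else 0)" for c w
  let ?S = "\<Union>c\<in>gens. \<iota>' c ` B"
  have linT: "Vector_Spaces.linear vscale fscale T"
    by (intro Vector_Spaces.linear.intro module_hom.intro module_hom_axioms.intro
        vec_vs.vector_space_axioms fun_vs.vector_space_axioms vec_vs.module_axioms fun_vs.module_axioms)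
      (auto simp: T_def fun_eq_iff vscale_apply fscale_apply)
  have lini: "module_hom fscale fscale (\<iota>' c)" for c
    by (intro module_hom.intro module_hom_axioms.intro fun_vs.module_axioms)
      (auto simp: \<iota>'_def fun_eq_iff fscale_apply)
  have TL: "T E \<in> fun_vs.span ?S" if E: "E \<in> L" for E
  proof -
    have "T E = (\<Sum>c\<in>gens. \<iota>' c (E c))"
    proof (rule ext)
      fix p show "T E p = (\<Sum>c\<in>gens. \<iota>' c (E c)) p"
        by (cases p) (simp add: T_def \<iota>'_def sum_fun_apply sum.delta gens(1))
    qed
    moreover have "\<iota>' c (E c) \<in> fun_vs.span ?S" if "c \<in> gens" for c
    proof -
      have "E c \<in> fun_vs.span B" using B(2,3) E that by auto
      then have "\<iota>' c (E c) \<in> fun_vs.span (\<iota>' c ` B)" unfolding module_hom.span_image[OF lini] by blast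
      moreover have "fun_vs.span (\<iota>' c ` B) \<subseteq> fun_vs.span ?S" by (rule fun_vs.span_mono) (use that in auto)
      ultimately show ?thesis by blast
    qed
    ultimately show ?thesis using fun_vs.span_sum[of gens "\<lambda>c. \<iota>' c (E c)" ?S] by simp
  qed
  obtain BL where BL: "BL \<subseteq> L" "vec_vs.independent BL" "L \<subseteq> vec_vs.span BL"
    by (rule vec_vs.maximal_independent_subset)
  have spL: "vec_vs.span BL = L" using BL(1,3) L(2) by (simp add: vec_vs.span_subspace)
  have inj: "inj_on T L"
  proof (rule inj_onI)
    fix D E assume DE: "D \<in> L" "E \<in> L" "T D = T E"
    have "D f = E f" if "f \<in> gens" for f
      using fun_cong[OF DE(3), of "(f, _)"] that by (auto simp: T_def fun_eq_iff)
    then show "D = E" using Vec_eqI DE L(1) by blast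
  qed
  interpret VP: vector_space_pair vscale fscale
    by (intro vector_space_pair.intro vec_vs.vector_space_axioms fun_vs.vector_space_axioms)
  have "fun_vs.independent (T ` BL)"
    by (rule VP.linear_independent_injective_image[OF linT BL(2)]) (use inj spL in simp)
  moreover have "finite ?S" using gens(1) B(1) by auto
  moreover have "T ` BL \<subseteq> fun_vs.span ?S" using TL BL(1) by auto
  ultimately have "finite (T ` BL)" using fun_vs.independent_span_bound by blast
  then have "finite BL" using inj BL(1) finite_imageD inj_on_subset by blast
  then show ?thesis using spL by (auto simp: finite_dimensional_def)
qed

definition Ad :: "('a \<Rightarrow> 'a) \<Rightarrow> (('a \<Rightarrow> 'k) \<Rightarrow> 'a \<Rightarrow> 'k) \<Rightarrow> ('a \<Rightarrow> 'k) \<Rightarrow> 'a \<Rightarrow> 'k"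
  where "Ad g E = (\<lambda>f. if f \<in> \<O> then act g (E (act (invX g) f)) else 0)"

lemma Ad_apply: "f \<in> \<O> \<Longrightarrow> Ad g E f = act g (E (act (invX g) f))" "f \<notin> \<O> \<Longrightarrow> Ad g E f = 0"
  by (simp_all add: Ad_def)

lemma Ad_linear: "Ad g (D + E) = Ad g D + Ad g E" "Ad g (vscale c E) = vscale c (Ad g E)" "Ad g 0 = 0"
proof -
  show "Ad g (D + E) = Ad g D + Ad g E"
    by (rule ext) (simp add: Ad_def act_hom)
  show "Ad g (vscale c E) = vscale c (Ad g E)"
    by (rule ext) (simp add: Ad_def act_hom vscale_apply)
  show "Ad g 0 = 0" by (rule ext) (simp add: Ad_def act_hom)
qed

lemma Ad_Vec:
  assumes g: "g \<in> carrier (Aut X)" and E: "E \<in> Vec X" shows "Ad g E \<in> Vec X"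
proof -
  note E = VecD[OF E]
  have i: "act (invX g) f \<in> \<O>" if "f \<in> \<O>" for f using that g by (auto intro: act_in)
  have "Ad g E (f1 * f2) = f1 * Ad g E f2 + Ad g E f1 * f2" if "f1 \<in> \<O>" "f2 \<in> \<O>" for f1 f2
    using that g i by (simp add: Ad_apply O.mult act_hom E act_inv)
  moreover have "Ad g E (f1 + f2) = Ad g E f1 + Ad g E f2" if "f1 \<in> \<O>" "f2 \<in> \<O>" for f1 f2
    using that i by (simp add: Ad_apply O.add act_hom E)
  moreover have "Ad g E (fscale c f) = fscale c (Ad g E f)" if "f \<in> \<O>" for c f
    using that i by (simp add: Ad_apply O.scale act_hom E)
  moreover have "Ad g E f \<in> \<O>" if "f \<in> \<O>" for f
    unfolding Ad_apply(1)[OF that] by (intro act_in g E(1) i that)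
  ultimately show ?thesis unfolding Vec_def using Ad_apply(2) by blast
qed

lemma Ad_mult:
  assumes "g \<in> carrier (Aut X)" "h \<in> carrier (Aut X)"
  shows "Ad (g \<odot> h) E = Ad h (Ad g E)"
  by (rule ext) (use assms in \<open>simp add: Ad_def act_mult A.inv_mult_group act_in\<close>)

lemma Ad_one:
  assumes "E \<in> Vec X" shows "Ad \<iota> E = E"
proof
  fix f show "Ad \<iota> E f = E f"
    by (cases "f \<in> \<O>") (simp_all add: Ad_apply act_one VecD[OF assms])
qed

lemma Ad_inv: "g \<in> carrier (Aut X) \<Longrightarrow> E \<in> Vec X \<Longrightarrow> Ad g (Ad (invX g) E) = E"
  using Ad_mult[of "invX g" g E] Ad_one by (simp add: A.l_inv)

lemma Ad_bracket:
  assumes g: "g \<in> carrier (Aut X)" and D: "D \<in> Vec X" and E: "E \<in> Vec X"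
  shows "Ad g (lie_bracket D E) = lie_bracket (Ad g D) (Ad g E)"
proof
  fix f
  show "Ad g (lie_bracket D E) f = lie_bracket (Ad g D) (Ad g E) f"
  proof (cases "f \<in> \<O>")
    case True
    then have i: "act (invX g) f \<in> \<O>" using g by (auto intro: act_in)
    then show ?thesis using True g VecD(1)[OF D] VecD(1)[OF E]
      by (simp add: lie_bracket_def Ad_apply act_in act_inv act_hom)
  qed (simp add: lie_bracket_def Ad_apply VecD(6)[OF Ad_Vec[OF g D]] VecD(6)[OF Ad_Vec[OF g E]])
qed

end

section \<open>Groups of automorphisms\<close>

definition orb :: "('a \<Rightarrow> 'a) set \<Rightarrow> ('a \<Rightarrow> 'k::zero) \<Rightarrow> 'a \<Rightarrow> ('a \<Rightarrow> 'a) \<Rightarrow> 'k"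
  where "orb Q f x = zero_outside Q (\<lambda>g. f (g x))"

text \<open>Linear functionals of the moving vector \<open>g \<mapsto> \<Psi> g v\<close>.\<close>

context function_group
begin

lemma moving_functional:
  fixes \<Psi> :: "'g \<Rightarrow> 'v \<Rightarrow> 's \<Rightarrow> 'k"
  assumes "\<And>s. zero_outside P (\<lambda>g. \<Psi> g v s) \<in> R"
  shows "zero_outside P (\<lambda>g. ev cs (\<Psi> g v)) \<in> R"
proof (induction cs)
  case Nil
  show ?case using const[of 0] by simp
next
  case (Cons c cs)
  obtain a s where c: "c = (a, s)" by (cases c)
  have "zero_outside P (\<lambda>g. ev (c # cs) (\<Psi> g v)) =
      fscale a (zero_outside P (\<lambda>g. \<Psi> g v s)) + zero_outside P (\<lambda>g. ev cs (\<Psi> g v))"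
    by (auto simp: c zero_outside_def fun_eq_iff fscale_apply)
  then show ?case using add[OF scale[OF assms] Cons.IH] by (simp only:)
qed

lemma pd_moving_functional:
  fixes \<Psi> :: "'g \<Rightarrow> 'v \<Rightarrow> 's \<Rightarrow> 'k"
  assumes A: "pd R x A" and \<Psi>: "\<And>s. zero_outside P (\<lambda>g. \<Psi> g v s) \<in> R"
  shows "A (zero_outside P (\<lambda>g. ev cs (\<Psi> g v))) = ev cs (\<lambda>s. A (zero_outside P (\<lambda>g. \<Psi> g v s)))"
proof (induction cs)
  case Nil
  have "zero_outside P (\<lambda>g. ev [] (\<Psi> g v)) = 0" by (auto simp: zero_outside_def)
  then show ?case using pdD(4)[OF A zero] by (simp only: ev_simps)
next
  case (Cons c cs)
  obtain a s where c: "c = (a, s)" by (cases c)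
  have "zero_outside P (\<lambda>g. ev (c # cs) (\<Psi> g v)) =
      fscale a (zero_outside P (\<lambda>g. \<Psi> g v s)) + zero_outside P (\<lambda>g. ev cs (\<Psi> g v))"
    by (auto simp: c zero_outside_def fun_eq_iff fscale_apply)
  then have "A (zero_outside P (\<lambda>g. ev (c # cs) (\<Psi> g v))) =
      a * A (zero_outside P (\<lambda>g. \<Psi> g v s)) + A (zero_outside P (\<lambda>g. ev cs (\<Psi> g v)))"
    by (simp only: pdD(1)[OF A scale[OF \<Psi>] moving_functional[where \<Psi> = \<Psi> and v = v, OF \<Psi>]] pdD(3)[OF A \<Psi>])
  then show ?case using Cons.IH by (simp add: c)
qed

lemma Dr_moving_functional:
  fixes \<Psi> :: "'g \<Rightarrow> 'v \<Rightarrow> 's \<Rightarrow> 'k"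
  assumes A: "pd R \<one> A" and \<Psi>: "\<And>s. zero_outside P (\<lambda>g. \<Psi> g v s) \<in> R"
    and D: "\<And>s. Dr A (zero_outside P (\<lambda>g. \<Psi> g v s)) = zero_outside P (\<lambda>g. \<Psi> g w s)"
  shows "Dr A (zero_outside P (\<lambda>g. ev cs (\<Psi> g v))) = zero_outside P (\<lambda>g. ev cs (\<Psi> g w))"
proof (induction cs)
  case Nil
  have "Dr A 0 = 0" using Dr_props(1)[OF A zero zero] by simp
  moreover have "zero_outside P (\<lambda>g. ev [] (\<Psi> g v)) = 0" "zero_outside P (\<lambda>g. ev [] (\<Psi> g w)) = 0" for v w
    by (auto simp: zero_outside_def)
  ultimately show ?case by (simp only:)
next
  case (Cons c cs)
  obtain a s where c: "c = (a, s)" by (cases c)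
  have e: "zero_outside P (\<lambda>g. ev (c # cs) (\<Psi> g v)) =
      fscale a (zero_outside P (\<lambda>g. \<Psi> g v s)) + zero_outside P (\<lambda>g. ev cs (\<Psi> g v))" for v
    by (auto simp: c zero_outside_def fun_eq_iff fscale_apply)
  show ?case unfolding e Dr_props(1)[OF A scale[OF \<Psi>] moving_functional[where \<Psi> = \<Psi> and v = v, OF \<Psi>]] Dr_props(3)[OF A \<Psi>] D Cons.IH ..
qed

end

text \<open>Infinitesimal invariance implies invariance: the equations of \<open>V\<close>, evaluated along
  the orbit of \<open>V\<close>, form a family that is stable under invariant derivations.\<close>

lemma (in connected_function_group) infinitesimal_invariance:
  fixes \<Psi> :: "'g \<Rightarrow> 'v \<Rightarrow> 's \<Rightarrow> 'k"
  assumes \<Psi>: "\<And>v s. v \<in> V \<Longrightarrow> zero_outside P (\<lambda>g. \<Psi> g v s) \<in> R"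
    and D: "\<And>v s A. v \<in> V \<Longrightarrow> pd R \<one> A \<Longrightarrow> 
      Dr A (zero_outside P (\<lambda>g. \<Psi> g v s)) = zero_outside P (\<lambda>g. \<Psi> g (\<delta> A v) s)"
    and V: "\<And>v A. v \<in> V \<Longrightarrow> pd R \<one> A \<Longrightarrow> \<delta> A v \<in> V"
    and cs: "\<And>v. v \<in> V \<Longrightarrow> ev cs (\<Psi> \<one> v) = 0" and v: "v \<in> V" and g: "g \<in> P"
  shows "ev cs (\<Psi> g v) = 0"
proof -
  have "zero_outside P (\<lambda>g. ev cs (\<Psi> g v)) = 0"
  proof (rule stable_zero[where F = "(\<lambda>v. zero_outside P (\<lambda>g. ev cs (\<Psi> g v))) ` V"])
    show "(\<lambda>v. zero_outside P (\<lambda>g. ev cs (\<Psi> g v))) ` V \<subseteq> m_one"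
      using moving_functional[where \<Psi> = \<Psi>, OF \<Psi>] cs by (auto simp: m_one_def zero_outside_apply)
    fix f A assume "f \<in> (\<lambda>v. zero_outside P (\<lambda>g. ev cs (\<Psi> g v))) ` V" and A: "pd R \<one> A"
    then obtain w where w: "w \<in> V" "f = zero_outside P (\<lambda>g. ev cs (\<Psi> g w))" by auto
    show "Dr A f \<in> (\<lambda>v. zero_outside P (\<lambda>g. ev cs (\<Psi> g v))) ` V"
      unfolding w(2) Dr_moving_functional[where \<Psi> = \<Psi> and v = w and w = "\<delta> A w", OF A \<Psi>[OF w(1)] D[OF w(1) A]]
      by (rule image_eqI[OF refl V[OF w(1) A]])
  qed (use v in auto)
  from fun_cong[OF this, of g] show ?thesis using g by (simp add: zero_outside_apply)
qed

locale action = aff X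
  for X :: "('a, 'k::{alg_closed_field,field_char_0}) variety" +
  fixes Q :: "('a \<Rightarrow> 'a) set" and R :: "(('a \<Rightarrow> 'a) \<Rightarrow> 'k) set"
  assumes sub: "subgroup Q (Aut X)"
    and fg: "function_group ((Aut X)\<lparr>carrier := Q\<rparr>) R"
    and coact: "f \<in> reg X \<Longrightarrow> \<exists>(n::nat) a b. (\<forall>i<n. a i \<in> R \<and> b i \<in> reg X) \<and>
      (\<forall>g\<in>Q. \<forall>x\<in>pts X. f (g x) = (\<Sum>i<n. a i g * b i x))"
begin

sublocale G: function_group "(Aut X)\<lparr>carrier := Q\<rparr>" R
  rewrites "carrier ((Aut X)\<lparr>carrier := Q\<rparr>) = Q" and "mult ((Aut X)\<lparr>carrier := Q\<rparr>) = mult (Aut X)"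
    and "one ((Aut X)\<lparr>carrier := Q\<rparr>) = one (Aut X)"
  by (fact fg) simp_all

lemma QA: "g \<in> Q \<Longrightarrow> g \<in> carrier (Aut X)"
  using subgroup.subset[OF sub] by blast

lemma Q_inv: "g \<in> Q \<Longrightarrow> inv\<^bsub>(Aut X)\<lparr>carrier := Q\<rparr>\<^esub> g = invX g"
  using sub by simp

lemma Q_closed: "g \<in> Q \<Longrightarrow> h \<in> Q \<Longrightarrow> g \<odot> h \<in> Q" "g \<in> Q \<Longrightarrow> invX g \<in> Q" "\<iota> \<in> Q"
  using sub by (auto simp: subgroup.m_closed subgroup.m_inv_closed subgroup.one_closed)

lemma inverse_in: "f \<in> R \<Longrightarrow> zero_outside Q (\<lambda>g. f (invX g)) \<in> R"
  using G.inverse[of f] zo_eq_iff[of Q "\<lambda>g. f (inv\<^bsub>(Aut X)\<lparr>carrier := Q\<rparr>\<^esub> g)" "\<lambda>g. f (invX g)"] Q_inv by simp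

lemma pd_inv: "pd R \<iota> A \<Longrightarrow> f \<in> R \<Longrightarrow> A (zero_outside Q (\<lambda>g. f (invX g))) = - A f"
  using G.pd_inverse[of A f] zo_eq_iff[of Q "\<lambda>g. f (inv\<^bsub>(Aut X)\<lparr>carrier := Q\<rparr>\<^esub> g)" "\<lambda>g. f (invX g)"] Q_inv by simp

lemma orb_apply: "g \<in> Q \<Longrightarrow> orb Q f x g = f (g x)"
  by (simp add: orb_def zero_outside_def)

lemma orb_in: assumes "f \<in> \<O>" "x \<in> PX" shows "orb Q f x \<in> R"
proof -
  obtain n :: nat and a b where ab: "\<forall>i<n. a i \<in> R \<and> b i \<in> \<O>"
    "\<forall>g\<in>Q. \<forall>x\<in>PX. f (g x) = (\<Sum>i<n. a i g * b i x)" using coact[OF assms(1)] by blast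
  have "orb Q f x = zero_outside Q (\<lambda>h. \<Sum>i<n. b i x * a i h)"
    unfolding orb_def by (rule zo_eq_iff) (use ab assms in \<open>simp add: mult.commute\<close>)
  moreover have "zero_outside Q (\<lambda>h. \<Sum>i<n. b i x * a i h) \<in> R" by (rule G.lincomb_in) (use ab in simp)
  ultimately show ?thesis by simp
qed

definition xi :: "((('a \<Rightarrow> 'a) \<Rightarrow> 'k) \<Rightarrow> 'k) \<Rightarrow> ('a \<Rightarrow> 'k) \<Rightarrow> 'a \<Rightarrow> 'k"
  where "xi A f = zero_outside PX (\<lambda>x. if f \<in> \<O> then A (orb Q f x) else 0)"

lemma xi_apply: "f \<in> \<O> \<Longrightarrow> x \<in> PX \<Longrightarrow> xi A f x = A (orb Q f x)" "f \<notin> \<O> \<Longrightarrow> xi A f = 0"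
  "x \<notin> PX \<Longrightarrow> xi A f x = 0"
  by (auto simp: xi_def zero_outside_def)

lemma fundamental_field_xi:
  assumes "pts Y = Q" shows "fundamental_field X Y A = xi A"
  unfolding fundamental_field_def differential_def pullback_def xi_def orb_def assms
  by (auto simp: zero_outside_def fun_eq_iff)

lemma xi_coact:
  assumes A: "pd R z A" and f: "f \<in> \<O>" and ab: "\<And>i. i < n \<Longrightarrow> a i \<in> R" "\<And>i. i < n \<Longrightarrow> b i \<in> \<O>"
    and eq: "\<And>g x. g \<in> Q \<Longrightarrow> x \<in> PX \<Longrightarrow> f (g x) = (\<Sum>i<(n::nat). a i g * b i x)"
  shows "xi A f = (\<Sum>i<n. fscale (A (a i)) (b i))"
proof (rule ext)
  fix x
  show "xi A f x = (\<Sum>i<n. fscale (A (a i)) (b i)) x"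
  proof (cases "x \<in> PX")
    case True
    have "orb Q f x = zero_outside Q (\<lambda>h. \<Sum>i<n. b i x * a i h)"
      unfolding orb_def by (rule zo_eq_iff) (use eq True in \<open>simp add: mult.commute\<close>)
    then have "A (orb Q f x) = (\<Sum>i<n. b i x * A (a i))"
      using G.pd_lincomb[OF A, of n a "\<lambda>i. b i x"] ab(1) by simp
    then show ?thesis using True f by (simp add: xi_apply sum_fun_apply fscale_apply mult.commute)
  next
    case False
    then have "b i x = 0" if "i < n" for i using O.supp ab(2) that by blast
    then show ?thesis using False by (simp add: xi_apply sum_fun_apply fscale_apply)
  qed
qed

lemma xi_in: assumes "pd R z A" "f \<in> \<O>" shows "xi A f \<in> \<O>"
proof -
  obtain n :: nat and a b where ab: "\<forall>i<n. a i \<in> R \<and> b i \<in> \<O>"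
    "\<forall>g\<in>Q. \<forall>x\<in>PX. f (g x) = (\<Sum>i<n. a i g * b i x)" using coact[OF assms(2)] by blast
  have "xi A f = (\<Sum>i<n. fscale (A (a i)) (b i))" by (rule xi_coact[OF assms]) (use ab in auto)
  moreover have "(\<Sum>i<n. fscale (A (a i)) (b i)) \<in> \<O>" by (intro O.sum O.scale) (use ab in auto)
  ultimately show ?thesis by simp
qed

lemma orb_act: "g \<in> Q \<Longrightarrow> x \<in> PX \<Longrightarrow> G.rt g (orb Q f x) = orb Q f (g x)"
  unfolding G.rt_def orb_def
  by (rule zo_eq_iff) (simp add: zero_outside_apply Q_closed Aut_mult QA)

lemma Dr_orb:
  assumes A: "pd R \<iota> A" and f: "f \<in> \<O>" and x: "x \<in> PX"
  shows "G.Dr A (orb Q f x) = orb Q (xi A f) x"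
  unfolding G.Dr_def orb_def[of Q "xi A f"]
  by (rule zo_eq_iff) (use f x in \<open>simp add: orb_act xi_apply Aut_in QA\<close>)

definition adv :: "(('a \<Rightarrow> 'k) \<Rightarrow> 'a \<Rightarrow> 'k) \<Rightarrow> ('a \<Rightarrow> 'k) \<Rightarrow> 'a \<Rightarrow> ('a \<Rightarrow> 'a) \<Rightarrow> 'k"
  where "adv E f x = zero_outside Q (\<lambda>g. Ad g E f x)"

lemma adv_trivial: "f \<notin> \<O> \<or> x \<notin> PX \<Longrightarrow> adv E f x = 0"
  by (auto simp: adv_def Ad_def zero_outside_def act_apply)

lemma adv_expand:
  assumes E: "E \<in> Vec X" and f: "f \<in> \<O>" and x: "x \<in> PX"
    and ab: "\<And>i. i < n \<Longrightarrow> a i \<in> R" "\<And>i. i < n \<Longrightarrow> b i \<in> \<O>"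
    and eq: "\<And>g x. g \<in> Q \<Longrightarrow> x \<in> PX \<Longrightarrow> f (g x) = (\<Sum>i<(n::nat). a i g * b i x)"
  shows "adv E f x = (\<Sum>i<n. zero_outside Q (\<lambda>g. a i (invX g)) * orb Q (E (b i)) x)"
proof (rule ext)
  fix g
  show "adv E f x g = (\<Sum>i<n. zero_outside Q (\<lambda>g. a i (invX g)) * orb Q (E (b i)) x) g"
  proof (cases "g \<in> Q")
    case True
    have "act (invX g) f = (\<Sum>i<n. fscale (a i (invX g)) (b i))"
    proof (rule O.eqI)
      show "act (invX g) f \<in> \<O>" using f True by (intro act_in QA Q_closed)
      show "(\<Sum>i<n. fscale (a i (invX g)) (b i)) \<in> \<O>" by (intro O.sum O.scale) (use ab in auto)
    qed (use True eq Q_closed(2) in \<open>simp add: act_apply sum_fun_apply fscale_apply\<close>)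
    then have "E (act (invX g) f) = (\<Sum>i<n. fscale (a i (invX g)) (E (b i)))"
      using Vec_sum[OF E, of "{..<n}" "\<lambda>i. fscale (a i (invX g)) (b i)"] ab(2)
      by (simp add: O.scale VecD(3)[OF E])
    then show ?thesis using True x f
      by (simp add: adv_def zero_outside_apply Ad_apply act_apply sum_fun_apply fscale_apply orb_apply)
  qed (simp add: adv_def orb_def zero_outside_apply sum_fun_apply)
qed

lemma adv_in: assumes E: "E \<in> Vec X" shows "adv E f x \<in> R"
proof (cases "f \<in> \<O> \<and> x \<in> PX")
  case True
  obtain n :: nat and a b where ab: "\<forall>i<n. a i \<in> R \<and> b i \<in> \<O>"
    "\<forall>g\<in>Q. \<forall>x\<in>PX. f (g x) = (\<Sum>i<n. a i g * b i x)" using coact True by blast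
  have "adv E f x = (\<Sum>i<n. zero_outside Q (\<lambda>g. a i (invX g)) * orb Q (E (b i)) x)"
    by (rule adv_expand[OF E]) (use True ab in auto)
  moreover have "(\<Sum>i<n. zero_outside Q (\<lambda>g. a i (invX g)) * orb Q (E (b i)) x) \<in> R"
    by (intro G.sum G.mult inverse_in orb_in VecD(1)[OF E]) (use True ab in auto)
  ultimately show ?thesis by simp
next
  case False
  then have "adv E f x = 0" using adv_trivial by blast
  then show ?thesis using G.zero by simp
qed

text \<open>The coaction writes \<open>g \<mapsto> (Ad g E) f x\<close> as a sum of products of functions of \<open>g\<inverse>\<close> and of \<open>g\<close>;
  the product rule and the sign of the derivative of the inverse give the two terms of the bracket.\<close>

lemma pd_adv:
  assumes A: "pd R \<iota> A" and E: "E \<in> Vec X" and f: "f \<in> \<O>" and x: "x \<in> PX"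
  shows "A (adv E f x) = lie_bracket (xi A) E f x"
proof -
  obtain n :: nat and a b where ab: "\<And>i. i < n \<Longrightarrow> a i \<in> R" "\<And>i. i < n \<Longrightarrow> b i \<in> \<O>"
    "\<And>g x. g \<in> Q \<Longrightarrow> x \<in> PX \<Longrightarrow> f (g x) = (\<Sum>i<n. a i g * b i x)" using coact[OF f] by blast
  let ?i = "\<lambda>i. zero_outside Q (\<lambda>g. a i (invX g))"
  have in1: "?i i \<in> R" "orb Q (E (b i)) x \<in> R" if "i < n" for i
    using that ab x by (auto intro!: inverse_in orb_in VecD(1)[OF E])
  have "A (adv E f x) = (\<Sum>i<n. A (?i i * orb Q (E (b i)) x))"
    using pd_sum[OF A G.zero G.add, of "{..<n}" "\<lambda>i. ?i i * orb Q (E (b i)) x"] G.mult[OF in1]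
    by (simp add: adv_expand[OF E f x ab])
  also have "\<dots> = (\<Sum>i<n. a i \<iota> * xi A (E (b i)) x - A (a i) * E (b i) x)"
  proof (intro sum.cong refl)
    fix i assume "i \<in> {..<n}"
    then have i: "i < n" by simp
    have "A (?i i * orb Q (E (b i)) x) = ?i i \<iota> * A (orb Q (E (b i)) x) + A (?i i) * orb Q (E (b i)) x \<iota>"
      by (rule pdD(2)[OF A in1[OF i]])
    then show "A (?i i * orb Q (E (b i)) x) = a i \<iota> * xi A (E (b i)) x - A (a i) * E (b i) x"
      using x ab(2)[OF i] VecD(1)[OF E] by (simp add: pd_inv[OF A ab(1)[OF i]] zero_outside_apply Q_closed
          orb_apply Aut_one xi_apply)
  qed
  also have "\<dots> = (\<Sum>i<n. a i \<iota> * xi A (E (b i)) x) - (\<Sum>i<n. A (a i) * E (b i) x)"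
    by (rule sum_subtractf)
  also have "(\<Sum>i<n. A (a i) * E (b i) x) = E (xi A f) x"
    using xi_coact[OF A f ab] Vec_sum[OF E, of "{..<n}" "\<lambda>i. fscale (A (a i)) (b i)"] ab(2)
    by (simp add: O.scale VecD(3)[OF E] sum_fun_apply fscale_apply)
  also have "(\<Sum>i<n. a i \<iota> * xi A (E (b i)) x) = xi A (E f) x"
  proof -
    have "f = (\<Sum>i<n. fscale (a i \<iota>) (b i))"
    proof (rule O.eqI[OF f])
      show "(\<Sum>i<n. fscale (a i \<iota>) (b i)) \<in> \<O>" by (intro O.sum O.scale) (use ab in auto)
    qed (use ab(3)[OF Q_closed(3)] in \<open>simp add: Aut_one sum_fun_apply fscale_apply\<close>)
    then have "E f = E (\<Sum>i<n. fscale (a i \<iota>) (b i))" by simp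
    also have "\<dots> = (\<Sum>i<n. fscale (a i \<iota>) (E (b i)))"
      using Vec_sum[OF E, of "{..<n}" "\<lambda>i. fscale (a i \<iota>) (b i)"] ab(2)
      by (simp add: O.scale VecD(3)[OF E])
    finally have Ef: "E f = (\<Sum>i<n. fscale (a i \<iota>) (E (b i)))" .
    have "orb Q (E f) x = zero_outside Q (\<lambda>g. \<Sum>i<n. a i \<iota> * orb Q (E (b i)) x g)"
      unfolding Ef orb_def[of Q "sum _ _"]
      by (rule zo_eq_iff) (simp add: orb_apply sum_fun_apply fscale_apply)
    then have "A (orb Q (E f) x) = (\<Sum>i<n. a i \<iota> * A (orb Q (E (b i)) x))"
      using G.pd_lincomb[OF A, of n "\<lambda>i. orb Q (E (b i)) x" "\<lambda>i. a i \<iota>"] in1 by simp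
    then show ?thesis using f x ab(2) VecD(1)[OF E] by (simp add: xi_apply)
  qed
  finally show ?thesis by (simp add: lie_bracket_def)
qed

lemma Dr_adv:
  assumes A: "pd R \<iota> A" and E: "E \<in> Vec X"
  shows "G.Dr A (adv E f x) = adv (lie_bracket (xi A) E) f x"
proof (cases "f \<in> \<O> \<and> x \<in> PX")
  case True
  have "G.rt g (adv E f x) = adv E (act (invX g) f) (g x)" if g: "g \<in> Q" for g
    unfolding G.rt_def adv_def
  proof (rule zo_eq_iff)
    fix h assume h: "h \<in> Q"
    have "act (invX g) f \<in> \<O>" using True g by (auto intro!: act_in QA Q_closed)
    then show "zero_outside Q (\<lambda>g. Ad g E f x) (h \<odot> g) = Ad h E (act (invX g) f) (g x)"
      using g h True by (simp add: zero_outside_apply Q_closed QA Ad_apply act_apply Aut_in Aut_mult A.inv_mult_group act_mult)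
  qed
  then have "A (G.rt g (adv E f x)) = Ad g (lie_bracket (xi A) E) f x" if "g \<in> Q" for g
    using True that pd_adv[OF A E, of "act (invX g) f" "g x"]
    by (simp add: Ad_apply act_apply Aut_in QA act_in Q_closed)
  then show ?thesis unfolding G.Dr_def adv_def[of "lie_bracket _ _"] by (intro zo_eq_iff)
next
  case False
  then have "adv E f x = 0" "adv (lie_bracket (xi A) E) f x = 0" using adv_trivial by blast+
  moreover have "G.Dr A 0 = 0" using G.Dr_props(1)[OF A G.zero G.zero] by simp
  ultimately show ?thesis by simp
qed

text \<open>A functional that vanishes on \<open>V\<close> vanishes along \<open>g \<mapsto> Ad g E\<close>, hence on the derivative at the
  identity, which is the bracket.\<close>

lemma Ad_stable_imp_bracket_stable:
  assumes V: "finite_dimensional vscale V" "V \<subseteq> Vec X" and st: "\<And>g E. g \<in> Q \<Longrightarrow> E \<in> V \<Longrightarrow> Ad g E \<in> V"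
    and A: "pd R \<iota> A" and E: "E \<in> V"
  shows "lie_bracket (xi A) E \<in> V"
proof (rule ccontr)
  assume no: "lie_bracket (xi A) E \<notin> V"
  obtain cs where cs: "\<forall>v\<in>V. ev cs (uncur v) = 0" "ev cs (uncur (lie_bracket (xi A) E)) \<noteq> 0"
    using vec_eval_separation[OF V(1) no] by blast
  have EV: "E \<in> Vec X" using E V by blast
  define \<Psi> where "\<Psi> = (\<lambda>g E. uncur (Ad g E) :: ('a \<Rightarrow> 'k) \<times> 'a \<Rightarrow> 'k)"
  have \<Psi>: "zero_outside Q (\<lambda>g. \<Psi> g E s) = adv E (fst s) (snd s)" for s
    by (simp add: \<Psi>_def uncur_def adv_def case_prod_unfold)
  have "zero_outside Q (\<lambda>g. ev cs (\<Psi> g E)) = 0"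
    using st[OF _ E] cs(1) by (auto simp: zero_outside_def \<Psi>_def)
  then have "0 = A (zero_outside Q (\<lambda>g. ev cs (\<Psi> g E)))" using pdD(4)[OF A G.zero] by simp
  also have "\<dots> = ev cs (\<lambda>s. A (adv E (fst s) (snd s)))"
    using G.pd_moving_functional[OF A, of \<Psi> E cs] by (simp add: \<Psi> adv_in[OF EV])
  also have "(\<lambda>s. A (adv E (fst s) (snd s))) = uncur (lie_bracket (xi A) E)"
  proof (rule ext, clarsimp simp: uncur_def)
    fix f x
    show "A (adv E f x) = lie_bracket (xi A) E f x"
    proof (cases "f \<in> \<O> \<and> x \<in> PX")
      case True
      then show ?thesis using pd_adv[OF A EV] by blast
    next
      case False
      have "E 0 = 0" "f \<notin> \<O> \<Longrightarrow> E f = 0" using VecD[OF EV] by auto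
      moreover have "xi A 0 x = 0"
      proof (cases "x \<in> PX")
        case True
        have "orb Q (0 :: 'a \<Rightarrow> 'k) x = 0" by (auto simp: orb_def zero_outside_def)
        then show ?thesis using True O.zero pdD(4)[OF A G.zero] by (simp add: xi_apply)
      qed (simp add: xi_apply)
      moreover have "E (xi A f) x = 0" if "x \<notin> PX" "f \<in> \<O>"
        using O.supp[OF VecD(1)[OF EV xi_in[OF A that(2)]] that(1)] .
      ultimately have "lie_bracket (xi A) E f x = 0" using False
        by (cases "f \<in> \<O>") (simp_all add: lie_bracket_def xi_apply)
      then show ?thesis using False adv_trivial[of f x E] pdD(4)[OF A G.zero] by simp
    qed
  qed
  finally show False using cs(2) by simp
qed

end

locale connected_action = action X Q R
  for X :: "('a, 'k::{alg_closed_field,field_char_0}) variety" and Q R +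
  fixes C
  assumes cfg: "connected_function_group ((Aut X)\<lparr>carrier := Q\<rparr>) R C"
begin

sublocale G: connected_function_group "(Aut X)\<lparr>carrier := Q\<rparr>" R C
  rewrites "carrier ((Aut X)\<lparr>carrier := Q\<rparr>) = Q" and "mult ((Aut X)\<lparr>carrier := Q\<rparr>) = mult (Aut X)"
    and "one ((Aut X)\<lparr>carrier := Q\<rparr>) = one (Aut X)"
  by (fact cfg) simp_all

lemma act_stable:
  assumes B: "finite B" "fun_vs.span B \<subseteq> \<O>"
    and st: "\<And>A f. pd R \<iota> A \<Longrightarrow> f \<in> fun_vs.span B \<Longrightarrow> xi A f \<in> fun_vs.span B"
    and g: "g \<in> Q" and f: "f \<in> fun_vs.span B"
  shows "act g f \<in> fun_vs.span B"
proof (rule ccontr)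
  assume "act g f \<notin> fun_vs.span B"
  then obtain cs where cs: "\<forall>v\<in>fun_vs.span B. ev cs v = 0" "ev cs (act g f) \<noteq> 0"
    using eval_separation[OF B(1)] by blast
  have e: "zero_outside Q (\<lambda>g. act g v s) = (if s \<in> PX then orb Q v s else 0)" for v s
    by (auto simp: orb_def zero_outside_def fun_eq_iff act_apply)
  have "ev cs (act g f) = 0"
  proof (rule G.infinitesimal_invariance[where V = "fun_vs.span B" and \<Psi> = act and \<delta> = xi])
    show "zero_outside Q (\<lambda>g. act g v s) \<in> R" if "v \<in> fun_vs.span B" for v s
      using that B(2) orb_in G.zero by (auto simp: e)
    show "G.Dr A (zero_outside Q (\<lambda>g. act g v s)) = zero_outside Q (\<lambda>g. act g (xi A v) s)"
      if "v \<in> fun_vs.span B" "pd R \<iota> A" for v s A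
      using Dr_orb[OF that(2), of v s] that(1) B(2) G.Dr_props(1)[OF that(2) G.zero G.zero] by (auto simp: e)
    show "ev cs (act \<iota> v) = 0" if "v \<in> fun_vs.span B" for v
      using cs(1) that B(2) act_one by auto
  qed (use st g f in auto)
  then show False using cs(2) by simp
qed

lemma Ad_stable:
  assumes V: "finite_dimensional vscale V" "V \<subseteq> Vec X"
    and st: "\<And>A E. pd R \<iota> A \<Longrightarrow> E \<in> V \<Longrightarrow> lie_bracket (xi A) E \<in> V"
    and g: "g \<in> Q" and E: "E \<in> V"
  shows "Ad g E \<in> V"
proof (rule ccontr)
  assume "Ad g E \<notin> V"
  then obtain cs where cs: "\<forall>v\<in>V. ev cs (uncur v) = 0" "ev cs (uncur (Ad g E)) \<noteq> 0"
    using vec_eval_separation[OF V(1)] by blast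
  define \<Psi> where "\<Psi> = (\<lambda>g E. uncur (Ad g E) :: ('a \<Rightarrow> 'k) \<times> 'a \<Rightarrow> 'k)"
  have e: "zero_outside Q (\<lambda>g. \<Psi> g E s) = adv E (fst s) (snd s)" for E s
    by (simp add: \<Psi>_def uncur_def adv_def case_prod_unfold)
  have "ev cs (\<Psi> g E) = 0"
  proof (rule G.infinitesimal_invariance[where \<Psi> = \<Psi> and V = V and \<delta> = "\<lambda>A E. lie_bracket (xi A) E"])
    show "zero_outside Q (\<lambda>g. \<Psi> g v s) \<in> R" if "v \<in> V" for v s
      unfolding e by (rule adv_in) (use that V in auto)
    show "G.Dr A (zero_outside Q (\<lambda>g. \<Psi> g v s)) = zero_outside Q (\<lambda>g. \<Psi> g (lie_bracket (xi A) v) s)"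
      if "v \<in> V" "pd R \<iota> A" for v s A
      unfolding e by (rule Dr_adv) (use that V in auto)
    show "ev cs (\<Psi> \<iota> v) = 0" if "v \<in> V" for v
      using cs(1) that V(2) Ad_one[of v] by (auto simp: \<Psi>_def)
  qed (use st g E in auto)
  then show False using cs(2) by (simp add: \<Psi>_def)
qed

end

section \<open>The Lie algebra generated by algebraic Lie algebras\<close>

context vector_space
begin

lemma span_image_lessThan:
  assumes "x \<in> span (f ` {..<n})" shows "\<exists>c. x = (\<Sum>k<(n::nat). c k *s f k)"
proof -
  let ?S = "{x. \<exists>c. x = (\<Sum>k<n. c k *s f k)}"
  have "subspace ?S"
    unfolding subspace_def mem_Collect_eq
  proof (intro conjI ballI allI)
    show "\<exists>c. 0 = (\<Sum>k<n. c k *s f k)" by (rule exI[of _ "\<lambda>_. 0"]) simp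
    fix x assume "x \<in> ?S"
    then obtain c where c: "x = (\<Sum>k<n. c k *s f k)" by auto
    fix y assume "y \<in> ?S"
    then obtain e where e: "y = (\<Sum>k<n. e k *s f k)" by auto
    show "\<exists>c. x + y = (\<Sum>k<n. c k *s f k)" unfolding c e
      by (rule exI[of _ "\<lambda>k. c k + e k"]) (simp add: sum.distrib scale_left_distrib)
  next
    fix a x assume "x \<in> ?S"
    then obtain c where c: "x = (\<Sum>k<n. c k *s f k)" by auto
    show "\<exists>c. a *s x = (\<Sum>k<n. c k *s f k)" unfolding c
      by (rule exI[of _ "\<lambda>k. a * c k"]) (simp add: scale_sum_right)
  qed
  moreover have "f ` {..<n} \<subseteq> ?S"
  proof (rule image_subsetI, unfold mem_Collect_eq)
    fix k assume "k \<in> {..<n}"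
    have "(if j = k then 1 else 0) *s f j = (if j = k then f j else 0)" for j by simp
    then show "\<exists>c. f k = (\<Sum>j<n. c j *s f j)" using \<open>k \<in> {..<n}\<close>
      by (intro exI[of _ "\<lambda>j. if j = k then 1 else 0"]) (simp only: sum.delta finite_lessThan if_True)
  qed
  ultimately have "span (f ` {..<n}) \<subseteq> ?S" by (intro span_minimal)
  then show ?thesis using assms by blast
qed

end

lemma (in action) Lie_eq:
  assumes "pts Y = Q" "reg Y = R" shows "Lie X Y = {xi A | A. pd R \<iota> A}"
proof -
  have "\<exists>A'\<in>tangent_space Y \<iota>. xi A' = xi A" if A: "pd R \<iota> A" for A
  proof
    let ?A = "\<lambda>f. if f \<in> R then A f else 0"
    show "?A \<in> tangent_space Y \<iota>" unfolding tangent_space_iff assms(2)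
      using A by (auto simp: pd_def G.add G.mult G.scale)
    show "xi ?A = xi A"
    proof (rule ext, rule ext)
      fix f x show "xi ?A f x = xi A f x"
        by (cases "f \<in> \<O>"; cases "x \<in> PX") (simp_all add: xi_apply orb_in)
    qed
  qed
  note ex = this
  show ?thesis
    unfolding Lie_def fundamental_field_xi[OF assms(1)]
  proof (intro equalityI subsetI)
    fix D assume "D \<in> xi ` tangent_space Y \<iota>"
    then obtain A where A: "D = xi A" "A \<in> tangent_space Y \<iota>" by (rule imageE)
    have "pd R \<iota> A" using A(2) unfolding tangent_space_iff assms(2) by (rule conjunct1)
    then show "D \<in> {xi A | A. pd R \<iota> A}" using A(1) by (intro CollectI exI conjI)
  next
    fix D assume "D \<in> {xi A | A. pd R \<iota> A}"
    then obtain A where A: "D = xi A" "pd R \<iota> A" by (elim CollectE exE conjE)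
    from ex[OF A(2)] obtain A' where A': "A' \<in> tangent_space Y \<iota>" "xi A' = xi A" by (rule bexE)
    show "D \<in> xi ` tangent_space Y \<iota>" by (rule image_eqI[OF _ A'(1)]) (simp only: A(1) A'(2))
  qed
qed

lemma (in aff) algebraic_subgroup_action:
  assumes "algebraic_subgroup X G" and conn: "connected_space (zariski_topology G)"
  shows "\<exists>C. connected_action X (pts G) (reg G) C"
proof -
  let ?H = "(Aut X)\<lparr>carrier := pts G\<rparr>"
  have sub: "subgroup (pts G) (Aut X)" and ag: "algebraic_group ?H G"
    and mor: "morphism (prod_variety G X) X (\<lambda>(g, x). g x)"
    using assms(1) by (auto simp: algebraic_subgroup_def)
  have grp: "group ?H" and aG: "affine_variety G"
    and mm: "morphism (prod_variety G G) G (\<lambda>(g, h). g \<otimes>\<^bsub>?H\<^esub> h)" and mi: "morphism G G (\<lambda>g. inv\<^bsub>?H\<^esub> g)"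
    using ag by (auto simp: algebraic_group_def)
  obtain C where C: "finite C" "\<forall>f\<in>C. \<forall>x. x \<notin> pts G \<longrightarrow> f x = 0" "reg G = alg_gen (pts G) C"
    using affine_variety_spectrum[OF aG] by auto
  interpret F: function_algebra "pts G" "reg G"
    unfolding C(3) by (rule function_algebra_alg_gen) (use C(2) in blast)
  have comul: "\<exists>(n::nat) a b. (\<forall>i<n. a i \<in> reg G \<and> b i \<in> reg G) \<and>
      (\<forall>g\<in>pts G. \<forall>h\<in>pts G. f (g \<otimes>\<^bsub>?H\<^esub> h) = (\<Sum>i<n. a i g * b i h))" if "f \<in> reg G" for f
  proof -
    have "pullback (prod_variety G G) (\<lambda>(g, h). g \<otimes>\<^bsub>?H\<^esub> h) f \<in> reg (prod_variety G G)"
      using mm that by (auto simp only: morphism_def)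
    note * = iffD1[OF prod_variety_expand this]
    from * obtain n :: nat and a b where ab: "\<forall>i<n. a i \<in> reg G \<and> b i \<in> reg G"
      "pullback (prod_variety G G) (\<lambda>(g, h). g \<otimes>\<^bsub>?H\<^esub> h) f = (\<lambda>(x, y). \<Sum>i<n. a i x * b i y)"
      using F.scale by auto
    have "f (g \<otimes>\<^bsub>?H\<^esub> h) = (\<Sum>i<n. a i g * b i h)" if "g \<in> pts G" "h \<in> pts G" for g h
      using fun_cong[OF ab(2), of "(g, h)"] that by (simp add: pullback_def zero_outside_def prod_variety_def)
    then show ?thesis using ab(1) by auto
  qed
  have "\<exists>(n::nat) a b. (\<forall>i<n. a i \<in> reg G \<and> b i \<in> \<O>) \<and>
      (\<forall>g\<in>pts G. \<forall>x\<in>PX. f (g x) = (\<Sum>i<n. a i g * b i x))" if "f \<in> \<O>" for f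
  proof -
    have "pullback (prod_variety G X) (\<lambda>(g, x). g x) f \<in> reg (prod_variety G X)"
      using mor that by (auto simp only: morphism_def)
    note * = iffD1[OF prod_variety_expand this]
    from * obtain n :: nat and a b where ab: "\<forall>i<n. a i \<in> reg G \<and> b i \<in> \<O>"
      "pullback (prod_variety G X) (\<lambda>(g, x). g x) f = (\<lambda>(x, y). \<Sum>i<n. a i x * b i y)"
      using F.scale by auto
    have "f (g x) = (\<Sum>i<n. a i g * b i x)" if "g \<in> pts G" "x \<in> PX" for g x
      using fun_cong[OF ab(2), of "(g, x)"] that by (simp add: pullback_def zero_outside_def prod_variety_def)
    then show ?thesis using ab(1) by auto
  qed
  note coact = this
  have fg: "function_group ?H (reg G)"
  proof (intro function_group.intro function_group_axioms.intro grp)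
    show "function_algebra (carrier ?H) (reg G)" using F.function_algebra_axioms by simp
    show "zero_outside (carrier ?H) (\<lambda>g. f (inv\<^bsub>?H\<^esub> g)) \<in> reg G" if "f \<in> reg G" for f
      using mi that by (simp add: morphism_def pullback_def)
  qed (use comul in simp)
  have "\<lparr>pts = pts G, reg = reg G\<rparr> = G" by (cases G) simp
  then have "connected_space (zariski_topology \<lparr>pts = pts G, reg = reg G\<rparr>)" using conn by (simp only:)
  then have "connected_function_group ?H (reg G) C"
    using C fg by (intro connected_function_group.intro algebraic_function_group.intro
        connected_function_group_axioms.intro algebraic_function_group_axioms.intro) simp_all
  moreover have "action X (pts G) (reg G)"
    by (intro action.intro action_axioms.intro aff_axioms sub fg coact)
  ultimately show ?thesis
    by (intro exI[of _ C] connected_action.intro connected_action_axioms.intro)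
qed

locale family = aff X
  for X :: "('a, 'k::{alg_closed_field,field_char_0}) variety" +
  fixes I :: "'i set" and Gi :: "'i \<Rightarrow> ('a \<Rightarrow> 'a, 'k) variety" and C :: "'i \<Rightarrow> (('a \<Rightarrow> 'a) \<Rightarrow> 'k) set"
  assumes ca: "i \<in> I \<Longrightarrow> connected_action X (pts (Gi i)) (reg (Gi i)) (C i)"
    and chars: "i \<in> I \<Longrightarrow> is_char (pts (Gi i)) (reg (Gi i)) \<chi> \<Longrightarrow> \<exists>x\<in>pts (Gi i). \<forall>f\<in>reg (Gi i). \<chi> f = f x"
    and LV: "i \<in> I \<Longrightarrow> Lie X (Gi i) \<subseteq> Vec X"
    and lf: "i \<in> I \<Longrightarrow> locally_finite X (Lie X (Gi i))"
begin

abbreviation "Q i \<equiv> pts (Gi i)"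
abbreviation "RR i \<equiv> reg (Gi i)"

definition "L = lie_generated X (\<Union>i\<in>I. Lie X (Gi i))"
definition "Gt = generate (Aut X) (\<Union>i\<in>I. Q i)"

lemma Lie_xi: "i \<in> I \<Longrightarrow> Lie X (Gi i) = {action.xi X (Q i) A | A. pd (RR i) \<iota> A}"
  using action.Lie_eq[OF connected_action.axioms(1)[OF ca]] by simp

lemma UV: "(\<Union>i\<in>I. Lie X (Gi i)) \<subseteq> Vec X" using LV by blast

lemma L_props: "lie_subalgebra X L" "i \<in> I \<Longrightarrow> Lie X (Gi i) \<subseteq> L" "L \<subseteq> Vec X" "vec_vs.subspace L"
  "D \<in> L \<Longrightarrow> E \<in> L \<Longrightarrow> lie_bracket D E \<in> L"
proof -
  show s: "lie_subalgebra X L" unfolding L_def by (rule lie_generated_props(1)[OF UV])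
  show "i \<in> I \<Longrightarrow> Lie X (Gi i) \<subseteq> L" unfolding L_def using lie_generated_props(2)[OF UV] by blast
  show "L \<subseteq> Vec X" "vec_vs.subspace L" "D \<in> L \<Longrightarrow> E \<in> L \<Longrightarrow> lie_bracket D E \<in> L"
    using s by (auto simp: lie_subalgebra_def)
qed

lemma QA: "i \<in> I \<Longrightarrow> g \<in> Q i \<Longrightarrow> g \<in> carrier (Aut X)"
  using action.QA[OF connected_action.axioms(1)[OF ca]] by blast

lemma Gt_subgroup: "subgroup Gt (Aut X)"
  unfolding Gt_def by (rule A.generate_is_subgroup) (use QA in blast)

lemma Gt_closed: "g \<in> Gt \<Longrightarrow> h \<in> Gt \<Longrightarrow> g \<odot> h \<in> Gt" "g \<in> Gt \<Longrightarrow> invX g \<in> Gt" "\<iota> \<in> Gt"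
  "g \<in> Gt \<Longrightarrow> g \<in> carrier (Aut X)" "i \<in> I \<Longrightarrow> g \<in> Q i \<Longrightarrow> g \<in> Gt"
  using Gt_subgroup by (auto simp: subgroup.m_closed subgroup.m_inv_closed subgroup.one_closed
      subgroup.mem_carrier Gt_def intro: generate.incl)

lemma Gt_induct [consumes 1, case_names one mem mult]:
  assumes "g \<in> Gt" "P \<iota>" "\<And>i g. i \<in> I \<Longrightarrow> g \<in> Q i \<Longrightarrow> P g"
    "\<And>g h. g \<in> Gt \<Longrightarrow> h \<in> Gt \<Longrightarrow> P g \<Longrightarrow> P h \<Longrightarrow> P (g \<odot> h)"
  shows "P g"
  using assms(1) unfolding Gt_def
proof (induction rule: generate.induct)
  case (inv h)
  then obtain i where i: "i \<in> I" "h \<in> Q i" by auto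
  then show ?case using assms(3)[OF i(1) action.Q_closed(2)[OF connected_action.axioms(1)[OF ca[OF i(1)]] i(2)]] by blast
next
  case (eng g h)
  then show ?case using assms(4)[of g h] by (simp add: Gt_def)
qed (use assms(2,3) in auto)

lemma Gt_stable:
  assumes "\<And>i g v. i \<in> I \<Longrightarrow> g \<in> Q i \<Longrightarrow> v \<in> V \<Longrightarrow> T g v \<in> V"
    and "\<And>v. v \<in> V \<Longrightarrow> T \<iota> v = v"
    and "\<And>g h v. g \<in> carrier (Aut X) \<Longrightarrow> h \<in> carrier (Aut X) \<Longrightarrow> T (g \<odot> h) v = T h (T g v)"
    and "g \<in> Gt" "v \<in> V"
  shows "T g v \<in> V"
proof -
  have "\<forall>v\<in>V. T g v \<in> V"
    using assms(4)
  proof (induction rule: Gt_induct)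
    case (mult g h)
    then show ?case using assms(3)[of g h] Gt_closed(4) by simp
  qed (use assms(1,2) in auto)
  then show ?thesis using assms(5) by blast
qed

lemma Ad_L:
  assumes fd: "finite_dimensional vscale L" and g: "g \<in> Gt" and E: "E \<in> L"
  shows "Ad g E \<in> L"
proof (rule Gt_stable[where T = Ad and V = L, OF _ _ _ g E])
  fix i g E assume i: "i \<in> I" and g: "g \<in> Q i" and E: "E \<in> L"
  interpret i: connected_action X "Q i" "RR i" "C i" by (rule ca[OF i])
  show "Ad g E \<in> L"
  proof (rule i.Ad_stable[OF fd L_props(3) _ g E])
    fix A E assume "pd (RR i) \<iota> A" "E \<in> L"
    then show "lie_bracket (i.xi A) E \<in> L" using L_props(2)[OF i] Lie_xi[OF i] by (intro L_props(5)) auto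
  qed
qed (use Ad_one L_props(3) Ad_mult in auto)

abbreviation "conjugates \<equiv> {Ad p E | p E. p \<in> Gt \<and> E \<in> (\<Union>i\<in>I. Lie X (Gi i))}"

text \<open>The span of the conjugates is stable under the groups, hence under their Lie algebras, hence
  a Lie algebra.\<close>

lemma L_span_conjugates:
  assumes fd: "finite_dimensional vscale L"
  shows "L = vec_vs.span conjugates"
proof
  let ?M = "vec_vs.span conjugates"
  have cL: "conjugates \<subseteq> L" using Ad_L[OF fd] L_props(2) by auto
  show M_sub: "?M \<subseteq> L" using cL L_props(4) by (rule vec_vs.span_minimal)
  have MV: "?M \<subseteq> Vec X" using M_sub L_props(3) by blast
  have fM: "finite_dimensional vscale ?M"
    by (rule vec_vs.finite_dimensional_subspace[OF fd _ M_sub]) simp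
  have AdM: "Ad q E \<in> ?M" if q: "q \<in> Gt" and E: "E \<in> ?M" for q E
  proof -
    have "vec_vs.subspace {E. Ad q E \<in> ?M}"
      unfolding vec_vs.subspace_def mem_Collect_eq
      by (auto simp: Ad_linear vec_vs.span_zero intro: vec_vs.span_add vec_vs.span_scale)
    moreover have "conjugates \<subseteq> {E. Ad q E \<in> ?M}"
    proof
      fix D assume "D \<in> conjugates"
      then obtain p E where pE: "D = Ad p E" "p \<in> Gt" "E \<in> (\<Union>i\<in>I. Lie X (Gi i))" by blast
      have "Ad q D = Ad (p \<odot> q) E" unfolding pE(1) by (rule Ad_mult[symmetric]) (use pE q Gt_closed(4) in auto)
      moreover have "Ad (p \<odot> q) E \<in> conjugates" using pE Gt_closed(1)[OF pE(2) q] by blast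
      ultimately show "D \<in> {E. Ad q E \<in> ?M}" by (simp add: vec_vs.span_base)
    qed
    ultimately have "?M \<subseteq> {E. Ad q E \<in> ?M}" by (intro vec_vs.span_minimal)
    then show ?thesis using E by blast
  qed
  have br: "lie_bracket E N \<in> ?M" if i: "i \<in> I" and E: "E \<in> Lie X (Gi i)" and N: "N \<in> ?M" for i E N
  proof -
    interpret i: connected_action X "Q i" "RR i" "C i" by (rule ca[OF i])
    obtain A where A: "pd (RR i) \<iota> A" "E = i.xi A" using E Lie_xi[OF i] by auto
    show ?thesis unfolding A(2)
      by (rule i.Ad_stable_imp_bracket_stable[OF fM MV _ A(1) N]) (use AdM Gt_closed(5)[OF i] in blast)
  qed
  have br2: "lie_bracket D N \<in> ?M" if D: "D \<in> ?M" and N: "N \<in> ?M" for D N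
  proof -
    have NV: "N \<in> Vec X" using N MV by blast
    have add: "lie_bracket (D + E) N = lie_bracket D N + lie_bracket E N" if "D \<in> Vec X" "E \<in> Vec X" for D E
    proof
      fix f show "lie_bracket (D + E) N f = (lie_bracket D N + lie_bracket E N) f"
        by (cases "f \<in> \<O>") (simp_all add: lie_bracket_def VecD[OF NV] VecD[OF that(1)] VecD[OF that(2)])
    qed
    have scl: "lie_bracket (vscale c D) N = vscale c (lie_bracket D N)" if "D \<in> Vec X" for D c
    proof
      fix f show "lie_bracket (vscale c D) N f = vscale c (lie_bracket D N) f"
        by (cases "f \<in> \<O>") (simp_all add: lie_bracket_def vscale_apply VecD[OF NV] VecD[OF that]
            fun_vs.scale_right_diff_distrib)
    qed
    have zer: "lie_bracket 0 N = 0" by (rule ext) (simp add: lie_bracket_def VecD[OF NV])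
    have "vec_vs.subspace {D \<in> Vec X. lie_bracket D N \<in> ?M}"
    proof (rule vec_vs.subspaceI)
      have "lie_bracket 0 N \<in> ?M" unfolding zer by (rule vec_vs.span_zero)
      then show "0 \<in> {D \<in> Vec X. lie_bracket D N \<in> ?M}"
        by (intro CollectI conjI vec_vs.subspace_0[OF subspace_Vec])
      fix D E assume D: "D \<in> {D \<in> Vec X. lie_bracket D N \<in> ?M}"
      then have D': "D \<in> Vec X" "lie_bracket D N \<in> ?M" by blast+
      show "vscale c D \<in> {D \<in> Vec X. lie_bracket D N \<in> ?M}" for c
      proof (intro CollectI conjI vec_vs.subspace_scale[OF subspace_Vec] D'(1))
        show "lie_bracket (vscale c D) N \<in> ?M" unfolding scl[OF D'(1)] by (rule vec_vs.span_scale[OF D'(2)])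
      qed
      assume E: "E \<in> {D \<in> Vec X. lie_bracket D N \<in> ?M}"
      then have "D + E \<in> Vec X" using D vec_vs.subspace_add[OF subspace_Vec] by blast
      moreover have "lie_bracket D N + lie_bracket E N \<in> ?M" using D E by (intro vec_vs.span_add) blast+
      moreover have "lie_bracket (D + E) N = lie_bracket D N + lie_bracket E N" using add D E by blast
      ultimately show "D + E \<in> {D \<in> Vec X. lie_bracket D N \<in> ?M}" by (intro CollectI conjI) (simp_all only:)
    qed
    moreover have "conjugates \<subseteq> {D \<in> Vec X. lie_bracket D N \<in> ?M}"
    proof
      fix D assume "D \<in> conjugates"
      then obtain p E i where pE: "D = Ad p E" "p \<in> Gt" "i \<in> I" "E \<in> Lie X (Gi i)" by blast
      have pA: "p \<in> carrier (Aut X)" and EV: "E \<in> Vec X" using pE Gt_closed(4) LV by auto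
      have "Ad (invX p) N \<in> ?M" by (rule AdM[OF Gt_closed(2)[OF pE(2)] N])
      then have 1: "Ad p (lie_bracket E (Ad (invX p) N)) \<in> ?M" using AdM[OF pE(2)] br[OF pE(3,4)] by blast
      have "Ad p (lie_bracket E (Ad (invX p) N)) = lie_bracket (Ad p E) (Ad p (Ad (invX p) N))"
        by (rule Ad_bracket[OF pA EV Ad_Vec[OF _ NV]]) (use pA in simp)
      then have "lie_bracket D N \<in> ?M" using 1 Ad_inv[OF pA NV] pE(1) by simp
      then show "D \<in> {D \<in> Vec X. lie_bracket D N \<in> ?M}" using Ad_Vec[OF pA EV] pE(1) by simp
    qed
    ultimately have "?M \<subseteq> {D \<in> Vec X. lie_bracket D N \<in> ?M}" by (intro vec_vs.span_minimal)
    then show ?thesis using D by blast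
  qed
  have "lie_subalgebra X ?M" using MV br2 by (simp add: lie_subalgebra_def)
  moreover have "(\<Union>i\<in>I. Lie X (Gi i)) \<subseteq> ?M"
  proof
    fix E assume E: "E \<in> (\<Union>i\<in>I. Lie X (Gi i))"
    then have "Ad \<iota> E = E" using Ad_one UV by blast
    then have "E \<in> conjugates" using E Gt_closed(3) by force
    then show "E \<in> ?M" by (rule vec_vs.span_base)
  qed
  ultimately show "L \<subseteq> ?M" unfolding L_def by (rule lie_generated_props(3)[OF UV])
qed

end

locale conjugate_basis = family X I Gi C
  for X :: "('a, 'k::{alg_closed_field,field_char_0}) variety" and I :: "'i set" and Gi C +
  fixes d :: nat and p :: "nat \<Rightarrow> 'a \<Rightarrow> 'a" and ix :: "nat \<Rightarrow> 'i" and E :: "nat \<Rightarrow> ('a \<Rightarrow> 'k) \<Rightarrow> 'a \<Rightarrow> 'k"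
  assumes p: "j < d \<Longrightarrow> p j \<in> Gt" and ix: "j < d \<Longrightarrow> ix j \<in> I" and E: "j < d \<Longrightarrow> E j \<in> Lie X (Gi (ix j))"
    and Lspan: "L = vec_vs.span ((\<lambda>j. Ad (p j) (E j)) ` {..<d})"
begin

definition "e j = Ad (p j) (E j)"

lemma pA: "j < d \<Longrightarrow> p j \<in> carrier (Aut X)" using p Gt_closed(4) by blast

lemma EV: "j < d \<Longrightarrow> E j \<in> Vec X" using E ix LV by blast

lemma L_e: "L = vec_vs.span (e ` {..<d})" using Lspan by (simp add: e_def[abs_def])

lemma e_L: "j < d \<Longrightarrow> e j \<in> L" unfolding L_e by (rule vec_vs.span_base) simp

lemma e_Vec: "j < d \<Longrightarrow> e j \<in> Vec X" using e_L L_props(3) by blast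

lemma L_fd: "finite_dimensional vscale L"
  unfolding finite_dimensional_def L_e by blast

lemma L_combination: "D \<in> L \<Longrightarrow> \<exists>c. D = (\<Sum>k<d. vscale (c k) (e k))"
  unfolding L_e by (rule vec_vs.span_image_lessThan)

lemma vsum_apply: "(\<Sum>k\<in>S. vscale (c k) (e k)) f = (\<Sum>k\<in>S. fscale (c k) (e k f))"
  by (simp add: sum_fun_apply vscale_apply)

lemma L_apply_span:
  assumes "D \<in> L" shows "D f \<in> fun_vs.span {e k f | k. k < d}"
proof -
  obtain c where c: "D = (\<Sum>k<d. vscale (c k) (e k))" using L_combination[OF assms] by blast
  show ?thesis unfolding c vsum_apply
    by (intro fun_vs.span_sum fun_vs.span_scale fun_vs.span_base) blast
qed

sublocale ops: lie_operators \<O> e d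
proof
  show "fun_vs.subspace \<O>" by (rule O.subspace)
  fix i j v assume ij: "i < d" "j < d"
  show "e i (e j v) - e j (e i v) \<in> fun_vs.span {e k v | k. k < d}"
    using L_apply_span[OF L_props(5)[OF e_L[OF ij(1)] e_L[OF ij(2)]], of v] by (simp only: lie_bracket_def)
qed (simp_all add: VecD[OF e_Vec])

lemma e_locally_finite:
  assumes j: "j < d" and v: "v \<in> \<O>"
  shows "\<exists>W\<subseteq>\<O>. finite_dimensional fscale W \<and> v \<in> W \<and> e j ` W \<subseteq> W"
proof -
  let ?p = "p j"
  have pj: "?p \<in> carrier (Aut X)" by (rule pA[OF j])
  have v': "act (invX ?p) v \<in> \<O>" by (rule act_in) (use pj v in auto)
  obtain W where W: "W \<subseteq> \<O>" "finite_dimensional fscale W" "act (invX ?p) v \<in> W"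
    "\<forall>D\<in>Lie X (Gi (ix j)). D ` W \<subseteq> W"
    using lf[OF ix[OF j]] v' unfolding locally_finite_def by meson
  have hom: "module_hom fscale fscale (act ?p)"
    by (intro module_hom.intro module_hom_axioms.intro fun_vs.module_axioms) (simp_all add: act_hom)
  obtain B where B: "finite B" "W = fun_vs.span B" using W(2) by (auto simp: finite_dimensional_def)
  have "act ?p ` W = fun_vs.span (act ?p ` B)" unfolding B(2) by (rule module_hom.span_image[OF hom, symmetric])
  then have "finite_dimensional fscale (act ?p ` W)" using B(1) by (auto simp: finite_dimensional_def)
  moreover have "act ?p ` W \<subseteq> \<O>" using W(1) act_in[OF pj] by blast
  moreover have "v \<in> act ?p ` W" using act_inv(1)[OF pj v] W(3) by (metis imageI)
  moreover have "e j ` (act ?p ` W) \<subseteq> act ?p ` W"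
  proof (intro image_subsetI)
    fix u assume "u \<in> act ?p ` W"
    then obtain w where w: "w \<in> W" "u = act ?p w" by blast
    have wO: "w \<in> \<O>" using w W(1) by blast
    have "e j u = act ?p (E j w)" unfolding e_def w(2)
      by (simp add: Ad_apply(1)[OF act_in[OF pj wO]] act_inv(2)[OF pj wO])
    moreover have "E j w \<in> W" using W(4) E[OF j] w(1) by blast
    ultimately show "e j u \<in> act ?p ` W" by simp
  qed
  ultimately show ?thesis by (intro exI[of _ "act ?p ` W"] conjI)
qed

lemma L_locally_finite: "locally_finite X L"
  unfolding locally_finite_def
proof
  fix v assume v: "v \<in> \<O>"
  obtain W where W: "W \<subseteq> \<O>" "finite_dimensional fscale W" "v \<in> W" "\<forall>i<d. e i ` W \<subseteq> W"
    using ops.locally_finite_of_generators[OF e_locally_finite v] by blast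
  have Ws: "fun_vs.subspace W" using W(2) by (auto simp: finite_dimensional_def)
  have "D w \<in> W" if D: "D \<in> L" and w: "w \<in> W" for D w
  proof -
    have "fun_vs.span {e k w | k. k < d} \<subseteq> W" by (rule fun_vs.span_minimal[OF _ Ws]) (use W(4) w in auto)
    then show ?thesis using L_apply_span[OF D] by (rule subsetD)
  qed
  then show "\<exists>V\<subseteq>\<O>. finite_dimensional fscale V \<and> v \<in> V \<and> (\<forall>D\<in>L. D ` V \<subseteq> V)" using W by (intro exI[of _ W]) auto
qed

end

lemma (in family) exists_conjugate_basis:
  assumes fd: "finite_dimensional vscale L"
  shows "\<exists>d p ix E. conjugate_basis X I Gi C d p ix E"
proof -
  obtain B where B: "finite B" "B \<subseteq> conjugates" "vec_vs.span B = L"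
    using vec_vs.finite_dimensional_spanning_subset[of conjugates] fd L_span_conjugates[OF fd] by auto
  obtain bs where bs: "set bs = B" using B(1) finite_list by blast
  have "\<forall>j\<in>{..<length bs}. \<exists>q. bs ! j = Ad (fst q) (snd (snd q)) \<and> fst q \<in> Gt \<and> fst (snd q) \<in> I \<and>
      snd (snd q) \<in> Lie X (Gi (fst (snd q)))"
  proof
    fix j assume "j \<in> {..<length bs}"
    then have "bs ! j \<in> conjugates" using bs B(2) nth_mem by blast
    then obtain p D i where "bs ! j = Ad p D" "p \<in> Gt" "i \<in> I" "D \<in> Lie X (Gi i)" by blast
    then show "\<exists>q. bs ! j = Ad (fst q) (snd (snd q)) \<and> fst q \<in> Gt \<and> fst (snd q) \<in> I \<and>
      snd (snd q) \<in> Lie X (Gi (fst (snd q)))" by (intro exI[of _ "(p, i, D)"]) simp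
  qed
  from bchoice[OF this] obtain q where q: "\<forall>j\<in>{..<length bs}. bs ! j = Ad (fst (q j)) (snd (snd (q j))) \<and> fst (q j) \<in> Gt \<and>
      fst (snd (q j)) \<in> I \<and> snd (snd (q j)) \<in> Lie X (Gi (fst (snd (q j))))" ..
  have "(\<lambda>j. Ad (fst (q j)) (snd (snd (q j)))) ` {..<length bs} = (\<lambda>j. bs ! j) ` {..<length bs}"
    by (rule image_cong) (use q in auto)
  also have "\<dots> = B" using bs by (auto simp: set_conv_nth)
  finally have "L = vec_vs.span ((\<lambda>j. Ad (fst (q j)) (snd (snd (q j)))) ` {..<length bs})" using B(3) by simp
  then have "conjugate_basis X I Gi C (length bs) (\<lambda>j. fst (q j)) (\<lambda>j. fst (snd (q j))) (\<lambda>j. snd (snd (q j)))"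
    using q by (intro conjugate_basis.intro conjugate_basis_axioms.intro family_axioms) auto
  then show ?thesis by blast
qed

lemma (in family) locally_finite_iff: "locally_finite X L \<longleftrightarrow> finite_dimensional vscale L"
proof
  assume "locally_finite X L"
  then show "finite_dimensional vscale L" by (rule locally_finite_imp_finite_dimensional[OF L_props(3,4)])
next
  assume "finite_dimensional vscale L"
  then obtain d p ix E where "conjugate_basis X I Gi C d p ix E" using exists_conjugate_basis by blast
  then show "locally_finite X L" by (rule conjugate_basis.L_locally_finite)
qed

section \<open>The algebra of functions of the generated group\<close>

text \<open>Membership in the image of \<open>S \<otimes> T\<close>. Lists of pure tensors are used as witnesses because sums
  and products of functions correspond to concatenations and to lists of pairwise products.\<close>

definition tens :: "('a \<Rightarrow> 'k::field) set \<Rightarrow> ('b \<Rightarrow> 'k) set \<Rightarrow> 'a set \<Rightarrow> 'b set \<Rightarrow> ('a \<Rightarrow> 'b \<Rightarrow> 'k) \<Rightarrow> bool"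
  where "tens S T P Q F \<longleftrightarrow> (\<exists>ps. set ps \<subseteq> S \<times> T \<and> (\<forall>x\<in>P. \<forall>y\<in>Q. F x y = (\<Sum>(a, b)\<leftarrow>ps. a x * b y)))"

lemma tens_sum:
  assumes "finite J" "\<And>j. j \<in> J \<Longrightarrow> a j \<in> S" "\<And>j. j \<in> J \<Longrightarrow> b j \<in> T"
    "\<And>x y. x \<in> P \<Longrightarrow> y \<in> Q \<Longrightarrow> F x y = (\<Sum>j\<in>J. a j x * b j y)"
  shows "tens S T P Q F"
proof -
  obtain js where js: "set js = J" "distinct js" using finite_distinct_list[OF assms(1)] by blast
  have "(\<Sum>j\<in>J. a j x * b j y) = (\<Sum>(a, b)\<leftarrow>map (\<lambda>j. (a j, b j)) js. a x * b y)" for x y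
    unfolding js(1)[symmetric] sum.distinct_set_conv_list[OF js(2)] by (simp add: comp_def)
  then show ?thesis unfolding tens_def
    by (intro exI[of _ "map (\<lambda>j. (a j, b j)) js"] conjI) (use assms(2-4) js(1) in auto)
qed

lemma tens_add:
  assumes "tens S T P Q F" "tens S T P Q G" shows "tens S T P Q (\<lambda>x y. F x y + G x y)"
proof -
  obtain ps qs where "set ps \<subseteq> S \<times> T" "\<forall>x\<in>P. \<forall>y\<in>Q. F x y = (\<Sum>(a, b)\<leftarrow>ps. a x * b y)"
    "set qs \<subseteq> S \<times> T" "\<forall>x\<in>P. \<forall>y\<in>Q. G x y = (\<Sum>(a, b)\<leftarrow>qs. a x * b y)"
    using assms unfolding tens_def by blast
  then show ?thesis unfolding tens_def by (intro exI[of _ "ps @ qs"]) auto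
qed

lemma tens_mult:
  assumes "tens S T P Q F" "tens S T P Q G"
    and cl: "\<And>a b. a \<in> S \<Longrightarrow> b \<in> S \<Longrightarrow> a * b \<in> S" "\<And>a b. a \<in> T \<Longrightarrow> b \<in> T \<Longrightarrow> a * b \<in> T"
  shows "tens S T P Q (\<lambda>x y. F x y * G x y)"
proof -
  obtain ps qs where pq: "set ps \<subseteq> S \<times> T" "\<forall>x\<in>P. \<forall>y\<in>Q. F x y = (\<Sum>(a, b)\<leftarrow>ps. a x * b y)"
    "set qs \<subseteq> S \<times> T" "\<forall>x\<in>P. \<forall>y\<in>Q. G x y = (\<Sum>(a, b)\<leftarrow>qs. a x * b y)"
    using assms(1,2) unfolding tens_def by blast
  have "\<exists>rs. set rs \<subseteq> S \<times> T \<and> (\<forall>x y. (\<Sum>(a, b)\<leftarrow>ps. a x * b y) * (\<Sum>(a, b)\<leftarrow>qs. a x * b y) = (\<Sum>(a, b)\<leftarrow>rs. a x * b y))"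
    using pq(1)
  proof (induction ps)
    case (Cons p ps)
    obtain a b where p: "p = (a, b)" by (cases p)
    obtain rs where rs: "set rs \<subseteq> S \<times> T"
      "\<And>x y. (\<Sum>(a, b)\<leftarrow>ps. a x * b y) * (\<Sum>(a, b)\<leftarrow>qs. a x * b y) = (\<Sum>(a, b)\<leftarrow>rs. a x * b y)"
      using Cons by auto
    let ?m = "map (\<lambda>(a', b'). (a * a', b * b')) qs"
    have "(\<Sum>(a', b')\<leftarrow>?m. a' x * b' y) = a x * b y * (\<Sum>(a', b')\<leftarrow>qs. a' x * b' y)" for x y
      by (induction qs) (auto simp: algebra_simps)
    moreover have "set ?m \<subseteq> S \<times> T" using cl pq(3) Cons.prems p by auto
    ultimately show ?case using rs p by (intro exI[of _ "?m @ rs"]) (auto simp: algebra_simps)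
  qed (auto intro!: exI[of _ "[]"])
  then show ?thesis using pq(2,4) unfolding tens_def by auto
qed

lemma tens_expand:
  assumes "tens S T P Q F"
  shows "\<exists>(n::nat) a b. (\<forall>i<n. a i \<in> S \<and> b i \<in> T) \<and> (\<forall>x\<in>P. \<forall>y\<in>Q. F x y = (\<Sum>i<n. a i x * b i y))"
proof -
  obtain ps where ps: "set ps \<subseteq> S \<times> T" "\<forall>x\<in>P. \<forall>y\<in>Q. F x y = (\<Sum>(a, b)\<leftarrow>ps. a x * b y)"
    using assms unfolding tens_def by blast
  have "(\<Sum>(a, b)\<leftarrow>ps. a x * b y) = (\<Sum>i<length ps. fst (ps ! i) x * snd (ps ! i) y)" for x y
    by (simp add: sum_list_sum_nth atLeast0LessThan case_prod_unfold)
  moreover have "ps ! i \<in> S \<times> T" if "i < length ps" for i using ps(1) nth_mem[OF that] by blast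
  then have "\<forall>i<length ps. fst (ps ! i) \<in> S \<and> snd (ps ! i) \<in> T" by (metis mem_Times_iff)
  ultimately show ?thesis using ps(2)
    by (intro exI[of _ "length ps"] exI[of _ "\<lambda>i. fst (ps ! i)"] exI[of _ "\<lambda>i. snd (ps ! i)"]) auto
qed

lemma tens_const:
  assumes "zero_outside P (\<lambda>_. c) \<in> S" "zero_outside Q (\<lambda>_. 1) \<in> T"
    "\<And>x y. x \<in> P \<Longrightarrow> y \<in> Q \<Longrightarrow> F x y = c"
  shows "tens S T P Q F"
  by (rule tens_sum[of "{()}" "\<lambda>_. zero_outside P (\<lambda>_. c)" _ "\<lambda>_. zero_outside Q (\<lambda>_. 1)"])
    (use assms in \<open>auto simp: zero_outside_apply\<close>)

text \<open>The basis \<open>B\<close> of an \<open>L\<close>-stable space that generates the coordinate ring, with coordinate functionals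
  \<open>cs w\<close>, gives matrices to the elements of the generated group.\<close>

locale generated_group = conjugate_basis X I Gi C d p ix E
  for X :: "('a, 'k::{alg_closed_field,field_char_0}) variety" and I :: "'i set" and Gi C d p ix E +
  fixes B :: "('a \<Rightarrow> 'k) set" and cs :: "('a \<Rightarrow> 'k) \<Rightarrow> ('k \<times> 'a) list"
  assumes B: "finite B" "fun_vs.span B \<subseteq> reg X" "gens \<subseteq> fun_vs.span B"
    and BL: "\<And>D f. D \<in> L \<Longrightarrow> f \<in> fun_vs.span B \<Longrightarrow> D f \<in> fun_vs.span B"
    and dual: "\<And>v w. v \<in> B \<Longrightarrow> w \<in> B \<Longrightarrow> ev (cs w) v = (if v = w then 1 else 0)"
begin

abbreviation "WB \<equiv> fun_vs.span B"

lemma span_expand: assumes "u \<in> WB" shows "u = (\<Sum>w\<in>B. fscale (ev (cs w) u) w)"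
proof -
  have "fun_vs.subspace {u. u = (\<Sum>w\<in>B. fscale (ev (cs w) u) w)}"
    by (rule fun_vs.subspaceI) (auto simp: ev_add ev_fscale fun_vs.scale_left_distrib sum.distrib
        fun_vs.scale_sum_right fun_eq_iff fscale_apply sum_fun_apply sum_distrib_left mult.assoc distrib_right)
  moreover have "B \<subseteq> {u. u = (\<Sum>w\<in>B. fscale (ev (cs w) u) w)}"
  proof
    fix v assume v: "v \<in> B"
    have "(\<Sum>w\<in>B. fscale (ev (cs w) v) w) = (\<Sum>w\<in>B. if v = w then v else 0)"
      by (intro sum.cong refl) (use v dual in \<open>auto simp: fscale_apply fun_eq_iff\<close>)
    also have "\<dots> = v" using v B(1) by (simp only: sum.delta' if_True)
    finally show "v \<in> {u. u = (\<Sum>w\<in>B. fscale (ev (cs w) u) w)}" by simp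
  qed
  ultimately have "WB \<subseteq> {u. u = (\<Sum>w\<in>B. fscale (ev (cs w) u) w)}" by (intro fun_vs.span_minimal)
  then show ?thesis using assms by blast
qed

lemma xi_L: assumes "i \<in> I" "pd (RR i) \<iota> A" shows "action.xi X (Q i) A \<in> L"
proof -
  have "action.xi X (Q i) A \<in> Lie X (Gi i)" unfolding Lie_xi[OF assms(1)] using assms(2) by (intro CollectI exI[of _ A]) simp
  then show ?thesis using L_props(2)[OF assms(1)] by (rule subsetD[rotated])
qed

lemma act_B:
  assumes g: "g \<in> Gt" and f: "f \<in> WB" shows "act g f \<in> WB"
proof (rule Gt_stable[where T = act and V = WB, OF _ _ _ g f])
  fix i g f assume i: "i \<in> I" and g: "g \<in> Q i" and f: "f \<in> WB"
  interpret i: connected_action X "Q i" "RR i" "C i" by (rule ca[OF i])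
  show "act g f \<in> WB"
  proof (rule i.act_stable[OF B(1,2) _ g f])
    fix A f assume "pd (RR i) \<iota> A" "f \<in> WB"
    then show "i.xi A f \<in> WB" by (intro BL[OF xi_L[OF i]])
  qed
next
  show "act \<iota> v = v" if "v \<in> WB" for v by (rule act_one[OF subsetD[OF B(2) that]])
qed (rule act_mult)

lemma ev_act:
  assumes "u \<in> WB"
  shows "ev c (act g u) = (\<Sum>v\<in>B. ev (cs v) u * ev c (act g v))"
proof -
  have "act g (\<Sum>v\<in>S. fscale (ev (cs v) u) v) = (\<Sum>v\<in>S. fscale (ev (cs v) u) (act g v))" if "finite S" for S
    using that
  proof (induction S rule: finite_induct)
    case (insert x F)
    then show ?case by (simp only: sum.insert act_hom not_False_eq_True)
  qed (simp only: sum.empty act_hom)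
  from this[OF B(1)] have "act g u = (\<Sum>v\<in>B. fscale (ev (cs v) u) (act g v))"
    unfolding span_expand[OF assms, symmetric] .
  then show ?thesis by (simp add: ev_sum ev_fscale)
qed

definition "mf f w = zero_outside Gt (\<lambda>g. ev (cs w) (act g f))"
definition "mi f w = zero_outside Gt (\<lambda>g. ev (cs w) (act (invX g) f))"
definition "CC = (\<lambda>(f, w). mf f w) ` (B \<times> B) \<union> (\<lambda>(f, w). mi f w) ` (B \<times> B)"
definition "R = alg_gen Gt CC"

lemma CC: "finite CC" "f \<in> CC \<Longrightarrow> x \<notin> Gt \<Longrightarrow> f x = 0"
  using B(1) by (auto simp: CC_def mf_def mi_def zero_outside_def)

sublocale R: function_algebra Gt R
  unfolding R_def by (rule function_algebra_alg_gen) (rule CC(2))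

lemma m_in: "v \<in> B \<Longrightarrow> w \<in> B \<Longrightarrow> mf v w \<in> R" "v \<in> B \<Longrightarrow> w \<in> B \<Longrightarrow> mi v w \<in> R"
  unfolding R_def by (auto intro!: alg_gen.gen simp: CC_def)

lemma R_induct [consumes 1, case_names const mf mi add mult]:
  assumes "r \<in> R" "\<And>c. P (zero_outside Gt (\<lambda>_. c))" "\<And>v w. v \<in> B \<Longrightarrow> w \<in> B \<Longrightarrow> P (mf v w)"
    "\<And>v w. v \<in> B \<Longrightarrow> w \<in> B \<Longrightarrow> P (mi v w)"
    "\<And>f g. f \<in> R \<Longrightarrow> g \<in> R \<Longrightarrow> P f \<Longrightarrow> P g \<Longrightarrow> P (f + g)"
    "\<And>f g. f \<in> R \<Longrightarrow> g \<in> R \<Longrightarrow> P f \<Longrightarrow> P g \<Longrightarrow> P (f * g)"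
  shows "P r"
  using assms(1) unfolding R_def
proof (induction rule: alg_gen_induct)
  case (gen f)
  then show ?case using assms(3,4) by (auto simp: CC_def)
next
  case (add f g)
  then have "P (f + g)" by (intro assms(5)) (simp_all only: R_def)
  then show ?case .
next
  case (mult f g)
  then have "P (f * g)" by (intro assms(6)) (simp_all only: R_def)
  then show ?case .
qed (rule assms(2))

lemma R_comul: assumes "r \<in> R" shows "tens R R Gt Gt (\<lambda>g h. r (g \<odot> h))"
  using assms
proof (induction rule: R_induct)
  case (const c)
  show ?case by (rule tens_const[OF R.const[of c] R.const]) (simp add: zero_outside_apply Gt_closed)
next
  case (mf v w)
  show ?case
  proof (rule tens_sum[OF B(1), where a = "\<lambda>u. mf v u" and b = "\<lambda>u. mf u w"])
    fix g h assume gh: "g \<in> Gt" "h \<in> Gt"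
    have "ev (cs w) (act (g \<odot> h) v) = (\<Sum>u\<in>B. ev (cs u) (act g v) * ev (cs w) (act h u))"
      unfolding act_mult[OF Gt_closed(4)[OF gh(1)] Gt_closed(4)[OF gh(2)]]
      by (rule ev_act) (rule act_B[OF gh(1) fun_vs.span_base[OF mf(1)]])
    then show "mf v w (g \<odot> h) = (\<Sum>u\<in>B. mf v u g * mf u w h)"
      using gh by (simp add: mf_def zero_outside_apply Gt_closed)
  qed (use mf m_in in auto)
next
  case (mi v w)
  show ?case
  proof (rule tens_sum[OF B(1), where a = "\<lambda>u. mi u w" and b = "\<lambda>u. mi v u"])
    fix g h assume gh: "g \<in> Gt" "h \<in> Gt"
    have "ev (cs w) (act (invX (g \<odot> h)) v) = (\<Sum>u\<in>B. ev (cs u) (act (invX h) v) * ev (cs w) (act (invX g) u))"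
      unfolding A.inv_mult_group[OF Gt_closed(4)[OF gh(1)] Gt_closed(4)[OF gh(2)]]
        act_mult[OF Gt_closed(4)[OF Gt_closed(2)[OF gh(2)]] Gt_closed(4)[OF Gt_closed(2)[OF gh(1)]]]
      by (rule ev_act) (rule act_B[OF Gt_closed(2)[OF gh(2)] fun_vs.span_base[OF mi(1)]])
    then show "mi v w (g \<odot> h) = (\<Sum>u\<in>B. mi u w g * mi v u h)"
      using gh by (simp add: mi_def zero_outside_apply Gt_closed mult.commute)
  qed (use mi m_in in auto)
next
  case (add f g)
  then show ?case using tens_add by simp
next
  case (mult f g)
  then show ?case using tens_mult[OF _ _ R.mult R.mult] by simp
qed

lemma R_inverse: assumes "r \<in> R" shows "zero_outside Gt (\<lambda>g. r (invX g)) \<in> R"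
  using assms
proof (induction rule: R_induct)
  case (const c)
  have "zero_outside Gt (\<lambda>g. zero_outside Gt (\<lambda>_. c) (invX g)) = zero_outside Gt (\<lambda>_. c)"
    by (rule zo_eq_iff) (simp add: zero_outside_apply Gt_closed)
  then show ?case using R.const by simp
next
  case (mf v w)
  have "zero_outside Gt (\<lambda>g. mf v w (invX g)) = mi v w"
    unfolding mi_def by (rule zo_eq_iff) (simp add: mf_def zero_outside_apply Gt_closed)
  then show ?case using m_in mf by simp
next
  case (mi v w)
  have "zero_outside Gt (\<lambda>g. mi v w (invX g)) = mf v w"
    unfolding mf_def by (rule zo_eq_iff) (simp add: mi_def zero_outside_apply Gt_closed)
  then show ?case using m_in mi by simp
next
  case (add f g)
  have "zero_outside Gt (\<lambda>x. (f + g) (invX x)) = zero_outside Gt (\<lambda>x. f (invX x)) + zero_outside Gt (\<lambda>x. g (invX x))"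
    by (auto simp: zero_outside_def)
  then show ?case using R.add[OF add.IH] by (simp only:)
next
  case (mult f g)
  have "zero_outside Gt (\<lambda>x. (f * g) (invX x)) = zero_outside Gt (\<lambda>x. f (invX x)) * zero_outside Gt (\<lambda>x. g (invX x))"
    by (auto simp: zero_outside_def)
  then show ?case using R.mult[OF mult.IH] by (simp only:)
qed

lemma R_coact: assumes "f \<in> \<O>" shows "tens R \<O> Gt PX (\<lambda>g x. f (g x))"
  using assms unfolding gens(3)
proof (induction rule: alg_gen_induct)
  case (const c)
  show ?case unfolding gens(3)[symmetric]
    by (rule tens_const[OF R.const[of c] O.const]) (simp add: zero_outside_apply Aut_in Gt_closed)
next
  case (gen f)
  then have f: "f \<in> WB" using B(3) by blast
  show ?case unfolding gens(3)[symmetric]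
  proof (rule tens_sum[OF B(1), where a = "\<lambda>w. zero_outside Gt (\<lambda>g. \<Sum>v\<in>B. ev (cs v) f * mf v w g)" and b = "\<lambda>w. w"])
    fix w assume w: "w \<in> B"
    have "zero_outside Gt (\<lambda>g. \<Sum>v\<in>B. ev (cs v) f * mf v w g) = (\<Sum>v\<in>B. fscale (ev (cs v) f) (mf v w))"
      by (auto simp: zero_outside_def fun_eq_iff sum_fun_apply fscale_apply mf_def)
    moreover have "(\<Sum>v\<in>B. fscale (ev (cs v) f) (mf v w)) \<in> R" by (intro R.sum R.scale m_in w)
    ultimately show "zero_outside Gt (\<lambda>g. \<Sum>v\<in>B. ev (cs v) f * mf v w g) \<in> R" by (simp only:)
    show "w \<in> \<O>" using B(2) fun_vs.span_base[OF w] by blast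
  next
    fix g x assume gx: "g \<in> Gt" "x \<in> PX"
    have "f (g x) = act g f x" using gx by (simp add: act_apply)
    also have "\<dots> = (\<Sum>w\<in>B. ev (cs w) (act g f) * w x)"
      using fun_cong[OF span_expand[OF act_B[OF gx(1) f]], of x] by (simp add: sum_fun_apply fscale_apply)
    finally show "f (g x) = (\<Sum>w\<in>B. zero_outside Gt (\<lambda>g. \<Sum>v\<in>B. ev (cs v) f * mf v w g) g * w x)"
      using gx by (simp add: ev_act[OF f] mf_def zero_outside_apply)
  qed
next
  case (add f g)
  then show ?case using tens_add by simp
next
  case (mult f g)
  show ?case using tens_mult[OF mult.IH R.mult O.mult[unfolded gens(3)]] by simp
qed

sublocale T: action X Gt R
proof (intro action.intro action_axioms.intro aff_axioms Gt_subgroup function_group.intro function_group_axioms.intro)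
  let ?H = "(Aut X)\<lparr>carrier := Gt\<rparr>"
  show "group ?H" by (rule subgroup.subgroup_is_group[OF Gt_subgroup A.is_group])
  show "function_algebra (carrier ?H) R" using R.function_algebra_axioms by simp
  show "zero_outside (carrier ?H) (\<lambda>g. f (inv\<^bsub>?H\<^esub> g)) \<in> R" if "f \<in> R" for f
  proof -
    have "zero_outside Gt (\<lambda>g. f (inv\<^bsub>?H\<^esub> g)) = zero_outside Gt (\<lambda>g. f (invX g))"
      by (rule zo_eq_iff) (simp add: Gt_subgroup)
    then show ?thesis using R_inverse[OF that] by simp
  qed
  show "\<exists>(n::nat) a b. (\<forall>i<n. a i \<in> R \<and> b i \<in> R) \<and>
      (\<forall>g\<in>carrier ?H. \<forall>h\<in>carrier ?H. f (g \<otimes>\<^bsub>?H\<^esub> h) = (\<Sum>i<n. a i g * b i h))" if "f \<in> R" for f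
    using tens_expand[OF R_comul[OF that]] by simp
  show "\<exists>(n::nat) a b. (\<forall>i<n. a i \<in> R \<and> b i \<in> \<O>) \<and> (\<forall>g\<in>Gt. \<forall>x\<in>PX. f (g x) = (\<Sum>i<n. a i g * b i x))"
    if "f \<in> \<O>" for f
    using tens_expand[OF R_coact[OF that]] .
qed

lemma zo_hom: "zero_outside S (f + g) = zero_outside S f + zero_outside S g"
  "zero_outside S (f * g) = zero_outside S f * (zero_outside S g :: _ \<Rightarrow> 'k)"
  "zero_outside S (fscale c f) = fscale c (zero_outside S f)"
  by (auto simp: zero_outside_def fun_eq_iff fscale_apply)

lemma zo_zo: "S \<subseteq> S' \<Longrightarrow> zero_outside S (zero_outside S' f) = zero_outside S f"
  by (auto simp: zero_outside_def fun_eq_iff)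

lemma Q_Gt: "i \<in> I \<Longrightarrow> Q i \<subseteq> Gt" using Gt_closed(5) by blast

lemma restrict_in:
  assumes i: "i \<in> I" and r: "r \<in> R" shows "zero_outside (Q i) r \<in> RR i"
proof -
  interpret i: connected_action X "Q i" "RR i" "C i" by (rule ca[OF i])
  have e: "zero_outside (Q i) (\<lambda>g. act g v s) = (if s \<in> PX then orb (Q i) v s else 0)" for v s
    by (auto simp: orb_def zero_outside_def fun_eq_iff act_apply)
  have BO: "v \<in> \<O>" if "v \<in> B" for v using B(2) fun_vs.span_base[OF that] by blast
  have m: "zero_outside (Q i) (\<lambda>g. ev (cs w) (act g v)) \<in> RR i" if "v \<in> B" for v w
    by (rule i.G.moving_functional) (use i.orb_in[OF BO[OF that]] i.G.zero in \<open>auto simp: e\<close>)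
  show ?thesis
    using r
  proof (induction rule: R_induct)
    case (const c)
    then show ?case unfolding zo_zo[OF Q_Gt[OF i]] by (rule i.G.const)
  next
    case (mf v w)
    show ?case unfolding mf_def zo_zo[OF Q_Gt[OF i]] by (rule m[OF mf(1)])
  next
    case (mi v w)
    have "zero_outside (Q i) (\<lambda>g. ev (cs w) (act (invX g) v)) =
        zero_outside (Q i) (\<lambda>g. zero_outside (Q i) (\<lambda>g. ev (cs w) (act g v)) (invX g))"
      by (rule zo_eq_iff) (simp add: zero_outside_apply i.Q_closed)
    then show ?case unfolding mi_def zo_zo[OF Q_Gt[OF i]] using i.inverse_in[OF m[OF mi(1)]] by simp
  next
    case (add f g)
    then show ?case unfolding zo_hom by (intro i.G.add)
  next
    case (mult f g)
    then show ?case unfolding zo_hom by (intro i.G.mult)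
  qed
qed

text \<open>Coordinates of the inverse being determined, a tangent vector at the identity is known by its
  fundamental vector field.\<close>

lemma pd_eqI:
  assumes A: "pd R \<iota> A" and A': "pd R \<iota> A'"
    and eq: "\<And>f x. f \<in> \<O> \<Longrightarrow> x \<in> PX \<Longrightarrow> A (orb Gt f x) = A' (orb Gt f x)" and r: "r \<in> R"
  shows "A r = A' r"
proof -
  have e: "zero_outside Gt (\<lambda>g. act g v s) = (if s \<in> PX then orb Gt v s else 0)" for v s
    by (auto simp: orb_def zero_outside_def fun_eq_iff act_apply)
  have BO: "v \<in> \<O>" if "v \<in> B" for v using B(2) fun_vs.span_base[OF that] by blast
  have m: "A (mf v w) = A' (mf v w)" if v: "v \<in> B" for v w
  proof -
    have "zero_outside Gt (\<lambda>g. act g v s) \<in> R" for s using T.orb_in[OF BO[OF v]] R.zero by (auto simp: e)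
    note mv = T.G.pd_moving_functional[where \<Psi> = act and v = v and cs = "cs w", OF _ this]
    have "(\<lambda>s. A (zero_outside Gt (\<lambda>g. act g v s))) = (\<lambda>s. A' (zero_outside Gt (\<lambda>g. act g v s)))"
      unfolding e using eq[OF BO[OF v]] pdD(4)[OF A R.zero] pdD(4)[OF A' R.zero] by auto
    then show ?thesis unfolding mf_def mv[OF A] mv[OF A'] by (simp only:)
  qed
  show ?thesis using r
  proof (induction rule: R_induct)
    case (const c)
    then show ?case using R.pd_const[OF A] R.pd_const[OF A'] Gt_closed(3) by simp
  next
    case (mi v w)
    have "mi v w = zero_outside Gt (\<lambda>g. mf v w (invX g))"
      unfolding mi_def by (rule zo_eq_iff) (simp add: mf_def zero_outside_apply Gt_closed)
    then show ?case using T.pd_inv[OF A m_in(1)[OF mi]] T.pd_inv[OF A' m_in(1)[OF mi]] m[OF mi(1)] by simp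
  next
    case (add f g)
    then show ?case by (simp only: pdD(1)[OF A] pdD(1)[OF A'])
  next
    case (mult f g)
    then show ?case by (simp only: pdD(2)[OF A] pdD(2)[OF A'])
  qed (use m in auto)
qed

definition "cj q r = zero_outside Gt (\<lambda>h. r (invX q \<odot> (h \<odot> q)))"

lemma lt_in: assumes "r \<in> R" "g \<in> Gt" shows "zero_outside Gt (\<lambda>h. r (g \<odot> h)) \<in> R"
proof -
  obtain n :: nat and a b where ab: "\<forall>i<n. a i \<in> R \<and> b i \<in> R"
    "\<forall>g\<in>Gt. \<forall>h\<in>Gt. r (g \<odot> h) = (\<Sum>i<n. a i g * b i h)" using T.G.comul[OF assms(1)] by blast
  have "zero_outside Gt (\<lambda>h. r (g \<odot> h)) = zero_outside Gt (\<lambda>h. \<Sum>i<n. a i g * b i h)"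
    by (rule zo_eq_iff) (use ab assms in simp)
  moreover have "zero_outside Gt (\<lambda>h. \<Sum>i<n. a i g * b i h) \<in> R" by (rule R.lincomb_in) (use ab in simp)
  ultimately show ?thesis by (simp only:)
qed

lemma cj_in: assumes "r \<in> R" "q \<in> Gt" shows "cj q r \<in> R"
proof -
  have "cj q r = T.G.rt q (zero_outside Gt (\<lambda>h. r (invX q \<odot> h)))"
    unfolding cj_def T.G.rt_def by (rule zo_eq_iff) (use assms in \<open>simp add: zero_outside_apply Gt_closed\<close>)
  then show ?thesis using T.G.rt_in[OF lt_in[OF assms(1) Gt_closed(2)[OF assms(2)]] assms(2)] by simp
qed

lemma cj_hom: "cj q (f + g) = cj q f + cj q g" "cj q (f * g) = cj q f * cj q g"
  "cj q (fscale c f) = fscale c (cj q f)"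
  by (auto simp: cj_def zero_outside_def fun_eq_iff fscale_apply)

lemma pd_conjugate:
  assumes i: "i \<in> I" and q: "q \<in> Gt" and b: "pd (RR i) \<iota> b"
  shows "pd R \<iota> (\<lambda>r. b (zero_outside (Q i) (cj q r)))" (is ?P)
    and "T.xi (\<lambda>r. b (zero_outside (Q i) (cj q r))) = Ad q (action.xi X (Q i) b)" (is ?X)
proof -
  interpret i: connected_action X "Q i" "RR i" "C i" by (rule ca[OF i])
  have inR: "zero_outside (Q i) (cj q r) \<in> RR i" if "r \<in> R" for r
    by (rule restrict_in[OF i cj_in[OF that q]])
  have val: "zero_outside (Q i) (cj q r) \<iota> = r \<iota>" for r
    using q by (simp add: cj_def zero_outside_apply i.Q_closed Gt_closed A.l_inv)
  show ?P unfolding pd_def by (simp add: cj_hom zo_hom pdD(1-3)[OF b] inR val)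
  show ?X
  proof (rule ext, rule ext)
    fix f x
    show "T.xi (\<lambda>r. b (zero_outside (Q i) (cj q r))) f x = Ad q (i.xi b) f x"
    proof (cases "f \<in> \<O> \<and> x \<in> PX")
      case True
      have "zero_outside (Q i) (cj q (orb Gt f x)) = orb (Q i) (act (invX q) f) (q x)"
        unfolding orb_def[of "Q i"]
      proof (rule zo_eq_iff)
        fix h assume h: "h \<in> Q i"
        then show "cj q (orb Gt f x) h = act (invX q) f (h (q x))"
          using True q Gt_closed(5)[OF i h] by (simp add: cj_def orb_def zero_outside_apply Gt_closed act_apply Aut_in Aut_mult)
      qed
      then show ?thesis using True q
        by (simp add: T.xi_apply i.xi_apply Ad_apply act_apply act_in Aut_in Gt_closed)
    next
      case False
      then show ?thesis by (cases "f \<in> \<O>") (simp_all add: T.xi_apply Ad_apply act_apply)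
    qed
  qed
qed

definition "Bt j = (SOME b. pd (RR (ix j)) \<iota> b \<and> E j = action.xi X (Q (ix j)) b)"

lemma Bt: assumes "j < d" shows "pd (RR (ix j)) \<iota> (Bt j)" "E j = action.xi X (Q (ix j)) (Bt j)"
proof -
  have "\<exists>b. pd (RR (ix j)) \<iota> b \<and> E j = action.xi X (Q (ix j)) b"
    using E[OF assms] Lie_xi[OF ix[OF assms]] by auto
  from someI_ex[OF this] show "pd (RR (ix j)) \<iota> (Bt j)" "E j = action.xi X (Q (ix j)) (Bt j)"
    by (simp_all add: Bt_def)
qed

definition "Ar j = (\<lambda>r. Bt j (zero_outside (Q (ix j)) (cj (p j) r)))"

lemma Ar: assumes "j < d" shows "pd R \<iota> (Ar j)" "T.xi (Ar j) = e j"
  using pd_conjugate[OF ix[OF assms] p[OF assms] Bt(1)[OF assms]] Bt(2)[OF assms]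
  by (simp_all add: Ar_def e_def)

lemma Ar_orb: "j < d \<Longrightarrow> f \<in> \<O> \<Longrightarrow> x \<in> PX \<Longrightarrow> Ar j (orb Gt f x) = e j f x"
  using Ar(2)[of j] T.xi_apply(1)[of f x "Ar j"] by simp

lemma pd_combination:
  "pd R \<iota> (\<lambda>r. \<Sum>k<d. c k * Ar k r)"
  unfolding pd_def
  by (simp add: pdD(1-3)[OF Ar(1)] sum.distrib distrib_left sum_distrib_left sum_distrib_right mult_ac)

text \<open>A tangent vector is determined by its field, and the fields of the \<open>Ar j\<close> span \<open>L\<close>.\<close>

lemma pd_L:
  assumes A: "pd R \<iota> A" and L: "D \<in> L" "\<And>f x. f \<in> \<O> \<Longrightarrow> x \<in> PX \<Longrightarrow> A (orb Gt f x) = D f x"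
  shows "\<exists>c. \<forall>r\<in>R. A r = (\<Sum>k<d. c k * Ar k r)"
proof -
  obtain c where c: "D = (\<Sum>k<d. vscale (c k) (e k))" using L_combination[OF L(1)] by blast
  have "A r = (\<Sum>k<d. c k * Ar k r)" if "r \<in> R" for r
  proof (rule pd_eqI[OF A pd_combination _ that])
    fix f x assume fx: "f \<in> \<O>" "x \<in> PX"
    have "D f x = (\<Sum>k<d. c k * e k f x)" unfolding c vsum_apply by (simp add: sum_fun_apply fscale_apply)
    then show "A (orb Gt f x) = (\<Sum>k<d. c k * Ar k (orb Gt f x))" using L(2)[OF fx] Ar_orb fx by simp
  qed
  then show ?thesis by blast
qed

abbreviation "DD j \<equiv> T.G.Dr (Ar j)"

sublocale gops: lie_operators R DD d
proof
  show "fun_vs.subspace R" by (rule R.subspace)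
  show DR: "\<And>i v. i < d \<Longrightarrow> v \<in> R \<Longrightarrow> DD i v \<in> R" using T.G.Dr_in[OF _ Ar(1)] by blast
  show "\<And>i v w. i < d \<Longrightarrow> v \<in> R \<Longrightarrow> w \<in> R \<Longrightarrow> DD i (v + w) = DD i v + DD i w"
    using T.G.Dr_props(1)[OF Ar(1)] by blast
  show "\<And>i c v. i < d \<Longrightarrow> v \<in> R \<Longrightarrow> DD i (fscale c v) = fscale c (DD i v)"
    using T.G.Dr_props(3)[OF Ar(1)] by blast
  fix i j v assume i: "i < d" and j: "j < d" and v: "v \<in> R"
  define T where "T r = Ar i (DD j r) - Ar j (DD i r)" for r
  have pdT: "pd R \<iota> T"
    unfolding pd_def T_def using DR i j
    by (simp add: T.G.Dr_props(1-3)[OF Ar(1)] pdD(1-3)[OF Ar(1)] R.add R.mult R.scale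
        T.G.Dr_props(4)[OF Ar(1)] algebra_simps)
  have "T (orb Gt f x) = lie_bracket (e i) (e j) f x" if fx: "f \<in> \<O>" "x \<in> PX" for f x
    using fx i j VecD(1)[OF e_Vec]
    by (simp add: T_def T.Dr_orb[OF Ar(1)] Ar(2) Ar_orb lie_bracket_def)
  then obtain c where c: "\<And>r. r \<in> R \<Longrightarrow> T r = (\<Sum>k<d. c k * Ar k r)"
    using pd_L[OF pdT L_props(5)[OF e_L[OF i] e_L[OF j]]] by blast
  have "DD i (DD j v) - DD j (DD i v) = (\<Sum>k<d. fscale (c k) (DD k v))"
  proof (rule R.eqI)
    show "DD i (DD j v) - DD j (DD i v) \<in> R" by (intro R.diff DR i j v)
    show "(\<Sum>k<d. fscale (c k) (DD k v)) \<in> R" by (intro R.sum R.scale DR v) simp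
    fix g assume g: "g \<in> Gt"
    have "(DD i (DD j v) - DD j (DD i v)) g = T (T.G.rt g v)"
      using g by (simp add: T.G.Dr_apply T_def T.G.rt_Dr)
    then show "(DD i (DD j v) - DD j (DD i v)) g = (\<Sum>k<d. fscale (c k) (DD k v)) g"
      using c[OF T.G.rt_in[OF v g]] g by (simp add: sum_fun_apply fscale_apply T.G.Dr_apply)
  qed
  moreover have "(\<Sum>k<d. fscale (c k) (DD k v)) \<in> fun_vs.span {DD k v | k. k < d}"
    by (intro fun_vs.span_sum fun_vs.span_scale fun_vs.span_base) blast
  ultimately show "DD i (DD j v) - DD j (DD i v) \<in> fun_vs.span {DD k v | k. k < d}" by (simp only:)
qed

abbreviation "wapp \<equiv> word_app DD"

lemma wapp_in: "r \<in> R \<Longrightarrow> set w \<subseteq> {..<d} \<Longrightarrow> wapp w r \<in> R" by (rule gops.word_app_in)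

lemma wapp_add: "r \<in> R \<Longrightarrow> s \<in> R \<Longrightarrow> set w \<subseteq> {..<d} \<Longrightarrow> wapp w (r + s) = wapp w r + wapp w s"
proof (induction w)
  case (Cons i w)
  have "wapp w (r + s) = wapp w r + wapp w s" by (rule Cons.IH) (use Cons.prems in simp_all)
  moreover have "wapp w r \<in> R" "wapp w s \<in> R" "i < d" using Cons.prems wapp_in by simp_all
  ultimately show ?case by (simp only: word_app.simps gops.add)
qed (simp only: word_app.simps)

lemma wapp_scale: "r \<in> R \<Longrightarrow> set w \<subseteq> {..<d} \<Longrightarrow> wapp w (fscale c r) = fscale c (wapp w r)"
proof (induction w)
  case (Cons i w)
  have "wapp w (fscale c r) = fscale c (wapp w r)" by (rule Cons.IH) (use Cons.prems in simp_all)
  moreover have "wapp w r \<in> R" "i < d" using Cons.prems wapp_in by simp_all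
  ultimately show ?case by (simp only: word_app.simps gops.scale)
qed (simp only: word_app.simps)

lemma wapp_snoc: "wapp w (DD k r) = wapp (w @ [k]) r"
proof (induction w)
  case (Cons i w)
  then show ?case by (simp only: word_app.simps append_Cons)
qed (simp only: word_app.simps append_Nil)

lemma wapp_rt: "g \<in> Gt \<Longrightarrow> wapp w (T.G.rt g r) = T.G.rt g (wapp w r)"
proof (induction w)
  case (Cons i w)
  then show ?case by (simp only: word_app.simps T.G.rt_Dr)
qed (simp only: word_app.simps)

definition "J = {r \<in> R. \<forall>w. set w \<subseteq> {..<d} \<longrightarrow> wapp w r \<iota> = 0}"

lemma J_subspace: "fun_vs.subspace J"
proof (rule fun_vs.subspaceI)
  have z: "wapp w 0 = 0" if "set w \<subseteq> {..<d}" for w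
    using wapp_scale[OF R.zero that, of 0] by (simp only: fun_vs.scale_zero_left)
  show "0 \<in> J" unfolding J_def by (intro CollectI conjI R.zero allI impI) (simp only: z zero_fun_apply)
  show "f + g \<in> J" if "f \<in> J" "g \<in> J" for f g
  proof -
    have fg: "f \<in> R" "g \<in> R" using that by (simp_all add: J_def)
    have "wapp w (f + g) \<iota> = 0" if w: "set w \<subseteq> {..<d}" for w
      unfolding wapp_add[OF fg w] using \<open>f \<in> J\<close> \<open>g \<in> J\<close> w by (simp add: J_def)
    then show ?thesis using R.add[OF fg] by (simp only: J_def mem_Collect_eq) blast
  qed
  show "fscale c f \<in> J" if "f \<in> J" for c f
  proof -
    have f: "f \<in> R" using that by (simp add: J_def)
    have "wapp w (fscale c f) \<iota> = 0" if w: "set w \<subseteq> {..<d}" for w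
      unfolding wapp_scale[OF f w] using \<open>f \<in> J\<close> w by (simp add: J_def fscale_apply)
    then show ?thesis using R.scale[OF f] by (simp only: J_def mem_Collect_eq) blast
  qed
qed

lemma J_DD: "r \<in> J \<Longrightarrow> k < d \<Longrightarrow> DD k r \<in> J"
  unfolding J_def wapp_snoc mem_Collect_eq using gops.closed by auto

lemma J_wapp: "r \<in> J \<Longrightarrow> set w \<subseteq> {..<d} \<Longrightarrow> wapp w r \<in> J"
proof (induction w)
  case (Cons i w)
  then have "wapp w r \<in> J" "i < d" by auto
  then show ?case by (simp only: word_app.simps J_DD)
qed (simp only: word_app.simps)

text \<open>Tangent vectors of \<open>G\<^sub>i\<close> have fields in \<open>L\<close>, so the restrictions of \<open>J\<close> to \<open>G\<^sub>i\<close> are stable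
  under the invariant derivations of \<open>G\<^sub>i\<close>.\<close>

lemma J_Q: assumes r: "r \<in> J" and i: "i \<in> I" and h: "h \<in> Q i" shows "r h = 0"
proof -
  interpret i: connected_action X "Q i" "RR i" "C i" by (rule ca[OF i])
  have JR: "r \<in> R" "r \<iota> = 0" if "r \<in> J" for r
    using that by (auto simp: J_def dest: spec[of _ "[]"])
  have "zero_outside (Q i) r = 0"
  proof (rule i.G.stable_zero[where F = "zero_outside (Q i) ` J"])
    show "zero_outside (Q i) ` J \<subseteq> i.G.m_one"
      unfolding i.G.m_one_def using JR restrict_in[OF i] by (auto simp: zero_outside_apply)
    fix f A assume "f \<in> zero_outside (Q i) ` J" and A: "pd (RR i) \<iota> A"
    then obtain s where s: "s \<in> J" "f = zero_outside (Q i) s" by (elim imageE)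
    define A' where "A' r = A (zero_outside (Q i) r)" for r
    have pdA': "pd R \<iota> A'" unfolding pd_def A'_def
      by (simp add: zo_hom pdD(1-3)[OF A] restrict_in[OF i] zero_outside_apply i.Q_closed)
    have "A' (orb Gt f x) = i.xi A f x" if "f \<in> \<O>" "x \<in> PX" for f x
      using that by (simp add: A'_def orb_def zo_zo[OF Q_Gt[OF i]] i.xi_apply)
    moreover have "i.xi A \<in> L" by (rule xi_L[OF i A])
    ultimately obtain c where c: "\<And>r. r \<in> R \<Longrightarrow> A' r = (\<Sum>k<d. c k * Ar k r)"
      using pd_L[OF pdA'] by blast
    have "i.G.Dr A f = zero_outside (Q i) (\<Sum>k<d. fscale (c k) (DD k s))"
      unfolding i.G.Dr_def
    proof (rule zo_eq_iff)
      fix g assume g: "g \<in> Q i"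
      then have gG: "g \<in> Gt" using Q_Gt[OF i] by blast
      have "i.G.rt g f = zero_outside (Q i) (T.G.rt g s)"
        unfolding s(2) i.G.rt_def T.G.rt_def zo_zo[OF Q_Gt[OF i]]
        by (rule zo_eq_iff) (use g in \<open>simp add: zero_outside_apply i.Q_closed\<close>)
      then have "A (i.G.rt g f) = A' (T.G.rt g s)" by (simp add: A'_def)
      also have "\<dots> = (\<Sum>k<d. fscale (c k) (DD k s)) g"
        using c[OF T.G.rt_in[OF JR(1)[OF s(1)] gG]] gG by (simp add: sum_fun_apply fscale_apply T.G.Dr_apply)
      finally show "A (i.G.rt g f) = (\<Sum>k<d. fscale (c k) (DD k s)) g" .
    qed
    moreover have "(\<Sum>k<d. fscale (c k) (DD k s)) \<in> J"
      by (intro fun_vs.subspace_sum[OF J_subspace] fun_vs.subspace_scale[OF J_subspace] J_DD s(1)) simp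
    ultimately show "i.G.Dr A f \<in> zero_outside (Q i) ` J" by (rule image_eqI)
  qed (use r in blast)
  from fun_cong[OF this, of h] show ?thesis using h by (simp add: zero_outside_apply)
qed

text \<open>Applied to the iterated derivatives of \<open>r\<close>, the previous lemma shows that \<open>J\<close> is stable under
  translation by each \<open>G\<^sub>i\<close>, hence by the generated group.\<close>

lemma J_zero: assumes "r \<in> J" shows "r = 0"
proof (rule R.eqI)
  show "r \<in> R" using assms by (simp add: J_def)
  fix g assume g: "g \<in> Gt"
  have "\<forall>r\<in>J. T.G.rt g r \<in> J"
    using g
  proof (induction rule: Gt_induct)
    case one
    then show ?case by (simp add: J_def T.G.rt_one)
  next
    case (mem i g)
    show ?case
    proof
      fix r assume r: "r \<in> J"
      have gG: "g \<in> Gt" using Q_Gt[OF mem(1)] mem(2) by blast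
      have "wapp w (T.G.rt g r) \<iota> = 0" if w: "set w \<subseteq> {..<d}" for w
        unfolding wapp_rt[OF gG] using J_Q[OF J_wapp[OF r w] mem] gG by (simp add: T.G.rt_apply Gt_closed A.l_one)
      moreover have "T.G.rt g r \<in> R" using r gG by (auto simp: J_def intro: T.G.rt_in)
      ultimately show "T.G.rt g r \<in> J" by (simp add: J_def)
    qed
  next
    case (mult g h)
    then show ?case by (simp add: T.G.rt_rt[symmetric])
  qed
  then have "T.G.rt g r \<in> J" using assms by blast
  then have "wapp [] (T.G.rt g r) \<iota> = 0" unfolding J_def by (elim CollectE conjE allE[of _ "[]"]) simp
  then show "r g = 0 g" using g by (simp add: T.G.rt_apply Gt_closed)
qed (rule R.zero)

end

section \<open>A word whose product map is dominant\<close>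

context generated_group
begin

definition "prodl ys = foldr (\<lambda>g h. g \<odot> h) ys \<iota>"
definition "YY ws = {ys. list_all2 (\<lambda>y i. y \<in> Q i) ys ws}"

lemma prodl_simps [simp]: "prodl [] = \<iota>" "prodl (y # ys) = y \<odot> prodl ys"
  by (simp_all add: prodl_def)

lemma prodl_in: "set ys \<subseteq> Gt \<Longrightarrow> prodl ys \<in> Gt"
  by (induction ys) (auto simp: Gt_closed)

lemma prodl_append: "set xs \<subseteq> Gt \<Longrightarrow> set ys \<subseteq> Gt \<Longrightarrow> prodl (xs @ ys) = prodl xs \<odot> prodl ys"
  by (induction xs) (simp_all add: Gt_closed A.m_assoc prodl_in)

lemma YY_Gt: "ys \<in> YY ws \<Longrightarrow> set ws \<subseteq> I \<Longrightarrow> set ys \<subseteq> Gt"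
  unfolding YY_def mem_Collect_eq
  by (induction ys ws rule: list_all2_induct) (auto simp: Gt_closed)

lemma YY_append: "xs \<in> YY us \<Longrightarrow> ys \<in> YY vs \<Longrightarrow> xs @ ys \<in> YY (us @ vs)"
  by (auto simp: YY_def intro: list_all2_appendI)

lemma Gt_word: assumes "g \<in> Gt" shows "\<exists>ws. set ws \<subseteq> I \<and> g \<in> prodl ` YY ws"
  using assms
proof (induction rule: Gt_induct)
  case one
  show ?case by (rule exI[of _ "[]"]) (auto simp: YY_def intro!: image_eqI[of _ _ "[]"])
next
  case (mem i g)
  then show ?case
    by (intro exI[of _ "[i]"]) (auto simp: YY_def Gt_closed intro!: image_eqI[of _ _ "[g]"])
next
  case (mult g h)
  then obtain us xs vs ys where w: "set us \<subseteq> I" "g = prodl xs" "xs \<in> YY us" "set vs \<subseteq> I" "h = prodl ys" "ys \<in> YY vs"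
    by blast
  then have "g \<odot> h = prodl (xs @ ys)" using prodl_append YY_Gt by metis
  then show ?case using YY_append[OF w(3,6)] w(1,4) by (intro exI[of _ "us @ vs"]) auto
qed

text \<open>The product of the conjugates of the \<open>G\<^sub>i\<close> to which \<open>e 0, \<dots>, e (k - 1)\<close> are tangent, with the
  factor of largest index on the left.\<close>

primrec Z :: "nat \<Rightarrow> ('a \<Rightarrow> 'a) set"
  where "Z 0 = {\<iota>}"
  | "Z (Suc k) = {(invX (p k) \<odot> (h \<odot> p k)) \<odot> z | h z. h \<in> Q (ix k) \<and> z \<in> Z k}"

lemma Q_one: "i \<in> I \<Longrightarrow> \<iota> \<in> Q i"
  using action.Q_closed(3)[OF connected_action.axioms(1)[OF ca]] by blast

lemma Z_Gt: "k \<le> d \<Longrightarrow> Z k \<subseteq> Gt"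
proof (induction k)
  case (Suc k)
  then have "k < d" by simp
  then show ?case using Suc p[of k] Gt_closed(5)[OF ix[of k]] by (auto intro!: Gt_closed(1,2))
qed (simp add: Gt_closed)

lemma Z_Suc: assumes "k < d" shows "Z k \<subseteq> Z (Suc k)"
proof
  fix z assume z: "z \<in> Z k"
  then have "z \<in> Gt" using Z_Gt[of k] assms by auto
  then have "z = (invX (p k) \<odot> (\<iota> \<odot> p k)) \<odot> z" using p[OF assms] by (simp add: Gt_closed A.l_inv)
  then show "z \<in> Z (Suc k)" using z Q_one[OF ix[OF assms]] unfolding Z.simps by blast
qed

lemma Z_mono: "k \<le> l \<Longrightarrow> l \<le> d \<Longrightarrow> Z k \<subseteq> Z l"
proof (induction l)
  case (Suc l)
  then show ?case using Z_Suc[of l] by (cases "k = Suc l") auto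
qed simp

lemma Z_word: "k \<le> d \<Longrightarrow> \<exists>ws. set ws \<subseteq> I \<and> Z k \<subseteq> prodl ` YY ws"
proof (induction k)
  case 0
  show ?case by (rule exI[of _ "[]"]) (auto simp: YY_def intro!: image_eqI[of _ _ "[]"])
next
  case (Suc k)
  then have k: "k < d" by simp
  obtain ws where ws: "set ws \<subseteq> I" "Z k \<subseteq> prodl ` YY ws" using Suc by auto
  obtain us xs where us: "set us \<subseteq> I" "invX (p k) = prodl xs" "xs \<in> YY us"
    using Gt_word[OF Gt_closed(2)[OF p[OF k]]] by blast
  obtain vs ys where vs: "set vs \<subseteq> I" "p k = prodl ys" "ys \<in> YY vs" using Gt_word[OF p[OF k]] by blast
  have "Z (Suc k) \<subseteq> prodl ` YY (us @ [ix k] @ vs @ ws)"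
  proof
    fix g assume "g \<in> Z (Suc k)"
    then obtain h z where hz: "g = (invX (p k) \<odot> (h \<odot> p k)) \<odot> z" "h \<in> Q (ix k)" "z \<in> Z k" by auto
    obtain zs where zs: "z = prodl zs" "zs \<in> YY ws" using ws(2) hz(3) by blast
    have G: "set xs \<subseteq> Gt" "set ys \<subseteq> Gt" "set zs \<subseteq> Gt" "h \<in> Gt"
      using YY_Gt us vs zs ws(1) Gt_closed(5)[OF ix[OF k] hz(2)] by blast+
    have "g = prodl (xs @ [h] @ ys @ zs)"
      using G unfolding hz(1) us(2) zs(1) by (subst vs(2)) (simp add: prodl_append prodl_in Gt_closed A.m_assoc)
    moreover have "xs @ [h] @ ys @ zs \<in> YY (us @ [ix k] @ vs @ ws)"
      by (intro YY_append us(3) vs(3) zs(2)) (simp add: YY_def hz(2))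
    ultimately show "g \<in> prodl ` YY (us @ [ix k] @ vs @ ws)" by (rule image_eqI)
  qed
  then show ?case using us(1) vs(1) ws(1) ix[OF k] by (intro exI[of _ "us @ [ix k] @ vs @ ws"]) auto
qed

text \<open>\<open>Z (Suc i)\<close> is stable under left multiplication by the \<open>i\<close>-th conjugate, so if a function vanishes
  on it, so does its derivative along \<open>e i\<close>. In an ordered word the indices decrease in the order of
  application, and the sets on which vanishing is known shrink accordingly, down to the identity.\<close>

lemma wapp_sorted_vanish:
  assumes r: "r \<in> R" "\<And>z. z \<in> Z d \<Longrightarrow> r z = 0"
  shows "sorted w \<Longrightarrow> set w \<subseteq> {..<d} \<Longrightarrow> k \<le> d \<Longrightarrow> \<forall>j\<in>set w. k \<le> Suc j \<Longrightarrow> z \<in> Z k \<Longrightarrow> wapp w r z = 0"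
proof (induction w arbitrary: k z)
  case Nil
  then show ?case using r(2) Z_mono[of k d] by auto
next
  case (Cons i w)
  have i: "i < d" "k \<le> Suc i" "Suc i \<le> d" using Cons.prems by auto
  let ?u = "wapp w r"
  let ?q = "p i"
  have uR: "?u \<in> R" by (rule wapp_in) (use r Cons.prems in auto)
  have u0: "?u z = 0" if "z \<in> Z (Suc i)" for z
    by (rule Cons.IH[OF _ _ i(3) _ that]) (use Cons.prems in auto)
  have "z \<in> Z (Suc i)" using Z_mono[OF i(2,3)] Cons.prems(5) by blast
  then obtain h z' where hz: "z = (invX ?q \<odot> (h \<odot> ?q)) \<odot> z'" "h \<in> Q (ix i)" "z' \<in> Z i" by auto
  have zG: "z \<in> Gt" using Z_Gt[OF Cons.prems(3)] Cons.prems(5) by blast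
  have G: "?q \<in> carrier (Aut X)" "invX ?q \<in> carrier (Aut X)" "h \<in> carrier (Aut X)" "z' \<in> carrier (Aut X)"
    using pA[OF i(1)] QA[OF ix[OF i(1)] hz(2)] Z_Gt[of i] hz(3) i Gt_closed(4) by auto
  interpret i: connected_action X "Q (ix i)" "RR (ix i)" "C (ix i)" by (rule ca[OF ix[OF i(1)]])
  have "zero_outside (Q (ix i)) (cj ?q (T.G.rt z ?u)) = 0"
  proof
    fix h'
    show "zero_outside (Q (ix i)) (cj ?q (T.G.rt z ?u)) h' = 0 h'"
    proof (cases "h' \<in> Q (ix i)")
      case True
      then have h': "h' \<in> Gt" "h' \<in> carrier (Aut X)" using Q_Gt[OF ix[OF i(1)]] Gt_closed(4) by auto
      have "?q \<odot> (invX ?q \<odot> y) = y" if "y \<in> carrier (Aut X)" for y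
        using that G by (simp add: A.m_assoc[symmetric] A.r_inv)
      then have "(invX ?q \<odot> (h' \<odot> ?q)) \<odot> z = (invX ?q \<odot> ((h' \<odot> h) \<odot> ?q)) \<odot> z'"
        unfolding hz(1) using G h' by (simp add: A.m_assoc)
      also have "\<dots> \<in> Z (Suc i)" using i.Q_closed(1)[OF True hz(2)] hz(3) unfolding Z.simps by blast
      finally have "?u ((invX ?q \<odot> (h' \<odot> ?q)) \<odot> z) = 0" by (rule u0)
      then show ?thesis using True h' zG p[OF i(1)]
        by (simp add: zero_outside_apply cj_def T.G.rt_apply Gt_closed)
    qed (simp add: zero_outside_apply)
  qed
  then have "Ar i (T.G.rt z ?u) = 0" using pdD(4)[OF Bt(1)[OF i(1)] i.G.zero] by (simp add: Ar_def)
  then show ?case using zG by (simp add: T.G.Dr_apply)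
qed

lemma vanish_imp_zero:
  assumes r: "r \<in> R" "\<And>z. z \<in> Z d \<Longrightarrow> r z = 0"
  shows "r = 0"
proof (rule J_zero)
  have "wapp w r \<iota> = 0" if w: "set w \<subseteq> {..<d}" for w
  proof -
    have "fun_vs.span {wapp w r | w. set w \<subseteq> {..<d} \<and> sorted w} \<subseteq> {u. u \<iota> = 0}"
    proof (rule fun_vs.span_minimal)
      show "{wapp w r | w. set w \<subseteq> {..<d} \<and> sorted w} \<subseteq> {u. u \<iota> = 0}"
        using wapp_sorted_vanish[OF r, where k = 0 and z = \<iota>] by auto
      show "fun_vs.subspace {u :: _ \<Rightarrow> 'k. u \<iota> = 0}" by (rule fun_vs.subspaceI) (auto simp: fscale_apply)
    qed
    then show ?thesis using gops.words_sorted_span[OF r(1) w] by blast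
  qed
  then show "r \<in> J" using r(1) by (simp add: J_def)
qed

lemma exists_dense_word: "\<exists>ws. set ws \<subseteq> I \<and> (\<forall>r\<in>R. (\<forall>ys\<in>YY ws. r (prodl ys) = 0) \<longrightarrow> r = 0)"
proof -
  obtain ws where ws: "set ws \<subseteq> I" "Z d \<subseteq> prodl ` YY ws" using Z_word[of d] by blast
  have "r = 0" if "r \<in> R" "\<forall>ys\<in>YY ws. r (prodl ys) = 0" for r
    by (rule vanish_imp_zero[OF that(1)]) (use ws(2) that(2) in auto)
  then show ?thesis using ws(1) by blast
qed

end

section \<open>The generated group is closed and has the expected Lie algebra\<close>

locale dense_word = generated_group X I Gi C d p ix E B cs
  for X :: "('a, 'k::{alg_closed_field,field_char_0}) variety" and I :: "'i set" and Gi C d p ix E B cs +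
  fixes ws :: "'i list"
  assumes wsI: "set ws \<subseteq> I" and dense: "r \<in> R \<Longrightarrow> (\<And>ys. ys \<in> YY ws \<Longrightarrow> r (prodl ys) = 0) \<Longrightarrow> r = 0"
begin

abbreviation "n \<equiv> length ws"
abbreviation "Y \<equiv> YY ws"

text \<open>Functions on the product of the groups of the word are encoded as functions on all lists that
  factor through the retraction \<open>prj\<close> onto the product; in this way constants remain constant
  functions.\<close>

definition "prj y = map (\<lambda>j. if j < length y \<and> y ! j \<in> Q (ws ! j) then y ! j else \<iota>) [0..<n]"

lemma wsj: "j < n \<Longrightarrow> ws ! j \<in> I" using wsI nth_mem by blast

lemma Y_iff: "y \<in> Y \<longleftrightarrow> length y = n \<and> (\<forall>j<n. y ! j \<in> Q (ws ! j))"
  by (auto simp: YY_def list_all2_conv_all_nth)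

lemma prj_props: "prj y \<in> Y" "y \<in> Y \<Longrightarrow> prj y = y" "length (prj y) = n" "j < n \<Longrightarrow> prj y ! j \<in> Q (ws ! j)"
proof -
  show 1: "prj y \<in> Y" using Q_one[OF wsj] by (auto simp: Y_iff prj_def)
  then show "length (prj y) = n" "j < n \<Longrightarrow> prj y ! j \<in> Q (ws ! j)" by (auto simp: Y_iff)
  show "y \<in> Y \<Longrightarrow> prj y = y" by (rule nth_equalityI) (auto simp: prj_def Y_iff)
qed

lemma Y_Gt: "y \<in> Y \<Longrightarrow> set y \<subseteq> Gt" by (rule YY_Gt[OF _ wsI])

lemma Y_update: "y \<in> Y \<Longrightarrow> j < n \<Longrightarrow> h \<in> Q (ws ! j) \<Longrightarrow> y[j := h] \<in> Y"
  by (auto simp: Y_iff nth_list_update)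

definition kap :: "nat \<Rightarrow> (('a \<Rightarrow> 'a) \<Rightarrow> 'k) \<Rightarrow> ('a \<Rightarrow> 'a) list \<Rightarrow> 'k"
  where "kap j r = (\<lambda>y. r (prj y ! j))"

lemma kap_hom: "kap j (r + s) = kap j r + kap j s" "kap j (r * s) = kap j r * kap j s"
  "kap j (fscale c r) = fscale c (kap j r)"
  by (auto simp: kap_def fun_eq_iff fscale_apply)

definition "ts = concat (map (\<lambda>j. map (kap j) (SOME cs. set cs = C (ws ! j))) [0..<n])"

lemma set_ts: "set ts = (\<Union>j<n. kap j ` C (ws ! j))"
proof -
  have "set (SOME cs. set cs = C (ws ! j)) = C (ws ! j)" if "j < n" for j
  proof -
    interpret j: connected_action X "Q (ws ! j)" "RR (ws ! j)" "C (ws ! j)" by (rule ca[OF wsj[OF that]])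
    show ?thesis by (rule someI_ex[OF finite_list[OF j.G.fin]])
  qed
  then show ?thesis by (auto simp: ts_def)
qed

definition "BY = adjoins consts_fun ts"

lemma BY: "is_subring BY" "consts_fun \<subseteq> BY" "set ts \<subseteq> BY"
  unfolding BY_def by (rule adjoins_props[OF is_subring_consts])+

lemmas BYD = is_subringD[OF BY(1)]

lemma BY_least: "is_subring S \<Longrightarrow> consts_fun \<subseteq> S \<Longrightarrow> (\<And>j c. j < n \<Longrightarrow> c \<in> C (ws ! j) \<Longrightarrow> kap j c \<in> S) \<Longrightarrow> BY \<subseteq> S"
  unfolding BY_def by (rule adjoins_least) (auto simp: set_ts)

lemma kap_in: assumes j: "j < n" and r: "r \<in> RR (ws ! j)" shows "kap j r \<in> BY"
proof -
  interpret j: connected_action X "Q (ws ! j)" "RR (ws ! j)" "C (ws ! j)" by (rule ca[OF wsj[OF j]])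
  show ?thesis
    using r unfolding j.G.gen
  proof (induction rule: alg_gen_induct)
    case (const c)
    have "kap j (zero_outside (Q (ws ! j)) (\<lambda>_. c)) = (\<lambda>_. c)"
      using prj_props(4)[OF j] by (auto simp: kap_def zero_outside_apply)
    then show ?case using BY(2) by auto
  next
    case (gen f)
    then show ?case using BY(3) j unfolding set_ts by blast
  next
    case (add f g)
    then show ?case unfolding kap_hom by (intro BYD(4))
  next
    case (mult f g)
    then show ?case unfolding kap_hom by (intro BYD(5))
  qed
qed

definition mu :: "(('a \<Rightarrow> 'a) \<Rightarrow> 'k) \<Rightarrow> ('a \<Rightarrow> 'a) list \<Rightarrow> 'k"
  where "mu r = (\<lambda>y. r (prodl (prj y)))"

lemma mu_hom: "mu (r + s) = mu r + mu s" "mu (r * s) = mu r * mu s" "mu 0 = 0"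
  by (auto simp: mu_def fun_eq_iff)

lemma prodl_prj: "prodl (prj y) \<in> Gt" by (rule prodl_in[OF Y_Gt[OF prj_props(1)]])

lemma mu_const: "mu (zero_outside Gt (\<lambda>_. c)) = (\<lambda>_. c)"
  using prodl_prj by (auto simp: mu_def zero_outside_apply)

lemma mu_in: assumes r: "r \<in> R" shows "mu r \<in> BY"
proof -
  have "\<forall>r\<in>R. (\<lambda>y. r (prodl (map (\<lambda>j. prj y ! j) js))) \<in> BY" if "set js \<subseteq> {..<n}" for js
    using that
  proof (induction js)
    case Nil
    have "(\<lambda>_. c) \<in> BY" for c using BY(2) by blast
    then show ?case by simp
  next
    case (Cons j js)
    show ?case
    proof
      fix r assume "r \<in> R"
      then obtain m :: nat and a b where ab: "\<forall>i<m. a i \<in> R \<and> b i \<in> R"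
        "\<forall>g\<in>Gt. \<forall>h\<in>Gt. r (g \<odot> h) = (\<Sum>i<m. a i g * b i h)" using T.G.comul by blast
      have j: "j < n" and js: "set js \<subseteq> {..<n}" using Cons.prems by auto
      have 1: "prj y ! j \<in> Gt" for y using Q_Gt[OF wsj[OF j]] prj_props(4)[OF j] by blast
      have 2: "prodl (map (\<lambda>j. prj y ! j) js) \<in> Gt" for y
      proof (rule prodl_in, rule subsetI)
        fix g assume "g \<in> set (map (\<lambda>j. prj y ! j) js)"
        then obtain q where q: "q \<in> set js" "g = prj y ! q" by auto
        then have "q < n" using js by auto
        then show "g \<in> Gt" unfolding q(2) using Q_Gt[OF wsj] prj_props(4) by blast
      qed
      have k: "kap j (zero_outside (Q (ws ! j)) a) y = a (prj y ! j)" for a y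
        using prj_props(4)[OF j] by (simp add: kap_def zero_outside_apply)
      have "(\<lambda>y. r (prodl (map (\<lambda>j. prj y ! j) (j # js)))) =
          (\<Sum>i<m. kap j (zero_outside (Q (ws ! j)) (a i)) * (\<lambda>y. b i (prodl (map (\<lambda>j. prj y ! j) js))))"
        (is "?l = ?r")
      proof
        fix y show "?l y = ?r y"
          using bspec[OF bspec[OF ab(2) 1[of y]] 2[of y]] by (simp add: sum_fun_apply k)
      qed
      also have "\<dots> \<in> BY"
      proof (rule is_subring_sum[OF BY(1)])
        fix i assume "i \<in> {..<m}"
        then have "a i \<in> R" "b i \<in> R" using ab(1) by auto
        then show "kap j (zero_outside (Q (ws ! j)) (a i)) * (\<lambda>y. b i (prodl (map (\<lambda>j. prj y ! j) js))) \<in> BY"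
          by (intro BYD(5) kap_in[OF j restrict_in[OF wsj[OF j]]] Cons.IH[OF js, rule_format])
      qed
      finally show "(\<lambda>y. r (prodl (map (\<lambda>j. prj y ! j) (j # js)))) \<in> BY" .
    qed
  qed
  from bspec[OF this[of "[0..<n]"] r] have "(\<lambda>y. r (prodl (map (\<lambda>j. prj y ! j) [0..<n]))) \<in> BY"
    by (simp add: atLeast0LessThan)
  moreover have "map (\<lambda>j. prj y ! j) [0..<n] = prj y" for y using map_nth[of "prj y"] prj_props(3) by simp
  ultimately show ?thesis by (simp add: mu_def)
qed

lemma mu_zero: "r \<in> R \<Longrightarrow> mu r = 0 \<Longrightarrow> r = 0"
proof (rule dense)
  fix ys assume "mu r = 0" "ys \<in> Y"
  then have "mu r ys = 0" by simp
  then show "r (prodl ys) = 0" by (simp add: mu_def prj_props(2)[OF \<open>ys \<in> Y\<close>])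
qed

lemma mu_inj: "inj_on mu R"
proof (rule inj_onI)
  fix r s assume rs: "r \<in> R" "s \<in> R" "mu r = mu s"
  have "mu (r - s) = 0" using rs(3) by (auto simp: mu_def fun_eq_iff)
  then have "r - s = 0" by (rule mu_zero[OF R.diff[OF rs(1,2)]])
  then show "r = s" by (simp only: right_minus_eq)
qed

lemma BY_slice:
  assumes F: "F \<in> BY" and y: "y \<in> Y" and j: "j < n"
  shows "zero_outside (Q (ws ! j)) (\<lambda>h. F (y[j := h])) \<in> RR (ws ! j)"
proof -
  interpret j: connected_action X "Q (ws ! j)" "RR (ws ! j)" "C (ws ! j)" by (rule ca[OF wsj[OF j]])
  let ?s = "\<lambda>F. zero_outside (Q (ws ! j)) (\<lambda>h. F (y[j := h]))"
  have h: "?s (F + G) = ?s F + ?s G" "?s (F * G) = ?s F * ?s G" "?s (- F) = - ?s F"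
    for F G :: "('a \<Rightarrow> 'a) list \<Rightarrow> 'k" by (auto simp: zero_outside_def fun_eq_iff)
  have neg: "- f \<in> RR (ws ! j)" if "f \<in> RR (ws ! j)" for f using j.G.diff[OF j.G.zero that] by simp
  have "BY \<subseteq> {F. ?s F \<in> RR (ws ! j)}"
  proof (rule BY_least)
    have "zero_outside (Q (ws ! j)) (\<lambda>_. 1) \<in> RR (ws ! j)" by (rule j.G.const)
    then have "?s 1 \<in> RR (ws ! j)" by (simp only: one_fun_apply)
    then show "is_subring {F. ?s F \<in> RR (ws ! j)}"
      unfolding is_subring_def mem_Collect_eq h by (auto intro: j.G.add j.G.mult neg)
    show "consts_fun \<subseteq> {F. ?s F \<in> RR (ws ! j)}" using j.G.const by auto
    fix j' c assume j': "j' < n" "c \<in> C (ws ! j')"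
    have "?s (kap j' c) = (if j' = j then zero_outside (Q (ws ! j)) c else zero_outside (Q (ws ! j)) (\<lambda>_. c (y ! j')))"
      using j' j y by (auto simp: zero_outside_def fun_eq_iff kap_def prj_props(2)[OF Y_update[OF y j]] Y_iff nth_list_update)
    moreover have "zero_outside (Q (ws ! j)) c = c" if "j' = j"
      using j'(2) that by (intro j.G.zo_self) (simp add: j.G.gen alg_gen.gen)
    moreover have "c \<in> RR (ws ! j)" if "j' = j" using j'(2) that by (simp add: j.G.gen alg_gen.gen)
    ultimately show "kap j' c \<in> {F. ?s F \<in> RR (ws ! j)}" using j.G.const by (cases "j' = j") simp_all
  qed
  then show ?thesis using F by blast
qed

lemma BY_prj: "F \<in> BY \<Longrightarrow> F (prj y) = F y"
proof -
  have "BY \<subseteq> {F. \<forall>y. F (prj y) = F y}"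
    by (rule BY_least) (auto simp: is_subring_def kap_def prj_props(2)[OF prj_props(1)])
  then show "F \<in> BY \<Longrightarrow> F (prj y) = F y" by blast
qed

text \<open>A product of connected groups is irreducible: points where \<open>F\<close> and \<open>G\<close> do not vanish are made equal
  in one factor after the other, since the functions on each factor form a domain.\<close>

lemma BY_domain:
  assumes "F \<in> BY" "G \<in> BY" "F * G = 0" shows "F = 0 \<or> G = 0"
proof (rule ccontr)
  assume "\<not> (F = 0 \<or> G = 0)"
  then obtain a b where "F a \<noteq> 0" "G b \<noteq> 0" by (auto simp: fun_eq_iff)
  then have "\<exists>a b. a \<in> Y \<and> b \<in> Y \<and> F a \<noteq> 0 \<and> G b \<noteq> 0 \<and> (\<forall>j<0. a ! j = b ! j)"
    using BY_prj[OF assms(1)] BY_prj[OF assms(2)] prj_props(1) by (intro exI[of _ "prj a"] exI[of _ "prj b"]) auto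
  then have "\<exists>a b. a \<in> Y \<and> b \<in> Y \<and> F a \<noteq> 0 \<and> G b \<noteq> 0 \<and> (\<forall>j<k. a ! j = b ! j)" if "k \<le> n" for k
    using that
  proof (induction k)
    case (Suc k)
    then obtain a b where ab: "a \<in> Y" "b \<in> Y" "F a \<noteq> 0" "G b \<noteq> 0" "\<forall>j<k. a ! j = b ! j" by auto
    have k: "k < n" using Suc by simp
    interpret j: connected_action X "Q (ws ! k)" "RR (ws ! k)" "C (ws ! k)" by (rule ca[OF wsj[OF k]])
    let ?F = "zero_outside (Q (ws ! k)) (\<lambda>h. F (a[k := h]))"
    let ?G = "zero_outside (Q (ws ! k)) (\<lambda>h. G (b[k := h]))"
    have "?F (a ! k) \<noteq> 0" "?G (b ! k) \<noteq> 0" using ab k by (auto simp: zero_outside_apply Y_iff)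
    then have "?F \<noteq> 0" "?G \<noteq> 0" by (metis zero_fun_apply)+
    then have "?F * ?G \<noteq> 0"
      using j.G.no_zero_divisors[OF BY_slice[OF assms(1) ab(1) k] BY_slice[OF assms(2) ab(2) k]] by blast
    then obtain h where "(?F * ?G) h \<noteq> 0" by (auto simp: fun_eq_iff simp del: times_fun_apply)
    then have h: "h \<in> Q (ws ! k)" "F (a[k := h]) \<noteq> 0" "G (b[k := h]) \<noteq> 0"
      by (auto simp: zero_outside_apply split: if_splits)
    have "\<forall>j<Suc k. a[k := h] ! j = b[k := h] ! j"
      using ab k by (auto simp: nth_list_update Y_iff less_Suc_eq)
    then show ?case using h Y_update[OF ab(1) k h(1)] Y_update[OF ab(2) k h(1)] by blast
  qed auto
  from this[of n] obtain a b where ab: "a \<in> Y" "b \<in> Y" "F a \<noteq> 0" "G b \<noteq> 0" "\<forall>j<n. a ! j = b ! j" by auto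
  then have "a = b" by (intro nth_equalityI) (auto simp: Y_iff)
  then have "(F * G) a \<noteq> 0" using ab by simp
  then show False using assms(3) by simp
qed

lemma R_domain: assumes "f \<in> R" "g \<in> R" "f * g = 0" shows "f = 0 \<or> g = 0"
proof -
  have "mu f * mu g = 0" unfolding mu_hom(2)[symmetric] assms(3) by (rule mu_hom(3))
  then show ?thesis using BY_domain[OF mu_in mu_in] mu_zero assms(1,2) by blast
qed

text \<open>Homomorphisms to dual numbers, that is, points with tangent vectors, lift generically along
  the product map.\<close>

lemma lift_tangent:
  "\<exists>a\<in>R. a \<noteq> 0 \<and> (\<forall>\<chi> \<delta>. is_char Gt R \<chi> \<longrightarrow> \<chi> a \<noteq> 0 \<longrightarrow>
    (\<forall>f\<in>R. \<forall>g\<in>R. \<delta> (f + g) = \<delta> f + \<delta> g \<and> \<delta> (f * g) = \<chi> f * \<delta> g + \<delta> f * \<chi> g) \<longrightarrow>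
    (\<forall>c. \<delta> (zero_outside Gt (\<lambda>_. c)) = 0) \<longrightarrow>
    (\<exists>y\<in>Y. \<exists>\<delta>'. (\<forall>r\<in>R. \<chi> r = r (prodl y) \<and> \<delta> r = \<delta>' (mu r)) \<and>
      (\<forall>F\<in>BY. \<forall>G\<in>BY. \<delta>' (F + G) = \<delta>' F + \<delta>' G \<and> \<delta>' (F * G) = F y * \<delta>' G + \<delta>' F * G y) \<and>
      (\<forall>c. \<delta>' (\<lambda>_. c) = 0)))"
proof -
  let ?A = "mu ` R"
  have A: "is_subring ?A"
    unfolding is_subring_def
  proof (intro conjI ballI)
    have "mu R.one_fun = 1" unfolding mu_const by (auto simp: fun_eq_iff)
    then show "1 \<in> ?A" using R.const by (metis imageI)
    fix F assume "F \<in> ?A"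
    then obtain r where r: "r \<in> R" "F = mu r" by blast
    have "- F = mu (0 - r)" by (auto simp: r(2) mu_def fun_eq_iff)
    then show "- F \<in> ?A" using R.diff[OF R.zero r(1)] by blast
    fix G assume "G \<in> ?A"
    then obtain s where s: "s \<in> R" "G = mu s" by blast
    show "F + G \<in> ?A" "F * G \<in> ?A" unfolding r(2) s(2) mu_hom[symmetric] using R.add R.mult r(1) s(1) by blast+
  qed
  have AB: "?A \<subseteq> BY" using mu_in by blast
  have cA: "consts_fun \<subseteq> ?A"
  proof
    fix F :: "('a \<Rightarrow> 'a) list \<Rightarrow> 'k" assume "F \<in> consts_fun"
    then obtain c where "F = (\<lambda>_. c)" by blast
    then show "F \<in> ?A" using mu_const[of c] R.const[of c] by (metis imageI)
  qed
  note P = adjoins_props[OF A, of ts]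
  have eq: "adjoins ?A ts = BY"
  proof
    show "adjoins ?A ts \<subseteq> BY" by (rule adjoins_least[OF BY(1) AB BY(3)])
    show "BY \<subseteq> adjoins ?A ts" unfolding BY_def
      by (rule adjoins_least[OF P(1) _ P(3)]) (use cA P(2) in blast)
  qed
  have char0: "of_nat m \<noteq> (0 :: ('a \<Rightarrow> 'a) list \<Rightarrow> 'k)" if "m > 0" for m
  proof -
    have "(of_nat m :: ('a \<Rightarrow> 'a) list \<Rightarrow> 'k) x = of_nat m" for x by (induction m) auto
    then show ?thesis using that by (metis of_nat_0_eq_iff less_irrefl zero_fun_apply)
  qed
  obtain a where a: "a \<in> ?A" "a \<noteq> 0" and lift: "\<forall>\<Psi> :: (('a \<Rightarrow> 'a) list \<Rightarrow> 'k) \<Rightarrow> 'k dual. rhom ?A \<Psi> \<longrightarrow>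
      dre (\<Psi> a) \<noteq> 0 \<longrightarrow> (\<exists>\<Psi>'. rhom BY \<Psi>' \<and> (\<forall>x\<in>?A. \<Psi>' x = \<Psi> x) \<and> dre (\<Psi>' 1) \<noteq> 0)"
    using generic_lifting[OF A, of ts 1, unfolded eq, OF _ char0 BYD(1) one_neq_zero, where 'k = 'k] BY_domain
    by auto
  obtain a0 where a0: "a0 \<in> R" "a = mu a0" using a(1) by blast
  have "a0 \<noteq> 0" using a(2) a0(2) mu_hom(3) by auto
  moreover have "\<exists>y\<in>Y. \<exists>\<delta>'. (\<forall>r\<in>R. \<chi> r = r (prodl y) \<and> \<delta> r = \<delta>' (mu r)) \<and>
      (\<forall>F\<in>BY. \<forall>G\<in>BY. \<delta>' (F + G) = \<delta>' F + \<delta>' G \<and> \<delta>' (F * G) = F y * \<delta>' G + \<delta>' F * G y) \<and>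
      (\<forall>c. \<delta>' (\<lambda>_. c) = 0)"
    if \<chi>: "is_char Gt R \<chi>" "\<chi> a0 \<noteq> 0"
      and \<delta>: "\<forall>f\<in>R. \<forall>g\<in>R. \<delta> (f + g) = \<delta> f + \<delta> g \<and> \<delta> (f * g) = \<chi> f * \<delta> g + \<delta> f * \<chi> g"
        "\<forall>c. \<delta> (zero_outside Gt (\<lambda>_. c)) = 0" for \<chi> \<delta>
  proof -
    have \<chi>D: "\<chi> (f + g) = \<chi> f + \<chi> g" "\<chi> (f * g) = \<chi> f * \<chi> g" "\<chi> (zero_outside Gt (\<lambda>_. c)) = c"
      if "f \<in> R" "g \<in> R" for f g c
      using \<chi>(1) that unfolding is_char_def plus_fun_def times_fun_def by auto
    define \<Psi> where "\<Psi> F = Dual (\<chi> (inv_into R mu F)) (\<delta> (inv_into R mu F))" for F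
    have \<Psi>: "\<Psi> (mu r) = Dual (\<chi> r) (\<delta> r)" if "r \<in> R" for r
      unfolding \<Psi>_def inv_into_f_f[OF mu_inj that] ..
    have "rhom ?A \<Psi>"
      unfolding rhom_def
    proof (intro conjI ballI)
      have "mu R.one_fun = 1" unfolding mu_const by (auto simp: fun_eq_iff)
      then have "\<Psi> 1 = Dual (\<chi> R.one_fun) (\<delta> R.one_fun)" using \<Psi>[OF R.const[of 1]] by simp
      then show "\<Psi> 1 = 1" using \<chi>D(3)[OF R.zero R.zero] \<delta>(2) by (simp add: one_dual_def)
      fix F G assume "F \<in> ?A" "G \<in> ?A"
      then obtain r s where rs: "r \<in> R" "F = mu r" "s \<in> R" "G = mu s" by blast
      show "\<Psi> (F + G) = \<Psi> F + \<Psi> G" "\<Psi> (F * G) = \<Psi> F * \<Psi> G"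
        unfolding rs(2,4) mu_hom[symmetric] using \<Psi> rs(1,3) R.add R.mult \<delta>(1) \<chi>D
        by (simp_all add: plus_dual_def times_dual_def)
    qed
    moreover have "dre (\<Psi> a) \<noteq> 0" using \<chi>(2) a0 \<Psi> by simp
    ultimately obtain \<Psi>' where \<Psi>': "rhom BY \<Psi>'" "\<forall>x\<in>?A. \<Psi>' x = \<Psi> x" using lift by blast
    note H = rhomD[OF \<Psi>'(1) BY(1)]
    have c: "\<Psi>' (\<lambda>_. c) = Dual c 0" for c
    proof -
      have "\<Psi>' (\<lambda>_. c) = \<Psi> (mu (zero_outside Gt (\<lambda>_. c)))" using \<Psi>'(2) R.const[of c] mu_const[of c] by (metis imageI)
      then show ?thesis using \<Psi>[OF R.const] \<chi>D(3)[OF R.zero R.zero] \<delta>(2) by simp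
    qed
    have "\<exists>x\<in>Q (ws ! j). \<forall>r\<in>RR (ws ! j). dre (\<Psi>' (kap j r)) = r x" if j: "j < n" for j
    proof -
      have "is_char (Q (ws ! j)) (RR (ws ! j)) (\<lambda>r. dre (\<Psi>' (kap j r)))"
        unfolding is_char_def
      proof (intro conjI ballI allI)
        fix f g assume "f \<in> RR (ws ! j)" "g \<in> RR (ws ! j)"
        then have "kap j f \<in> BY" "kap j g \<in> BY" using kap_in[OF j] by auto
        then have "dre (\<Psi>' (kap j (f + g))) = dre (\<Psi>' (kap j f)) + dre (\<Psi>' (kap j g))"
          "dre (\<Psi>' (kap j (f * g))) = dre (\<Psi>' (kap j f)) * dre (\<Psi>' (kap j g))"
          unfolding kap_hom by (simp_all only: H dual_sel)
        then show "dre (\<Psi>' (kap j (\<lambda>x. f x + g x))) = dre (\<Psi>' (kap j f)) + dre (\<Psi>' (kap j g))"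
          "dre (\<Psi>' (kap j (\<lambda>x. f x * g x))) = dre (\<Psi>' (kap j f)) * dre (\<Psi>' (kap j g))"
          unfolding plus_fun_def times_fun_def .
      next
        fix c
        have "kap j (zero_outside (Q (ws ! j)) (\<lambda>_. c)) = (\<lambda>_. c)"
          using prj_props(4)[OF j] by (auto simp: kap_def zero_outside_apply)
        then show "dre (\<Psi>' (kap j (zero_outside (Q (ws ! j)) (\<lambda>_. c)))) = c" using c by simp
      qed
      then show ?thesis using chars[OF wsj[OF j]] by blast
    qed
    then obtain yf where yf: "\<And>j. j < n \<Longrightarrow> yf j \<in> Q (ws ! j)"
      "\<And>j r. j < n \<Longrightarrow> r \<in> RR (ws ! j) \<Longrightarrow> dre (\<Psi>' (kap j r)) = r (yf j)" by metis
    define y where "y = map yf [0..<n]"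
    have y: "y \<in> Y" using yf(1) by (simp add: Y_iff y_def)
    have "BY \<subseteq> {F \<in> BY. dre (\<Psi>' F) = F y}"
    proof (rule BY_least)
      show "is_subring {F \<in> BY. dre (\<Psi>' F) = F y}"
        unfolding is_subring_def
      proof (intro conjI ballI)
        show "1 \<in> {F \<in> BY. dre (\<Psi>' F) = F y}" using BYD(1) H(1) by simp
        fix F assume F: "F \<in> {F \<in> BY. dre (\<Psi>' F) = F y}"
        have "\<Psi>' (F + - F) = \<Psi>' F + \<Psi>' (- F)" by (rule H(2)) (use F BYD(3) in auto)
        then have "dre (\<Psi>' F) + dre (\<Psi>' (- F)) = 0" using H(4) by (metis dual_sel(1,5) add.right_inverse)
        then have "dre (\<Psi>' (- F)) = (- F) y" using F by (simp add: eq_neg_iff_add_eq_0 add.commute)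
        then show "- F \<in> {F \<in> BY. dre (\<Psi>' F) = F y}" using F BYD(3) by blast
        fix G assume G: "G \<in> {F \<in> BY. dre (\<Psi>' F) = F y}"
        have FG: "F \<in> BY" "G \<in> BY" using F G by auto
        have "dre (\<Psi>' (F + G)) = (F + G) y" "dre (\<Psi>' (F * G)) = (F * G) y"
          unfolding H(2)[OF FG] H(3)[OF FG] using F G by simp_all
        then show "F + G \<in> {F \<in> BY. dre (\<Psi>' F) = F y}" "F * G \<in> {F \<in> BY. dre (\<Psi>' F) = F y}"
          using BYD(4,5)[OF FG] by blast+
      qed
      show "consts_fun \<subseteq> {F \<in> BY. dre (\<Psi>' F) = F y}" using BY(2) c by auto
      fix j r assume j: "j < n" and r: "r \<in> C (ws ! j)"
      interpret j: connected_action X "Q (ws ! j)" "RR (ws ! j)" "C (ws ! j)" by (rule ca[OF wsj[OF j]])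
      have rR: "r \<in> RR (ws ! j)" unfolding j.G.gen by (rule alg_gen.gen[OF r])
      have "kap j r y = r (yf j)" using prj_props(2)[OF y] j by (simp add: kap_def y_def)
      then show "kap j r \<in> {F \<in> BY. dre (\<Psi>' F) = F y}" using kap_in[OF j rR] yf(2)[OF j rR] by simp
    qed
    then have dre: "dre (\<Psi>' F) = F y" if "F \<in> BY" for F using that by blast
    have mp: "mu r y = r (prodl y)" for r using prj_props(2)[OF y] by (simp add: mu_def)
    have "\<chi> r = r (prodl y) \<and> \<delta> r = dep (\<Psi>' (mu r))" if r: "r \<in> R" for r
    proof -
      have "\<Psi>' (mu r) = Dual (\<chi> r) (\<delta> r)" using \<Psi>'(2) \<Psi>[OF r] r by (metis imageI)
      then show ?thesis using dre[OF mu_in[OF r]] mp by simp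
    qed
    then show ?thesis using y H(2,3) dre c
      by (intro bexI[of _ y] exI[of _ "\<lambda>F. dep (\<Psi>' F)"]) simp_all
  qed
  ultimately show ?thesis using a0(1) by (intro bexI[of _ a0]) auto
qed

definition "Gv = \<lparr>pts = Gt, reg = R\<rparr>"

lemma separate_Gt:
  assumes "g \<in> Gt" "h \<in> Gt" "\<And>r. r \<in> R \<Longrightarrow> r g = r h" shows "g = h"
proof (rule Aut_ext)
  show "g \<in> carrier (Aut X)" "h \<in> carrier (Aut X)" using assms Gt_closed by auto
  fix x assume x: "x \<in> PX"
  show "g x = h x"
  proof (rule separate_points)
    show "g x \<in> PX" "h x \<in> PX" using assms x Aut_in Gt_closed by auto
    fix f assume "f \<in> \<O>"
    then show "f (g x) = f (h x)" using assms(3)[OF T.orb_in[of f x]] x assms(1,2) by (simp add: T.orb_apply)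
  qed
qed

text \<open>Points of the spectrum outside the zeros of some \<open>a \<noteq> 0\<close> lift to the product of the groups.
  Every point has a translate by an element of the group among these, for otherwise expanding
  \<open>a(h (h\<inverse> g))\<close> by the comultiplication would give \<open>a = 0\<close>.\<close>

lemma chars_Gt:
  assumes \<chi>: "is_char Gt R \<chi>" shows "\<exists>g\<in>Gt. \<forall>r\<in>R. \<chi> r = r g"
proof -
  have \<chi>D: "\<chi> (f + g) = \<chi> f + \<chi> g" "\<chi> (f * g) = \<chi> f * \<chi> g" if "f \<in> R" "g \<in> R" for f g
    using \<chi> that unfolding is_char_def plus_fun_def times_fun_def by auto
  have \<chi>c: "\<chi> (zero_outside Gt (\<lambda>_. c)) = c" for c using \<chi> unfolding is_char_def by blast
  have \<chi>s: "\<chi> (fscale c f) = c * \<chi> f" if "f \<in> R" for c f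
    unfolding R.fscale_eq[OF that] \<chi>D(2)[OF R.const that] \<chi>c ..
  have \<chi>0: "\<chi> 0 = 0" using \<chi>s[OF R.zero, of 0] by simp
  have \<chi>sum: "\<chi> (\<Sum>i<m. f i) = (\<Sum>i<m. \<chi> (f i))" if "\<And>i. i < m \<Longrightarrow> f i \<in> R" for f and m :: nat
    using that
  proof (induction m)
    case (Suc m)
    then have "\<chi> ((\<Sum>i<m. f i) + f m) = \<chi> (\<Sum>i<m. f i) + \<chi> (f m)" by (intro \<chi>D(1) R.sum) auto
    then show ?case using Suc by (simp only: sum.lessThan_Suc)
  qed (simp only: lessThan_0 sum.empty \<chi>0)
  from lift_tangent obtain a where a: "a \<in> R" "a \<noteq> 0" and lift: "\<And>\<chi> \<delta>. is_char Gt R \<chi> \<Longrightarrow> \<chi> a \<noteq> 0 \<Longrightarrow>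
    (\<forall>f\<in>R. \<forall>g\<in>R. \<delta> (f + g) = \<delta> f + \<delta> g \<and> \<delta> (f * g) = \<chi> f * \<delta> g + \<delta> f * \<chi> g) \<Longrightarrow>
    (\<forall>c. \<delta> (zero_outside Gt (\<lambda>_. c)) = 0) \<Longrightarrow> (\<exists>y\<in>Y. \<exists>\<delta>'. (\<forall>r\<in>R. \<chi> r = r (prodl y) \<and> \<delta> r = \<delta>' (mu r)) \<and>
      (\<forall>F\<in>BY. \<forall>G\<in>BY. \<delta>' (F + G) = \<delta>' F + \<delta>' G \<and> \<delta>' (F * G) = F y * \<delta>' G + \<delta>' F * G y) \<and>
      (\<forall>c. \<delta>' (\<lambda>_. c) = 0))"
    by (elim bexE conjE) blast
  have "\<exists>g\<in>Gt. \<chi> (T.G.rt g a) \<noteq> 0"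
  proof (rule ccontr)
    assume "\<not> ?thesis"
    then have no: "\<And>g. g \<in> Gt \<Longrightarrow> \<chi> (T.G.rt g a) = 0" by blast
    obtain m :: nat and b c where bc: "\<And>i. i < m \<Longrightarrow> b i \<in> R" "\<And>i. i < m \<Longrightarrow> c i \<in> R"
      "\<And>g h. g \<in> Gt \<Longrightarrow> h \<in> Gt \<Longrightarrow> a (g \<odot> h) = (\<Sum>i<m. b i g * c i h)" using T.G.comul[OF a(1)] by blast
    have k: "(\<Sum>i<m. \<chi> (b i) * c i u) = 0" if u: "u \<in> Gt" for u
    proof -
      have "T.G.rt u a = (\<Sum>i<m. fscale (c i u) (b i))"
      proof (rule R.eqI)
        show "T.G.rt u a \<in> R" by (rule T.G.rt_in[OF a(1) u])
        show "(\<Sum>i<m. fscale (c i u) (b i)) \<in> R" by (intro R.sum R.scale) (use bc in simp)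
      qed (use bc(3) u in \<open>simp add: T.G.rt_apply sum_fun_apply fscale_apply mult.commute\<close>)
      then have "0 = \<chi> (\<Sum>i<m. fscale (c i u) (b i))" using no[OF u] by simp
      also have "\<dots> = (\<Sum>i<m. \<chi> (b i) * c i u)"
        using \<chi>sum[of m "\<lambda>i. fscale (c i u) (b i)"] bc(1) R.scale by (simp add: \<chi>s mult.commute)
      finally show ?thesis by simp
    qed
    have "a g = 0" if g: "g \<in> Gt" for g
    proof -
      define \<beta> where "\<beta> i = zero_outside Gt (\<lambda>h. c i (invX h \<odot> g))" for i
      have \<beta>R: "\<beta> i \<in> R" if "i < m" for i
      proof -
        have "\<beta> i = zero_outside Gt (\<lambda>h. T.G.rt g (c i) (invX h))"
          unfolding \<beta>_def by (rule zo_eq_iff) (simp add: T.G.rt_apply Gt_closed)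
        then show ?thesis using R_inverse[OF T.G.rt_in[OF bc(2)[OF that] g]] by simp
      qed
      have "(\<Sum>i<m. b i * \<beta> i) = zero_outside Gt (\<lambda>_. a g)"
      proof (rule R.eqI[OF _ R.const])
        show "(\<Sum>i<m. b i * \<beta> i) \<in> R" by (intro R.sum R.mult) (use bc \<beta>R in auto)
        fix h assume h: "h \<in> Gt"
        have "h \<odot> (invX h \<odot> g) = g" using h g by (simp add: A.m_assoc[symmetric] A.r_inv Gt_closed)
        then show "(\<Sum>i<m. b i * \<beta> i) h = zero_outside Gt (\<lambda>_. a g) h"
          using bc(3)[OF h, of "invX h \<odot> g"] h g by (simp add: sum_fun_apply \<beta>_def zero_outside_apply Gt_closed)
      qed
      then have "a g = \<chi> (\<Sum>i<m. b i * \<beta> i)" using \<chi>c by simp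
      also have "\<dots> = (\<Sum>i<m. \<chi> (b i) * \<chi> (\<beta> i))"
        using \<chi>sum[of m "\<lambda>i. b i * \<beta> i"] bc(1) \<beta>R R.mult by (simp add: \<chi>D)
      also have "\<dots> = \<chi> (\<Sum>i<m. fscale (\<chi> (b i)) (\<beta> i))"
        using \<chi>sum[of m "\<lambda>i. fscale (\<chi> (b i)) (\<beta> i)"] \<beta>R R.scale by (simp add: \<chi>s)
      finally have ag: "a g = \<chi> (\<Sum>i<m. fscale (\<chi> (b i)) (\<beta> i))" .
      have "(\<Sum>i<m. fscale (\<chi> (b i)) (\<beta> i)) = 0"
      proof (rule R.eqI[OF _ R.zero])
        show "(\<Sum>i<m. fscale (\<chi> (b i)) (\<beta> i)) \<in> R" by (intro R.sum R.scale) (use \<beta>R in simp)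
      qed (use k g in \<open>simp add: sum_fun_apply fscale_apply \<beta>_def zero_outside_apply Gt_closed\<close>)
      then show ?thesis unfolding ag by (simp only: \<chi>0)
    qed
    then show False using a R.eqI[OF a(1) R.zero] by simp
  qed
  then obtain g where g: "g \<in> Gt" "\<chi> (T.G.rt g a) \<noteq> 0" by blast
  have "is_char Gt R (\<lambda>r. \<chi> (T.G.rt g r))"
    unfolding is_char_def
  proof (intro conjI ballI allI)
    fix r s assume "r \<in> R" "s \<in> R"
    then have "T.G.rt g r \<in> R" "T.G.rt g s \<in> R" using T.G.rt_in g(1) by auto
    then have "\<chi> (T.G.rt g (r + s)) = \<chi> (T.G.rt g r) + \<chi> (T.G.rt g s)"
      "\<chi> (T.G.rt g (r * s)) = \<chi> (T.G.rt g r) * \<chi> (T.G.rt g s)"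
      unfolding T.G.rt_hom by (simp_all only: \<chi>D)
    then show "\<chi> (T.G.rt g (\<lambda>x. r x + s x)) = \<chi> (T.G.rt g r) + \<chi> (T.G.rt g s)"
      "\<chi> (T.G.rt g (\<lambda>x. r x * s x)) = \<chi> (T.G.rt g r) * \<chi> (T.G.rt g s)"
      unfolding plus_fun_def times_fun_def .
  next
    fix c
    have "T.G.rt g (zero_outside Gt (\<lambda>_. c)) = zero_outside Gt (\<lambda>_. c)"
      unfolding T.G.rt_def by (rule zo_eq_iff) (use g in \<open>simp add: zero_outside_apply Gt_closed\<close>)
    then show "\<chi> (T.G.rt g (zero_outside Gt (\<lambda>_. c))) = c" using \<chi>c by simp
  qed
  then have "\<exists>y\<in>Y. \<exists>\<delta>'. (\<forall>r\<in>R. \<chi> (T.G.rt g r) = r (prodl y) \<and> 0 = \<delta>' (mu r)) \<and>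
      (\<forall>F\<in>BY. \<forall>G\<in>BY. \<delta>' (F + G) = \<delta>' F + \<delta>' G \<and> \<delta>' (F * G) = F y * \<delta>' G + \<delta>' F * G y) \<and>
      (\<forall>c. \<delta>' (\<lambda>_. c) = 0)"
    by (rule lift[of "\<lambda>r. \<chi> (T.G.rt g r)" "\<lambda>_. 0"]) (use g(2) in simp_all)
  then obtain y where y: "y \<in> Y" "\<And>r. r \<in> R \<Longrightarrow> \<chi> (T.G.rt g r) = r (prodl y)" by blast
  have u: "prodl y \<in> Gt" by (rule prodl_in[OF Y_Gt[OF y(1)]])
  have "\<chi> r = r (prodl y \<odot> invX g)" if r: "r \<in> R" for r
  proof -
    have "T.G.rt g (T.G.rt (invX g) r) = r"
      using g(1) r by (simp add: T.G.rt_rt Gt_closed A.r_inv T.G.rt_one)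
    then show ?thesis using y(2)[OF T.G.rt_in[OF r Gt_closed(2)[OF g(1)]]] u by (simp add: T.G.rt_apply)
  qed
  then show ?thesis using Gt_closed(1)[OF u Gt_closed(2)[OF g(1)]] by blast
qed

lemma affine_Gv: "affine_variety Gv"
proof (rule affine_varietyI[of CC])
  show "reg Gv = alg_gen (pts Gv) CC" by (simp add: Gv_def R_def)
qed (use CC separate_Gt chars_Gt in \<open>simp_all add: Gv_def\<close>)

text \<open>At a point \<open>u = y\<^sub>1 \<cdots> y\<^sub>n\<close> of the group the translate of \<open>A\<close> lifts to a tangent vector \<open>\<delta>'\<close> of the
  product. The part of \<open>\<delta>'\<close> along the \<open>j\<close>-th factor, moved to the identity of that factor, is a tangent
  vector \<open>bj j\<close>, and its field reappears conjugated by \<open>y\<^sub>1 \<cdots> y\<^sub>j\<^sub>-\<^sub>1\<close>.\<close>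

lemma xi_in_L:
  assumes A: "pd R \<iota> A" shows "T.xi A \<in> L"
proof -
  from lift_tangent obtain a where a: "a \<in> R" "a \<noteq> 0" and lift: "\<And>\<chi> \<delta>. is_char Gt R \<chi> \<Longrightarrow> \<chi> a \<noteq> 0 \<Longrightarrow>
    (\<forall>f\<in>R. \<forall>g\<in>R. \<delta> (f + g) = \<delta> f + \<delta> g \<and> \<delta> (f * g) = \<chi> f * \<delta> g + \<delta> f * \<chi> g) \<Longrightarrow>
    (\<forall>c. \<delta> (zero_outside Gt (\<lambda>_. c)) = 0) \<Longrightarrow> (\<exists>y\<in>Y. \<exists>\<delta>'. (\<forall>r\<in>R. \<chi> r = r (prodl y) \<and> \<delta> r = \<delta>' (mu r)) \<and>
      (\<forall>F\<in>BY. \<forall>G\<in>BY. \<delta>' (F + G) = \<delta>' F + \<delta>' G \<and> \<delta>' (F * G) = F y * \<delta>' G + \<delta>' F * G y) \<and>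
      (\<forall>c. \<delta>' (\<lambda>_. c) = 0))"
    by (elim bexE conjE) blast
  obtain u where u: "u \<in> Gt" "a u \<noteq> 0" using a R.eqI[OF a(1) R.zero] by auto
  have l1: "is_char Gt R (\<lambda>r. r u)" using u(1) by (auto simp: is_char_def zero_outside_apply)
  have l2: "\<forall>f\<in>R. \<forall>g\<in>R. A (T.G.rt u (f + g)) = A (T.G.rt u f) + A (T.G.rt u g) \<and>
      A (T.G.rt u (f * g)) = f u * A (T.G.rt u g) + A (T.G.rt u f) * g u"
    using u(1) by (simp add: T.G.rt_hom pdD(1,2)[OF A] T.G.rt_in T.G.rt_apply Gt_closed)
  have l3: "\<forall>c. A (T.G.rt u (zero_outside Gt (\<lambda>_. c))) = 0"
  proof
    fix c
    have "T.G.rt u (zero_outside Gt (\<lambda>_. c)) = zero_outside Gt (\<lambda>_. c)"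
      unfolding T.G.rt_def by (rule zo_eq_iff) (use u in \<open>simp add: zero_outside_apply Gt_closed\<close>)
    then show "A (T.G.rt u (zero_outside Gt (\<lambda>_. c))) = 0" using R.pd_const[OF A] Gt_closed(3) by simp
  qed
  from lift[of "\<lambda>r. r u" "\<lambda>r. A (T.G.rt u r)", OF l1 u(2) l2 l3]
  obtain y \<delta>' where y: "y \<in> Y" and yr: "\<forall>r\<in>R. r u = r (prodl y) \<and> A (T.G.rt u r) = \<delta>' (mu r)"
    and d: "\<forall>F\<in>BY. \<forall>G\<in>BY. \<delta>' (F + G) = \<delta>' F + \<delta>' G \<and> \<delta>' (F * G) = F y * \<delta>' G + \<delta>' F * G y"
      "\<forall>c. \<delta>' (\<lambda>_. c) = 0"
    by (elim bexE exE conjE) (rule that)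
  have \<delta>': "\<delta>' (F + G) = \<delta>' F + \<delta>' G" "\<delta>' (F * G) = F y * \<delta>' G + \<delta>' F * G y"
    if "F \<in> BY" "G \<in> BY" for F G
    using d(1) that by blast+
  have \<delta>'c: "\<delta>' (\<lambda>_. c) = 0" for c using d(2) by blast
  have yG: "set y \<subseteq> Gt" and yn: "length y = n" using Y_Gt[OF y] y by (auto simp: Y_iff)
  have up: "u = prodl y" by (rule separate_Gt[OF u(1) prodl_in[OF yG]]) (use yr in blast)
  have cB: "(\<lambda>_. c) \<in> BY" for c using BY(2) by blast
  have \<delta>s: "\<delta>' (fscale c F) = c * \<delta>' F" if "F \<in> BY" for c F
  proof -
    have "fscale c F = (\<lambda>_. c) * F" by (auto simp: fun_eq_iff fscale_apply)
    then show ?thesis using \<delta>'(2)[OF cB that] \<delta>'c by simp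
  qed
  define pt where "pt j F = (\<lambda>z. F (y[j := prj z ! j]))" for j and F :: "('a \<Rightarrow> 'a) list \<Rightarrow> 'k"
  have pth: "pt j (F + G) = pt j F + pt j G" "pt j (F * G) = pt j F * pt j G" "pt j (- F) = - pt j F"
    "pt j 1 = 1" "pt j (\<lambda>_. c) = (\<lambda>_. c)" for j F G c by (auto simp: pt_def fun_eq_iff)
  have pty: "pt j F y = F y" for j F by (simp add: pt_def prj_props(2)[OF y])
  have ptk: "pt j (kap j' r) = (if j = j' then kap j' r else (\<lambda>_. r (y ! j')))" if "j < n" "j' < n" for j j' r
    using that yn by (auto simp: pt_def kap_def fun_eq_iff prj_props(2)[OF Y_update[OF y that(1) prj_props(4)[OF that(1)]]])
  have ptB: "pt j F \<in> BY" if j: "j < n" and F: "F \<in> BY" for j F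
  proof -
    have "BY \<subseteq> {F. pt j F \<in> BY}"
    proof (rule BY_least)
      show "is_subring {F. pt j F \<in> BY}" unfolding is_subring_def mem_Collect_eq pth using BYD by auto
      show "consts_fun \<subseteq> {F. pt j F \<in> BY}" using cB pth(5) by auto
      fix j' c assume j': "j' < n" "c \<in> C (ws ! j')"
      have "kap j' c \<in> BY" using BY(3) j' unfolding set_ts by blast
      then show "kap j' c \<in> {F. pt j F \<in> BY}" using ptk[OF j j'(1), of c] cB by simp
    qed
    then show ?thesis using F by blast
  qed
  \<comment> \<open>A derivation at a point of a product is the sum of its partial derivations.\<close>
  have split: "\<delta>' F = (\<Sum>j<n. \<delta>' (pt j F))" if F: "F \<in> BY" for F
  proof -
    let ?S = "{F \<in> BY. \<delta>' F = (\<Sum>j<n. \<delta>' (pt j F))}"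
    have SB: "F \<in> BY" "\<delta>' F = (\<Sum>j<n. \<delta>' (pt j F))" if "F \<in> ?S" for F using that by blast+
    have add: "F + G \<in> ?S" if "F \<in> ?S" "G \<in> ?S" for F G
    proof -
      note F = SB[OF that(1)] and G = SB[OF that(2)]
      have "(\<Sum>j<n. \<delta>' (pt j (F + G))) = (\<Sum>j<n. \<delta>' (pt j F)) + (\<Sum>j<n. \<delta>' (pt j G))"
        unfolding pth using ptB F G by (simp add: \<delta>'(1) sum.distrib)
      then have "\<delta>' (F + G) = (\<Sum>j<n. \<delta>' (pt j (F + G)))" unfolding \<delta>'(1)[OF F(1) G(1)] using F(2) G(2) by simp
      then show ?thesis using BYD(4)[OF F(1) G(1)] by blast
    qed
    have mult: "F * G \<in> ?S" if "F \<in> ?S" "G \<in> ?S" for F G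
    proof -
      note F = SB[OF that(1)] and G = SB[OF that(2)]
      have "(\<Sum>j<n. \<delta>' (pt j (F * G))) = F y * (\<Sum>j<n. \<delta>' (pt j G)) + (\<Sum>j<n. \<delta>' (pt j F)) * G y"
        unfolding pth using ptB F G by (simp add: \<delta>'(2) pty sum.distrib sum_distrib_left sum_distrib_right)
      then have "\<delta>' (F * G) = (\<Sum>j<n. \<delta>' (pt j (F * G)))" unfolding \<delta>'(2)[OF F(1) G(1)] using F(2) G(2) by simp
      then show ?thesis using BYD(5)[OF F(1) G(1)] by blast
    qed
    have const: "(\<lambda>_. c) \<in> ?S" for c using cB \<delta>'c pth(5) by simp
    have "BY \<subseteq> ?S"
    proof (rule BY_least)
      show "is_subring ?S"
        unfolding is_subring_def
      proof (intro conjI ballI add mult)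
        show "1 \<in> ?S" using const[of 1] by (simp only: one_fun_def)
        fix F assume F: "F \<in> ?S"
        have "- F = (\<lambda>_. - 1) * F" by (auto simp: fun_eq_iff)
        then show "- F \<in> ?S" using mult[OF const F, of "- 1"] by (simp only:)
      qed
      show "consts_fun \<subseteq> ?S" using const by blast
      fix j' c assume j': "j' < n" "c \<in> C (ws ! j')"
      have kB: "kap j' c \<in> BY" using BY(3) j' unfolding set_ts by blast
      have "(\<Sum>j<n. \<delta>' (pt j (kap j' c))) = (\<Sum>j<n. if j = j' then \<delta>' (kap j' c) else 0)"
        by (intro sum.cong refl) (use j'(1) in \<open>simp add: ptk \<delta>'c\<close>)
      also have "\<dots> = \<delta>' (kap j' c)" using j'(1) by simp
      finally show "kap j' c \<in> ?S" using kB by simp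
    qed
    then show ?thesis using F by blast
  qed
  define Pj where "Pj j = prodl (take j y)" for j
  define bj where "bj j r = \<delta>' (kap j (zero_outside (Q (ws ! j)) (\<lambda>h. r (h \<odot> invX (y ! j)))))" for j r
  have PG: "Pj j \<in> Gt" for j unfolding Pj_def by (rule prodl_in) (use yG set_take_subset[of j y] in blast)
  have bj: "pd (RR (ws ! j)) \<iota> (bj j)" if j: "j < n" for j
  proof -
    interpret j: connected_action X "Q (ws ! j)" "RR (ws ! j)" "C (ws ! j)" by (rule ca[OF wsj[OF j]])
    have yj: "y ! j \<in> Q (ws ! j)" using y j by (simp add: Y_iff)
    have iyj: "invX (y ! j) \<in> Q (ws ! j)" by (rule j.Q_closed(2)[OF yj])
    have e: "bj j r = \<delta>' (kap j (j.G.rt (invX (y ! j)) r))" for r by (simp add: bj_def j.G.rt_def)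
    have inB: "kap j (j.G.rt (invX (y ! j)) r) \<in> BY" if "r \<in> RR (ws ! j)" for r
      by (rule kap_in[OF j j.G.rt_in[OF that iyj]])
    have val: "kap j (j.G.rt (invX (y ! j)) r) y = r \<iota>" for r
      using yj j.QA[OF yj] by (simp add: kap_def prj_props(2)[OF y] j.G.rt_apply A.r_inv)
    show ?thesis unfolding pd_def e j.G.rt_hom kap_hom
      by (simp add: \<delta>'(1,2) \<delta>s inB val)
  qed
  have main: "T.xi A = (\<Sum>j<n. Ad (invX (Pj j)) (action.xi X (Q (ws ! j)) (bj j)))"
  proof (rule ext, rule ext)
    fix f x
    show "T.xi A f x = (\<Sum>j<n. Ad (invX (Pj j)) (action.xi X (Q (ws ! j)) (bj j))) f x"
    proof (cases "f \<in> \<O> \<and> x \<in> PX")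
      case True
      have uA: "u \<in> carrier (Aut X)" using u(1) Gt_closed(4) by blast
      let ?x = "invX u x"
      have x': "?x \<in> PX" using True uA by (simp add: Aut_in)
      let ?o = "orb Gt f ?x"
      have oR: "?o \<in> R" using T.orb_in True x' by blast
      have o: "T.G.rt u ?o = orb Gt f x" using T.orb_act[OF u(1) x', of f] Aut_inv(1)[OF uA] True by simp
      have "A (T.G.rt u ?o) = \<delta>' (mu ?o)" using yr oR by blast
      then have "T.xi A f x = \<delta>' (mu ?o)" unfolding o using True by (simp add: T.xi_apply)
      also have "\<dots> = (\<Sum>j<n. \<delta>' (pt j (mu ?o)))" by (rule split[OF mu_in[OF oR]])
      also have "\<dots> = (\<Sum>j<n. Ad (invX (Pj j)) (action.xi X (Q (ws ! j)) (bj j)) f x)"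
      proof (intro sum.cong refl)
        fix j assume "j \<in> {..<n}"
        then have j: "j < n" by simp
        interpret j: connected_action X "Q (ws ! j)" "RR (ws ! j)" "C (ws ! j)" by (rule ca[OF wsj[OF j]])
        have yj: "y ! j \<in> Q (ws ! j)" using y j by (simp add: Y_iff)
        define S where "S = prodl (drop (Suc j) y)"
        have SG: "S \<in> Gt" unfolding S_def by (rule prodl_in) (use yG set_drop_subset[of "Suc j" y] in blast)
        have tk: "set (take j y) \<subseteq> Gt" "set (drop (Suc j) y) \<subseteq> Gt"
          using yG set_take_subset[of j y] set_drop_subset[of "Suc j" y] by blast+
        have upd: "prodl (y[j := h]) = Pj j \<odot> (h \<odot> S)" if "h \<in> Gt" for h
          using that tk j yn unfolding upd_conv_take_nth_drop[OF j[folded yn]] Pj_def S_def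
          by (subst prodl_append) auto
        have yjG: "y ! j \<in> Gt" using Q_Gt[OF wsj[OF j]] yj by blast
        note GA = Gt_closed(4)[OF PG[of j]] Gt_closed(4)[OF SG] Gt_closed(4)[OF yjG]
        have u2: "u = Pj j \<odot> (y ! j \<odot> S)" unfolding up using upd[OF yjG] by simp
        have "Pj j ((y ! j) (S ?x)) = x"
        proof -
          have "u ?x = x" using Aut_inv(1)[OF uA] True by blast
          moreover have "(Pj j \<odot> (y ! j \<odot> S)) ?x = Pj j ((y ! j) (S ?x))"
            using GA x' A.m_closed[OF GA(3) GA(2)] by (simp add: Aut_mult Aut_in)
          ultimately show ?thesis unfolding u2[symmetric] by (simp only:)
        qed
        then have "(y ! j) (S ?x) = invX (Pj j) x"
          using Aut_inv(2)[OF GA(1), of "(y ! j) (S ?x)"] GA x' by (simp add: Aut_in)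
        then have Sx: "S ?x = invX (y ! j) (invX (Pj j) x)"
          using Aut_inv(2)[OF GA(3), of "S ?x"] GA x' by (simp add: Aut_in)
        have iPx: "invX (Pj j) x \<in> PX" using GA True by (simp add: Aut_in)
        have aP: "act (Pj j) f \<in> \<O>" using act_in[OF GA(1)] True by blast
        have "pt j (mu ?o) = kap j (zero_outside (Q (ws ! j)) (\<lambda>h. orb (Q (ws ! j)) (act (Pj j) f) (invX (Pj j) x) (h \<odot> invX (y ! j))))"
        proof
          fix z
          let ?h = "prj z ! j"
          have hQ: "?h \<in> Q (ws ! j)" by (rule prj_props(4)[OF j])
          have hG: "?h \<in> Gt" using Q_Gt[OF wsj[OF j]] hQ by blast
          note hA = Gt_closed(4)[OF hG]
          have "pt j (mu ?o) z = ?o (Pj j \<odot> (?h \<odot> S))"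
            by (simp add: pt_def mu_def prj_props(2)[OF Y_update[OF y j hQ]] upd[OF hG])
          also have "\<dots> = f (Pj j (?h (S ?x)))"
            using PG SG hG GA hA x' by (simp add: orb_def zero_outside_apply Gt_closed Aut_mult Aut_in)
          also have "\<dots> = kap j (zero_outside (Q (ws ! j)) (\<lambda>h. orb (Q (ws ! j)) (act (Pj j) f) (invX (Pj j) x) (h \<odot> invX (y ! j)))) z"
            unfolding Sx using hQ yj GA hA iPx
            by (simp add: kap_def orb_def zero_outside_apply j.Q_closed act_apply Aut_in Aut_mult)
          finally show "pt j (mu ?o) z = kap j (zero_outside (Q (ws ! j)) (\<lambda>h. orb (Q (ws ! j)) (act (Pj j) f) (invX (Pj j) x) (h \<odot> invX (y ! j)))) z" .
        qed
        then have "\<delta>' (pt j (mu ?o)) = bj j (orb (Q (ws ! j)) (act (Pj j) f) (invX (Pj j) x))" by (simp add: bj_def)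
        also have "\<dots> = j.xi (bj j) (act (Pj j) f) (invX (Pj j) x)" using aP iPx by (simp add: j.xi_apply)
        also have "\<dots> = Ad (invX (Pj j)) (j.xi (bj j)) f x" using True GA by (simp add: Ad_apply act_apply)
        finally show "\<delta>' (pt j (mu ?o)) = Ad (invX (Pj j)) (j.xi (bj j)) f x" .
      qed
      finally show ?thesis by (simp add: sum_fun_apply)
    next
      case False
      then show ?thesis by (cases "f \<in> \<O>") (simp_all add: T.xi_apply Ad_apply act_apply sum_fun_apply)
    qed
  qed
  show ?thesis unfolding main
  proof (rule vec_vs.subspace_sum[OF L_props(4)])
    fix j assume "j \<in> {..<n}"
    then have j: "j < n" by simp
    show "Ad (invX (Pj j)) (action.xi X (Q (ws ! j)) (bj j)) \<in> L"
      by (rule Ad_L[OF L_fd Gt_closed(2)[OF PG] xi_L[OF wsj[OF j] bj[OF j]]])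
  qed
qed

lemma Lie_Gv: "Lie X Gv = L"
proof -
  have "Lie X Gv = {T.xi A | A. pd R \<iota> A}" by (rule T.Lie_eq) (simp_all add: Gv_def)
  moreover have "D \<in> {T.xi A | A. pd R \<iota> A}" if D: "D \<in> L" for D
  proof -
    obtain c where c: "D = (\<Sum>k<d. vscale (c k) (e k))" using L_combination[OF D] by blast
    have "D = T.xi (\<lambda>r. \<Sum>k<d. c k * Ar k r)"
    proof (rule ext, rule ext)
      fix f x
      have "D f x = (\<Sum>k<d. c k * e k f x)" unfolding c vsum_apply by (simp add: sum_fun_apply fscale_apply)
      moreover have "e k f x = 0" if "k < d" "f \<notin> \<O> \<or> x \<notin> PX" for k
        using that VecD(5)[OF e_Vec[OF that(1)]] O.supp[OF VecD(1)[OF e_Vec[OF that(1)]]] by (cases "f \<in> \<O>") simp_all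
      ultimately show "D f x = T.xi (\<lambda>r. \<Sum>k<d. c k * Ar k r) f x"
        by (cases "f \<in> \<O>"; cases "x \<in> PX") (simp_all add: T.xi_apply Ar_orb)
    qed
    then show ?thesis using pd_combination[of c] by blast
  qed
  moreover have "D \<in> L" if "D \<in> {T.xi A | A. pd R \<iota> A}" for D
  proof -
    from that obtain A where A: "D = T.xi A" "pd R \<iota> A" by (elim CollectE exE conjE) (rule that)
    show ?thesis unfolding A(1) by (rule xi_in_L[OF A(2)])
  qed
  ultimately show ?thesis by (intro subset_antisym subsetI) (simp_all only:)
qed

text \<open>Nonempty open sets meet because \<open>R\<close> is a domain.\<close>

lemma connected_Gv: "connected_space (zariski_topology Gv)"
proof -
  have nb: "\<exists>f\<in>R. x \<in> Gt \<and> f x \<noteq> 0 \<and> {z \<in> Gt. f z \<noteq> 0} \<subseteq> U"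
    if "openin (zariski_topology Gv) U" "x \<in> U" for U x
  proof -
    have "generate_topology_on ((\<lambda>f. {x \<in> Gt. f x \<noteq> 0}) ` R) U"
      using that(1) by (simp add: zariski_topology_def Gv_def openin_topology_generated_by_iff)
    then show ?thesis using that(2)
    proof (induction rule: generate_topology_on.induct)
      case (Int U V)
      then obtain f g where fg: "f \<in> R" "g \<in> R" "x \<in> Gt" "f x \<noteq> 0" "g x \<noteq> 0"
        "{z \<in> Gt. f z \<noteq> 0} \<subseteq> U" "{z \<in> Gt. g z \<noteq> 0} \<subseteq> V" by auto
      have "f * g \<in> R" "(f * g) x \<noteq> 0" "{z \<in> Gt. (f * g) z \<noteq> 0} \<subseteq> U \<inter> V" using fg R.mult by auto
      then show ?case using fg(3) by blast
    next
      case (UN K)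
      then obtain k where k: "k \<in> K" "x \<in> k" by blast
      then show ?case using UN.IH[OF k] by blast
    next
      case (Basis s)
      then show ?case by blast
    qed simp
  qed
  show ?thesis
    unfolding connected_space_def
  proof (intro notI, elim exE conjE)
    fix U V assume UV: "openin (zariski_topology Gv) U" "openin (zariski_topology Gv) V"
      "U \<inter> V = {}" "U \<noteq> {}" "V \<noteq> {}"
    obtain x z where xz: "x \<in> U" "z \<in> V" using UV(4,5) by blast
    obtain f where f: "f \<in> R" "x \<in> Gt" "f x \<noteq> 0" "{z \<in> Gt. f z \<noteq> 0} \<subseteq> U" using nb[OF UV(1) xz(1)] by blast
    obtain g where g: "g \<in> R" "z \<in> Gt" "g z \<noteq> 0" "{z \<in> Gt. g z \<noteq> 0} \<subseteq> V" using nb[OF UV(2) xz(2)] by blast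
    have "f * g = 0"
    proof (rule R.eqI[OF R.mult[OF f(1) g(1)] R.zero])
      fix w assume "w \<in> Gt"
      then show "(f * g) w = 0 w" using f(4) g(4) UV(3) by auto
    qed
    then show False using R_domain[OF f(1) g(1)] f(3) g(3) by auto
  qed
qed

lemma algebraic_Gv: "algebraic_subgroup X Gv"
proof -
  let ?H = "(Aut X)\<lparr>carrier := Gt\<rparr>"
  have P: "pts Gv = Gt" "reg Gv = R" by (simp_all add: Gv_def)
  have sc: "fscale c f \<in> reg Gv" if "f \<in> reg Gv" for c f using R.scale that by (simp add: P)
  have m1: "morphism (prod_variety Gv Gv) Gv (\<lambda>(g, h). g \<otimes>\<^bsub>?H\<^esub> h)"
    unfolding morphism_def
  proof (intro conjI ballI)
    show "(\<lambda>(g, h). g \<otimes>\<^bsub>?H\<^esub> h) \<in> pts (prod_variety Gv Gv) \<rightarrow> pts Gv"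
      by (auto simp: prod_variety_def P Gt_closed)
    fix f assume "f \<in> reg Gv"
    then have f: "f \<in> R" by (simp add: P)
    obtain m :: nat and a b where ab: "\<forall>i<m. a i \<in> R \<and> b i \<in> R"
      "\<forall>g\<in>Gt. \<forall>h\<in>Gt. f (g \<odot> h) = (\<Sum>i<m. a i g * b i h)" using T.G.comul[OF f] by blast
    have "pullback (prod_variety Gv Gv) (\<lambda>(g, h). g \<otimes>\<^bsub>?H\<^esub> h) f = (\<lambda>(x, y). \<Sum>i<m. a i x * b i y)"
    proof (rule ext)
      fix q :: "('a \<Rightarrow> 'a) \<times> ('a \<Rightarrow> 'a)"
      obtain g h where q: "q = (g, h)" by (cases q)
      have "(\<Sum>i<m. a i g * b i h) = 0" if "g \<notin> Gt \<or> h \<notin> Gt"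
        using that ab(1) R.supp by (intro sum.neutral) auto
      then show "pullback (prod_variety Gv Gv) (\<lambda>(g, h). g \<otimes>\<^bsub>?H\<^esub> h) f q = (case q of (x, y) \<Rightarrow> \<Sum>i<m. a i x * b i y)"
        using ab(2) by (auto simp: q pullback_def zero_outside_apply prod_variety_def P)
    qed
    moreover have "(\<lambda>(x, y). \<Sum>i<m. a i x * b i y) \<in> reg (prod_variety Gv Gv)"
      by (rule iffD2[OF prod_variety_expand]) (use ab(1) sc in \<open>auto simp: P\<close>)
    ultimately show "pullback (prod_variety Gv Gv) (\<lambda>(g, h). g \<otimes>\<^bsub>?H\<^esub> h) f \<in> reg (prod_variety Gv Gv)" by (simp only:)
  qed
  have m2: "morphism (prod_variety Gv X) X (\<lambda>(g, x). g x)"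
    unfolding morphism_def
  proof (intro conjI ballI)
    show "(\<lambda>(g, x). g x) \<in> pts (prod_variety Gv X) \<rightarrow> PX"
      by (auto simp: prod_variety_def P Gt_closed Aut_in)
    fix f assume f: "f \<in> \<O>"
    obtain m :: nat and a b where ab: "\<forall>i<m. a i \<in> R \<and> b i \<in> \<O>"
      "\<forall>g\<in>Gt. \<forall>x\<in>PX. f (g x) = (\<Sum>i<m. a i g * b i x)" using T.coact[OF f] by blast
    have "pullback (prod_variety Gv X) (\<lambda>(g, x). g x) f = (\<lambda>(x, y). \<Sum>i<m. a i x * b i y)"
    proof (rule ext)
      fix q :: "('a \<Rightarrow> 'a) \<times> 'a"
      obtain g x where q: "q = (g, x)" by (cases q)
      have "(\<Sum>i<m. a i g * b i x) = 0" if "g \<notin> Gt \<or> x \<notin> PX"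
        using that ab(1) R.supp O.supp by (intro sum.neutral) auto
      then show "pullback (prod_variety Gv X) (\<lambda>(g, x). g x) f q = (case q of (x, y) \<Rightarrow> \<Sum>i<m. a i x * b i y)"
        using ab(2) by (auto simp: q pullback_def zero_outside_apply prod_variety_def P)
    qed
    moreover have "(\<lambda>(x, y). \<Sum>i<m. a i x * b i y) \<in> reg (prod_variety Gv X)"
      by (rule iffD2[OF prod_variety_expand]) (use ab(1) sc in \<open>auto simp: P\<close>)
    ultimately show "pullback (prod_variety Gv X) (\<lambda>(g, x). g x) f \<in> reg (prod_variety Gv X)" by (simp only:)
  qed
  have m3: "morphism Gv Gv (\<lambda>g. inv\<^bsub>?H\<^esub> g)"
    unfolding morphism_def P
  proof (intro conjI ballI)
    show "(\<lambda>g. inv\<^bsub>?H\<^esub> g) \<in> Gt \<rightarrow> Gt" by (simp add: T.Q_inv Gt_closed)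
    fix f assume f: "f \<in> R"
    show "pullback Gv (\<lambda>g. inv\<^bsub>?H\<^esub> g) f \<in> R" unfolding pullback_def P using T.G.inverse[OF f] by simp
  qed
  show ?thesis
    unfolding algebraic_subgroup_def algebraic_group_def P
    using Gt_subgroup subgroup.subgroup_is_group[OF Gt_subgroup A.is_group] affine_Gv m1 m2 m3 by simp
qed

end

lemma (in conjugate_basis) exists_generating_space:
  "\<exists>B cs. generated_group X I Gi C d p ix E B cs"
proof -
  obtain B' where B': "finite B'" "fun_vs.span B' \<subseteq> \<O>" "gens \<subseteq> fun_vs.span B'"
    "\<forall>D\<in>L. D ` fun_vs.span B' \<subseteq> fun_vs.span B'"
    using exists_invariant_generating[OF L_props(3) L_locally_finite] by blast
  obtain B where B: "B \<subseteq> B'" "fun_vs.independent B" "B' \<subseteq> fun_vs.span B"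
    by (rule fun_vs.maximal_independent_subset)
  have sp: "fun_vs.span B = fun_vs.span B'"
    by (rule subset_antisym[OF fun_vs.span_mono[OF B(1)] fun_vs.span_minimal[OF B(3) fun_vs.subspace_span]])
  have fB: "finite B" using B(1) B'(1) by (rule finite_subset)
  have "\<forall>w\<in>B. \<exists>c. \<forall>v\<in>B. ev c v = (if v = w then 1 else 0)"
  proof
    fix w assume w: "w \<in> B"
    have "w \<notin> fun_vs.span (B - {w})" using B(2) w unfolding fun_vs.dependent_def by blast
    then obtain c where c: "\<forall>v\<in>fun_vs.span (B - {w}). ev c v = 0" "ev c w \<noteq> 0"
      using eval_separation[of "B - {w}" w] fB by auto
    have "ev (map (\<lambda>(a, s). (inverse (ev c w) * a, s)) c) v = (if v = w then 1 else 0)" if "v \<in> B" for v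
      unfolding ev_scale_list using c that fun_vs.span_base[of v "B - {w}"] by (cases "v = w") simp_all
    then show "\<exists>c. \<forall>v\<in>B. ev c v = (if v = w then 1 else 0)" by blast
  qed
  from bchoice[OF this] obtain cs where cs: "\<forall>w\<in>B. \<forall>v\<in>B. ev (cs w) v = (if v = w then 1 else 0)" ..
  have "generated_group X I Gi C d p ix E B cs"
  proof (intro generated_group.intro generated_group_axioms.intro conjugate_basis_axioms fB)
    show "fun_vs.span B \<subseteq> \<O>" "gens \<subseteq> fun_vs.span B" unfolding sp by (rule B'(2), rule B'(3))
    show "D f \<in> fun_vs.span B" if "D \<in> L" "f \<in> fun_vs.span B" for D f using B'(4) that unfolding sp by blast
    show "ev (cs w) v = (if v = w then 1 else 0)" if "v \<in> B" "w \<in> B" for v w using cs that by simp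
  qed
  then show ?thesis by blast
qed

lemma (in family) generated_group_algebraic:
  assumes "finite_dimensional vscale L"
  shows "\<exists>G. pts G = Gt \<and> algebraic_subgroup X G \<and> L = Lie X G \<and> connected_space (zariski_topology G)"
proof -
  obtain d p ix E where 1: "conjugate_basis X I Gi C d p ix E" using exists_conjugate_basis[OF assms] by blast
  obtain B cs where 2: "generated_group X I Gi C d p ix E B cs"
    using conjugate_basis.exists_generating_space[OF 1] by blast
  interpret g: generated_group X I Gi C d p ix E B cs by (rule 2)
  obtain ws where ws: "set ws \<subseteq> I" "\<forall>r\<in>g.R. (\<forall>ys\<in>g.YY ws. r (g.prodl ys) = 0) \<longrightarrow> r = 0"
    using g.exists_dense_word by blast
  have "dense_word X I Gi C d p ix E B cs ws"
    by (intro dense_word.intro dense_word_axioms.intro 2 ws(1)) (use ws(2) in blast)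
  then interpret w: dense_word X I Gi C d p ix E B cs ws .
  show ?thesis
    by (rule exI[of _ w.Gv]) (simp add: w.algebraic_Gv w.Lie_Gv w.connected_Gv, simp add: w.Gv_def)
qed

theorem mainTheorem13:
  fixes X :: "('a, 'k::{alg_closed_field, field_char_0}) variety"
    and I :: "'i set"
    and Li :: "'i \<Rightarrow> (('a \<Rightarrow> 'k) \<Rightarrow> 'a \<Rightarrow> 'k) set"
    and Gi :: "'i \<Rightarrow> ('a \<Rightarrow> 'a, 'k) variety"
    and L :: "(('a \<Rightarrow> 'k) \<Rightarrow> 'a \<Rightarrow> 'k) set"
  assumes "affine_variety X"
    and "\<And>i. i \<in> I \<Longrightarrow> lie_subalgebra X (Li i)"
    and "\<And>i. i \<in> I \<Longrightarrow> locally_finite X (Li i)"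
    and "\<And>i. i \<in> I \<Longrightarrow> algebraic_subgroup X (Gi i)"
    and "\<And>i. i \<in> I \<Longrightarrow> connected_space (zariski_topology (Gi i))"
    and "\<And>i. i \<in> I \<Longrightarrow> Li i = Lie X (Gi i)"
    and "L = lie_generated X (\<Union>i\<in>I. Li i)"
  shows "(locally_finite X L \<longleftrightarrow> finite_dimensional vscale L) \<and>
    (locally_finite X L \<longrightarrow>
      (\<exists>G. pts G = generate (Aut X) (\<Union>i\<in>I. pts (Gi i)) \<and>
           algebraic_subgroup X G \<and> L = Lie X G) \<and>
      algebraic_lie X L)"
proof -
  interpret aff X by (rule aff.intro[OF assms(1)])
  have "\<forall>i\<in>I. \<exists>C. connected_action X (pts (Gi i)) (reg (Gi i)) C"
    using algebraic_subgroup_action[OF assms(4,5)] by blast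
  from bchoice[OF this] obtain C where C: "\<forall>i\<in>I. connected_action X (pts (Gi i)) (reg (Gi i)) (C i)" ..
  interpret family X I Gi C
  proof (intro family.intro family_axioms.intro aff_axioms)
    fix i assume i: "i \<in> I"
    show "connected_action X (pts (Gi i)) (reg (Gi i)) (C i)" using C i by blast
    show "Lie X (Gi i) \<subseteq> Vec X" using assms(2)[OF i] assms(6)[OF i] by (simp add: lie_subalgebra_def)
    show "locally_finite X (Lie X (Gi i))" using assms(3)[OF i] assms(6)[OF i] by simp
    have "affine_variety (Gi i)" using assms(4)[OF i] by (simp add: algebraic_subgroup_def algebraic_group_def)
    then show "\<exists>x\<in>pts (Gi i). \<forall>f\<in>reg (Gi i). \<chi> f = f x" if "is_char (pts (Gi i)) (reg (Gi i)) \<chi>" for \<chi>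
      using affine_variety_spectrum[of "Gi i"] that by auto
  qed
  have LL: "L = lie_generated X (\<Union>i\<in>I. Lie X (Gi i))" using assms(6,7) by simp
  have "\<exists>G. pts G = generate (Aut X) (\<Union>i\<in>I. pts (Gi i)) \<and> algebraic_subgroup X G \<and> L = Lie X G \<and>
      connected_space (zariski_topology G)" if "locally_finite X L"
    using generated_group_algebraic[unfolded L_def Gt_def, folded LL] locally_finite_iff[unfolded L_def, folded LL] that
    by blast
  then show ?thesis
    using locally_finite_iff[unfolded L_def, folded LL] unfolding algebraic_lie_def by blast
qed

end
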